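(* Let $p\in(1,p_f)$, where $p_f:=1+\frac{2\beta}{N}$, and $q\in[1,\infty]$. Let $u$ be a nontrivial nonnegative $L^q$-solution to the problem $$\partial_t^\alpha u+(-\Delta)^\beta u=|u|^{p-1}u,\qquad u(\cdot,0)=u_0.$$ There exists $T\in(0,\infty)$ such that $\limsup_{t\nearrow T}\|u(\cdot,t)\|_{L^q(\mathbb{R}^N)}=\infty$.
   Context: Throughout, $\alpha\in(0,1)$, $\beta\in(0,1]$, and $N>4\beta$, where $N$ is the space dimension. The initial datum $u_0$ is assumed to belong to $L^q(\mathbb{R}^N)$. $\partial_t^\alpha$ is the Caputo derivative, defined for smooth functions by $\partial_t^\alpha u(x,t)=\frac1{\Gamma(1-\alpha)}\,\partial_t\int_0^t\frac{u(x,s)-u(x,0)}{(t-s)^\alpha}\,ds$, and $(-\Delta)^\beta$ is the usual $\beta$ power of the Laplacian, i.e. the operator with Fourier symbol $|\xi|^{2\beta}$. $Z$ is the fundamental solution of the linear equation $\partial_t^\alpha u+(-\Delta)^\beta u=0$ (with initial datum a Dirac mass at the origin), and $Y={}^{R}\partial_t^{1-\alpha}Z$, where ${}^{R}\partial_t^{1-\alpha}$ is the Riemann-Liouville derivative of order $1-\alpha$, that is, $Y(x,t)=\frac{1}{\Gamma(\alpha)}\,\partial_t\int_0^t\frac{Z(x,s)}{(t-s)^{1-\alpha}}\,ds$. For $q\in[1,\infty]$ and $u_0\in L^q(\mathbb{R}^N)$, an $L^q$-solution of the problem with initial datum $u_0$ and existence time $T_*\in(0,\infty]$ is a function $u\in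 L^\infty_{\rm loc}([0,T_* );L^q(\mathbb{R}^N))$ satisfying $$u(x,t)=\int_{\mathbb{R}^N} u_0(y)Z(x-y,t)\,dy+\int_0^t\int_{\mathbb{R}^N}|u(y,s)|^{p-1}u(y,s)Y(x-y,t-s)\,dy\,ds$$ in $L^q(\mathbb{R}^N)$ for almost all $t\in(0,T_* )$, and such that $\operatorname{ess\,lim}_{t\to0^+}\|u(\cdot,t)-u_0\|_{L^q(\mathbb{R}^N)}=0$. Nontrivial means not identically zero (almost everywhere).
   Formalization: The L^q-solution u is taken with its maximal existence time T_* in (0,∞] (no L^q-solution with larger existence time extends it), since a solution restricted to a shorter time interval stays bounded and would violate the claim; the limsup is the essential one. *)

theory Defs
  imports "HOL-Analysis.Analysis" "HOL-Probability.Essential_Supremum"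
begin

text \<open>
  The space \<open>\<real>\<^sup>N\<close> is a type of class \<open>euclidean_space\<close>, with \<open>N = DIM('a)\<close>.
  A function \<open>u(x,t)\<close> is written with the time first, \<open>u t x\<close>, so that \<open>u t\<close> is its time slice.
\<close>

definition has_caputo_derivative ::
  "real \<Rightarrow> (real \<Rightarrow> 'b::euclidean_space) \<Rightarrow> 'b \<Rightarrow> real \<Rightarrow> bool" where
  "has_caputo_derivative \<alpha> w D t \<longleftrightarrow>
     ((\<lambda>\<tau>. (1 / Gamma (1 - \<alpha>)) *\<^sub>R
        (LINT s:{0<..<\<tau>}|lebesgue. (1 / (\<tau> - s) powr \<alpha>) *\<^sub>R (w s - w 0)))
      has_vector_derivative D) (at t)"

definition fourier :: "('a::euclidean_space \<Rightarrow> real) \<Rightarrow> 'a \<Rightarrow> complex" where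
  "fourier f \<xi> = (LINT x|lebesgue. f x *\<^sub>R cis (- (x \<bullet> \<xi>)))"

text \<open>
  \<open>Z\<close> solves \<open>\<partial>\<^sub>t\<^sup>\<alpha> Z + (-\<Delta>)\<^sup>\<beta> Z = 0\<close> with a Dirac mass at the origin as initial datum.
  The power of the Laplacian is the operator with symbol \<open>|\<xi>|\<^bsup>2\<beta>\<^esup>\<close>, so the equation is
  expressed for the spatial Fourier transform; the Dirac mass has transform 1, which is the value
  at time 0, and the continuity at time 0 says that the datum is attained.
  These conditions determine \<open>Z t\<close> only up to null sets. As \<open>Y\<close> is defined by differentiating
  in time at a fixed point, we take the representative that is continuous away from the origin
  (\<open>Z t\<close> is singular there); its value at \<open>x = 0\<close> is irrelevant.
\<close>
definition fundamental_solution ::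
  "real \<Rightarrow> real \<Rightarrow> (real \<Rightarrow> 'a::euclidean_space \<Rightarrow> real) \<Rightarrow> bool" where
  "fundamental_solution \<alpha> \<beta> Z \<longleftrightarrow>
     continuous_on ({0<..} \<times> (- {0})) (\<lambda>(t, x). Z t x) \<and>
     (\<forall>t>0. integrable lebesgue (Z t)) \<and>
     (\<forall>\<xi>. let w = (\<lambda>t. if t = 0 then 1 else fourier (Z t) \<xi>) in
        continuous_on {0..} w \<and>
        (\<forall>t>0. has_caputo_derivative \<alpha> w (- ((norm \<xi> powr (2 * \<beta>)) *\<^sub>R w t)) t))"

text \<open>
  The Riemann-Liouville derivative of order \<open>1 - \<alpha>\<close> of the fundamental solution, pointwise in
  \<open>x\<close>; it is meaningful for \<open>x \<noteq> 0\<close>.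
\<close>
definition Y_kernel ::
  "real \<Rightarrow> (real \<Rightarrow> 'a::euclidean_space \<Rightarrow> real) \<Rightarrow> real \<Rightarrow> 'a \<Rightarrow> real" where
  "Y_kernel \<alpha> Z t x =
     1 / Gamma \<alpha> *
     deriv (\<lambda>\<tau>. LINT s:{0<..<\<tau>}|lebesgue. Z s x / (\<tau> - s) powr (1 - \<alpha>)) t"

text \<open>The \<open>L\<^sup>q\<close> norm for \<open>1 \<le> q \<le> \<infinity>\<close>, with value \<open>\<infinity>\<close> outside \<open>L\<^sup>q\<close>.\<close>
definition Lq_norm :: "ereal \<Rightarrow> ('a::euclidean_space \<Rightarrow> real) \<Rightarrow> ennreal" where
  "Lq_norm q f =
     (if q = \<infinity> then esssup lebesgue (\<lambda>x. ennreal \<bar>f x\<bar>)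
      else let r = real_of_ereal q; I = (\<integral>\<^sup>+ x. ennreal (\<bar>f x\<bar> powr r) \<partial>lebesgue)
           in if I = \<infinity> then \<infinity> else ennreal (enn2real I powr (1 / r)))"

definition in_Lq :: "ereal \<Rightarrow> ('a::euclidean_space \<Rightarrow> real) \<Rightarrow> bool" where
  "in_Lq q f \<longleftrightarrow> f \<in> borel_measurable lebesgue \<and> Lq_norm q f < \<infinity>"

text \<open>
  Essential limits: a property holds eventually for \<open>ess_at_left T\<close> iff it holds for almost every
  \<open>t\<close> in some interval \<open>(T - \<epsilon>, T)\<close>, and likewise on the right.
\<close>
definition ess_at_left :: "real \<Rightarrow> real filter" where
  "ess_at_left T = inf (ae_filter lebesgue) (at_left T)"

definition ess_at_right :: "real \<Rightarrow> real filter" where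
  "ess_at_right T = inf (ae_filter lebesgue) (at_right T)"

text \<open>
  \<open>Lq_solution \<alpha> Z p q u0 T u\<close>: \<open>u\<close> is an \<open>L\<^sup>q\<close>-solution with initial datum \<open>u0\<close> and existence
  time \<open>T \<in> (0, \<infinity>]\<close>; its values at times outside \<open>(0, T)\<close> play no role. Since the Lebesgue
  integral has a default value for functions that are not integrable, the absolute convergence of
  the integrals in the Duhamel formula is stated explicitly.
\<close>
definition Lq_solution ::
  "real \<Rightarrow> (real \<Rightarrow> 'a::euclidean_space \<Rightarrow> real) \<Rightarrow> real \<Rightarrow> ereal \<Rightarrow> ('a \<Rightarrow> real) \<Rightarrow> ereal \<Rightarrow>
     (real \<Rightarrow> 'a \<Rightarrow> real) \<Rightarrow> bool" where
  "Lq_solution \<alpha> Z p q u0 T u \<longleftrightarrow>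
     0 < T \<and>
     (\<lambda>(t, x). u t x) \<in> borel_measurable (lebesgue_on ({t. 0 < t \<and> ereal t < T} \<times> UNIV)) \<and>
     (\<forall>t1. 0 < t1 \<and> ereal t1 < T \<longrightarrow>
        (\<exists>C. AE t in lebesgue. 0 < t \<and> t < t1 \<longrightarrow> Lq_norm q (u t) \<le> ennreal C)) \<and>
     (AE t in lebesgue. 0 < t \<and> ereal t < T \<longrightarrow>
        (AE x in lebesgue.
           integrable lebesgue (\<lambda>y. u0 y * Z t (x - y)) \<and>
           set_integrable lebesgue ({0<..<t} \<times> UNIV)
             (\<lambda>(s, y). \<bar>u s y\<bar> powr (p - 1) * u s y * Y_kernel \<alpha> Z (t - s) (x - y)) \<and>
           u t x =
             (LINT y|lebesgue. u0 y * Z t (x - y)) +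
             (LINT s:{0<..<t}|lebesgue. LINT y|lebesgue.
                \<bar>u s y\<bar> powr (p - 1) * u s y * Y_kernel \<alpha> Z (t - s) (x - y)))) \<and>
     ((\<lambda>t. Lq_norm q (\<lambda>x. u t x - u0 x)) \<longlongrightarrow> 0) (ess_at_right 0)"

text \<open>
  \<open>T\<close> is the maximal existence time of \<open>u\<close>: no \<open>L\<^sup>q\<close>-solution with the same datum and a larger
  existence time extends \<open>u\<close>.
\<close>
definition maximal_Lq_solution ::
  "real \<Rightarrow> (real \<Rightarrow> 'a::euclidean_space \<Rightarrow> real) \<Rightarrow> real \<Rightarrow> ereal \<Rightarrow> ('a \<Rightarrow> real) \<Rightarrow> ereal \<Rightarrow>
     (real \<Rightarrow> 'a \<Rightarrow> real) \<Rightarrow> bool" where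
  "maximal_Lq_solution \<alpha> Z p q u0 T u \<longleftrightarrow>
     Lq_solution \<alpha> Z p q u0 T u \<and>
     \<not> (\<exists>T' v. T < T' \<and> Lq_solution \<alpha> Z p q u0 T' v \<and>
          (AE t in lebesgue. 0 < t \<and> ereal t < T \<longrightarrow> (AE x in lebesgue. v t x = u t x)))"

end

theory Submission
  imports Defs "HOL-Probability.Probability"
begin

text \<open>Two mechanisms exclude the alternatives to blow-up in finite time.

A solution that exists for all times is tested against \<open>exp (-|x|/R)\<close>. With \<open>\<tau> = R^(2\<beta>/\<alpha>)\<close> the
kernels \<open>Z t\<close> and \<open>Y t\<close>, \<open>t \<le> \<tau>\<close>, move mass by at most a distance of order \<open>R\<close>, so the weighted mass \<open>m\<close>
satisfies \<open>m(t) \<ge> A + B \<integral> m^p\<close> on \<open>(0, \<tau>)\<close>, where \<open>A\<close> stays away from 0 as \<open>R\<close> grows and \<open>B\<close> is of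
order \<open>\<tau>^(\<alpha>-1) R^(-N(p-1))\<close>. Such an \<open>m\<close> doubles in times that form a convergent series
(\<open>doubling\<close>), which bounds \<open>A^(p-1) B \<tau>\<close>. This product is of order \<open>R^(2\<beta> - N(p-1))\<close>, and the exponent is
positive exactly when \<open>p < 1 + 2\<beta>/N\<close>: hence \<open>u0 = 0\<close> (\<open>no_global_mild\<close>).

If the existence time \<open>T\<close> is finite and the \<open>L^q\<close> norm stays bounded near \<open>T\<close>, the solution can be
continued, against maximality (\<open>continuation\<close>). The nonlinearity need not be integrable when \<open>q < p\<close>.
Positivity of the kernel makes a weighted integral of \<open>u^p\<close> finite, and a Gronwall argument with
singular kernel upgrades this to \<open>u(t) \<in> L^r\<close> with \<open>r\<close> large enough (\<open>smoothing\<close>). After that a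
monotone iteration of the Duhamel map beyond \<open>T\<close> converges. The same bound is proportional to the
norm of \<open>u0\<close>, so that \<open>u0 = 0\<close> forces \<open>u = 0\<close>, which nontriviality excludes.

Both arguments need positivity and size of the kernels, while \<open>Z\<close> is only given through the
Fourier transform of its fractional evolution equation. It is identified by subordination. Let \<open>\<sigma>\<close> and \<open>S\<close>
be independent positive stable variables of orders \<open>\<alpha>\<close> and \<open>\<beta>\<close>, and \<open>\<rho> = (t/\<sigma>)^(\<alpha>/\<beta>) S\<close>; with \<open>G s\<close> the
heat kernel at time \<open>s\<close>,
\<open>Z t = E[G \<rho>]\<close> and \<open>Y t = \<alpha> t^(\<alpha>-1) E[\<sigma>^(-\<alpha>) G \<rho>]\<close>.
The transform of the first mixture is the Mittag-Leffler function \<open>E[exp (-|\<xi>|^(2\<beta>) t^\<alpha> \<sigma>^(-\<alpha>))]\<close>. The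
relaxation equation has only one solution, and a Fourier transform determines a function wherever
the function is continuous. Every estimate on the kernels then reduces to one on Gaussians and to moments
of stable laws: finite negative moments, and finite positive moments below the order.\<close>

text \<open>
  \<open>NN x. f x\<close> is the Lebesgue integral of a function with values in \<open>[0, \<infinity>]\<close>, and \<open>AEl x. P x\<close> is
  truth for Lebesgue-almost every \<open>x\<close>. Throughout, \<open>al\<close> and \<open>be\<close> are the orders \<open>\<alpha>\<close> and \<open>\<beta>\<close> of the
  equation, and times are named \<open>ta\<close> where \<open>\<tau>\<close> is customary.
\<close>

abbreviation NI :: "('a::euclidean_space => ennreal) => ennreal" (binder "NN " 10) where
  "NI f == nn_integral lborel f"
abbreviation AEb :: "('a::euclidean_space => bool) => bool" (binder "AEl " 10) where
  "AEb P == eventually P (ae_filter lborel)"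
abbreviation Bm :: "('a::topological_space => 'b::topological_space) set" where
  "Bm == borel_measurable borel"
abbreviation Bm2 :: "('a::topological_space * 'b::topological_space => 'c::topological_space) set" where
  "Bm2 == borel_measurable (borel \<Otimes>\<^sub>M borel)"
abbreviation EN :: "real => ennreal" where "EN == ennreal"
lemmas emult = ennreal_mult[symmetric]

section \<open>Powers and Lebesgue norms of nonnegative functions\<close>

text \<open>Powers with real exponent on \<open>[0, \<infinity>]\<close>; the exponent 0 gives 1 even at \<open>0\<close> and \<open>\<infinity>\<close>.\<close>

definition epow :: "ennreal => real => ennreal" where
 "epow x s = (if s = 0 then 1 else if x = top then top else EN (enn2real x powr s))"

lemma epow_ennreal: "0 <= x ==> s ~= 0 ==> epow (EN x) s = EN (x powr s)"
 by (simp add: epow_def)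

lemma epow_zero_exp [simp]: "epow x 0 = 1" by (simp add: epow_def)
lemma epow_one_exp [simp]: "epow x 1 = x"
 by (cases x) (auto simp: epow_def)
lemma epow_0 [simp]: "s ~= 0 ==> epow 0 s = 0" by (simp add: epow_def)
lemma epow_1 [simp]: "epow 1 s = 1" by (simp add: epow_def)
lemma epow_top [simp]: "s ~= 0 ==> epow top s = top" by (simp add: epow_def)

lemma epow_measurable [measurable (raw)]:
 assumes [measurable]: "f \<in> borel_measurable M"
 shows "(%x. epow (f x) s) \<in> borel_measurable M"
 unfolding epow_def by measurable

lemma epow_mono: "x <= y ==> 0 <= s ==> epow x s <= epow y s"
 by (cases "x = top"; cases x; cases y) (auto simp: epow_def top_unique intro!: ennreal_leI powr_mono2)

lemma epow_mult: "0 <= s ==> epow (x * y) s = epow x s * epow y s"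
 apply (cases "s = 0", simp)
 apply (cases x; cases y)
  apply (auto simp: epow_def emult enn2real_mult powr_mult ennreal_mult_top ennreal_top_mult ennreal_mult_eq_top_iff)
 done

lemma epow_epow: "0 <= s ==> 0 <= r ==> epow (epow x s) r = epow x (s * r)"
 by (cases x) (auto simp: epow_def powr_powr)

lemma epow_add: "0 <= s ==> 0 <= r ==> epow x (s + r) = epow x s * epow x r"
 by (cases x) (auto simp: epow_def powr_add emult)

lemma epow_eq_0_iff: "0 < s ==> epow x s = 0 \<longleftrightarrow> x = 0"
 by (cases x) (auto simp: epow_def)

lemma epow_eq_top_iff: "0 < s ==> epow x s = top \<longleftrightarrow> x = top"
 by (cases x) (auto simp: epow_def)

lemma epow_inverse: "0 < s ==> epow (epow x s) (1/s) = x"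
 by (simp add: epow_epow)

lemma epow_inverse': "0 < s ==> epow (epow x (1/s)) s = x"
 by (simp add: epow_epow)

lemma epow_le_iff: "0 < s ==> epow x s <= epow y s \<longleftrightarrow> x <= y"
 using epow_mono[of x y s] epow_mono[of "epow x s" "epow y s" "1/s"] epow_inverse[of s] by auto

lemma epow_SUP:
 assumes "0 < s" "I ~= {}"
 shows "epow (SUP i\<in>I. f i) s = (SUP i\<in>I. epow (f i) s)"
proof (rule antisym)
 have "epow (SUP i\<in>I. f i) s <= (SUP i\<in>I. epow (f i) s) \<longleftrightarrow> (SUP i\<in>I. f i) <= epow (SUP i\<in>I. epow (f i) s) (1/s)"
  using assms by (metis epow_inverse' epow_le_iff)
 moreover have "f i <= epow (SUP i\<in>I. epow (f i) s) (1/s)" if "i \<in> I" for i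
 proof -
  have "epow (epow (f i) s) (1/s) <= epow (SUP i\<in>I. epow (f i) s) (1/s)"
  using assms that by (intro epow_mono SUP_upper) auto
  then show ?thesis using assms by (simp add: epow_inverse)
 qed
 ultimately show "epow (SUP i\<in>I. f i) s <= (SUP i\<in>I. epow (f i) s)"
  by (simp add: SUP_le_iff)
 show "(SUP i\<in>I. epow (f i) s) <= epow (SUP i\<in>I. f i) s"
  using assms by (intro SUP_least epow_mono SUP_upper) auto
qed

lemma young_real:
 fixes a b i :: real assumes "0 <= a" "0 <= b" "0 < i" "i < 1"
 shows "a powr i * b powr (1 - i) <= i * a + (1 - i) * b"
proof (cases "a = 0 \<or> b = 0")
 case False
 then have pos: "0 < a" "0 < b" using assms by auto
 have "a powr i * b powr (1 - i) = exp (i * ln a + (1 - i) * ln b)"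
  using pos by (simp add: powr_def exp_add)
 also have "... <= i * exp (ln a) + (1 - i) * exp (ln b)"
  using convex_onD[OF exp_convex, of "1-i" "ln a" "ln b"] assms by simp
 finally show ?thesis using pos by simp
qed (use assms in auto)

text \<open>The weighted arithmetic-geometric mean inequality, from which Hoelder's inequality follows by
normalising both factors.\<close>

lemma young_epow:
 assumes "0 < i" "i < 1"
 shows "epow a i * epow b (1 - i) <= EN i * a + EN (1 - i) * b"
proof (cases "a = top \<or> b = top")
 case True then show ?thesis using assms by (auto simp: ennreal_mult_top)
next
 case False
 then obtain x y where xy: "a = EN x" "b = EN y" "0 <= x" "0 <= y"
  by (metis ennreal_cases infinity_ennreal_def)
 have "epow a i * epow b (1 - i) = EN (x powr i * y powr (1-i))"
  using xy assms by (simp add: epow_ennreal ennreal_mult)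
 also have "... <= EN (i * x + (1-i) * y)" using young_real xy assms by (intro ennreal_leI) auto
 also have "... = EN i * a + EN (1 - i) * b" using xy assms by (simp add: ennreal_plus ennreal_mult)
 finally show ?thesis .
qed

lemma holder_nn:
 assumes [measurable]: "f \<in> borel_measurable M" "g \<in> borel_measurable M" and i: "0 < i" "i < 1"
 shows "(\<integral>\<^sup>+x. epow (f x) i * epow (g x) (1 - i) \<partial>M)
  <= epow (\<integral>\<^sup>+x. f x \<partial>M) i * epow (\<integral>\<^sup>+x. g x \<partial>M) (1 - i)"
proof -
 define A where "A = (\<integral>\<^sup>+x. f x \<partial>M)"
 define B where "B = (\<integral>\<^sup>+x. g x \<partial>M)"
 have z: ?thesis if "A = 0 \<or> B = 0"
 proof -
  have "AE x in M. f x = 0 \<or> g x = 0" using that unfolding A_def B_def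
  by (auto simp: nn_integral_0_iff_AE)
  then have "AE x in M. epow (f x) i * epow (g x) (1 - i) = 0" by (rule eventually_mono) (use i in auto)
  then have "(\<integral>\<^sup>+x. epow (f x) i * epow (g x) (1 - i) \<partial>M) = 0" by (subst nn_integral_0_iff_AE) auto
  then show ?thesis by simp
 qed
 have t: ?thesis if "A ~= 0" "B ~= 0" "A = top \<or> B = top"
  using that i unfolding A_def[symmetric] B_def[symmetric]
  by (auto simp: ennreal_top_mult ennreal_mult_top epow_eq_0_iff)
 have ?thesis if nz: "A ~= 0" "B ~= 0" "A ~= top" "B ~= top"
 proof -
  obtain a where a: "A = EN a" "0 < a" using nz by (cases A) (auto simp: less_le)
  obtain b where b: "B = EN b" "0 < b" using nz by (cases B) (auto simp: less_le)
  have sc: "(\<integral>\<^sup>+x. epow (EN (1/a) * f x) i * epow (EN (1/b) * g x) (1 - i) \<partial>M) <= 1"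
  proof -
  have "(\<integral>\<^sup>+x. epow (EN (1/a) * f x) i * epow (EN (1/b) * g x) (1 - i) \<partial>M)
  <= (\<integral>\<^sup>+x. EN i * (EN (1/a) * f x) + EN (1 - i) * (EN (1/b) * g x) \<partial>M)"
  by (intro nn_integral_mono young_epow i)
  also have "... = EN i * (EN (1/a) * A) + EN (1 - i) * (EN (1/b) * B)"
  by (simp add: nn_integral_add nn_integral_cmult A_def B_def)
  also have "... = 1" using a b i by (simp add: emult ennreal_plus[symmetric] del: ennreal_plus)
  finally show ?thesis .
  qed
  have eq: "epow (f x) i * epow (g x) (1 - i) = epow A i * epow B (1 - i) * (epow (EN (1/a) * f x) i * epow (EN (1/b) * g x) (1 - i))" for x
  proof -
  have 1: "f x = A * (EN (1/a) * f x)" using a by (simp add: mult.assoc[symmetric] emult)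
  have 2: "g x = B * (EN (1/b) * g x)" using b by (simp add: mult.assoc[symmetric] emult)
  have "epow (f x) i * epow (g x) (1 - i) = (epow A i * epow (EN (1/a) * f x) i) * (epow B (1-i) * epow (EN (1/b) * g x) (1 - i))"
  using i by (subst 1, subst 2) (simp only: epow_mult less_imp_le diff_ge_0_iff_ge)
  then show ?thesis by (simp add: ac_simps)
  qed
  have "(\<integral>\<^sup>+x. epow (f x) i * epow (g x) (1 - i) \<partial>M) = epow A i * epow B (1 - i) * (\<integral>\<^sup>+x. epow (EN (1/a) * f x) i * epow (EN (1/b) * g x) (1 - i) \<partial>M)"
  by (subst eq, subst nn_integral_cmult) auto
  also have "... <= epow A i * epow B (1 - i) * 1" by (intro mult_left_mono sc) auto
  finally show ?thesis by (simp add: A_def B_def)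
 qed
 with z t show ?thesis by blast
qed

lemma ennreal_inverse_mult_self: "a ~= 0 ==> a ~= top ==> inverse a * (a::ennreal) = 1"
 using mult_divide_eq_ennreal[of a 1] by (simp add: divide_ennreal_def mult.commute)

lemma ennreal_mult_div_self: "a ~= 0 ==> a ~= top ==> a * (b / a) = (b::ennreal)"
 using mult_divide_eq_ennreal[of a b] by (simp add: ennreal_times_divide mult.commute)

text \<open>Jensen's inequality for powers, from the tangent inequality.\<close>
lemma tangent_real: fixes a m c :: real assumes "0 <= a" "0 <= m" "1 < c"
 shows "c * (m powr (c-1) * a) <= a powr c + (c-1) * m powr c"
proof -
 have "(a powr c) powr (1/c) * (m powr c) powr (1 - 1/c) <= 1/c * a powr c + (1 - 1/c) * m powr c"
  using assms by (intro young_real) auto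
 moreover have "(a powr c) powr (1/c) = a" using assms by (simp add: powr_powr)
 moreover have "(m powr c) powr (1 - 1/c) = m powr (c - 1)" using assms by (simp add: powr_powr algebra_simps)
 ultimately have "a * m powr (c-1) <= 1/c * a powr c + (1 - 1/c) * m powr c" by simp
 then have "c * (a * m powr (c-1)) <= c * (1/c * a powr c + (1 - 1/c) * m powr c)" using assms by (intro mult_left_mono) auto
 also have "... = a powr c + (c-1) * m powr c" using assms by (simp add: field_simps)
 finally show ?thesis by (simp add: ac_simps)
qed

lemma jensen_epow:
 assumes "prob_space M" and [measurable]: "f \<in> borel_measurable M" and c: "1 <= c"
 shows "epow (\<integral>\<^sup>+x. f x \<partial>M) c <= (\<integral>\<^sup>+x. epow (f x) c \<partial>M)"
proof (cases "c = 1")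
 case False
 then have c: "1 < c" using c by simp
 interpret prob_space M by fact
 define m where "m = (\<integral>\<^sup>+x. f x \<partial>M)"
 show ?thesis
 proof (cases "m = top")
  case True
  have "f x <= 1 + epow (f x) c" for x
  proof (cases "f x")
  case (real r)
  show ?thesis
  proof (cases "r <= 1")
  case False
  then have "r powr 1 <= r powr c" using c by (intro powr_mono) auto
  then have "EN r <= epow (f x) c" using real c False by (simp add: epow_ennreal ennreal_leI)
  then show ?thesis using real by (simp add: add_increasing)
  qed (use real in \<open>auto intro: add_increasing2\<close>)
  qed (use c in auto)
  then have "m <= (\<integral>\<^sup>+x. 1 + epow (f x) c \<partial>M)" unfolding m_def by (intro nn_integral_mono) auto
  also have "... = 1 + (\<integral>\<^sup>+x. epow (f x) c \<partial>M)" by (simp add: nn_integral_add emeasure_space_1)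
  finally have "(\<integral>\<^sup>+x. epow (f x) c \<partial>M) = top" using True by (simp add: top_unique ennreal_add_eq_top)
  then show ?thesis by simp
 next
  case fin: False
  show ?thesis
  proof (cases "(\<integral>\<^sup>+x. epow (f x) c \<partial>M) = top")
  case False
  obtain r where r: "m = EN r" "0 <= r" using fin by (cases m) auto
  have "EN c * (EN (r powr (c-1)) * f x) <= epow (f x) c + EN ((c-1) * r powr c)" for x
  proof (cases "f x")
  case (real y)
  have "EN c * (EN (r powr (c-1)) * f x) = EN (c * (r powr (c-1) * y))"
  using real c by (simp add: ennreal_mult)
  also have "... <= EN (y powr c + (c-1) * r powr c)"
  using real r c by (intro ennreal_leI tangent_real) auto
  also have "... = epow (f x) c + EN ((c-1) * r powr c)" using real c by (simp add: epow_ennreal)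
  finally show ?thesis .
  qed (use c in auto)
  then have "(\<integral>\<^sup>+x. EN c * (EN (r powr (c-1)) * f x) \<partial>M) <= (\<integral>\<^sup>+x. epow (f x) c + EN ((c-1) * r powr c) \<partial>M)"
  by (intro nn_integral_mono)
  then have 1: "EN c * (EN (r powr (c-1)) * m) <= (\<integral>\<^sup>+x. epow (f x) c \<partial>M) + EN ((c-1) * r powr c)"
  by (simp add: nn_integral_cmult nn_integral_add emeasure_space_1 m_def)
  obtain I where I: "(\<integral>\<^sup>+x. epow (f x) c \<partial>M) = EN I" "0 <= I" using False by (cases "(\<integral>\<^sup>+x. epow (f x) c \<partial>M)") auto
  have rr: "r powr (c-1) * r = r powr c" using r by (cases "r = 0") (auto simp: powr_mult_base powr_diff)
  have "EN (c * r powr c) <= EN (I + (c-1) * r powr c)"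
  using 1 I c r rr by (simp add: emult)
  then have "c * r powr c <= I + (c-1) * r powr c" using I c by (subst (asm) ennreal_le_iff) auto
  then have "r powr c <= I" by (simp add: algebra_simps)
  then show ?thesis using I r c by (simp add: m_def[symmetric] epow_ennreal ennreal_leI)
  qed (simp)
 qed
qed simp

text \<open>The norm of \<open>L^(1/i)\<close>, so that \<open>i = 0\<close> is the essential supremum. With the reciprocal exponent as
parameter the inequalities of Hoelder and the smoothing estimates are linear in the indices
and the endpoint needs no separate notation.\<close>

definition Nm :: "real => ('a::euclidean_space => ennreal) => ennreal" where
 "Nm i f = (if i = 0 then Inf {z. AEl x. f x <= z} else epow (NN x. epow (f x) (1/i)) i)"

lemma AE_le_Nm0:
 assumes [measurable]: "f \<in> Bm" shows "AEl x. f x <= Nm 0 f"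
 using esssup_AE[of f lborel] by (simp add: Nm_def esssup_eq_AE)

lemma Nm0_le: "AEl x. f x <= z ==> Nm 0 f <= z"
 by (auto simp: Nm_def intro: Inf_lower)

lemma Nm_pos: "i ~= 0 ==> Nm i f = epow (NN x. epow (f x) (1/i)) i" by (simp add: Nm_def)

lemma Nm_1: "Nm 1 f = (NN x. f x)" by (simp add: Nm_def)

lemma Nm_mono_AE:
 assumes "AEl x. f x <= g x" "0 <= i" shows "Nm i f <= Nm i g"
proof (cases "i = 0")
 case True
 have "{z. AEl x. g x <= z} \<subseteq> {z. AEl x. f x <= z}"
  using assms by (auto elim: eventually_elim2 intro: order_trans)
 then show ?thesis using True by (simp add: Nm_def Inf_superset_mono)
next
 case False
 then have "(NN x. epow (f x) (1/i)) <= (NN x. epow (g x) (1/i))"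
  using assms by (intro nn_integral_mono_AE) (auto elim!: eventually_mono intro!: epow_mono)
 then show ?thesis using False assms by (auto simp: Nm_def intro!: epow_mono)
qed

lemma Nm_mono: "(!!x. f x <= g x) ==> 0 <= i ==> Nm i f <= Nm i g"
 by (rule Nm_mono_AE) auto

lemma Nm_cong_AE: "AEl x. f x = g x ==> 0 <= i ==> Nm i f = Nm i g"
 by (intro antisym Nm_mono_AE) (auto elim!: eventually_mono)

lemma Nm_cmult:
 assumes [measurable]: "f \<in> Bm" and "0 <= i"
 shows "Nm i (%x. c * f x) <= c * Nm i f"
proof (cases "i = 0")
 case True
 show ?thesis unfolding True
  using AE_le_Nm0[of f] by (intro Nm0_le) (auto elim!: eventually_mono intro!: mult_left_mono)
next
 case False
 have "(NN x. epow (c * f x) (1/i)) = epow c (1/i) * (NN x. epow (f x) (1/i))"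
  using assms False by (simp add: epow_mult nn_integral_cmult)
 then show ?thesis using assms False by (simp add: Nm_def epow_mult epow_inverse')
qed

lemma Nm_epow:
 assumes [measurable]: "f \<in> Bm" and "0 <= i" "0 < s"
 shows "Nm (s * i) (%x. epow (f x) s) = epow (Nm i f) s"
proof (cases "i = 0")
 case True
 have "Nm 0 (%x. epow (f x) s) = epow (Nm 0 f) s"
 proof (rule antisym)
  show "Nm 0 (%x. epow (f x) s) <= epow (Nm 0 f) s"
  using AE_le_Nm0[of f] assms by (intro Nm0_le) (auto elim!: eventually_mono intro!: epow_mono)
  have "Nm 0 f <= epow (Nm 0 (%x. epow (f x) s)) (1/s)"
  proof (rule Nm0_le)
  have "AEl x. epow (f x) s <= Nm 0 (%x. epow (f x) s)" by (rule AE_le_Nm0) auto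
  then show "AEl x. f x <= epow (Nm 0 (%x. epow (f x) s)) (1/s)"
  by eventually_elim (metis assms(3) epow_inverse' epow_le_iff)
  qed
  then show "epow (Nm 0 f) s <= Nm 0 (%x. epow (f x) s)"
  by (metis assms(3) epow_inverse' epow_le_iff)
 qed
 then show ?thesis using True by simp
next
 case False
 then show ?thesis using assms by (simp add: Nm_def epow_epow field_simps)
qed

lemma Nm_eq_0:
 assumes [measurable]: "f \<in> Bm" and "0 <= i" "Nm i f = 0"
 shows "AEl x. f x = 0"
proof (cases "i = 0")
 case True then show ?thesis using AE_le_Nm0[of f] assms by (auto elim!: eventually_mono intro: le_less_trans)
next
 case False
 then have "(NN x. epow (f x) (1/i)) = 0" using assms by (auto simp: Nm_def epow_eq_0_iff)
 then show ?thesis using False assms by (subst (asm) nn_integral_0_iff_AE) (auto simp: epow_eq_0_iff)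
qed

lemma Nm_zero [simp]:
 assumes "0 <= i" shows "Nm i (%_. 0) = 0"
proof (cases "i = 0")
 case True
 then show ?thesis using Nm0_le[of "%_. 0" 0] by simp
next
 case False
 then show ?thesis using assms by (simp add: Nm_def)
qed

lemma Nm_finite_AE:
 assumes [measurable]: "f \<in> Bm" and "0 <= i" "Nm i f < top"
 shows "AEl x. f x < top"
proof (cases "i = 0")
 case True then show ?thesis using AE_le_Nm0[of f] assms by (auto elim!: eventually_mono intro: le_less_trans)
next
 case False
 then have "(NN x. epow (f x) (1/i)) ~= \<infinity>" using assms by (auto simp: Nm_def)
 then have "AEl x. epow (f x) (1/i) ~= \<infinity>" by (intro nn_integral_PInf_AE) auto
 then show ?thesis
  using False assms by (auto elim!: eventually_mono simp: less_top epow_eq_top_iff)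
qed

lemma Nm_SUP:
 fixes f :: "nat => 'a::euclidean_space => ennreal"
 assumes [measurable]: "!!n. f n \<in> Bm" and "incseq f" "0 <= i" and B: "!!n. Nm i (f n) <= B"
 shows "Nm i (%x. SUP n. f n x) <= B"
proof (cases "i = 0")
 case True
 have "AEl x. \<forall>n. f n x <= B"
 proof (subst AE_all_countable, rule allI)
  fix n show "AEl x. f n x <= B"
  using AE_le_Nm0[of "f n"] B[of n] True by (auto elim!: eventually_mono)
 qed
 then show ?thesis unfolding True
  by (intro Nm0_le) (auto elim!: eventually_mono intro!: SUP_least)
next
 case False
 then have i: "0 < i" using assms by auto
 have "(NN x. epow (SUP n. f n x) (1/i)) = (NN x. (SUP n. epow (f n x) (1/i)))"
  using i by (simp add: epow_SUP)
 also have "... = (SUP n. (NN x. epow (f n x) (1/i)))"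
  using i \<open>incseq f\<close> by (intro nn_integral_monotone_convergence_SUP) (auto simp: incseq_def le_fun_def intro!: epow_mono)
 finally have "Nm i (%x. SUP n. f n x) = (SUP n. Nm i (f n))" using i by (simp add: Nm_def epow_SUP)
 then show ?thesis using B by (simp add: SUP_le_iff)
qed

text \<open>For \<open>i = 0\<close> a superlevel set of the norm consists of the times whose slice exceeds the level on a
set of positive measure, and the measure of a slice is a measurable function of time.\<close>

lemma Nm_measurable [measurable (raw)]:
 assumes [measurable]: "(%(t, x). f t x) \<in> Bm2" and "0 <= i"
 shows "(%t::real. Nm i (%x::'a::euclidean_space. f t x)) \<in> Bm"
proof (cases "i = 0")
 case True
 have sec: "f t \<in> Bm" for t by measurable
 have iff: "(Nm 0 (f t) > z) \<longleftrightarrow> emeasure lborel {x \<in> space lborel. f t x > z} ~= 0" for t z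
 proof
  assume *: "Nm 0 (f t) > z"
  show "emeasure lborel {x \<in> space lborel. f t x > z} ~= 0"
  proof
  assume "emeasure lborel {x \<in> space lborel. f t x > z} = 0"
  then have "AEl x. f t x <= z" by (auto simp: AE_iff_measurable[OF _ refl] not_le sec)
  then show False using Nm0_le * by fastforce
  qed
 next
  assume *: "emeasure lborel {x \<in> space lborel. f t x > z} ~= 0"
  show "Nm 0 (f t) > z"
  proof (rule ccontr)
  assume "~ Nm 0 (f t) > z"
  then have "AEl x. f t x <= z" using AE_le_Nm0[OF sec, of t] by (auto elim!: eventually_mono)
  then show False using * by (auto simp: AE_iff_measurable[OF _ refl] not_le sec)
  qed
 qed
 show ?thesis
 proof (rule borel_measurableI_greater)
  fix z
  have "{t \<in> space borel. z < Nm i (f t)} = {t. emeasure lborel {x \<in> space lborel. f t x > z} ~= 0}"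
  using iff True by auto
  also have "... \<in> sets borel"
  proof -
  have "(%t. emeasure lborel {x \<in> space (lborel::'a measure). f t x > z}) \<in> Bm"
  by measurable
  then show ?thesis by measurable
  qed
  finally show "{t \<in> space borel. z < Nm i (f t)} \<in> sets borel" .
 qed
qed (use assms in \<open>simp add: Nm_def cong: if_cong\<close>)

text \<open>The integral is \<open>N = \<integral> n\<close> times the mean of \<open>f s / n s\<close> under the probability measure with density \<open>n/N\<close>, and
Jensen's inequality bounds the power of the mean. Where \<open>n\<close> vanishes, so does \<open>f s\<close> almost everywhere.\<close>

lemma minkowski_integral:
 fixes f :: "'b => 'a::euclidean_space => ennreal"
 assumes "sigma_finite_measure M" and fm[measurable]: "(%(s, x). f s x) \<in> borel_measurable (M \<Otimes>\<^sub>M borel)"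
  and [measurable]: "n \<in> borel_measurable M"
  and i: "0 <= i" "i <= 1" and bd: "AE s in M. Nm i (f s) <= n s"
 shows "Nm i (%x. \<integral>\<^sup>+s. f s x \<partial>M) <= (\<integral>\<^sup>+s. n s \<partial>M)"
proof -
 interpret M: sigma_finite_measure M by fact
 interpret P: pair_sigma_finite M "lborel :: 'a measure" ..
 have sec[measurable]: "f s \<in> Bm" if "s \<in> space M" for s using that by measurable
 show ?thesis
 proof (cases "i = 0")
  case True
  have "AE s in M. AEl x. f s x <= n s"
  using bd AE_space
  proof eventually_elim
  case (elim s)
  then have "AEl x. f s x <= Nm 0 (f s)" by (intro AE_le_Nm0) auto
  then show ?case using elim True by (auto elim!: eventually_mono)
  qed
  moreover have "{z \<in> space (M \<Otimes>\<^sub>M lborel). f (fst z) (snd z) <= n (fst z)} \<in> sets (M \<Otimes>\<^sub>M lborel)" by measurable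
  ultimately have "AEl x. AE s in M. f s x <= n s"
  using P.AE_commute[of "%s x. f s x <= n s"] by blast
  then show ?thesis unfolding True
  by (intro Nm0_le) (auto elim!: eventually_mono intro!: nn_integral_mono_AE)
 next
  case False
  then have i0: "0 < i" using i by auto
  define b where "b = 1 / i"
  have b: "1 <= b" "0 < b" "1 / b = i" using i0 i by (auto simp: b_def)
  define N where "N = (\<integral>\<^sup>+s. n s \<partial>M)"
  define F where "F = (%x. \<integral>\<^sup>+s. f s x \<partial>M)"
  have [measurable]: "F \<in> Bm" unfolding F_def by measurable
  show ?thesis
  proof (cases "N = top")
  case Nfin: False
  have bd': "AE s in M. (NN x. epow (f s x) b) <= epow (n s) b"
  using bd
  proof eventually_elim
  case (elim s)
  then have "epow (NN x. epow (f s x) b) i <= n s" using i0 by (simp add: Nm_def b_def)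
  then show ?case using epow_mono[of _ "n s" b] b i0
  by (metis b_def epow_inverse less_imp_le)
  qed
  have z: "AE s in M. n s = 0 --> (AEl x. f s x = 0)"
  using bd' AE_space
  proof eventually_elim
  case (elim s)
  show ?case
  proof
  assume "n s = 0"
  then have "(NN x. epow (f s x) b) = 0" using elim b by simp
  then show "AEl x. f s x = 0"
  using b elim by (subst (asm) nn_integral_0_iff_AE) (auto simp: epow_eq_0_iff)
  qed
  qed
  have ntop: "AE s in M. n s ~= \<infinity>" using Nfin by (intro nn_integral_PInf_AE) (auto simp: N_def)
  define h where "h s x = (if n s = 0 then 0 else f s x / n s)" for s x
  have hm[measurable]: "(%(s, x). h s x) \<in> borel_measurable (M \<Otimes>\<^sub>M borel)"
  unfolding h_def by measurable
  have "AE s in M. AEl x. f s x = n s * h s x"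
  using z ntop
  proof eventually_elim
  case (elim s)
  show ?case
  proof (cases "n s = 0")
  case True then show ?thesis using elim by (auto elim!: eventually_mono)
  next
  case False
  then have "f s x = n s * (f s x / n s)" for x
  using elim(2) by (simp add: ennreal_mult_div_self)
  then show ?thesis using False by (simp add: h_def)
  qed
  qed
  moreover have "{z \<in> space (M \<Otimes>\<^sub>M lborel). f (fst z) (snd z) = n (fst z) * h (fst z) (snd z)} \<in> sets (M \<Otimes>\<^sub>M lborel)" by measurable
  ultimately have fh: "AEl x. AE s in M. f s x = n s * h s x"
  using P.AE_commute[of "%s x. f s x = n s * h s x"] by blast
  have hb: "AE s in M. n s * (NN x. epow (h s x) b) <= n s"
  using bd' ntop AE_space
  proof eventually_elim
  case (elim s)
  show ?case
  proof (cases "n s = 0")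
  case False
  have sm[measurable]: "f s \<in> Bm" using elim by auto
  have "(NN x. epow (h s x) b) = (NN x. epow (inverse (n s)) b * epow (f s x) b)"
  using False b by (simp add: h_def divide_ennreal_def epow_mult mult.commute)
  also have "... = epow (inverse (n s)) b * (NN x. epow (f s x) b)"
  by (rule nn_integral_cmult) auto
  also have "... <= epow (inverse (n s)) b * epow (n s) b" using elim by (intro mult_left_mono) auto
  also have "... = epow (inverse (n s) * n s) b" using b by (simp add: epow_mult)
  also have "inverse (n s) * n s = 1" using False elim by (simp add: ennreal_inverse_mult_self)
  finally have "(NN x. epow (h s x) b) <= 1" by simp
  then show ?thesis using mult_left_mono[of _ 1 "n s"] by simp
  qed simp
  qed
  show ?thesis
  proof (cases "N = 0")
  case True
  then have "AE s in M. n s = 0" by (simp add: N_def nn_integral_0_iff_AE)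
  with fh have "AEl x. F x = 0"
  unfolding F_def
  proof (elim eventually_mono)
  fix x assume "AE s in M. n s = 0" "AE s in M. f s x = n s * h s x"
  then have "AE s in M. f s x = 0" by eventually_elim auto
  then show "(\<integral>\<^sup>+s. f s x \<partial>M) = 0" by (subst nn_integral_0_iff_AE) auto
  qed
  then have "Nm i F = Nm i (%_::'a. 0)" by (rule Nm_cong_AE[OF _ i(1)])
  then show ?thesis using i by (simp add: F_def)
  next
  case N0: False
  define P where "P = density M (%s. n s / N)"
  have P1: "(\<integral>\<^sup>+s. n s / N \<partial>M) = 1"
  using N0 Nfin by (simp add: nn_integral_divide N_def[symmetric] less_top)
  have Pp: "prob_space P"
  by (rule prob_spaceI) (simp add: P_def emeasure_density P1 cong: nn_integral_cong)
  have key: "AEl x. epow (F x) b <= epow N b * (\<integral>\<^sup>+s. epow (h s x) b * (n s / N) \<partial>M)"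
  using fh
  proof eventually_elim
  case (elim x)
  have hx[measurable]: "(%s. h s x) \<in> borel_measurable M" by measurable
  have "F x = (\<integral>\<^sup>+s. n s * h s x \<partial>M)" unfolding F_def using elim by (rule nn_integral_cong_AE)
  also have "... = (\<integral>\<^sup>+s. N * (n s / N * h s x) \<partial>M)"
  using N0 Nfin by (intro nn_integral_cong) (simp add: mult.assoc[symmetric] ennreal_mult_div_self)
  also have "... = N * (\<integral>\<^sup>+s. h s x \<partial>P)" by (simp add: P_def nn_integral_cmult nn_integral_density)
  finally have "epow (F x) b = epow N b * epow (\<integral>\<^sup>+s. h s x \<partial>P) b" using b by (simp add: epow_mult)
  also have "... <= epow N b * (\<integral>\<^sup>+s. epow (h s x) b \<partial>P)"
  using b by (intro mult_left_mono jensen_epow Pp) (auto simp: P_def)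
  also have "(\<integral>\<^sup>+s. epow (h s x) b \<partial>P) = (\<integral>\<^sup>+s. epow (h s x) b * (n s / N) \<partial>M)"
  unfolding P_def by (subst nn_integral_density) (auto simp: mult.commute)
  finally show ?case .
  qed
  have "(NN x. epow (F x) b) <= (NN x. epow N b * (\<integral>\<^sup>+s. epow (h s x) b * (n s / N) \<partial>M))"
  by (rule nn_integral_mono_AE[OF key])
  also have "... = epow N b * (NN x. (\<integral>\<^sup>+s. epow (h s x) b * (n s / N) \<partial>M))"
  by (rule nn_integral_cmult) measurable
  also have "(NN x. (\<integral>\<^sup>+s. epow (h s x) b * (n s / N) \<partial>M)) = (\<integral>\<^sup>+s. (NN x. epow (h s x) b * (n s / N)) \<partial>M)"
  by (rule P.Fubini') measurable
  also have "... = (\<integral>\<^sup>+s. n s * (NN x. epow (h s x) b) / N \<partial>M)"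
  proof (rule nn_integral_cong)
  fix s assume s: "s \<in> space M"
  have "(%x. epow (h s x) b) \<in> borel_measurable lborel" using s by measurable
  then have "(NN x. epow (h s x) b * (n s / N)) = (NN x. epow (h s x) b) * (n s / N)"
  by (rule nn_integral_multc)
  then show "(NN x. epow (h s x) b * (n s / N)) = n s * (NN x. epow (h s x) b) / N"
  by (simp add: divide_ennreal_def ac_simps)
  qed
  also have "... <= (\<integral>\<^sup>+s. n s / N \<partial>M)"
  using hb by (intro nn_integral_mono_AE) (auto elim!: eventually_mono intro!: divide_right_mono_ennreal)
  also have "... = 1" by (rule P1)
  finally have "(NN x. epow (F x) b) <= epow N b" by (simp add: mult_left_mono)
  then have "epow (NN x. epow (F x) b) i <= epow (epow N b) i" using i by (intro epow_mono) auto
  then show ?thesis using i0 b by (simp add: Nm_def F_def[symmetric] N_def[symmetric] b_def epow_epow)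
  qed
  qed (simp add: N_def[symmetric])
 qed
qed

section \<open>One-sided stable laws\<close>

definition Lap :: "real measure => real => ennreal" where
 "Lap M s = (\<integral>\<^sup>+x. EN (exp (- s * x)) \<partial>M)"

text \<open>Laws carried by the half-line \<open>[0, \<infinity>)\<close>; \<open>Lap\<close> is the Laplace transform.\<close>

definition pos_law :: "real measure => bool" where
 "pos_law M \<longleftrightarrow> real_distribution M & (AE x in M. 0 <= x)"

definition is_stable :: "real => real measure => bool" where
 "is_stable a M \<longleftrightarrow> real_distribution M & (AE x in M. 0 < x) & (\<forall>s\<ge>0. Lap M s = EN (exp (- (s powr a))))"

lemma sibuya_nonneg:
 fixes a :: real assumes "0 < a" "a < 1"
 shows "0 <= (-1) ^ k * (a gchoose Suc k)"
proof (induction k)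
 case 0 then show ?case using assms by simp
next
 case (Suc k)
 have "of_nat (Suc (Suc k)) * (a gchoose Suc (Suc k)) = (a - of_nat (Suc k)) * (a gchoose Suc k)"
  using gbinomial_mult_1[of a "Suc k"] by (simp add: algebra_simps)
 then have eq: "(a gchoose Suc (Suc k)) = (a - of_nat (Suc k)) / of_nat (Suc (Suc k)) * (a gchoose Suc k)"
  by (simp add: field_simps)
 have "(-1) ^ Suc k * (a gchoose Suc (Suc k)) = (of_nat (Suc k) - a) / of_nat (Suc (Suc k)) * ((-1) ^ k * (a gchoose Suc k))"
  unfolding eq by (simp add: field_simps)
 also have "... \<ge> 0" by (rule mult_nonneg_nonneg) (use Suc assms in auto)
 finally show ?case .
qed

lemma sibuya_sums:
 fixes a z :: real assumes "0 < a" "a < 1" "0 <= z" "z < 1"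
 shows "(%k. ((-1) ^ k * (a gchoose Suc k)) * z ^ Suc k) sums (1 - (1 - z) powr a)"
proof -
 have "(%n. (a gchoose n) * (- z) ^ n) sums (1 + (- z)) powr a"
  using assms by (intro gen_binomial_real) auto
 then have "(%n. (a gchoose Suc n) * (- z) ^ Suc n) sums ((1 + (- z)) powr a - 1)"
  by (subst sums_Suc_iff) simp
 from sums_minus[OF this]
 have "(%n. - ((a gchoose Suc n) * (- z) ^ Suc n)) sums (1 - (1 - z) powr a)" by simp
 moreover have "- ((a gchoose Suc n) * (- z) ^ Suc n) = ((-1) ^ n * (a gchoose Suc n)) * z ^ Suc n" for n
  by (subst power_minus) simp
 ultimately show ?thesis by (simp only:)
qed

text \<open>The coefficients of \<open>1 - (1-z)^a\<close> are nonnegative and sum to 1, so they are the weights of a law on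
the positive integers, whose Laplace transform arises from \<open>z = exp (-s)\<close>.\<close>

lemma sibuya_law:
 fixes a :: real assumes a: "0 < a" "a < 1"
 shows "\<exists>M. pos_law M & (\<forall>s\<ge>0. Lap M s = EN (1 - (1 - exp (-s)) powr a))"
proof -
 define c where "c k = (-1) ^ k * (a gchoose Suc k)" for k
 have c0: "0 <= c k" for k unfolding c_def by (rule sibuya_nonneg[OF a])
 have cz: "(%k. c k * z ^ Suc k) sums (1 - (1 - z) powr a)" if "0 <= z" "z < 1" for z
  using sibuya_sums[OF a that] by (simp add: c_def)
 have part: "(\<Sum>k<n. c k) <= 1" for n
 proof (rule tendsto_upperbound)
  show "((%z. \<Sum>k<n. c k * z ^ Suc k) \<longlongrightarrow> (\<Sum>k<n. c k)) (at_left 1)"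
  by (rule tendsto_eq_intros | simp)+
  show "\<forall>\<^sub>F z in at_left 1. (\<Sum>k<n. c k * z ^ Suc k) <= 1"
  unfolding eventually_at_left_field
  proof (intro exI[of _ 0] conjI allI impI)
  fix z :: real assume z: "0 < z" "z < 1"
  have "(\<Sum>k<n. c k * z ^ Suc k) <= (\<Sum>k. c k * z ^ Suc k)"
  using cz[of z] z c0 by (intro sum_le_suminf) (auto simp: sums_iff)
  also have "... <= 1" using cz[of z] z by (simp add: sums_iff)
  finally show "(\<Sum>k<n. c k * z ^ Suc k) <= 1" .
  qed simp
 qed simp
 have sm: "summable c" using c0 part by (intro summableI_nonneg_bounded) auto
 have "(\<Sum>k. c k) = 1"
 proof (rule antisym)
  show "(\<Sum>k. c k) <= 1" using sm part by (intro suminf_le_const) auto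
  show "1 <= (\<Sum>k. c k)"
  proof (rule tendsto_upperbound)
  show "((%z. 1 - (1 - z) powr a) \<longlongrightarrow> 1) (at_left (1::real))"
  proof -
  have "((%z. 1 - (1 - z) powr a) \<longlongrightarrow> 1 - 0 powr a) (at_left (1::real))"
  using a by (intro tendsto_intros tendsto_powr') (auto intro!: tendsto_eq_intros simp: eventually_at_left_field intro: exI[of _ 0])
  then show ?thesis by simp
  qed
  show "\<forall>\<^sub>F z in at_left 1. 1 - (1 - z) powr a <= (\<Sum>k. c k)"
  unfolding eventually_at_left_field
  proof (intro exI[of _ 0] conjI allI impI)
  fix z :: real assume z: "0 < z" "z < 1"
  have "(\<Sum>k. c k * z ^ Suc k) <= (\<Sum>k. c k)"
  proof (rule suminf_le)
  show "c k * z ^ Suc k <= c k" for k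
  using mult_left_mono[OF power_le_one[of z "Suc k"] c0[of k]] z by simp
  qed (use sm cz[of z] z in \<open>auto simp: sums_iff\<close>)
  then show "1 - (1 - z) powr a <= (\<Sum>k. c k)" using cz[of z] z by (simp add: sums_iff)
  qed simp
  qed simp
 qed
 then have csum: "c sums 1" using sm by (simp add: sums_iff)
 have nn1: "(\<integral>\<^sup>+k. EN (c k) \<partial>count_space UNIV) = 1"
  unfolding nn_integral_count_space_nat using suminf_ennreal_eq[OF c0 csum] by simp
 define p where "p = embed_pmf c"
 have pc: "pmf p k = c k" for k unfolding p_def using c0 nn1 by (intro pmf_embed_pmf) auto
 define M where "M = distr (measure_pmf p) borel (%k. real (Suc k))"
 have rd: "real_distribution M" unfolding M_def by (rule prob_space.real_distribution_distr[OF measure_pmf.prob_space_axioms]) simp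
 have ge: "AE x in M. 0 <= x" unfolding M_def by (subst AE_distr_iff) auto
 have lap: "Lap M s = EN (1 - (1 - exp (-s)) powr a)" if s: "0 <= s" for s
 proof -
  have "Lap M s = (\<integral>\<^sup>+k. EN (exp (- s * real (Suc k))) \<partial>measure_pmf p)"
  unfolding Lap_def M_def by (subst nn_integral_distr) auto
  also have "... = (\<integral>\<^sup>+k. EN (c k) * EN (exp (- s * real (Suc k))) \<partial>count_space UNIV)"
  by (simp add: nn_integral_measure_pmf pc)
  also have "... = (\<Sum>k. EN (c k * exp (-s) ^ Suc k))"
  by (subst nn_integral_count_space_nat) (simp only: exp_of_nat2_mult ennreal_mult[OF c0 zero_le_power] exp_ge_zero)
  also have "... = EN (1 - (1 - exp (-s)) powr a)"
  proof (rule suminf_ennreal_eq)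
  show "(%k. c k * exp (-s) ^ Suc k) sums (1 - (1 - exp (-s)) powr a)"
  using cz[of "exp (-s)"] csum s by (cases "s = 0") auto
  qed (use c0 in auto)
  finally show ?thesis .
 qed
 show ?thesis using rd ge lap by (auto simp: pos_law_def intro!: exI[of _ M])
qed

lemma convolution_law:
 assumes "pos_law A" "pos_law B"
 shows "\<exists>C. pos_law C & (\<forall>s. Lap C s = Lap A s * Lap B s)"
proof -
 interpret A: real_distribution A using assms by (auto simp: pos_law_def)
 interpret B: real_distribution B using assms by (auto simp: pos_law_def)
 interpret P: pair_prob_space A B ..
 define C where "C = distr (A \<Otimes>\<^sub>M B) borel (%(x, y). x + y)"
 have m[measurable]: "(%(x, y). x + y) \<in> borel_measurable (A \<Otimes>\<^sub>M B)" by measurable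
 have rd: "real_distribution C" unfolding C_def by (rule P.real_distribution_distr[OF m])
 have "AE z in A \<Otimes>\<^sub>M B. 0 <= fst z + snd z"
 proof (rule P.AE_pair_measure)
  show "AE x in A. AE y in B. 0 <= fst (x, y) + snd (x, y)"
  using assms unfolding pos_law_def by (auto elim!: eventually_mono)
 qed measurable
 then have ge: "AE x in C. 0 <= x" unfolding C_def by (subst AE_distr_iff) (auto simp: case_prod_beta)
 have "Lap C s = Lap A s * Lap B s" for s
 proof -
  have "Lap C s = (\<integral>\<^sup>+z. EN (exp (- s * fst z)) * EN (exp (- s * snd z)) \<partial>(A \<Otimes>\<^sub>M B))"
  unfolding Lap_def C_def
  by (subst nn_integral_distr) (auto simp: case_prod_beta emult exp_add[symmetric] algebra_simps)
  also have "... = (\<integral>\<^sup>+x. \<integral>\<^sup>+y. EN (exp (- s * x)) * EN (exp (- s * y)) \<partial>B \<partial>A)"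
  by (subst B.nn_integral_fst[symmetric]) auto
  also have "... = Lap A s * Lap B s"
  by (simp add: Lap_def nn_integral_cmult nn_integral_multc)
  finally show ?thesis .
 qed
 then show ?thesis using rd ge by (auto simp: pos_law_def intro!: exI[of _ C])
qed

lemma convolution_power_law:
 assumes "pos_law A"
 shows "\<exists>C. pos_law C & (\<forall>s. Lap C s = Lap A s ^ Suc n)"
proof (induction n)
 case 0 then show ?case using assms by auto
next
 case (Suc n)
 then obtain C where "pos_law C" "\<forall>s. Lap C s = Lap A s ^ Suc n" by blast
 with convolution_law[OF assms \<open>pos_law C\<close>] show ?case by auto
qed

lemma scale_law:
 assumes "pos_law A" "0 <= h"
 shows "\<exists>C. pos_law C & (\<forall>s. Lap C s = Lap A (s * h))"
proof -
 interpret A: real_distribution A using assms by (auto simp: pos_law_def)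
 define C where "C = distr A borel (%x. x * h)"
 have rd: "real_distribution C" unfolding C_def by (rule A.real_distribution_distr) simp
 have ge: "AE x in C. 0 <= x" unfolding C_def using assms
  by (subst AE_distr_iff) (auto simp: pos_law_def elim!: eventually_mono)
 have "Lap C s = Lap A (s * h)" for s
  unfolding Lap_def C_def by (subst nn_integral_distr) (auto simp: ac_simps)
 then show ?thesis using rd ge by (auto simp: pos_law_def intro!: exI[of _ C])
qed

lemma tendsto_power_exp:
 fixes y :: "nat => real"
 assumes y: "(%n. real (Suc n) * y n) \<longlonglongrightarrow> x" and y0: "!!n. 0 <= y n"
 shows "(%n. (1 - y n) ^ Suc n) \<longlonglongrightarrow> exp (- x)"
proof -
 have "(%n. (real (Suc n) * y n) * (1 / real (Suc n))) \<longlonglongrightarrow> x * 0"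
  by (intro tendsto_mult y LIMSEQ_Suc lim_1_over_n)
 then have yl: "y \<longlonglongrightarrow> 0" by simp
 have ev: "\<forall>\<^sub>F n in sequentially. y n < 1/2" using yl by (rule order_tendstoD) simp
 have "(%n. real (Suc n) * ln (1 - y n)) \<longlonglongrightarrow> - x"
 proof (rule tendsto_sandwich)
  show "\<forall>\<^sub>F n in sequentially. - (real (Suc n) * y n) / (1 - y n) <= real (Suc n) * ln (1 - y n)"
  using ev
  proof eventually_elim
  case (elim n)
  have "- ln (1 - y n) = ln (1 + y n / (1 - y n))"
  using elim y0[of n] by (subst ln_inverse[symmetric]) (auto simp: field_simps)
  also have "... <= y n / (1 - y n)" using elim y0[of n] by (intro ln_add_one_self_le_self) auto
  finally have "- (y n / (1 - y n)) <= ln (1 - y n)" by simp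
  then have "real (Suc n) * - (y n / (1 - y n)) <= real (Suc n) * ln (1 - y n)" by (intro mult_left_mono) auto
  then show ?case by simp
  qed
  show "\<forall>\<^sub>F n in sequentially. real (Suc n) * ln (1 - y n) <= - (real (Suc n) * y n)"
  using ev
  proof eventually_elim
  case (elim n)
  have "ln (1 - y n) <= - y n" using ln_add_one_self_le_self2[of "- y n"] elim y0[of n] by simp
  then have "real (Suc n) * ln (1 - y n) <= real (Suc n) * (- y n)" by (intro mult_left_mono) auto
  then show ?case by simp
  qed
  have "(%n. - (real (Suc n) * y n) / (1 - y n)) \<longlonglongrightarrow> - x / (1 - 0)"
  by (intro tendsto_intros y yl) auto
  then show "(%n. - (real (Suc n) * y n) / (1 - y n)) \<longlonglongrightarrow> - x" by simp
  show "(%n. - (real (Suc n) * y n)) \<longlonglongrightarrow> - x" by (intro tendsto_intros y)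
 qed
 then have "(%n. exp (real (Suc n) * ln (1 - y n))) \<longlonglongrightarrow> exp (- x)" by (intro tendsto_intros)
 moreover have "\<forall>\<^sub>F n in sequentially. exp (real (Suc n) * ln (1 - y n)) = (1 - y n) ^ Suc n"
  using ev
 proof eventually_elim
  case (elim n)
  then show ?case by (subst exp_of_nat_mult) (auto simp: exp_ln)
 qed
 ultimately show ?thesis by (rule Lim_transform_eventually)
qed

text \<open>A sum of \<open>n\<close> independent variables with the preceding law, divided by \<open>n^(1/a)\<close>.\<close>

lemma stable_approx:
 fixes a :: real assumes a: "0 < a" "a < 1"
 shows "\<exists>M. pos_law M & (\<forall>s\<ge>0. Lap M s = EN ((1 - (1 - exp (- s * (real (Suc n)) powr (-1/a))) powr a) ^ Suc n))"
proof -
 obtain M1 where M1: "pos_law M1" "!!s. s\<ge>0 ==> Lap M1 s = EN (1 - (1 - exp (-s)) powr a)"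
  using sibuya_law[OF a] by blast
 obtain M2 where M2: "pos_law M2" "!!s. Lap M2 s = Lap M1 (s * real (Suc n) powr (-1/a))"
  using scale_law[OF M1(1), of "real (Suc n) powr (-1/a)"] by auto
 obtain M3 where M3: "pos_law M3" "!!s. Lap M3 s = Lap M2 s ^ Suc n"
  using convolution_power_law[OF M2(1), of n] by blast
 have "Lap M3 s = EN ((1 - (1 - exp (- s * (real (Suc n)) powr (-1/a))) powr a) ^ Suc n)" if "s \<ge> 0" for s
 proof -
  have "(1 - exp (- s * (real (Suc n)) powr (-1/a))) powr a <= 1 powr a"
  using that a by (intro powr_mono2) auto
  then show ?thesis using that by (subst ennreal_power[symmetric]) (auto simp: M3 M2 M1)
 qed
 then show ?thesis using M3(1) by blast
qed

lemma one_minus_exp_scaled: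
 fixes s a :: real assumes "0 < a" "0 <= s"
 defines "y \<equiv> %n. (1 - exp (- s * (real (Suc n)) powr (-1/a))) powr a"
 shows "real (Suc n) * y n <= s powr a" "(%n. real (Suc n) * y n) \<longlonglongrightarrow> s powr a" "0 <= y n" "y n <= 1"
proof -
 have yn: "real (Suc n) * y n = (real (Suc n) powr (1/a) * (1 - exp (- s * (real (Suc n)) powr (-1/a)))) powr a" for n
  using assms by (simp add: y_def powr_mult powr_powr)
 have inv: "real (Suc n) powr (1/a) * real (Suc n) powr (-1/a) = 1" for n
  by (simp add: powr_add[symmetric])
 show "real (Suc n) * y n <= s powr a"
 proof -
  have "1 - exp (- s * (real (Suc n)) powr (-1/a)) <= s * real (Suc n) powr (-1/a)"
  using exp_ge_add_one_self[of "- s * (real (Suc n)) powr (-1/a)"] by simp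
  then have "real (Suc n) powr (1/a) * (1 - exp (- s * (real (Suc n)) powr (-1/a))) <= real (Suc n) powr (1/a) * (s * real (Suc n) powr (-1/a))"
  by (intro mult_left_mono) auto
  also have "... = s" using inv[of n] by (simp add: algebra_simps)
  finally show ?thesis unfolding yn using assms by (intro powr_mono2) auto
 qed
 show "(%n. real (Suc n) * y n) \<longlonglongrightarrow> s powr a"
 proof (cases "s = 0")
  case True then show ?thesis using assms by (simp add: y_def)
 next
  case False
  define h where "h n = real (Suc n) powr (-1/a)" for n
  have h0: "h \<longlonglongrightarrow> 0" unfolding h_def using assms
  by (intro tendsto_neg_powr filterlim_compose[OF filterlim_real_sequentially] filterlim_Suc) auto
  have hpos: "0 < h n" for n by (simp add: h_def)
  have "((%x. (1 - exp (- s * x)) / x) \<longlongrightarrow> s) (at_right 0)"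
  proof -
  have "((%x. 1 - exp (- s * x)) has_real_derivative s) (at 0)"
  by (auto intro!: derivative_eq_intros)
  then have "((%x. (1 - exp (- s * x)) / x) \<longlongrightarrow> s) (at 0)"
  by (simp add: has_field_derivative_iff)
  then show ?thesis by (rule filterlim_mono) (auto simp: at_within_le_at)
  qed
  moreover have "filterlim h (at_right 0) sequentially"
  using h0 hpos by (auto simp: filterlim_at less_imp_neq[OF hpos, symmetric] intro!: always_eventually)
  ultimately have "(%n. (1 - exp (- s * h n)) / h n) \<longlonglongrightarrow> s" by (rule filterlim_compose)
  moreover have "real (Suc n) powr (1/a) = 1 / h n" for n using inv[of n] hpos[of n] by (simp add: h_def field_simps)
  ultimately have "(%n. real (Suc n) powr (1/a) * (1 - exp (- s * h n))) \<longlonglongrightarrow> s" by simp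
  then have "(%n. (real (Suc n) powr (1/a) * (1 - exp (- s * h n))) powr a) \<longlonglongrightarrow> s powr a"
  using False assms by (intro tendsto_intros) auto
  then show ?thesis unfolding yn h_def .
 qed
 show "0 <= y n" by (simp add: y_def)
 show "y n <= 1" unfolding y_def using assms powr_mono2[of a "1 - exp (- s * (real (Suc n)) powr (-1/a))" 1] by simp
qed

lemma Lap_eq_integral:
 assumes "pos_law M" "0 <= s"
 shows "Lap M s = EN (\<integral>x. exp (- s * max 0 x) \<partial>M)"
proof -
 interpret real_distribution M using assms by (auto simp: pos_law_def)
 have "Lap M s = (\<integral>\<^sup>+x. EN (exp (- s * max 0 x)) \<partial>M)"
  unfolding Lap_def using assms by (intro nn_integral_cong_AE) (auto simp: pos_law_def max_def elim!: eventually_mono)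
 also have "... = EN (\<integral>x. exp (- s * max 0 x) \<partial>M)"
  using assms by (intro nn_integral_eq_integral integrable_const_bound[where B=1]) auto
 finally show ?thesis .
qed

text \<open>Where \<open>x > K\<close> the integrand \<open>1 - exp (-x/K)\<close> is at least \<open>1 - 1/e > 1/2\<close>; this turns continuity of the limiting
transform at 0 into tightness.\<close>

lemma pos_law_tail:
 assumes "pos_law M" "0 < K"
 shows "measure M {K<..} <= 2 * (1 - (\<integral>x. exp (- (1/K) * max 0 x) \<partial>M))"
proof -
 interpret real_distribution M using assms by (auto simp: pos_law_def)
 have int: "integrable M (%x. exp (- (1/K) * max 0 x))"
  using assms by (intro integrable_const_bound[where B=1]) auto
 have "measure M {K<..} = (\<integral>x. indicator {K<..} x \<partial>M)" by simp
 also have "... <= (\<integral>x. 2 * (1 - exp (- (1/K) * max 0 x)) \<partial>M)"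
 proof (rule integral_mono)
  fix x show "indicator {K<..} x <= 2 * (1 - exp (- (1/K) * max 0 x))"
  proof (cases "x > K")
  case True
  have "exp (- (1/K) * max 0 x) <= exp (-1)" using True assms by (simp add: field_simps max_def)
  also have "... <= 1/2" using exp_ge_add_one_self[of 1] by (simp add: exp_minus field_simps)
  finally show ?thesis using True by simp
  qed (use assms in simp)
 qed (use int in \<open>auto intro!: integrable_const_bound[where B=1] simp: indicator_def\<close>)
 also have "... = 2 * (1 - (\<integral>x. exp (- (1/K) * max 0 x) \<partial>M))"
  using int prob_space by (simp add: space_eq_univ)
 finally show ?thesis .
qed

text \<open>The transforms of the rescaled sums converge to \<open>exp (-s^a)\<close>. The tail bound makes the laws tight, and a
weak limit along a subsequence has that transform. There is no mass at 0 because the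
transform tends to 0 at infinity.\<close>

theorem stable_law_exists:
 assumes a: "0 < a" "a <= 1"
 shows "\<exists>M. is_stable a M"
proof (cases "a = 1")
 case True
 interpret r: prob_space "return borel (1::real)" by (rule prob_space_return) simp
 have "real_distribution (return borel (1::real))" by standard simp
 moreover have "AE x in return borel (1::real). 0 < x" by (subst AE_return) auto
 moreover have "Lap (return borel 1) s = EN (exp (- s))" for s
  unfolding Lap_def by (subst nn_integral_return) auto
 ultimately show ?thesis using True by (auto simp: is_stable_def)
next
 case False
 then have a: "0 < a" "a < 1" using a by auto
 define y where "y s n = (1 - exp (- s * (real (Suc n)) powr (-1/a))) powr a" for s n
 obtain \<mu> where \<mu>: "!!n. pos_law (\<mu> n)" "!!n s. s \<ge> 0 ==> Lap (\<mu> n) s = EN ((1 - y s n) ^ Suc n)"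
  using stable_approx[OF a] unfolding y_def by metis
 note yy = one_minus_exp_scaled[OF a(1), folded y_def]
 have L: "(\<integral>x. exp (- s * max 0 x) \<partial>\<mu> n) = (1 - y s n) ^ Suc n" if "s \<ge> 0" for s n
 proof -
  have "EN (\<integral>x. exp (- s * max 0 x) \<partial>\<mu> n) = EN ((1 - y s n) ^ Suc n)"
  using Lap_eq_integral[OF \<mu>(1) that] \<mu>(2)[OF that] by metis
  then show ?thesis using yy(4)[OF that] by (subst (asm) ennreal_inj) auto
 qed
 have rd: "real_distribution (\<mu> n)" for n using \<mu>(1)[of n] by (simp add: pos_law_def)
 have tight: "tight \<mu>" unfolding tight_def
 proof (intro conjI allI impI rd)
  fix e :: real assume e: "0 < e"
  define K where "K = max 1 ((e/4) powr (-1/a))"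
  have K: "0 < K" "(1/K) powr a <= e/4"
  proof -
  show "0 < K" by (simp add: K_def)
  have "(1/K) <= (e/4) powr (1/a)"
  proof -
  have "(e/4) powr (-1/a) <= K" by (simp add: K_def)
  then have "1 / K <= 1 / (e/4) powr (-1/a)" using e by (intro divide_left_mono mult_pos_pos) (auto simp: K_def)
  also have "... = (e/4) powr (1/a)" by (simp add: powr_minus_divide)
  finally show ?thesis .
  qed
  then have "(1/K) powr a <= ((e/4) powr (1/a)) powr a" using a \<open>0 < K\<close> by (intro powr_mono2) auto
  also have "... = e/4" using e a by (simp add: powr_powr)
  finally show "(1/K) powr a <= e/4" .
  qed
  show "\<exists>a b. a < b & (\<forall>n. 1 - e < measure (\<mu> n) {a<..b})"
  proof (rule exI[of _ "-1"], rule exI[of _ K], intro conjI allI)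
  fix n
  interpret real_distribution "\<mu> n" by (rule rd)
  have "1 + real (Suc n) * (- y (1/K) n) <= (1 + (- y (1/K) n)) ^ Suc n"
  using yy(4)[of "1/K" n] K by (intro Bernoulli_inequality) auto
  then have "measure (\<mu> n) {K<..} <= 2 * (real (Suc n) * y (1/K) n)"
  using pos_law_tail[OF \<mu>(1) K(1), of n] L[of "1/K" n] K by simp
  also have "... <= e/2" using yy(1)[of "1/K" n] K by simp
  finally have t: "measure (\<mu> n) {K<..} <= e/2" .
  have "AE x in \<mu> n. x \<notin> {..-1}" using \<mu>(1)[of n] by (auto simp: pos_law_def elim!: eventually_mono)
  then have n0: "measure (\<mu> n) {..-1} = 0" by (subst prob_eq_0) auto
  have "prob UNIV = prob ({..-1} \<union> {-1<..K} \<union> {K<..})" using K by (intro arg_cong[where f=prob]) auto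
  also have "... <= prob {..-1} + prob {-1<..K} + prob {K<..}"
  by (intro order_trans[OF measure_Un_le] add_right_mono measure_Un_le) auto
  finally show "1 - e < prob {-1<..K}" using n0 t e prob_space by simp
  qed (use K in auto)
 qed
 obtain r M where rM: "strict_mono r" "real_distribution M" "weak_conv_m (\<mu> \<circ> id \<circ> r) M"
  using tight_imp_convergent_subsubsequence[OF tight strict_mono_id] by blast
 interpret M: real_distribution M by fact
 have conv: "(%n. \<integral>x. f x \<partial>\<mu> (r n)) \<longlonglongrightarrow> (\<integral>x. f x \<partial>M)" if "!!x. isCont f x" "!!x. \<bar>f x\<bar> <= B" for f :: "real => real" and B
  using weak_conv_imp_integral_bdd_continuous_conv[of "\<mu> \<circ> id \<circ> r" M f B] rM rd that by (simp add: comp_def)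
 have ge: "AE x in M. 0 <= x"
 proof -
  have "(\<integral>x. min 1 (max 0 (-x)) \<partial>\<mu> (r n)) = 0" for n
  proof -
  interpret real_distribution "\<mu> (r n)" by (rule rd)
  have "AE x in \<mu> (r n). min 1 (max 0 (-x)) = 0" using \<mu>(1)[of "r n"] by (auto simp: pos_law_def elim!: eventually_mono)
  then show ?thesis by (rule integral_eq_zero_AE)
  qed
  moreover have "(%n. \<integral>x. min 1 (max 0 (-x)) \<partial>\<mu> (r n)) \<longlonglongrightarrow> (\<integral>x. min 1 (max 0 (-x)) \<partial>M)"
  by (rule conv[of _ 1]) (auto intro!: continuous_intros)
  ultimately have "(\<integral>x. min 1 (max 0 (-x)) \<partial>M) = 0" by (simp add: LIMSEQ_const_iff)
  moreover have "integrable M (%x. min 1 (max 0 (-x)))" by (intro M.integrable_const_bound[where B=1]) auto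
  ultimately have "AE x in M. min 1 (max 0 (-x)) = 0" by (subst (asm) integral_nonneg_eq_0_iff_AE) auto
  then show ?thesis by eventually_elim (auto simp: min_def max_def split: if_splits)
 qed
 have Mp: "pos_law M" using ge rM(2) by (simp add: pos_law_def)
 have lapM: "(\<integral>x. exp (- s * max 0 x) \<partial>M) = exp (- (s powr a))" if s: "0 <= s" for s
 proof -
  have "(%n. \<integral>x. exp (- s * max 0 x) \<partial>\<mu> (r n)) \<longlonglongrightarrow> (\<integral>x. exp (- s * max 0 x) \<partial>M)"
  using s by (intro conv[of _ 1]) (auto intro!: continuous_intros)
  moreover have "(%n. \<integral>x. exp (- s * max 0 x) \<partial>\<mu> (r n)) \<longlonglongrightarrow> exp (- (s powr a))"
  proof -
  have "(%n. (1 - y s n) ^ Suc n) \<longlonglongrightarrow> exp (- (s powr a))"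
  using yy(2,3)[OF s] by (rule tendsto_power_exp)
  from LIMSEQ_subseq_LIMSEQ[OF this rM(1)] show ?thesis by (simp only: L[OF s] comp_def)
  qed
  ultimately show ?thesis by (rule LIMSEQ_unique)
 qed
 have "AE x in M. 0 < x"
 proof -
  have le: "measure M {0} <= exp (- (real n powr a))" for n
  proof -
  have "measure M {0} = (\<integral>x. indicator {0} x \<partial>M)" by simp
  also have "... <= (\<integral>x. exp (- real n * max 0 x) \<partial>M)"
  by (intro integral_mono M.integrable_const_bound[where B=1]) (auto simp: indicator_def)
  finally show ?thesis using lapM[of "real n"] by simp
  qed
  have "(%n. exp (- (real n powr a))) \<longlonglongrightarrow> 0"
  using a by real_asymp
  then have "measure M {0} <= 0" by (rule LIMSEQ_le_const) (use le in auto)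
  then have "AE x in M. x \<notin> {0}" by (subst M.prob_eq_0[symmetric]) (auto intro: antisym)
  with ge show ?thesis by eventually_elim auto
 qed
 moreover have "Lap M s = EN (exp (- (s powr a)))" if "s \<ge> 0" for s
  using Lap_eq_integral[OF Mp that] lapM[OF that] by simp
 ultimately show ?thesis using rM(2) by (auto simp: is_stable_def)
qed

definition stab :: "real => real measure" where "stab a = (SOME M. is_stable a M)"

abbreviation mix :: "real => real => (real * real) measure" where
  "mix a b == stab a \<Otimes>\<^sub>M stab b"

lemma is_stable_stab: "0 < a ==> a <= 1 ==> is_stable a (stab a)"
 unfolding stab_def by (rule someI_ex) (rule stable_law_exists)

section \<open>Moments of stable laws and Beta integrals\<close>

lemma nn_integral_powr_exp_powr:
 fixes b c :: real assumes b: "0 < b" and c: "0 < c"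
 shows "(NN s. EN (s powr (c - 1) * exp (- (s powr b))) * indicator {0<..} s) = EN (Gamma (c / b) / b)"
proof -
 have "((%t. t powr (c / b - 1) / exp t) has_integral Gamma (c / b)) {0..}"
  using Gamma_integral_real[of "c / b"] assms by simp
 then have "((%t. if t \<in> {0<..} then t powr (c / b - 1) / exp t else 0) has_integral Gamma (c / b)) {0..}"
  by (rule has_integral_spike [of "{0}", rotated 2]) auto
 then have G: "((%t. t powr (c / b - 1) / exp t) has_integral Gamma (c / b)) {0<..}"
  by (subst (asm) has_integral_restrict) auto
 have img: "(%s. s powr b) ` {0<..} = {0::real<..}"
 proof (intro equalityI subsetI)
  fix y :: real assume "y \<in> {0<..}"
  then have "y = (y powr (1/b)) powr b" "y powr (1/b) \<in> {0<..}" using b by (auto simp: powr_powr)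
  then show "y \<in> (%s. s powr b) ` {0<..}" by blast
 qed auto
 have inj: "inj_on (%s. s powr b) {0::real<..}"
  proof (rule inj_onI)
  fix x y :: real assume xy: "x \<in> {0<..}" "y \<in> {0<..}" "x powr b = y powr b"
  have "(x powr b) powr (1/b) = (y powr b) powr (1/b)" using xy(3) by simp
  then show "x = y" using b xy(1,2) by (simp add: powr_powr)
 qed
 have der: "((%s. s powr b) has_field_derivative (b * s powr (b - 1))) (at s within {0<..})" if "s \<in> {0<..}" for s
  using that by (auto intro!: derivative_eq_intros)
 have absG: "(%t. t powr (c / b - 1) / exp t) absolutely_integrable_on {0<..}"
  using G by (intro nonnegative_absolutely_integrable_1) (auto simp: has_integral_iff)
 have "(%s. \<bar>b * s powr (b - 1)\<bar> * ((s powr b) powr (c / b - 1) / exp (s powr b))) absolutely_integrable_on {0<..} &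
  integral {0<..} (%s. \<bar>b * s powr (b - 1)\<bar> * ((s powr b) powr (c / b - 1) / exp (s powr b))) = Gamma (c / b)"
  by (subst has_absolute_integral_change_of_variables_1'[OF _ der inj]) (use absG G img in \<open>auto simp: has_integral_iff\<close>)
 then have H: "((%s. \<bar>b * s powr (b - 1)\<bar> * ((s powr b) powr (c / b - 1) / exp (s powr b))) has_integral Gamma (c / b)) {0<..}"
  by (auto simp: has_integral_iff intro: set_lebesgue_integral_eq_integral)
 have "((%s. (1/b) * (\<bar>b * s powr (b - 1)\<bar> * ((s powr b) powr (c / b - 1) / exp (s powr b)))) has_integral (1/b) * Gamma (c / b)) {0<..}"
  by (rule has_integral_mult_right[OF H])
 moreover have "(1/b) * (\<bar>b * s powr (b - 1)\<bar> * ((s powr b) powr (c / b - 1) / exp (s powr b))) = s powr (c - 1) * exp (- (s powr b))" if "s \<in> {0<..}" for s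
 proof -
  have "s powr (b - 1) * s powr (b * (c / b - 1)) = s powr (c - 1)"
  using that b by (simp add: powr_add[symmetric] algebra_simps)
  then show ?thesis using that b by (simp add: powr_powr exp_minus field_simps)
 qed
 ultimately have "((%s. s powr (c - 1) * exp (- (s powr b))) has_integral (1/b) * Gamma (c / b)) {0<..}"
  by (rule has_integral_eq[rotated])
 then have "(NN s. EN (s powr (c - 1) * exp (- (s powr b))) * indicator {0<..} s) = EN ((1/b) * Gamma (c / b))"
  by (intro nn_integral_has_integral_lebesgue') auto
 then show ?thesis by simp
qed

lemma nn_integral_powr_exp:
 fixes x c :: real assumes x: "0 < x" and c: "0 < c"
 shows "(NN s. EN (s powr (c - 1) * exp (- (s * x))) * indicator {0<..} s) = EN (Gamma c * x powr (-c))"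
proof -
 have "(NN s. EN (s powr (c - 1) * exp (- (s powr 1))) * indicator {0<..} s) = EN (Gamma c)"
  using nn_integral_powr_exp_powr[of 1 c] c by simp
 moreover have "(NN s. EN (s powr (c - 1) * exp (- (s powr 1))) * indicator {0<..} s)
  = EN x * (NN s. EN ((x * s) powr (c - 1) * exp (- ((x * s) powr 1))) * indicator {0<..} (x * s))"
  using x by (subst nn_integral_real_affine[where c=x and t=0]) auto
 moreover have "(NN s. EN ((x * s) powr (c - 1) * exp (- ((x * s) powr 1))) * indicator {0<..} (x * s))
  = (NN s. EN (x powr (c - 1)) * (EN (s powr (c - 1) * exp (- (s * x))) * indicator {0<..} s))"
  using x by (intro nn_integral_cong) (auto simp: indicator_def powr_mult emult zero_less_mult_iff ac_simps)
 moreover have "... = EN (x powr (c - 1)) * (NN s. (EN (s powr (c - 1) * exp (- (s * x))) * indicator {0<..} s))"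
  by (rule nn_integral_cmult) measurable
 ultimately have eq: "EN (x powr c) * (NN s. (EN (s powr (c - 1) * exp (- (s * x))) * indicator {0<..} s)) = EN (Gamma c)"
  using x by (simp add: mult.assoc[symmetric] emult powr_mult_base)
 have "(NN s. (EN (s powr (c - 1) * exp (- (s * x))) * indicator {0<..} s))
  = EN (x powr (-c)) * (EN (x powr c) * (NN s. (EN (s powr (c - 1) * exp (- (s * x))) * indicator {0<..} s)))"
  using x by (simp add: mult.assoc[symmetric] emult powr_add[symmetric])
 also have "... = EN (Gamma c * x powr (-c))" unfolding eq using c by (simp add: emult mult.commute)
 finally show ?thesis .
qed

context
 fixes b :: real and M :: "real measure"
 assumes b: "0 < b" "b <= 1" and M: "M = stab b"
begin

lemma stab_real_distribution: "real_distribution M"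
 and stab_pos: "AE x in M. 0 < x"
 and stab_Lap: "0 <= s ==> (\<integral>\<^sup>+x. EN (exp (- (s * x))) \<partial>M) = EN (exp (- (s powr b)))"
 unfolding M using is_stable_stab[OF b] by (auto simp: is_stable_def Lap_def)

lemma stab_prob: "prob_space M" and stab_sets [measurable_cong]: "sets M = sets borel" and stab_space: "space M = UNIV"
proof -
 interpret real_distribution M by (rule stab_real_distribution)
 show "prob_space M" "sets M = sets borel" "space M = UNIV" by (auto intro: prob_space_axioms)
qed

text \<open>Integrate \<open>s^(c-1) exp (-s x)\<close> in \<open>s\<close> and exchange the integrals: on one side appears \<open>\<Gamma>(c) x^(-c)\<close>, on the
other the integral of \<open>s^(c-1) exp (-s^b)\<close>.\<close>

lemma stab_neg_moment:
 assumes c: "0 < c"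
 shows "(\<integral>\<^sup>+x. EN (x powr (-c)) \<partial>M) = EN (Gamma (c / b) / (b * Gamma c))"
proof -
 interpret real_distribution M by (rule stab_real_distribution)
 interpret pair_sigma_finite M lborel ..
 have G: "0 < Gamma c" using c by (rule Gamma_real_pos)
 have "(\<integral>\<^sup>+x. EN (Gamma c) * EN (x powr (-c)) \<partial>M) = (\<integral>\<^sup>+x. (NN s. EN (s powr (c - 1) * exp (- (s * x))) * indicator {0<..} s) \<partial>M)"
  using stab_pos by (intro nn_integral_cong_AE) (auto elim!: eventually_mono simp: nn_integral_powr_exp c emult G less_imp_le)
 also have "... = (NN s. \<integral>\<^sup>+x. EN (s powr (c - 1) * exp (- (s * x))) * indicator {0<..} s \<partial>M)"
  by (rule Fubini'[symmetric]) measurable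
 also have "... = (NN s. EN (s powr (c - 1) * exp (- (s powr b))) * indicator {0<..} s)"
 proof (rule nn_integral_cong)
  fix s :: real
  have "(\<integral>\<^sup>+x. EN (s powr (c - 1) * exp (- (s * x))) * indicator {0<..} s \<partial>M)
  = (\<integral>\<^sup>+x. (EN (s powr (c - 1)) * indicator {0<..} s) * EN (exp (- (s * x))) \<partial>M)"
  by (intro nn_integral_cong) (simp add: ennreal_mult ac_simps)
  also have "... = (EN (s powr (c - 1)) * indicator {0<..} s) * (\<integral>\<^sup>+x. EN (exp (- (s * x))) \<partial>M)"
  by (rule nn_integral_cmult) measurable
  also have "... = EN (s powr (c - 1) * exp (- (s powr b))) * indicator {0<..} s"
  by (cases "0 < s") (auto simp: stab_Lap ennreal_mult)
  finally show "(\<integral>\<^sup>+x. EN (s powr (c - 1) * exp (- (s * x))) * indicator {0<..} s \<partial>M) = ..." .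
 qed
 also have "... = EN (Gamma (c / b) / b)" using b c by (intro nn_integral_powr_exp_powr) auto
 finally have eq: "EN (Gamma c) * (\<integral>\<^sup>+x. EN (x powr (-c)) \<partial>M) = EN (Gamma (c / b) / b)"
  by (simp add: nn_integral_cmult)
 have "(\<integral>\<^sup>+x. EN (x powr (-c)) \<partial>M) = EN (1 / Gamma c) * (EN (Gamma c) * (\<integral>\<^sup>+x. EN (x powr (-c)) \<partial>M))"
  using G by (simp add: mult.assoc[symmetric] emult)
 also have "... = EN (Gamma (c / b) / (b * Gamma c))" unfolding eq using G b c
  by (subst emult) (auto intro!: divide_nonneg_nonneg less_imp_le[OF Gamma_real_pos] simp: field_simps)
 finally show ?thesis .
qed

text \<open>Moments below the order are finite because \<open>1 - exp (-s^b) \<le> s^b\<close> makes \<open>\<integral> s^(-1-k) (1 - E exp (-s X)) ds\<close>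
converge at 0.\<close>

lemma stab_pos_moment:
 assumes k: "0 < k" "k < b"
 shows "(\<integral>\<^sup>+x. EN (x powr k) \<partial>M) < \<infinity>"
proof -
 interpret real_distribution M by (rule stab_real_distribution)
 interpret pair_sigma_finite M lborel ..
 have i1: "(NN s. EN (s powr (-k-1)) * indicator {a..} s) = EN (a powr (-k) / k)" if "0 < a" for a :: real
  using has_integral_powr_to_inf[of "-k-1" a] that k
  by (intro nn_integral_has_integral_lebesgue') auto
 have i2: "(NN s. EN (s powr (b-k-1)) * indicator {0..1} s) = EN (1 / (b-k))"
  using has_integral_powr_from_0[of "b-k-1" 1] k
  by (intro nn_integral_has_integral_lebesgue') auto
 have lap: "(\<integral>\<^sup>+x. EN (1 - exp (- (s * x))) \<partial>M) <= EN (1 - exp (- (s powr b)))" if s: "0 <= s" for s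
 proof -
  have "(\<integral>\<^sup>+x. EN (1 - exp (- (s * x))) \<partial>M) + (\<integral>\<^sup>+x. EN (exp (- (s * x))) \<partial>M) = (\<integral>\<^sup>+x. EN (1 - exp (- (s * x))) + EN (exp (- (s * x))) \<partial>M)"
  by (rule nn_integral_add[symmetric]) auto
  also have "... = (\<integral>\<^sup>+x. 1 \<partial>M)"
  using stab_pos s by (intro nn_integral_cong_AE) (auto elim!: eventually_mono simp: ennreal_plus[symmetric] simp del: ennreal_plus)
  also have "... = 1" using emeasure_space_1 by simp
  finally have "(\<integral>\<^sup>+x. EN (1 - exp (- (s * x))) \<partial>M) + EN (exp (- (s powr b))) = 1" by (simp add: stab_Lap s)
  then have "(\<integral>\<^sup>+x. EN (1 - exp (- (s * x))) \<partial>M) = 1 - EN (exp (- (s powr b)))"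
  by (metis ennreal_add_diff_cancel_right ennreal_neq_top)
  then show ?thesis by (simp add: ennreal_minus[symmetric])
 qed
 have "(\<integral>\<^sup>+x. EN (1/2) * EN (x powr k / k) \<partial>M) <= (\<integral>\<^sup>+x. (NN s. EN (1 - exp (- (s * x))) * (EN (s powr (-k-1)) * indicator {0<..} s)) \<partial>M)"
 proof (rule nn_integral_mono_AE)
  show "AE x in M. EN (1/2) * EN (x powr k / k) <= (NN s. EN (1 - exp (- (s * x))) * (EN (s powr (-k-1)) * indicator {0<..} s))"
  using stab_pos
  proof eventually_elim
  case (elim x)
  have "EN (1/2) * EN (x powr k / k) = EN (1/2) * (NN s. EN (s powr (-k-1)) * indicator {1/x..} s)"
  using elim by (subst i1) (auto simp: powr_minus_divide powr_divide)
  also have "... = (NN s. EN (1/2) * (EN (s powr (-k-1)) * indicator {1/x..} s))"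
  by (rule nn_integral_cmult[symmetric]) measurable
  also have "... <= (NN s. EN (1 - exp (- (s * x))) * (EN (s powr (-k-1)) * indicator {0<..} s))"
  proof (rule nn_integral_mono)
  fix s :: real
  show "EN (1/2) * (EN (s powr (-k-1)) * indicator {1/x..} s) <= EN (1 - exp (- (s * x))) * (EN (s powr (-k-1)) * indicator {0<..} s)"
  proof (cases "1/x <= s")
  case True
  have s: "0 < s" using True elim by (meson divide_pos_pos less_le_trans zero_less_one)
  have "1 <= s * x" using True elim by (simp add: field_simps)
  then have "exp (- (s * x)) <= exp (-1)" by simp
  also have "... <= 1/2" using exp_ge_add_one_self[of 1] by (simp add: exp_minus field_simps)
  finally have "1/2 <= 1 - exp (- (s * x))" by simp
  then show ?thesis using s True by (intro mult_mono ennreal_leI) auto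
  qed simp
  qed
  finally show ?case .
  qed
 qed
 also have "... = (NN s. \<integral>\<^sup>+x. EN (1 - exp (- (s * x))) * (EN (s powr (-k-1)) * indicator {0<..} s) \<partial>M)"
  by (rule Fubini'[symmetric]) measurable
 also have "... <= (NN s. EN (s powr (b-k-1)) * indicator {0..1} s + EN (s powr (-k-1)) * indicator {1..} s)"
 proof (rule nn_integral_mono)
  fix s :: real
  show "(\<integral>\<^sup>+x. EN (1 - exp (- (s * x))) * (EN (s powr (-k-1)) * indicator {0<..} s) \<partial>M) <= EN (s powr (b-k-1)) * indicator {0..1} s + EN (s powr (-k-1)) * indicator {1..} s"
  proof (cases "0 < s")
  case True
  have "(\<integral>\<^sup>+x. EN (1 - exp (- (s * x))) * (EN (s powr (-k-1)) * indicator {0<..} s) \<partial>M) = (\<integral>\<^sup>+x. EN (1 - exp (- (s * x))) \<partial>M) * EN (s powr (-k-1))"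
  using True by (simp add: nn_integral_multc)
  also have "... <= EN (1 - exp (- (s powr b))) * EN (s powr (-k-1))"
  using lap[of s] True by (intro mult_right_mono) auto
  also have "... <= EN (s powr (b-k-1)) * indicator {0..1} s + EN (s powr (-k-1)) * indicator {1..} s"
  proof (cases "s <= 1")
  case le: True
  have "1 - exp (- (s powr b)) <= s powr b" using exp_ge_add_one_self[of "- (s powr b)"] by simp
  then have "(1 - exp (- (s powr b))) * s powr (-k-1) <= s powr b * s powr (-k-1)" by (intro mult_right_mono) auto
  also have "... = s powr (b-k-1)" by (simp add: powr_add[symmetric] algebra_simps)
  finally have "EN (1 - exp (- (s powr b))) * EN (s powr (-k-1)) <= EN (s powr (b-k-1))"
  by (simp add: ennreal_mult'[symmetric] ennreal_leI)
  then show ?thesis using True le by (simp add: add_increasing2)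
  next
  case False
  have "EN (1 - exp (- (s powr b))) * EN (s powr (-k-1)) <= 1 * EN (s powr (-k-1))"
  by (intro mult_right_mono) (auto intro: ennreal_le_1[THEN iffD2])
  then show ?thesis using False by simp
  qed
  finally show ?thesis .
  qed simp
 qed
 also have "... = EN (1 / (b-k)) + EN (1 / k)"
  using i1[of 1] i2 by (simp add: nn_integral_add)
 also have "... < \<infinity>" by simp
 finally have "EN (1/2) * (\<integral>\<^sup>+x. EN (x powr k / k) \<partial>M) < \<infinity>" by (simp add: nn_integral_cmult)
 then have f: "(\<integral>\<^sup>+x. EN (x powr k / k) \<partial>M) < \<infinity>" by (auto simp: ennreal_mult_less_top)
 have "(\<integral>\<^sup>+x. EN (x powr k) \<partial>M) = (\<integral>\<^sup>+x. EN k * EN (x powr k / k) \<partial>M)"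
  using k by (intro nn_integral_cong) (simp add: emult)
 also have "... = EN k * (\<integral>\<^sup>+x. EN (x powr k / k) \<partial>M)" by (rule nn_integral_cmult) measurable
 finally show ?thesis using f by (simp add: ennreal_mult_less_top)
qed

end

lemma nn_integral_Beta:
 fixes a b r t :: real assumes ab: "0 < a" "0 < b" and t: "r < t"
 shows "(NN s. EN ((t - s) powr (a - 1) * (s - r) powr (b - 1)) * indicator {r<..<t} s) = EN ((t - r) powr (a + b - 1) * Beta a b)"
proof -
 have B: "((%x. x powr (b - 1) * (1 - x) powr (a - 1)) has_integral Beta b a) {0<..<1}"
  using has_integral_Beta_real[OF ab(2,1)] by (simp add: has_integral_Icc_iff_Ioo)
 have "(NN s. EN ((t - s) powr (a - 1) * (s - r) powr (b - 1)) * indicator {r<..<t} s)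
  = EN \<bar>t - r\<bar> * (NN x. EN ((t - (r + (t-r)*x)) powr (a - 1) * ((r + (t-r)*x) - r) powr (b - 1)) * indicator {r<..<t} (r + (t-r)*x))"
  using t by (intro nn_integral_real_affine) auto
 also have "(NN x. EN ((t - (r + (t-r)*x)) powr (a - 1) * ((r + (t-r)*x) - r) powr (b - 1)) * indicator {r<..<t} (r + (t-r)*x))
  = (NN x. EN ((t - r) powr (a + b - 2)) * (EN (x powr (b - 1) * (1 - x) powr (a - 1)) * indicator {0<..<1} x))"
 proof (rule nn_integral_cong)
  fix x :: real
  have ind: "indicator {r<..<t} (r + (t-r)*x) = (indicator {0<..<1} x :: ennreal)"
  proof -
  have "r + (t-r)*x < t \<longleftrightarrow> (t-r)*x < (t-r)*1" by auto
  also have "... \<longleftrightarrow> x < 1" using t by (subst mult_less_cancel_left_pos) auto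
  finally show ?thesis using t by (auto simp: indicator_def zero_less_mult_iff)
  qed
  show "EN ((t - (r + (t-r)*x)) powr (a - 1) * ((r + (t-r)*x) - r) powr (b - 1)) * indicator {r<..<t} (r + (t-r)*x) = EN ((t - r) powr (a + b - 2)) * (EN (x powr (b - 1) * (1 - x) powr (a - 1)) * indicator {0<..<1} x)"
  proof (cases "0 < x & x < 1")
  case True
  have "t - (r + (t-r)*x) = (t-r)*(1-x)" by (simp add: algebra_simps)
  then have "(t - (r + (t-r)*x)) powr (a - 1) * ((r + (t-r)*x) - r) powr (b - 1) = ((t-r) powr (a-1) * (t-r) powr (b-1)) * (x powr (b - 1) * (1 - x) powr (a - 1))"
  using True t by (simp add: powr_mult)
  also have "(t-r) powr (a-1) * (t-r) powr (b-1) = (t - r) powr (a + b - 2)" by (simp add: powr_add[symmetric])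
  finally show ?thesis unfolding ind by (simp add: ennreal_mult ac_simps)
  next
  case False then show ?thesis unfolding ind by (auto simp: indicator_def)
  qed
 qed
 also have "... = EN ((t - r) powr (a + b - 2)) * (NN x. EN (x powr (b - 1) * (1 - x) powr (a - 1)) * indicator {0<..<1} x)"
  by (rule nn_integral_cmult) auto
 also have "(NN x. EN (x powr (b - 1) * (1 - x) powr (a - 1)) * indicator {0<..<1} x) = EN (Beta b a)"
  by (rule nn_integral_has_integral_lebesgue'[OF _ B]) auto
 also have "EN \<bar>t - r\<bar> * (EN ((t - r) powr (a + b - 2)) * EN (Beta b a)) = EN ((t-r) * (t - r) powr (a + b - 2) * Beta b a)"
  using t ab by (simp add: emult Beta_def mult.assoc less_imp_le Gamma_real_pos)
 also have "(t-r) * (t - r) powr (a + b - 2) = (t - r) powr (a + b - 1)"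
  using t powr_add[of "t-r" 1 "a+b-2"] by (simp add: add_diff_eq[symmetric] powr_one)
 finally show ?thesis by (simp add: Beta_commute)
qed

lemma integral_Beta:
 fixes a b r t :: real assumes ab: "0 < a" "0 < b" and t: "r < t"
 shows "set_integrable lborel {r<..<t} (%s. (t - s) powr (a - 1) * (s - r) powr (b - 1))"
  and "(LBINT s:{r<..<t}. (t - s) powr (a - 1) * (s - r) powr (b - 1)) = (t - r) powr (a + b - 1) * Beta a b"
proof -
 have B: "0 <= Beta a b" using ab by (simp add: Beta_def less_imp_le Gamma_real_pos)
 have e: "(NN s. EN (indicator {r<..<t} s *\<^sub>R ((t - s) powr (a - 1) * (s - r) powr (b - 1)))) = EN ((t - r) powr (a + b - 1) * Beta a b)"
  using nn_integral_Beta[OF assms] by (simp add: ennreal_mult'' ennreal_indicator mult.commute)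
 show "set_integrable lborel {r<..<t} (%s. (t - s) powr (a - 1) * (s - r) powr (b - 1))"
  unfolding set_integrable_def using e by (intro integrableI_nonneg) auto
 show "(LBINT s:{r<..<t}. (t - s) powr (a - 1) * (s - r) powr (b - 1)) = (t - r) powr (a + b - 1) * Beta a b"
  unfolding set_lebesgue_integral_def using e B
  by (subst integral_eq_nn_integral) auto
qed

section \<open>The Mittag-Leffler function\<close>

lemma Gamma_lower_bound:
 fixes s M :: real assumes "1 <= s" "0 < M"
 shows "M powr (s - 1) * exp (- (M + 1)) <= Gamma s"
proof -
 have "EN (M powr (s - 1) * exp (- (M + 1))) = (NN t. EN (M powr (s - 1) * exp (- (M + 1))) * indicator {M..M+1} t)"
  by (simp add: nn_integral_cmult)
 also have "... <= (NN t. EN (indicator {0..} t * t powr (s - 1) / exp t))"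
 proof (rule nn_integral_mono)
  fix t :: real
  show "EN (M powr (s - 1) * exp (- (M + 1))) * indicator {M..M+1} t <= EN (indicator {0..} t * t powr (s - 1) / exp t)"
  proof (cases "t \<in> {M..M+1}")
  case True
  have "M powr (s - 1) * exp (- (M + 1)) <= t powr (s - 1) * exp (- t)"
  using True assms by (intro mult_mono powr_mono2) auto
  then show ?thesis using True assms by (auto simp: exp_minus field_simps intro!: ennreal_leI)
  qed simp
 qed
 also have "... = EN (Gamma s)" using Gamma_conv_nn_integral_real[of s] assms by simp
 finally show ?thesis using Gamma_real_pos[of s] assms by (subst (asm) ennreal_le_iff) auto
qed

lemma ml_summable:
 fixes a x :: real assumes a: "0 < a" and x: "0 <= x"
 shows "summable (%k. x ^ k / Gamma (a * real k + 1))"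
proof (rule summable_comparison_test')
 define M where "M = (2 * x + 1) powr (1 / a)"
 have M: "0 < M" using x by (simp add: M_def)
 show "summable (%k. exp (M + 1) * (1/2) ^ k :: real)" by (intro summable_mult summable_geometric) simp
 fix k :: nat
 have G: "M powr (a * real k) * exp (- (M + 1)) <= Gamma (a * real k + 1)"
  using Gamma_lower_bound[of "a * real k + 1" M] M a by simp
 have Mk: "M powr (a * real k) = (2 * x + 1) ^ k"
  using a x by (simp add: M_def powr_powr powr_realpow)
 have "x ^ k / Gamma (a * real k + 1) <= x ^ k / (M powr (a * real k) * exp (- (M + 1)))"
  using G M x by (intro divide_left_mono mult_pos_pos Gamma_real_pos) (auto simp: a less_imp_le add_nonneg_pos)
 also have "... = exp (M + 1) * (x / (2 * x + 1)) ^ k"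
  by (simp add: Mk divide_inverse power_mult_distrib power_inverse exp_minus[symmetric] ac_simps)
 also have "... <= exp (M + 1) * (1/2) ^ k" using x
  by (intro mult_left_mono power_mono) (auto simp: field_simps)
 finally show "norm (x ^ k / Gamma (a * real k + 1)) <= exp (M + 1) * (1/2) ^ k"
  using x a Gamma_real_pos[of "a * real k + 1"] by (simp add: add_nonneg_pos)
qed

text \<open>The Mittag-Leffler function of order \<open>a\<close> at \<open>-x\<close>, written as an expectation over a stable variable. In
this form its bounds \<open>0 \<le> ml a x \<le> 1\<close> for \<open>x \<ge> 0\<close> are evident.\<close>

definition ml :: "real => real => real" where
 "ml a x = (\<integral>sg. exp (- (x * sg powr (-a))) \<partial>stab a)"

context
 fixes a :: real assumes a: "0 < a" "a < 1"
begin

interpretation S: real_distribution "stab a" by (rule stab_real_distribution) (use a in auto)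

lemma stab_integer_moment:
 "(\<integral>\<^sup>+sg. EN ((sg powr (-a)) ^ k) \<partial>stab a) = EN (fact k / Gamma (a * real k + 1))"
proof (cases "k = 0")
 case True then show ?thesis using S.emeasure_space_1 by simp
next
 case False
 have "(\<integral>\<^sup>+sg. EN ((sg powr (-a)) ^ k) \<partial>stab a) = (\<integral>\<^sup>+sg. EN (sg powr (-(a * real k))) \<partial>stab a)"
 proof (rule nn_integral_cong_AE)
  have "AE x in stab a. 0 < x" using a by (intro stab_pos) auto
  then show "AE sg in stab a. EN ((sg powr (-a)) ^ k) = EN (sg powr (-(a * real k)))"
  by eventually_elim (simp add: powr_realpow[symmetric] powr_powr)
 qed
 also have "... = EN (Gamma (a * real k / a) / (a * Gamma (a * real k)))"
  using a False by (intro stab_neg_moment) auto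
 also have "Gamma (a * real k / a) / (a * Gamma (a * real k)) = fact k / Gamma (a * real k + 1)"
 proof -
  have 1: "Gamma (a * real k + 1) = a * real k * Gamma (a * real k)" proof -
  have "0 < a * real k" using a False by simp
  then have "a * real k \<notin> \<int>\<^sub>\<le>\<^sub>0" using nonpos_Ints_nonpos by force
  then show ?thesis by (rule Gamma_plus1)
  qed
  have 2: "fact k = real k * Gamma (real k)" using False Gamma_fact[of "k - 1", where 'a=real] fact_reduce[of k, where 'a=real] by (simp add: of_nat_diff)
  show ?thesis unfolding 1 2 using a False by simp
 qed
 finally show ?thesis .
qed

text \<open>The negative moments of integral order of the stable law are \<open>k! / \<Gamma>(a k + 1)\<close>, so expanding the exponential
gives the Mittag-Leffler series.\<close>

lemma ml_sums:
 assumes x: "0 <= x"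
 shows "(%k. (-x) ^ k / Gamma (a * real k + 1)) sums ml a x"
proof -
 define f where "f k sg = (- (x * sg powr (-a))) ^ k / fact k" for k sg
 have Gp: "0 < Gamma (a * real k + 1)" for k using a by (intro Gamma_real_pos) (simp add: add_nonneg_pos)
 have mom: "integrable (stab a) (%sg. (sg powr (-a)) ^ k)" "(\<integral>sg. (sg powr (-a)) ^ k \<partial>stab a) = fact k / Gamma (a * real k + 1)" for k
 proof -
  show "integrable (stab a) (%sg. (sg powr (-a)) ^ k)"
  using stab_integer_moment[of k] by (intro integrableI_nonneg) auto
  show "(\<integral>sg. (sg powr (-a)) ^ k \<partial>stab a) = fact k / Gamma (a * real k + 1)"
  using stab_integer_moment[of k] Gp[of k] by (subst integral_eq_nn_integral) (auto simp: less_imp_le)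
 qed
 have f_eq: "f k sg = ((-x) ^ k / fact k) * (sg powr (-a)) ^ k" for k sg
  by (simp add: f_def power_mult_distrib[symmetric])
 have nf: "norm (f k sg) = (x ^ k / fact k) * (sg powr (-a)) ^ k" for k sg
  using x by (simp add: f_eq abs_mult power_abs)
 have fint: "integrable (stab a) (f k)" for k unfolding f_eq using mom by auto
 have "(%k. integral\<^sup>L (stab a) (f k)) sums (\<integral>sg. (\<Sum>k. f k sg) \<partial>stab a)"
 proof (rule sums_integral)
  show "integrable (stab a) (f k)" for k by (rule fint)
  show "AE sg in stab a. summable (%k. norm (f k sg))"
  proof (rule AE_I2)
  fix sg show "summable (%k. norm (f k sg))"
  using summable_norm_exp[of "- (x * sg powr (-a))"] by (simp add: f_def divide_inverse mult.commute abs_mult)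
  qed
  show "summable (%k. \<integral>sg. norm (f k sg) \<partial>stab a)"
  using ml_summable[OF a(1) x] unfolding nf by (simp add: mom)
 qed
 moreover have "(\<Sum>k. f k sg) = exp (- (x * sg powr (-a)))" for sg
  by (simp add: f_def exp_def divide_inverse mult.commute)
 moreover have "integral\<^sup>L (stab a) (f k) = (-x) ^ k / Gamma (a * real k + 1)" for k
 proof -
  have "integral\<^sup>L (stab a) (f k) = (\<integral>sg. ((-x) ^ k / fact k) * (sg powr (-a)) ^ k \<partial>stab a)" by (rule Bochner_Integration.integral_cong) (auto simp: f_eq)
  also have "... = (-x) ^ k / Gamma (a * real k + 1)" by (simp only: integral_mult_right_zero mom) simp
  finally show ?thesis .
 qed
 ultimately show ?thesis by (simp add: ml_def)
qed

lemma ml_0 [simp]: "ml a 0 = 1" using S.prob_space by (simp add: ml_def)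

lemma ml_bounds: "0 <= x ==> 0 <= ml a x" "0 <= x ==> ml a x <= 1"
proof -
 show "0 <= ml a x" unfolding ml_def by (intro integral_nonneg_AE) auto
 show "ml a x <= 1" if "0 <= x" unfolding ml_def using that
  by (intro S.integral_le_const S.integrable_const_bound[where B=1]) auto
qed

lemma ml_continuous: "continuous_on {0..} (ml a)"
 unfolding continuous_on_sequentially comp_def
proof (intro ballI allI impI)
 fix x0 and x :: "nat => real" assume x: "x0 \<in> {0..}" "(\<forall>n. x n \<in> {0..}) & x \<longlonglongrightarrow> x0"
 show "(%n. ml a (x n)) \<longlonglongrightarrow> ml a x0"
  unfolding ml_def
 proof (rule integral_dominated_convergence[where w="%_. 1"])
  show "AE sg in stab a. (%n. exp (- (x n * sg powr - a))) \<longlonglongrightarrow> exp (- (x0 * sg powr - a))"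
  using x by (intro AE_I2 tendsto_intros) auto
 qed (use x in auto)
qed

text \<open>Termwise integration: a Beta integral shifts the index of the series by one.\<close>

lemma ml_volterra:
 assumes L: "0 <= L" and t: "0 < t"
 shows "set_integrable lborel {0<..<t} (%s. (t - s) powr (a - 1) * ml a (L * s powr a))"
  and "L * (LBINT s:{0<..<t}. (t - s) powr (a - 1) * ml a (L * s powr a)) = Gamma a * (1 - ml a (L * t powr a))"
proof -
 define f where "f k s = indicator {0<..<t} s *\<^sub>R ((t - s) powr (a - 1) * ((- (L * s powr a)) ^ k / Gamma (a * real k + 1)))" for k s
 have Gp: "0 < Gamma (a * real k + 1)" for k using a by (intro Gamma_real_pos) (simp add: add_nonneg_pos)
 have f_eq: "f k s = ((-L) ^ k / Gamma (a * real k + 1)) * (indicator {0<..<t} s *\<^sub>R ((t - s) powr (a - 1) * (s - 0) powr ((a * real k + 1) - 1)))" for k s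
  proof (cases "s \<in> {0<..<t}")
  case True
  then have "(s powr a) ^ k = s powr (a * real k)" by (simp add: powr_realpow[symmetric] powr_powr)
  then show ?thesis by (simp add: f_def power_mult_distrib[of "-L" "s powr a", symmetric, simplified] power_mult_distrib power_minus[of "L * s powr a"] power_minus[of L])
 qed (simp add: f_def)
 have nf: "norm (f k s) = (L ^ k / Gamma (a * real k + 1)) * (indicator {0<..<t} s *\<^sub>R ((t - s) powr (a - 1) * (s - 0) powr ((a * real k + 1) - 1)))" for k s
  using L Gp[of k] by (simp add: f_eq abs_mult power_abs less_imp_le)
 have ak: "0 < a * real k + 1" for k using a by (simp add: add_nonneg_pos)
 note B = integral_Beta[OF a(1) ak t, unfolded set_integrable_def set_lebesgue_integral_def]
 have Bv: "t powr (a + (a * real k + 1) - 1) * Beta a (a * real k + 1) / Gamma (a * real k + 1) = Gamma a * ((t powr a) ^ Suc k / Gamma (a * real (Suc k) + 1))" for k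
 proof -
  have "t powr (a + (a * real k + 1) - 1) = (t powr a) ^ Suc k"
  using t by (simp add: powr_realpow[symmetric] powr_powr algebra_simps powr_add)
  then show ?thesis using Gp[of k] by (simp add: Beta_def algebra_simps)
 qed
 have f_fun: "f k = (%s. ((-L) ^ k / Gamma (a * real k + 1)) * (indicator {0<..<t} s *\<^sub>R ((t - s) powr (a - 1) * (s - 0) powr ((a * real k + 1) - 1))))" for k
  by (rule ext) (rule f_eq)
 have fint: "integrable lborel (f k)" for k unfolding f_fun by (intro integrable_mult_right B(1))
 have fval: "integral\<^sup>L lborel (f k) = (-L) ^ k * (Gamma a * ((t powr a) ^ Suc k / Gamma (a * real (Suc k) + 1)))" for k
  unfolding f_fun by (simp only: integral_mult_right_zero B(2) Bv[symmetric]) simp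
 have nval: "(LBINT s. norm (f k s)) = L ^ k * (Gamma a * ((t powr a) ^ Suc k / Gamma (a * real (Suc k) + 1)))" for k
  unfolding nf by (simp only: integral_mult_right_zero B(2) Bv[symmetric]) simp
 define g where "g s = indicator {0<..<t} s *\<^sub>R ((t - s) powr (a - 1) * ml a (L * s powr a))" for s
 have fs: "(%k. f k s) sums g s" for s
 proof -
  have "(%k. (- (L * s powr a)) ^ k / Gamma (a * real k + 1)) sums ml a (L * s powr a)"
  using L by (intro ml_sums) auto
  then show ?thesis unfolding f_def g_def by (intro sums_scaleR_right sums_mult)
 qed
 have smn: "summable (%k. norm (f k s))" for s
 proof (cases "s \<in> {0<..<t}")
  case True
  have "summable (%k. (t - s) powr (a - 1) * ((L * s powr a) ^ k / Gamma (a * real k + 1)))"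
  using L a by (intro summable_mult ml_summable) auto
  then show ?thesis using True L Gp by (simp add: f_def abs_mult power_abs less_imp_le)
 qed (simp add: f_def)
 have gsum: "(%s. \<Sum>k. f k s) = g" using fs by (auto simp: sums_iff)
 have summ: "summable (%k. (LBINT s. norm (f k s)))"
 proof -
  have 1: "summable (%k. (L * t powr a) ^ Suc k / Gamma (a * real (Suc k) + 1))"
  using ml_summable[OF a(1), of "L * t powr a"] L by (subst summable_Suc_iff) simp
  show ?thesis
  proof (cases "L = 0")
  case True
  have "(%k. (LBINT s. norm (f k s))) = (%k. if k = 0 then (LBINT s. norm (f 0 s)) else 0)"
  unfolding nval True by (rule ext) simp
  then show ?thesis using summable_single[of 0 "%_. (LBINT s. norm (f 0 s))"] by (simp only:)
  next
  case False
  have "(%k. (Gamma a / L) * ((L * t powr a) ^ Suc k / Gamma (a * real (Suc k) + 1))) = (%k. (LBINT s. norm (f k s)))"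
  unfolding nval using False by (intro ext) (simp add: power_mult_distrib)
  then show ?thesis using summable_mult[OF 1, of "Gamma a / L"] by simp
  qed
 qed
 have gint: "integrable lborel g"
  using integrable_suminf[OF fint AE_I2[OF smn] summ] by (simp add: gsum)
 have sm: "(%k. integral\<^sup>L lborel (f k)) sums (LBINT s. g s)"
  using sums_integral[OF fint AE_I2[OF smn] summ] by (simp add: gsum[THEN fun_cong])
 show "set_integrable lborel {0<..<t} (%s. (t - s) powr (a - 1) * ml a (L * s powr a))"
  using gint by (simp add: set_integrable_def g_def[abs_def])
 have "(%k. L * integral\<^sup>L lborel (f k)) sums (L * (LBINT s. g s))"
  by (rule sums_mult[OF sm])
 moreover have "L * integral\<^sup>L lborel (f k) = - Gamma a * ((- (L * t powr a)) ^ Suc k / Gamma (a * real (Suc k) + 1))" for k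
  unfolding fval by (simp add: power_minus[of "L * t powr a"] power_minus[of L] power_mult_distrib)
 moreover have "(%k. - Gamma a * ((- (L * t powr a)) ^ Suc k / Gamma (a * real (Suc k) + 1))) sums (- Gamma a * (ml a (L * t powr a) - 1))"
 proof (rule sums_mult)
  show "(%k. (- (L * t powr a)) ^ Suc k / Gamma (a * real (Suc k) + 1)) sums (ml a (L * t powr a) - 1)"
  using ml_sums[of "L * t powr a"] L by (subst sums_Suc_iff) simp
 qed
 ultimately have "L * (LBINT s. g s) = - Gamma a * (ml a (L * t powr a) - 1)"
  using sums_unique2 by simp blast
 then show "L * (LBINT s:{0<..<t}. (t - s) powr (a - 1) * ml a (L * s powr a)) = Gamma a * (1 - ml a (L * t powr a))"
  by (simp add: set_lebesgue_integral_def g_def algebra_simps)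
qed

end

section \<open>Uniqueness for the fractional relaxation equation\<close>

text \<open>The semigroup law of fractional integrals: after Fubini the inner integral is a Beta integral.\<close>

lemma riemann_liouville_compose:
 fixes g :: "real => complex"
 assumes ab: "0 < a" "0 < b" and t: "0 < t" and [measurable]: "g \<in> Bm"
  and K: "!!r. 0 < r ==> r < t ==> norm (g r) <= K"
 shows "(LBINT s:{0<..<t}. (t - s) powr (a - 1) *\<^sub>R (LBINT r:{0<..<s}. (s - r) powr (b - 1) *\<^sub>R g r))
  = Beta a b *\<^sub>R (LBINT r:{0<..<t}. (t - r) powr (a + b - 1) *\<^sub>R g r)"
proof -
 define h where "h s r = (indicator {0<..<t} r * indicator {r<..<t} s * ((t - s) powr (a - 1) * (s - r) powr (b - 1))) *\<^sub>R g r" for s r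
 have ind: "indicator {u<..<v} s = (if u < s & s < v then 1 else 0 :: real)" for u v s :: real by (auto simp: indicator_def)
 have hm0: "(%(s, r). h s r) \<in> Bm2"
  unfolding h_def ind by measurable
 have hm[measurable]: "(%(s, r). h s r) \<in> borel_measurable (lborel \<Otimes>\<^sub>M lborel)"
  using hm0 by (subst measurable_cong_sets[OF sets_pair_measure_cong[OF sets_lborel sets_lborel] refl])
 have K0: "0 <= K" using order_trans[OF norm_ge_zero K[of "t/2"]] t by simp
 have "(\<integral>\<^sup>+z. EN (norm (case z of (s, r) => h s r)) \<partial>(lborel \<Otimes>\<^sub>M lborel)) < \<infinity>"
 proof -
  have "(\<integral>\<^sup>+z. EN (norm (case z of (s, r) => h s r)) \<partial>(lborel \<Otimes>\<^sub>M lborel)) = (NN r. (NN s. EN (norm (h s r))))"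
  by (subst lborel_pair.nn_integral_snd[symmetric]) auto
  also have "... <= (NN r. EN (K * Beta a b) * (EN ((t - r) powr ((a + b) - 1) * (r - 0) powr (1 - 1)) * indicator {0<..<t} r))"
  proof (rule nn_integral_mono)
  fix r :: real
  show "(NN s. EN (norm (h s r))) <= EN (K * Beta a b) * (EN ((t - r) powr ((a + b) - 1) * (r - 0) powr (1 - 1)) * indicator {0<..<t} r)"
  proof (cases "r \<in> {0<..<t}")
  case True
  have "(NN s. EN (norm (h s r))) <= (NN s. EN K * (EN ((t - s) powr (a - 1) * (s - r) powr (b - 1)) * indicator {r<..<t} s))"
  proof (rule nn_integral_mono)
  fix s
  have "norm (h s r) <= K * ((t - s) powr (a - 1) * (s - r) powr (b - 1)) * indicator {r<..<t} s"
  using True K[of r] by (auto simp: h_def indicator_def mult.commute intro!: mult_left_mono)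
  then show "EN (norm (h s r)) <= EN K * (EN ((t - s) powr (a - 1) * (s - r) powr (b - 1)) * indicator {r<..<t} s)"
  using K0 by (cases "s \<in> {r<..<t}") (auto simp: emult intro!: ennreal_leI)
  qed
  also have "... = EN K * (NN s. (EN ((t - s) powr (a - 1) * (s - r) powr (b - 1)) * indicator {r<..<t} s))"
  by (rule nn_integral_cmult) auto
  also have "... = EN K * EN ((t - r) powr (a + b - 1) * Beta a b)" using True by (subst nn_integral_Beta[OF ab]) auto
  also have "... = EN (K * Beta a b) * EN ((t - r) powr (a + b - 1))"
  using K0 ab by (simp add: emult Beta_def less_imp_le Gamma_real_pos ac_simps)
  finally show ?thesis using True by simp
  qed (simp add: h_def)
  qed
  also have "... = EN (K * Beta a b) * EN ((t - 0) powr ((a + b) + 1 - 1) * Beta (a + b) 1)"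
  using ab t by (subst nn_integral_cmult) (auto simp only: nn_integral_Beta zero_less_one add_pos_pos, auto)
  also have "... < \<infinity>" by (simp add: ennreal_mult_less_top)
  finally show ?thesis .
 qed
 then have hint: "integrable (lborel \<Otimes>\<^sub>M lborel) (%(s, r). h s r)"
  by (intro integrableI_bounded hm) simp
 have "(LBINT s:{0<..<t}. (t - s) powr (a - 1) *\<^sub>R (LBINT r:{0<..<s}. (s - r) powr (b - 1) *\<^sub>R g r)) = (LBINT s. (LBINT r. h s r))"
  unfolding set_lebesgue_integral_def
 proof (rule Bochner_Integration.integral_cong[OF refl])
  fix s :: real
  have "(LBINT r. h s r) = (LBINT r. (indicator {0<..<t} s * (t - s) powr (a - 1)) *\<^sub>R (indicator {0<..<s} r *\<^sub>R (s - r) powr (b - 1) *\<^sub>R g r))"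
  by (rule Bochner_Integration.integral_cong[OF refl]) (auto simp: h_def indicator_def)
  also have "... = (indicator {0<..<t} s * (t - s) powr (a - 1)) *\<^sub>R (LBINT r. indicator {0<..<s} r *\<^sub>R (s - r) powr (b - 1) *\<^sub>R g r)"
  by (rule integral_scaleR_right)
  finally show "indicator {0<..<t} s *\<^sub>R (t - s) powr (a - 1) *\<^sub>R (LBINT r. indicator {0<..<s} r *\<^sub>R (s - r) powr (b - 1) *\<^sub>R g r) = (LBINT r. h s r)"
  by simp
 qed
 also have "... = (LBINT r. (LBINT s. h s r))"
  by (rule lborel_pair.Fubini_integral[symmetric]) (use hint in simp)
 also have "... = (LBINT r. Beta a b *\<^sub>R (indicator {0<..<t} r *\<^sub>R (t - r) powr (a + b - 1) *\<^sub>R g r))"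
 proof (rule Bochner_Integration.integral_cong[OF refl])
  fix r :: real
  show "(LBINT s. h s r) = Beta a b *\<^sub>R (indicator {0<..<t} r *\<^sub>R (t - r) powr (a + b - 1) *\<^sub>R g r)"
  proof (cases "r \<in> {0<..<t}")
  case True
  have "(LBINT s. h s r) = (LBINT s. (indicator {r<..<t} s *\<^sub>R ((t - s) powr (a - 1) * (s - r) powr (b - 1))) *\<^sub>R g r)"
  using True by (simp add: h_def)
  also have "... = (LBINT s. indicator {r<..<t} s *\<^sub>R ((t - s) powr (a - 1) * (s - r) powr (b - 1))) *\<^sub>R g r"
  using integral_Beta(1)[OF ab, of r t] True by (intro integral_scaleR_left) (auto simp: set_integrable_def)
  also have "(LBINT s. indicator {r<..<t} s *\<^sub>R ((t - s) powr (a - 1) * (s - r) powr (b - 1))) = (t - r) powr (a + b - 1) * Beta a b"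
  using integral_Beta(2)[OF ab, of r t] True by (simp only: set_lebesgue_integral_def) auto
  finally show ?thesis using True by simp
  qed (simp add: h_def)
 qed
 also have "... = Beta a b *\<^sub>R (LBINT r:{0<..<t}. (t - r) powr (a + b - 1) *\<^sub>R g r)"
  unfolding set_lebesgue_integral_def by (rule integral_scaleR_right)
 finally show ?thesis .
qed

lemma norm_integral_le_nn:
 fixes f :: "'a => 'b::{banach, second_countable_topology}"
 shows "EN (norm (integral\<^sup>L M f)) <= (\<integral>\<^sup>+x. EN (norm (f x)) \<partial>M)"
 by (cases "integrable M f") (auto intro: integral_norm_bound_ennreal simp: not_integrable_integral_eq)

lemma nn_integral_powr_exp_diff:
 fixes a c t :: real assumes "0 < a" "0 < c"
 shows "(NN s. EN ((t - s) powr (a - 1) * exp (- c * (t - s))) * indicator {0<..<t} s) <= EN (Gamma a * c powr (-a))"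
proof -
 have "(NN s. EN ((t - s) powr (a - 1) * exp (- c * (t - s))) * indicator {0<..<t} s)
  <= (NN s. EN ((t - s) powr (a - 1) * exp (- ((t - s) * c))) * indicator {0<..} (t - s))"
  by (intro nn_integral_mono) (auto simp: indicator_def mult.commute)
 also have "... = (NN s. EN (s powr (a - 1) * exp (- (s * c))) * indicator {0<..} s)"
  by (subst nn_integral_real_affine[where c="-1" and t=t and f="%s. EN (s powr (a - 1) * exp (- (s * c))) * indicator {0<..} s"]) auto
 also have "... = EN (Gamma a * c powr (-a))" using assms by (intro nn_integral_powr_exp) auto
 finally show ?thesis .
qed

text \<open>The singular Volterra operator is a contraction for the supremum weighted by \<open>exp (-ct)\<close> when \<open>c\<close> is
large, because \<open>\<integral> s^(a-1) exp (-cs) ds\<close> is of order \<open>c^(-a)\<close>.\<close>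

lemma volterra_zero:
 fixes D :: "real => complex"
 assumes a: "0 < a" and K: "0 <= K" and T: "0 <= T" and D: "continuous_on {0..T} D"
  and eq: "!!t. 0 < t ==> t <= T ==> D t = - K *\<^sub>R (LBINT s:{0<..<t}. (t - s) powr (a - 1) *\<^sub>R D s)"
  and D0: "D 0 = 0" and t: "0 <= t" "t <= T"
 shows "D t = 0"
proof -
 have G: "0 < Gamma a" using a by (rule Gamma_real_pos)
 define c where "c = (2 * K * Gamma a + 1) powr (1 / a)"
 have X: "0 < 2 * K * Gamma a + 1" using K G by (simp add: add_nonneg_pos)
 have c: "0 < c" using X less_imp_neq[OF X] by (simp add: c_def)
 have ca: "c powr (- a) = 1 / (2 * K * Gamma a + 1)"
  using a X unfolding c_def powr_powr by (simp add: powr_minus_divide)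
 have "continuous_on {0..T} (%s. exp (- c * s) * norm (D s))" by (intro continuous_intros D)
 then obtain t0 where t0: "t0 \<in> {0..T}" "!!s. s \<in> {0..T} ==> exp (- c * s) * norm (D s) <= exp (- c * t0) * norm (D t0)"
  using continuous_attains_sup[of "{0..T}" "%s. exp (- c * s) * norm (D s)"] T by auto
 define m where "m = exp (- c * t0) * norm (D t0)"
 have m0: "0 <= m" by (simp add: m_def)
 have Ds: "norm (D s) <= m * exp (c * s)" if "s \<in> {0..T}" for s
 proof -
  have "norm (D s) = exp (c * s) * (exp (- c * s) * norm (D s))" by (simp add: mult.assoc[symmetric] exp_add[symmetric])
  also have "... <= exp (c * s) * m" unfolding m_def using t0(2)[OF that] by (intro mult_left_mono) auto
  finally show ?thesis by (simp add: mult.commute)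
 qed
 have "D t0 = 0"
 proof (cases "t0 = 0")
  case False
  then have t0': "0 < t0" "t0 <= T" using t0(1) by auto
  have "(NN s. EN (norm (indicator {0<..<t0} s *\<^sub>R (t0 - s) powr (a - 1) *\<^sub>R D s)))
  <= (NN s. EN (m * exp (c * t0)) * (EN ((t0 - s) powr (a - 1) * exp (- c * (t0 - s))) * indicator {0<..<t0} s))"
  proof (rule nn_integral_mono)
  fix s
  show "EN (norm (indicator {0<..<t0} s *\<^sub>R (t0 - s) powr (a - 1) *\<^sub>R D s)) <= EN (m * exp (c * t0)) * (EN ((t0 - s) powr (a - 1) * exp (- c * (t0 - s))) * indicator {0<..<t0} s)"
  proof (cases "s \<in> {0<..<t0}")
  case True
  have "(t0 - s) powr (a - 1) * norm (D s) <= (t0 - s) powr (a - 1) * (m * exp (c * s))"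
  using True t0' by (intro mult_left_mono Ds) auto
  also have "... = m * exp (c * t0) * ((t0 - s) powr (a - 1) * exp (- c * (t0 - s)))"
  by (simp add: exp_add[symmetric] exp_minus algebra_simps exp_diff)
  finally have "(t0 - s) powr (a - 1) * norm (D s) <= m * exp (c * t0) * ((t0 - s) powr (a - 1) * exp (- c * (t0 - s)))" .
  then show ?thesis using True m0 by (auto simp: emult intro!: ennreal_leI)
  qed simp
  qed
  also have "... = EN (m * exp (c * t0)) * (NN s. EN ((t0 - s) powr (a - 1) * exp (- c * (t0 - s))) * indicator {0<..<t0} s)"
  by (rule nn_integral_cmult) auto
  also have "... <= EN (m * exp (c * t0)) * EN (Gamma a * c powr (-a))"
  by (intro mult_left_mono nn_integral_powr_exp_diff a c) auto
  finally have I: "(NN s. EN (norm (indicator {0<..<t0} s *\<^sub>R (t0 - s) powr (a - 1) *\<^sub>R D s))) <= EN (m * exp (c * t0)) * EN (Gamma a * c powr (-a))" .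
  have "EN (norm (D t0)) = EN K * EN (norm (LBINT s:{0<..<t0}. (t0 - s) powr (a - 1) *\<^sub>R D s))"
  using K by (subst eq[OF t0']) (simp add: ennreal_mult)
  also have "... <= EN K * (NN s. EN (norm (indicator {0<..<t0} s *\<^sub>R (t0 - s) powr (a - 1) *\<^sub>R D s)))"
  unfolding set_lebesgue_integral_def by (intro mult_left_mono norm_integral_le_nn) auto
  also have "... <= EN K * (EN (m * exp (c * t0)) * EN (Gamma a * c powr (-a)))"
  by (intro mult_left_mono I) auto
  also have "... = EN (K * (m * exp (c * t0)) * (Gamma a * c powr (-a)))"
  using K m0 G by (simp add: emult mult.assoc)
  finally have "norm (D t0) <= K * (m * exp (c * t0)) * (Gamma a * c powr (-a))"
  using K m0 G by (subst (asm) ennreal_le_iff) (auto simp: mult.left_commute)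
  also have "... = m * exp (c * t0) * (K * Gamma a / (2 * K * Gamma a + 1))" by (simp add: ca)
  also have "... <= m * exp (c * t0) * (1/2)" 
  proof (intro mult_left_mono)
  show "K * Gamma a / (2 * K * Gamma a + 1) <= 1 / 2" using X by (subst pos_divide_le_eq[OF X]) simp
  qed (use m0 in auto)
  also have "m * exp (c * t0) = norm (D t0)" by (simp add: m_def exp_minus)
  finally show ?thesis by simp
 qed (use D0 in simp)
 then have "m = 0" by (simp add: m_def)
 then show ?thesis using Ds[of t] t by simp
qed

lemma lebesgue_set_integral_borel:
 fixes f :: "real => complex"
 assumes "f \<in> Bm" "A \<in> sets borel"
 shows "(LINT s:A|lebesgue. f s) = (LBINT s:A. f s)"
 unfolding set_lebesgue_integral_def using assms by (intro integral_completion) auto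

lemma set_integral_Ioo_eq_integral:
 fixes f :: "real => complex" assumes "continuous_on UNIV f"
 shows "(LBINT s:{a<..<b}. f s) = integral {a..b} f"
proof -
 have "set_integrable lborel {a..b} f" using assms
  by (intro borel_integrable_atLeastAtMost') (auto intro: continuous_on_subset)
 then have "(LBINT s:{a..b}. f s) = integral {a..b} f" by (rule set_borel_integral_eq_integral)
 moreover have "(LBINT s:{a..b}. f s) = (LBINT s:{a<..<b}. f s)"
  unfolding set_lebesgue_integral_def
 proof (rule integral_cong_AE)
  have "AEl s. s ~= a" "AEl s. s ~= b" by (rule AE_lborel_singleton)+
  then show "AEl s. indicat_real {a..b} s *\<^sub>R f s = indicat_real {a<..<b} s *\<^sub>R f s"
  by eventually_elim (auto simp: indicator_def)
 qed (auto intro!: borel_measurable_scaleR borel_measurable_continuous_onI[OF assms])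
 ultimately show ?thesis by simp
qed

lemma indefinite_integral_derivative:
 fixes f :: "real => complex" assumes "continuous_on UNIV f" "0 < t"
 shows "((%t. integral {0..t} f) has_vector_derivative f t) (at t)"
proof -
 have "((%t. integral {0..t} f) has_vector_derivative f t) (at t within {0..t+1})"
  using assms by (intro integral_has_vector_derivative) (auto intro: continuous_on_subset)
 then have "((%t. integral {0..t} f) has_vector_derivative f t) (at t within {0<..<t+1})"
  by (rule has_vector_derivative_within_subset) auto
 then show ?thesis using assms by (subst (asm) at_within_open) auto
qed

text \<open>Integrating the equation in time and applying the fractional integral of order \<open>a\<close> turns the Caputo
equation into a Volterra equation of the second kind for the primitive of \<open>W - ml\<close>, which vanishes. The
initial value enters through continuity at 0.\<close>

lemma caputo_relaxation_unique:
 fixes W :: "real => complex"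
 assumes a: "0 < a" "a < 1" and L: "0 <= L" and W: "continuous_on UNIV W" and W0: "W 0 = 1"
  and cap: "!!t. 0 < t ==> has_caputo_derivative a W (- (L *\<^sub>R W t)) t" and t: "0 < t"
 shows "W t = of_real (ml a (L * t powr a))"
proof -
 have Wm[measurable]: "W \<in> Bm" using W by (rule borel_measurable_continuous_onI)
 have G: "0 < Gamma a" "0 < Gamma (1 - a)" using a by (auto intro: Gamma_real_pos)
 have Bet: "Beta a (1 - a) = Gamma a * Gamma (1 - a)" "Beta (1 - a) a = Gamma a * Gamma (1 - a)"
  by (auto simp: Beta_def)
 define J where "J f ta = (LBINT s:{0<..<ta}. (ta - s) powr ((1 - a) - 1) *\<^sub>R (f s :: complex))" for f ta
 define h where "h f ta = integral {0..ta} (f :: real => complex)" for f ta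
 define V where "V s = complex_of_real (ml a (L * (max 0 s) powr a))" for s
 have V: "continuous_on UNIV V" unfolding V_def
  using a L by (intro continuous_intros continuous_on_compose2[OF ml_continuous[OF a]] continuous_on_powr') auto
 have Vm[measurable]: "V \<in> Bm" using V by (rule borel_measurable_continuous_onI)
 have bdd: "\<exists>K. \<forall>s\<in>{0..T}. norm (f s) <= K" if "continuous_on UNIV f" for f :: "real => complex" and T
 proof -
  have "compact (f ` {0..T})" using that by (intro compact_continuous_image) (auto intro: continuous_on_subset)
  then have "bounded (f ` {0..T})" by (rule compact_imp_bounded)
  then show ?thesis by (auto simp: bounded_iff)
 qed
 have Jint: "set_integrable lborel {0<..<ta} (%s. (ta - s) powr ((1 - a) - 1) *\<^sub>R f s)" and
  Jbound: "!!K. [|!!s. s \<in> {0..ta} ==> norm (f s) <= K|] ==> norm (J f ta) <= K * (ta powr (1 - a) * Beta (1 - a) 1)"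
  if f: "continuous_on UNIV f" and ta: "0 < ta" for f ta
 proof -
  have fm[measurable]: "f \<in> Bm" using f by (rule borel_measurable_continuous_onI)
  have b1: "set_integrable lborel {0<..<ta} (%s. (ta - s) powr ((1 - a) - 1))"
  "(LBINT s:{0<..<ta}. (ta - s) powr ((1 - a) - 1)) = ta powr (1 - a) * Beta (1 - a) 1"
  proof -
  have "indicat_real {0<..<ta} s *\<^sub>R ((ta - s) powr ((1 - a) - 1) * (s - 0) powr (1 - 1)) = indicat_real {0<..<ta} s *\<^sub>R ((ta - s) powr ((1 - a) - 1))" for s
  by (auto simp: indicator_def)
  then have "(%s. indicat_real {0<..<ta} s *\<^sub>R ((ta - s) powr ((1 - a) - 1) * (s - 0) powr (1 - 1))) = (%s. indicat_real {0<..<ta} s *\<^sub>R ((ta - s) powr ((1 - a) - 1)))"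
  by (rule ext)
  note eq = this
  show "set_integrable lborel {0<..<ta} (%s. (ta - s) powr ((1 - a) - 1))"
  "(LBINT s:{0<..<ta}. (ta - s) powr ((1 - a) - 1)) = ta powr (1 - a) * Beta (1 - a) 1"
  using integral_Beta[of "1 - a" 1 0 ta] a ta unfolding set_integrable_def set_lebesgue_integral_def eq by auto
  qed
  show int: "set_integrable lborel {0<..<ta} (%s. (ta - s) powr ((1 - a) - 1) *\<^sub>R f s)"
  proof -
  obtain K where K: "\<forall>s\<in>{0..ta}. norm (f s) <= K" using bdd[OF f] by blast
  show ?thesis unfolding set_integrable_def
  proof (rule Bochner_Integration.integrable_bound)
  show "integrable lborel (%s. K * (indicator {0<..<ta} s *\<^sub>R (ta - s) powr ((1 - a) - 1)))"
  using b1(1) unfolding set_integrable_def by (rule integrable_mult_right)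
  show "AEl s. norm (indicat_real {0<..<ta} s *\<^sub>R (ta - s) powr ((1 - a) - 1) *\<^sub>R f s) <= norm (K * (indicator {0<..<ta} s *\<^sub>R (ta - s) powr ((1 - a) - 1)))"
  proof (rule AE_I2)
  fix s show "norm (indicat_real {0<..<ta} s *\<^sub>R (ta - s) powr ((1 - a) - 1) *\<^sub>R f s) <= norm (K * (indicator {0<..<ta} s *\<^sub>R (ta - s) powr ((1 - a) - 1)))"
  proof (cases "s \<in> {0<..<ta}")
  case True
  then have "norm (f s) <= \<bar>K\<bar>" using K by (meson abs_ge_self atLeastAtMost_iff greaterThanLessThan_iff less_imp_le order_trans)
  then show ?thesis using True by (simp add: abs_mult mult.commute mult_left_mono)
  qed simp
  qed
  qed auto
  qed
  fix K assume K: "!!s. s \<in> {0..ta} ==> norm (f s) <= K"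
  have "norm (J f ta) <= (LBINT s:{0<..<ta}. norm ((ta - s) powr ((1 - a) - 1) *\<^sub>R f s))"
  unfolding J_def using int by (rule set_integral_norm_bound)
  also have "... <= (LBINT s:{0<..<ta}. K * (ta - s) powr ((1 - a) - 1))"
  proof (rule set_integral_mono)
  show "set_integrable lborel {0<..<ta} (%s. norm ((ta - s) powr ((1 - a) - 1) *\<^sub>R f s))"
  using int by (rule set_integrable_norm)
  show "set_integrable lborel {0<..<ta} (%s. K * (ta - s) powr ((1 - a) - 1))"
  using b1(1) by (rule set_integrable_mult_right)
  qed (use K in \<open>auto simp: mult.commute intro!: mult_left_mono\<close>)
  also have "... = K * (ta powr (1 - a) * Beta (1 - a) 1)" by (simp only: set_integral_mult_right b1(2))
  finally show "norm (J f ta) <= K * (ta powr (1 - a) * Beta (1 - a) 1)" .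
 qed
 have JW: "J (%s. W s - 1) ta = - (L * Gamma (1 - a)) *\<^sub>R h W ta" if ta: "0 < ta" for ta
 proof -
  define P where "P ta = (1 / Gamma (1 - a)) *\<^sub>R J (%s. W s - 1) ta + L *\<^sub>R h W ta" for ta
  have W1: "continuous_on UNIV (%s. W s - 1)" by (intro continuous_intros W)
  have eqJ: "(%ta. (1 / Gamma (1 - a)) *\<^sub>R (LINT s:{0<..<ta}|lebesgue. (1 / (ta - s) powr a) *\<^sub>R (W s - W 0))) = (%ta. (1 / Gamma (1 - a)) *\<^sub>R J (%s. W s - 1) ta)"
  unfolding J_def W0 by (subst lebesgue_set_integral_borel) (auto simp: powr_minus_divide)
  have der: "(P has_vector_derivative 0) (at t)" if "0 < t" for t
  proof -
  have "((%ta. (1 / Gamma (1 - a)) *\<^sub>R J (%s. W s - 1) ta) has_vector_derivative (- (L *\<^sub>R W t))) (at t)"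
  using cap[OF that] unfolding has_caputo_derivative_def eqJ .
  moreover have "((%ta. L *\<^sub>R h W ta) has_vector_derivative (L *\<^sub>R W t)) (at t)"
  unfolding h_def using indefinite_integral_derivative[OF W that] by (auto intro!: derivative_eq_intros)
  ultimately show ?thesis unfolding P_def using has_vector_derivative_add by fastforce
  qed
  obtain c where c: "!!x. x \<in> {0<..} ==> P x = c"
  proof (rule has_vector_derivative_zero_constant)
  show "convex {0::real<..}" by simp
  show "(P has_vector_derivative 0) (at x within {0<..})" if "x \<in> {0<..}" for x
  using der[of x] that by (auto intro: has_vector_derivative_at_within)
  qed blast
  obtain K where K: "\<forall>s\<in>{0..1}. norm (W s) <= K" using bdd[OF W] by blast
  have K0: "0 <= K" using order_trans[OF norm_ge_zero[of "W 0"]] K by auto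
  have Pb: "norm (P x) <= (1 / Gamma (1 - a)) * ((K + 1) * (x powr (1 - a) * Beta (1 - a) 1)) + L * (K * x)" if x: "0 < x" "x <= 1" for x
  proof -
  have Ks: "norm (W s - 1) <= K + 1" if "s \<in> {0..x}" for s
  using K that x norm_triangle_ineq4[of "W s" 1] by (auto intro: order_trans)
  have "norm (J (%s. W s - 1) x) <= (K + 1) * (x powr (1 - a) * Beta (1 - a) 1)"
  by (rule Jbound[OF W1 x(1)]) (use Ks in auto)
  moreover have "norm (h W x) <= K * (x - 0)" unfolding h_def
  using x K W by (intro integral_bound) (auto intro: continuous_on_subset)
  ultimately show ?thesis unfolding P_def using G L
  by (intro order_trans[OF norm_triangle_ineq] add_mono) (auto intro!: mult_left_mono divide_right_mono)
  qed
  have "((%x. (1 / Gamma (1 - a)) * ((K + 1) * (x powr (1 - a) * Beta (1 - a) 1)) + L * (K * x)) \<longlongrightarrow> (1 / Gamma (1 - a)) * ((K + 1) * (0 powr (1 - a) * Beta (1 - a) 1)) + L * (K * 0)) (at_right (0::real))"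
  using a by (intro tendsto_intros tendsto_powr') (auto simp: eventually_at_right_field intro: exI[of _ 1])
  then have lim: "((%x. (1 / Gamma (1 - a)) * ((K + 1) * (x powr (1 - a) * Beta (1 - a) 1)) + L * (K * x)) \<longlongrightarrow> 0) (at_right (0::real))"
  by simp
  have "norm c <= 0"
  proof (rule tendsto_lowerbound[OF lim])
  show "\<forall>\<^sub>F x in at_right 0. norm c <= (1 / Gamma (1 - a)) * ((K + 1) * (x powr (1 - a) * Beta (1 - a) 1)) + L * (K * x)"
  unfolding eventually_at_right_field by (rule exI[of _ 1]) (use Pb c in force)
  qed simp
  then have "P ta = 0" using c[of ta] ta by simp
  then have "(1 / Gamma (1 - a)) *\<^sub>R J (%s. W s - 1) ta = - (L *\<^sub>R h W ta)" by (simp add: P_def eq_neg_iff_add_eq_0)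
  then have "Gamma (1 - a) *\<^sub>R ((1 / Gamma (1 - a)) *\<^sub>R J (%s. W s - 1) ta) = Gamma (1 - a) *\<^sub>R (- (L *\<^sub>R h W ta))" by simp
  then show ?thesis using G by (simp add: mult.commute)
 qed
 have hL: "h f ta = (LBINT s:{0<..<ta}. f s)" if "continuous_on UNIV f" for f ta
  unfolding h_def using set_integral_Ioo_eq_integral[OF that] by simp
 have comp: "(LBINT s:{0<..<ta}. (ta - s) powr (b - 1) *\<^sub>R (LBINT r:{0<..<s}. (s - r) powr ((1 - b) - 1) *\<^sub>R f r)) = (Gamma a * Gamma (1 - a)) *\<^sub>R h f ta"
  if f: "continuous_on UNIV f" and ta: "0 < ta" and b: "b = a \<or> b = 1 - a" for f :: "real => complex" and ta b
 proof -
  obtain K where K: "\<forall>s\<in>{0..ta}. norm (f s) <= K" using bdd[OF f] by blast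
  have [measurable]: "f \<in> Bm" using f by (rule borel_measurable_continuous_onI)
  have "(LBINT s:{0<..<ta}. (ta - s) powr (b - 1) *\<^sub>R (LBINT r:{0<..<s}. (s - r) powr ((1 - b) - 1) *\<^sub>R f r))
  = Beta b (1 - b) *\<^sub>R (LBINT r:{0<..<ta}. (ta - r) powr (b + (1 - b) - 1) *\<^sub>R f r)"
  using a b ta K by (intro riemann_liouville_compose[where K=K]) auto
  also have "(LBINT r:{0<..<ta}. (ta - r) powr (b + (1 - b) - 1) *\<^sub>R f r) = (LBINT r:{0<..<ta}. f r)"
  by (rule set_lebesgue_integral_cong) auto
  also have "Beta b (1 - b) = Gamma a * Gamma (1 - a)" using b Bet by auto
  finally show ?thesis using hL[OF f] by simp
 qed
 have JV: "J (%s. V s - 1) ta = - (L * Gamma (1 - a)) *\<^sub>R h V ta" if ta: "0 < ta" for ta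
 proof -
  have inner: "L *\<^sub>R (LBINT r:{0<..<s}. (s - r) powr (a - 1) *\<^sub>R V r) = Gamma a *\<^sub>R (1 - V s)" if s: "0 < s" for s
  proof -
  have "(LBINT r:{0<..<s}. (s - r) powr (a - 1) *\<^sub>R V r) = (LBINT r:{0<..<s}. complex_of_real ((s - r) powr (a - 1) * ml a (L * r powr a)))"
  by (rule set_lebesgue_integral_cong) (auto simp: V_def scaleR_conv_of_real)
  also have "... = complex_of_real (LBINT r:{0<..<s}. (s - r) powr (a - 1) * ml a (L * r powr a))"
  by (rule set_integral_complex_of_real)
  finally have "L *\<^sub>R (LBINT r:{0<..<s}. (s - r) powr (a - 1) *\<^sub>R V r) = complex_of_real (L * (LBINT r:{0<..<s}. (s - r) powr (a - 1) * ml a (L * r powr a)))"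
  by (simp add: scaleR_conv_of_real)
  also have "... = Gamma a *\<^sub>R (1 - V s)" using ml_volterra(2)[OF a L s] s by (simp add: V_def scaleR_conv_of_real max_def)
  finally show ?thesis .
  qed
  have "L *\<^sub>R (LBINT s:{0<..<ta}. (ta - s) powr ((1-a) - 1) *\<^sub>R (LBINT r:{0<..<s}. (s - r) powr (a - 1) *\<^sub>R V r))
  = (LBINT s:{0<..<ta}. (ta - s) powr ((1-a) - 1) *\<^sub>R (L *\<^sub>R (LBINT r:{0<..<s}. (s - r) powr (a - 1) *\<^sub>R V r)))"
  by (subst set_integral_scaleR_right[symmetric]) (simp add: ac_simps)
  also have "... = (LBINT s:{0<..<ta}. (- Gamma a) *\<^sub>R ((ta - s) powr ((1-a) - 1) *\<^sub>R (V s - 1)))"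
  by (rule set_lebesgue_integral_cong) (auto simp: inner scaleR_right_diff_distrib algebra_simps)
  also have "... = (- Gamma a) *\<^sub>R J (%s. V s - 1) ta" unfolding J_def by (rule set_integral_scaleR_right)
  finally have "(- Gamma a) *\<^sub>R J (%s. V s - 1) ta = L *\<^sub>R ((Gamma a * Gamma (1 - a)) *\<^sub>R h V ta)"
  using comp[OF V ta, of "1 - a"] by simp
  then have "(-1 / Gamma a) *\<^sub>R ((- Gamma a) *\<^sub>R J (%s. V s - 1) ta) = (-1 / Gamma a) *\<^sub>R (L *\<^sub>R ((Gamma a * Gamma (1 - a)) *\<^sub>R h V ta))" by simp
  then show ?thesis using G by (simp add: field_simps)
 qed
 define d where "d s = W s - V s" for s
 have d: "continuous_on UNIV d" unfolding d_def by (intro continuous_intros W V)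
 have Jd: "J d ta = - (L * Gamma (1 - a)) *\<^sub>R h d ta" if ta: "0 < ta" for ta
 proof -
  have "J d ta = (LBINT s:{0<..<ta}. (ta - s) powr ((1 - a) - 1) *\<^sub>R (W s - 1) - (ta - s) powr ((1 - a) - 1) *\<^sub>R (V s - 1))"
  unfolding J_def by (rule set_lebesgue_integral_cong) (auto simp: d_def algebra_simps)
  also have "... = J (%s. W s - 1) ta - J (%s. V s - 1) ta" unfolding J_def
  by (intro set_integral_diff Jint[OF _ ta] continuous_intros W V)
  also have "... = - (L * Gamma (1 - a)) *\<^sub>R (h W ta - h V ta)" by (simp only: JW[OF ta] JV[OF ta] scaleR_right_diff_distrib)
  also have "h W ta - h V ta = h d ta" unfolding h_def d_def using W V
  by (intro Henstock_Kurzweil_Integration.integral_diff[symmetric]) (auto intro!: integrable_continuous_interval intro: continuous_on_subset)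
  finally show ?thesis .
 qed
 have hd: "h d ta = - (L / Gamma a) *\<^sub>R (LBINT s:{0<..<ta}. (ta - s) powr (a - 1) *\<^sub>R h d s)" if ta: "0 < ta" for ta
 proof -
  have "(Gamma a * Gamma (1 - a)) *\<^sub>R h d ta = (LBINT s:{0<..<ta}. (ta - s) powr (a - 1) *\<^sub>R J d s)"
  using comp[OF d ta, of a] by (simp add: J_def)
  also have "... = (LBINT s:{0<..<ta}. (- (L * Gamma (1 - a))) *\<^sub>R ((ta - s) powr (a - 1) *\<^sub>R h d s))"
  by (rule set_lebesgue_integral_cong) (auto simp: Jd)
  also have "... = (- (L * Gamma (1 - a))) *\<^sub>R (LBINT s:{0<..<ta}. (ta - s) powr (a - 1) *\<^sub>R h d s)"
  by (rule set_integral_scaleR_right)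
  finally have "(1 / (Gamma a * Gamma (1 - a))) *\<^sub>R ((Gamma a * Gamma (1 - a)) *\<^sub>R h d ta) = (1 / (Gamma a * Gamma (1 - a))) *\<^sub>R ((- (L * Gamma (1 - a))) *\<^sub>R (LBINT s:{0<..<ta}. (ta - s) powr (a - 1) *\<^sub>R h d s))"
  by simp
  then show ?thesis using G by (simp add: field_simps)
 qed
 have hd0: "h d ta = 0" if "0 <= ta" for ta
 proof (rule volterra_zero[of a "L / Gamma a" ta "h d" ta])
  show "continuous_on {0..ta} (h d)" unfolding h_def
  using d by (intro indefinite_integral_continuous_1 integrable_continuous_interval) (auto intro: continuous_on_subset)
  show "h d 0 = 0" by (simp add: h_def)
 qed (use a L G that hd in auto)
 have "(h d has_vector_derivative d t) (at t)"
  unfolding h_def using indefinite_integral_derivative[OF d t] .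
 moreover have "(h d has_vector_derivative 0) (at t)"
 proof (rule has_vector_derivative_transform_within_open[of "%_. 0" 0 t "{0<..}"])
  show "((%_. 0) has_vector_derivative 0) (at t)" by simp
 qed (use t hd0 in auto)
 ultimately have "d t = 0" by (rule vector_derivative_unique_at)
 then show ?thesis using t by (simp add: d_def V_def max_def)
qed

section \<open>Heat kernels and Fourier uniqueness\<close>

lemma borel_measurable_cis [measurable (raw)]:
 assumes [measurable]: "f \<in> borel_measurable M"
 shows "(%x. cis (f x)) \<in> borel_measurable M"
 unfolding cis_conv_exp by measurable

lemma integral_lborel_prod:
 fixes f :: "'a::euclidean_space => real => complex"
 assumes "!!b. b \<in> Basis ==> integrable lborel (f b)"
 shows "(LBINT x. (\<Prod>b\<in>Basis. f b (x \<bullet> b))) = (\<Prod>b\<in>Basis. (LBINT x. f b x))"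
proof -
 interpret P: product_sigma_finite "%_::'a. lborel :: real measure" ..
 have [measurable]: "!!b. b \<in> Basis ==> f b \<in> Bm" using borel_measurable_integrable[OF assms] by simp
 have "(LBINT x. (\<Prod>b\<in>Basis. f b (x \<bullet> b))) = (\<integral>x. (\<Prod>b\<in>Basis. f b ((\<Sum>c\<in>Basis. x c *\<^sub>R c) \<bullet> b)) \<partial>(\<Pi>\<^sub>M b\<in>(Basis::'a set). lborel))"
 proof (subst lborel_eq, rule integral_distr)
  have "(%x. x b) \<in> borel_measurable (\<Pi>\<^sub>M b\<in>(Basis::'a set). (lborel::real measure))" if "b \<in> Basis" for b
  using measurable_component_singleton[OF that, of "%_. lborel :: real measure"] by simp
  then show "(%f. \<Sum>b\<in>Basis. f b *\<^sub>R b) \<in> (\<Pi>\<^sub>M b\<in>(Basis::'a set). (lborel::real measure)) \<rightarrow>\<^sub>M borel"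
  by (intro borel_measurable_sum borel_measurable_scaleR borel_measurable_const)
 qed measurable
 also have "... = (\<integral>x. (\<Prod>b\<in>Basis. f b (x b)) \<partial>(\<Pi>\<^sub>M b\<in>(Basis::'a set). lborel))"
  by (intro Bochner_Integration.integral_cong refl prod.cong) (simp add: inner_sum_left inner_Basis if_distrib cong: if_cong)
 also have "... = (\<Prod>b\<in>Basis. (LBINT x. f b x))"
  by (rule P.product_integral_prod) (use assms in auto)
 finally show ?thesis .
qed

lemma gauss1_integrable:
 fixes s :: real assumes "0 < s" shows "integrable lborel (%x::real. exp (- x\<^sup>2 / (4 * s)))"
proof -
 have "integrable lborel (%x. sqrt (2 * pi * (sqrt (2 * s))\<^sup>2) * normal_density 0 (sqrt (2 * s)) x)"
  using assms by (intro integrable_mult_right integrable_normal_density) auto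
 then show ?thesis using assms by (simp add: normal_density_def)
qed

lemma gauss1_fourier:
 fixes s xi :: real assumes s: "0 < s"
 shows "(LBINT x. exp (- x\<^sup>2 / (4 * s)) *\<^sub>R cis (- (x * xi))) = of_real (sqrt (4 * pi * s) * exp (- (s * xi\<^sup>2)))"
proof -
 define t where "t = - xi * sqrt (2 * s)"
 have "complex_of_real (exp (- (t^2) / 2)) = char std_normal_distribution t" by (simp add: char_std_normal_distribution)
 also have "... = (LBINT y. std_normal_density y *\<^sub>R iexp (t * y))"
  unfolding char_def by (subst integral_density) auto
 also have "... = \<bar>1 / sqrt (2 * s)\<bar> *\<^sub>R (LBINT x. std_normal_density (0 + 1 / sqrt (2 * s) * x) *\<^sub>R iexp (t * (0 + 1 / sqrt (2 * s) * x)))"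
  using s by (intro lborel_integral_real_affine) auto
 also have "(%x. std_normal_density (0 + 1 / sqrt (2 * s) * x) *\<^sub>R iexp (t * (0 + 1 / sqrt (2 * s) * x))) = (%x. (1 / sqrt (2 * pi)) *\<^sub>R (exp (- x\<^sup>2 / (4 * s)) *\<^sub>R cis (- (x * xi))))"
 proof
  fix x
  have 1: "std_normal_density (0 + 1 / sqrt (2 * s) * x) = (1 / sqrt (2 * pi)) * exp (- x\<^sup>2 / (4 * s))"
  using s by (simp add: std_normal_density_def power_divide)
  have 2: "t * (0 + 1 / sqrt (2 * s) * x) = - (x * xi)" using s by (simp add: t_def)
  show "std_normal_density (0 + 1 / sqrt (2 * s) * x) *\<^sub>R iexp (t * (0 + 1 / sqrt (2 * s) * x)) = (1 / sqrt (2 * pi)) *\<^sub>R (exp (- x\<^sup>2 / (4 * s)) *\<^sub>R cis (- (x * xi)))"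
  unfolding 1 2 by (simp add: cis_conv_exp)
 qed
 also have "(LBINT x. (1 / sqrt (2 * pi)) *\<^sub>R (exp (- x\<^sup>2 / (4 * s)) *\<^sub>R cis (- (x * xi)))) = (1 / sqrt (2 * pi)) *\<^sub>R (LBINT x. exp (- x\<^sup>2 / (4 * s)) *\<^sub>R cis (- (x * xi)))"
  by (rule integral_scaleR_right)
 finally have e: "complex_of_real (exp (- (t^2) / 2)) = \<bar>1 / sqrt (2 * s)\<bar> *\<^sub>R (1 / sqrt (2 * pi)) *\<^sub>R (LBINT x. exp (- x\<^sup>2 / (4 * s)) *\<^sub>R cis (- (x * xi)))" .
 have "t^2 / 2 = s * xi\<^sup>2" using s by (simp add: t_def power_mult_distrib)
 moreover have "\<bar>1 / sqrt (2 * s)\<bar> * (1 / sqrt (2 * pi)) = 1 / sqrt (4 * pi * s)"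
 proof -
  have "sqrt (2 * s) * sqrt (2 * pi) = sqrt (4 * pi * s)" by (simp add: real_sqrt_mult[symmetric] algebra_simps)
  then show ?thesis using s by simp
 qed
 ultimately have "complex_of_real (exp (- (s * xi\<^sup>2))) = (1 / sqrt (4 * pi * s)) *\<^sub>R (LBINT x. exp (- x\<^sup>2 / (4 * s)) *\<^sub>R cis (- (x * xi)))"
  using e by simp
 then have "sqrt (4 * pi * s) *\<^sub>R complex_of_real (exp (- (s * xi\<^sup>2))) = sqrt (4 * pi * s) *\<^sub>R ((1 / sqrt (4 * pi * s)) *\<^sub>R (LBINT x. exp (- x\<^sup>2 / (4 * s)) *\<^sub>R cis (- (x * xi))))"
  by simp
 then show ?thesis using s by (simp add: scaleR_conv_of_real)
qed

text \<open>The heat kernel at time \<open>s\<close>.\<close>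

definition gauss :: "real => 'a::euclidean_space => real" where
 "gauss s x = (4 * pi * s) powr (- (real DIM('a) / 2)) * exp (- (norm x)\<^sup>2 / (4 * s))"

lemma gauss_nonneg [simp]: "0 <= gauss s x" by (simp add: gauss_def)

lemma gauss_minus [simp]: "gauss s (- x) = gauss s x" by (simp add: gauss_def)

lemma gauss_commute: "gauss s (x - y) = gauss s (y - x)" by (simp add: gauss_def norm_minus_commute)

lemma gauss_measurable [measurable (raw)]:
 assumes [measurable]: "f \<in> borel_measurable M" "g \<in> borel_measurable M"
 shows "(%wo. gauss (f wo) (g wo :: 'a::euclidean_space)) \<in> borel_measurable M"
 unfolding gauss_def by measurable

lemma exp_norm_prod:
 fixes x :: "'a::euclidean_space"
 shows "exp (- (norm x)\<^sup>2 / (4 * s)) = (\<Prod>b\<in>Basis. exp (- (x \<bullet> b)\<^sup>2 / (4 * s)))"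
proof -
 have "(norm x)\<^sup>2 = (\<Sum>b\<in>Basis. (x \<bullet> b)\<^sup>2)"
  unfolding power2_norm_eq_inner by (subst euclidean_inner) (simp add: power2_eq_square)
 then show ?thesis by (simp add: exp_sum[symmetric] sum_negf sum_divide_distrib)
qed

lemma cis_inner_prod:
 fixes x xi :: "'a::euclidean_space"
 shows "cis (- (x \<bullet> xi)) = (\<Prod>b\<in>Basis. cis (- ((x \<bullet> b) * (xi \<bullet> b))))"
proof -
 have "x \<bullet> xi = (\<Sum>b\<in>Basis. (x \<bullet> b) * (xi \<bullet> b))" by (rule euclidean_inner)
 then show ?thesis by (simp add: cis_conv_exp exp_sum[symmetric] sum_negf sum_distrib_left)
qed

lemma nn_integral_gauss:
 assumes s: "0 < s" shows "(NN x. EN (gauss s (x::'a::euclidean_space))) = 1"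
proof -
 have 1: "(NN x. EN (exp (- x\<^sup>2 / (4 * s)))) = EN (sqrt (4 * pi * s))"
 proof -
  have "complex_of_real (LBINT x. exp (- x\<^sup>2 / (4 * s))) = (LBINT x. complex_of_real (exp (- x\<^sup>2 / (4 * s))))"
  by (rule integral_complex_of_real[symmetric])
  also have "... = (LBINT x. exp (- x\<^sup>2 / (4 * s)) *\<^sub>R cis (- (x * 0)))"
  by (simp only: scaleR_conv_of_real mult_zero_right minus_zero cis_zero mult_1_right)
  also have "... = of_real (sqrt (4 * pi * s))" using gauss1_fourier[OF s, of 0] by simp
  finally have "(LBINT x. exp (- x\<^sup>2 / (4 * s))) = sqrt (4 * pi * s)" by (simp only: of_real_eq_iff)
  then show ?thesis using nn_integral_eq_integral[OF gauss1_integrable[OF s]] by simp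
 qed
 have "(NN x. EN (gauss s (x::'a))) = EN ((4 * pi * s) powr (- (real DIM('a) / 2))) * (NN x. (\<Prod>b\<in>Basis. EN (exp (- ((x::'a) \<bullet> b)\<^sup>2 / (4 * s)))))"
 proof -
  have g: "EN (gauss s x) = EN ((4 * pi * s) powr (- (real DIM('a) / 2))) * (\<Prod>b\<in>Basis. EN (exp (- (x \<bullet> b)\<^sup>2 / (4 * s))))" for x :: 'a
  unfolding gauss_def exp_norm_prod by (simp add: ennreal_mult prod_nonneg prod_ennreal)
  show ?thesis unfolding g by (rule nn_integral_cmult) measurable
 qed
 also have "(NN x. (\<Prod>b\<in>Basis. EN (exp (- ((x::'a) \<bullet> b)\<^sup>2 / (4 * s))))) = EN (sqrt (4 * pi * s)) ^ DIM('a)"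
  by (subst nn_integral_lborel_prod) (simp_all only: 1 prod_constant, auto)
 also have "EN ((4 * pi * s) powr (- (real DIM('a) / 2))) * EN (sqrt (4 * pi * s)) ^ DIM('a) = EN ((4 * pi * s) powr (- (real DIM('a) / 2)) * sqrt (4 * pi * s) ^ DIM('a))"
  using s by (simp add: ennreal_power ennreal_mult)
 also have "sqrt (4 * pi * s) ^ DIM('a) = (4 * pi * s) powr (real DIM('a) / 2)"
  using s by (simp add: powr_half_sqrt[symmetric] powr_realpow[symmetric] powr_powr)
 also have "(4 * pi * s) powr (- (real DIM('a) / 2)) * (4 * pi * s) powr (real DIM('a) / 2) = 1"
  using s by (simp add: powr_add[symmetric])
 finally show ?thesis by simp
qed

lemma gauss_integrable: "0 < s ==> integrable lborel (gauss s :: 'a::euclidean_space => real)"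
 by (intro integrableI_nonneg) (auto simp: nn_integral_gauss)

lemma nn_integral_lborel_reflect:
 fixes f :: "'a::euclidean_space => ennreal"
 assumes [measurable]: "f \<in> Bm"
 shows "(NN y. f (x - y)) = (NN y. f y)"
 by (subst (2) lborel_affine[of "-1" x]) (auto simp: nn_integral_density nn_integral_distr)

lemma nn_integral_lborel_shift:
 fixes f :: "'a::euclidean_space => ennreal"
 assumes [measurable]: "f \<in> Bm"
 shows "(NN y. f (y - x)) = (NN y. f y)"
 by (subst (2) lborel_affine[of 1 "-x"]) (auto simp: nn_integral_density nn_integral_distr)

definition FT :: "('a::euclidean_space => real) => 'a => complex" where
 "FT f xi = (LBINT x. f x *\<^sub>R cis (- (x \<bullet> xi)))"

lemma FT_exp_norm:
 fixes xi :: "'a::euclidean_space" assumes s: "0 < s"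
 shows "(LBINT x. exp (- (norm x)\<^sup>2 / (4 * s)) *\<^sub>R cis (- (x \<bullet> xi))) = of_real ((4 * pi * s) powr (real DIM('a) / 2) * exp (- (s * (norm xi)\<^sup>2)))"
proof -
 have "(LBINT x. exp (- (norm x)\<^sup>2 / (4 * s)) *\<^sub>R cis (- (x \<bullet> xi))) = (LBINT x. (\<Prod>b\<in>(Basis::'a set). exp (- (x \<bullet> b)\<^sup>2 / (4 * s)) *\<^sub>R cis (- ((x \<bullet> b) * (xi \<bullet> b)))))"
  unfolding exp_norm_prod cis_inner_prod by (simp add: scaleR_conv_of_real prod.distrib)
 also have "... = (\<Prod>b\<in>Basis. (LBINT x. exp (- x\<^sup>2 / (4 * s)) *\<^sub>R cis (- (x * (xi \<bullet> b)))))"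
 proof (rule integral_lborel_prod)
  fix b :: 'a
  show "integrable lborel (%x. exp (- x\<^sup>2 / (4 * s)) *\<^sub>R cis (- (x * (xi \<bullet> b))))"
  by (rule Bochner_Integration.integrable_bound[OF gauss1_integrable[OF s]]) auto
 qed
 also have "... = (\<Prod>b\<in>Basis. of_real (sqrt (4 * pi * s) * exp (- (s * (xi \<bullet> b)\<^sup>2))))"
  by (simp only: gauss1_fourier[OF s])
 also have "... = of_real (\<Prod>b\<in>Basis. (sqrt (4 * pi * s) * exp (- (s * (xi \<bullet> b)\<^sup>2))))" by (rule of_real_prod[symmetric])
 also have "(\<Prod>b\<in>Basis. (sqrt (4 * pi * s) * exp (- (s * (xi \<bullet> b)\<^sup>2)))) = sqrt (4 * pi * s) ^ DIM('a) * (\<Prod>b\<in>Basis. exp (- (xi \<bullet> b)\<^sup>2 / (4 * (1 / (4 * s)))))"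
  using s by (simp add: prod.distrib mult.commute)
 also have "(\<Prod>b\<in>Basis. exp (- (xi \<bullet> b)\<^sup>2 / (4 * (1 / (4 * s))))) = exp (- (norm xi)\<^sup>2 / (4 * (1 / (4 * s))))" by (rule exp_norm_prod[symmetric])
 also have "- (norm xi)\<^sup>2 / (4 * (1 / (4 * s))) = - (s * (norm xi)\<^sup>2)" by simp
 also have "sqrt (4 * pi * s) ^ DIM('a) = (4 * pi * s) powr (real DIM('a) / 2)"
  using s by (simp add: powr_half_sqrt[symmetric] powr_realpow[symmetric] powr_powr)
 finally show ?thesis .
qed

lemma FT_gauss:
 fixes xi :: "'a::euclidean_space" assumes s: "0 < s"
 shows "FT (gauss s) xi = of_real (exp (- (s * (norm xi)\<^sup>2)))"
proof -
 have "FT (gauss s) xi = (LBINT x. (4 * pi * s) powr (- (real DIM('a) / 2)) *\<^sub>R (exp (- (norm x)\<^sup>2 / (4 * s)) *\<^sub>R cis (- (x \<bullet> xi))))"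
  by (simp add: FT_def gauss_def)
 also have "... = (4 * pi * s) powr (- (real DIM('a) / 2)) *\<^sub>R (LBINT x. (exp (- (norm x)\<^sup>2 / (4 * s)) *\<^sub>R cis (- (x \<bullet> xi))))"
  by (rule integral_scaleR_right)
 also have "... = of_real ((4 * pi * s) powr (- (real DIM('a) / 2)) * (4 * pi * s) powr (real DIM('a) / 2) * exp (- (s * (norm xi)\<^sup>2)))"
  unfolding FT_exp_norm[OF s] by (simp add: scaleR_conv_of_real)
 also have "(4 * pi * s) powr (- (real DIM('a) / 2)) * (4 * pi * s) powr (real DIM('a) / 2) = 1"
  using s by (simp add: powr_add[symmetric])
 finally show ?thesis by simp
qed

text \<open>A Gaussian is the transform of a Gaussian. This is the only case of Fourier inversion that
the uniqueness argument uses.\<close>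

lemma gauss_inversion:
 fixes z :: "'a::euclidean_space" assumes s: "0 < s"
 shows "\<exists>c. \<forall>z::'a. complex_of_real (gauss s z) = of_real c * (LBINT xi. exp (- (s * (norm xi)\<^sup>2)) *\<^sub>R cis (xi \<bullet> z))"
proof -
 define r where "r = 1 / (4 * s)"
 have r: "0 < r" using s by (simp add: r_def)
 define C where "C = (4 * pi * r) powr (real DIM('a) / 2)"
 have C: "0 < C" using r by (simp add: C_def)
 define c where "c = (4 * pi * s) powr (- (real DIM('a) / 2)) / C"
 have "complex_of_real (gauss s z) = of_real c * (LBINT xi. exp (- (s * (norm xi)\<^sup>2)) *\<^sub>R cis (xi \<bullet> z))" for z :: 'a
 proof -
  have "(LBINT xi. exp (- (s * (norm xi)\<^sup>2)) *\<^sub>R cis (xi \<bullet> z)) = (LBINT xi. exp (- (norm xi)\<^sup>2 / (4 * r)) *\<^sub>R cis (- (xi \<bullet> (- z))))"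
  using s by (simp add: r_def mult.commute)
  also have "... = of_real (C * exp (- (r * (norm (- z))\<^sup>2)))" unfolding C_def by (rule FT_exp_norm[OF r])
  finally show ?thesis using C by (simp add: c_def gauss_def r_def)
 qed
 then show ?thesis by blast
qed

text \<open>Polynomial decay of Gaussians with constants uniform in the time variable.\<close>
lemma powr_exp_bounded: "0 <= m ==> \<exists>C>0. \<forall>y>0. y powr m * exp (- y) <= (C::real)"
proof -
 assume m: "0 <= m"
 obtain n :: nat where n: "m <= real n" using real_arch_simple by blast
 have "y powr m * exp (- y) <= 1 + fact n" if y: "0 < y" for y
 proof -
  have "y powr m <= 1 + y ^ n"
  proof (cases "y <= 1")
  case True
  then have "y powr m <= 1 powr m" using m y by (intro powr_mono2) auto
  then show ?thesis using y by (simp add: add_increasing2)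
  next
  case False
  then have "y powr m <= y powr real n" using n by (intro powr_mono) auto
  then show ?thesis using y by (simp add: powr_realpow)
  qed
  then have "y powr m * exp (- y) <= (1 + y ^ n) * exp (- y)" by (intro mult_right_mono) auto
  also have "... = exp (- y) + y ^ n * exp (- y)" by (simp add: algebra_simps)
  also have "y ^ n * exp (- y) <= fact n"
  proof -
  have "y ^ n /\<^sub>R fact n <= exp y"
  unfolding exp_def using y sum_le_suminf[of "%n. y ^ n /\<^sub>R fact n" "{n}"] summable_exp_generic[of y] by auto
  then show ?thesis by (simp add: exp_minus field_simps)
  qed
  finally have "y powr m * exp (- y) <= exp (- y) + fact n" by simp
  moreover have "exp (- y) <= 1" using y by simp
  ultimately show ?thesis by linarith
 qed
 then show ?thesis by (intro exI[of _ "1 + fact n"]) (auto simp: add_pos_pos)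
qed

text \<open>Away from the origin the heat kernel is bounded uniformly in time: \<open>y^m exp (-y)\<close> is bounded, with
\<open>y = |z|^2/(4s)\<close>.\<close>

lemma gauss_decay:
 assumes k: "0 <= k"
 shows "\<exists>C>0. \<forall>s>0. \<forall>z::'a::euclidean_space. z ~= 0 --> gauss s z <= C * s powr k * norm z powr (- (real DIM('a) + 2 * k))"
proof -
 define m where "m = real DIM('a) / 2 + k"
 obtain C where C: "0 < C" "!!y. 0 < y ==> y powr m * exp (- y) <= C"
  using powr_exp_bounded[of m] k unfolding m_def by (auto simp: add_nonneg_nonneg)
 define C' where "C' = pi powr (- (real DIM('a) / 2)) * 4 powr k * C"
 have "gauss s z <= C' * s powr k * norm z powr (- (real DIM('a) + 2 * k))" if s: "0 < s" and z: "z ~= 0" for s and z :: 'a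
 proof -
  define y where "y = (norm z)\<^sup>2 / (4 * s)"
  have y: "0 < y" using s z by (simp add: y_def)
  have s4: "4 * s = (norm z)\<^sup>2 / y" using s z by (simp add: y_def)
  have "(4 * pi * s) powr (- (real DIM('a) / 2)) = pi powr (- (real DIM('a) / 2)) * (4 * s) powr (- (real DIM('a) / 2))"
  using s by (simp add: powr_mult[symmetric] ac_simps)
  also have "(4 * s) powr (- (real DIM('a) / 2)) = (4 * s) powr k * (4 * s) powr (- m)"
  using s by (simp add: powr_add[symmetric] m_def)
  also have "(4 * s) powr (- m) = norm z powr (- 2 * m) * y powr m"
  proof -
  have "(4 * s) powr (- m) = ((norm z)\<^sup>2) powr (- m) / y powr (- m)" unfolding s4 using y z by (simp add: powr_divide)
  also have "((norm z)\<^sup>2) powr (- m) = norm z powr (- 2 * m)" 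
  proof -
  have "(norm z)\<^sup>2 = norm z powr 2" using z by simp
  then show ?thesis by (simp only: powr_powr) simp
  qed
  finally show ?thesis by (simp add: powr_minus_divide divide_inverse powr_minus)
  qed
  finally have "gauss s z = pi powr (- (real DIM('a) / 2)) * ((4 * s) powr k * (norm z powr (- 2 * m) * y powr m)) * exp (- y)"
  by (simp add: gauss_def y_def)
  also have "... = (pi powr (- (real DIM('a) / 2)) * 4 powr k * s powr k * norm z powr (- 2 * m)) * (y powr m * exp (- y))"
  using s by (simp add: powr_mult)
  also have "... <= (pi powr (- (real DIM('a) / 2)) * 4 powr k * s powr k * norm z powr (- 2 * m)) * C"
  by (intro mult_left_mono C y) auto
  also have "- 2 * m = - (real DIM('a) + 2 * k)" by (simp add: m_def)
  finally show ?thesis by (simp add: C'_def ac_simps)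
 qed
 moreover have "0 < C'" using C by (simp add: C'_def)
 ultimately show ?thesis by blast
qed

text \<open>If the transform of \<open>h\<close> vanishes, so does the convolution of \<open>h\<close> with every Gaussian, by the inversion formula
for Gaussians and Fubini. At a point of continuity these convolutions converge to \<open>h x\<close>.\<close>

lemma fourier_uniqueness:
 fixes h :: "'a::euclidean_space => real"
 assumes hi: "integrable lborel h" and z: "!!xi. xi ~= 0 ==> FT h xi = 0" and c: "isCont h x"
 shows "h x = 0"
proof -
 have hm[measurable]: "h \<in> Bm" using borel_measurable_integrable[OF hi] by simp
 have conv0: "(LBINT y. h y * gauss e (x - y)) = 0" if e: "0 < e" for e
 proof -
  obtain k where k: "!!z::'a. complex_of_real (gauss e z) = of_real k * (LBINT xi. exp (- (e * (norm xi)\<^sup>2)) *\<^sub>R cis (xi \<bullet> z))"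
  using gauss_inversion[OF e] by blast
  define E where "E xi = exp (- (e * (norm (xi::'a))\<^sup>2))" for xi
  have Ei: "integrable lborel E"
  proof -
  define r where "r = 1 / (4 * e)"
  have "integrable lborel (%xi::'a. (4 * pi * r) powr (real DIM('a) / 2) * gauss r xi)"
  using e by (intro integrable_mult_right gauss_integrable) (auto simp: r_def)
  moreover have "(4 * pi * r) powr (real DIM('a) / 2) * gauss r xi = E xi" for xi
  proof -
  have "(4 * pi * r) powr (real DIM('a) / 2) * (4 * pi * r) powr (- (real DIM('a) / 2)) = 1"
  using e by (simp add: powr_add[symmetric] r_def)
  moreover have "exp (- (norm xi)\<^sup>2 / (4 * r)) = E xi" using e by (simp add: E_def r_def mult.commute)
  ultimately show ?thesis unfolding gauss_def by (simp only: mult.assoc[symmetric] mult_1_left)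
  qed
  ultimately show ?thesis by simp
  qed
  have [measurable]: "E \<in> Bm" using borel_measurable_integrable[OF Ei] by simp
  define F where "F y xi = (h y * E xi) *\<^sub>R cis (xi \<bullet> (x - y))" for y xi
  have Fm: "(%(y, xi). F y xi) \<in> borel_measurable (lborel \<Otimes>\<^sub>M lborel)"
  unfolding F_def cis_conv_exp by measurable
  have Fi: "integrable (lborel \<Otimes>\<^sub>M lborel) (%(y, xi). F y xi)"
  proof (rule lborel_pair.Fubini_integrable[OF Fm])
  have n: "norm (case (y, xi) of (y, xi) => F y xi) = \<bar>h y\<bar> * E xi" for y xi
  by (simp add: F_def abs_mult E_def)
  show "integrable lborel (%y. (LBINT xi. norm (case (y, xi) of (y, xi) => F y xi)))"
  unfolding n using hi by simp
  show "AEl y. integrable lborel (%xi. case (y, xi) of (y, xi) => F y xi)"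
  proof (rule AE_I2)
  fix y
  have "integrable lborel (%xi. \<bar>h y\<bar> * E xi)" using Ei by simp
  then show "integrable lborel (%xi. case (y, xi) of (y, xi) => F y xi)"
  by (rule Bochner_Integration.integrable_bound) (auto simp: F_def abs_mult cis_conv_exp simp del: norm_cis)
  qed
  qed
  have "complex_of_real (LBINT y. h y * gauss e (x - y)) = (LBINT y. of_real k * (LBINT xi. F y xi))"
  proof -
  have "complex_of_real (h y * gauss e (x - y)) = of_real k * (LBINT xi. F y xi)" for y
  proof -
  have "(LBINT xi. F y xi) = (LBINT xi. h y *\<^sub>R (E xi *\<^sub>R cis (xi \<bullet> (x - y))))" by (simp add: F_def)
  also have "... = h y *\<^sub>R (LBINT xi. E xi *\<^sub>R cis (xi \<bullet> (x - y)))" by (rule integral_scaleR_right)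
  finally show ?thesis using k[of "x - y"] by (simp add: E_def scaleR_conv_of_real)
  qed
  then show ?thesis by (simp only: integral_complex_of_real[symmetric])
  qed
  also have "... = of_real k * (LBINT y. (LBINT xi. F y xi))" by (rule integral_mult_right_zero)
  also have "(LBINT y. (LBINT xi. F y xi)) = (LBINT xi. (LBINT y. F y xi))"
  by (rule lborel_pair.Fubini_integral[symmetric]) (rule Fi)
  also have "... = (\<integral>xi. 0 \<partial>(lborel :: 'a measure))"
  proof (rule integral_cong_AE)
  show "(%xi. (LBINT y. F y xi)) \<in> borel_measurable lborel"
  using Fm by measurable
  have "AE xi in lborel. xi ~= (0::'a)" by (rule AE_lborel_singleton)
  then show "AE xi in lborel. (LBINT y. F y xi) = 0"
  proof eventually_elim
  case (elim xi)
  have "F y xi = (E xi *\<^sub>R cis (xi \<bullet> x)) * (h y *\<^sub>R cis (- (y \<bullet> xi)))" for y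
  by (simp add: F_def inner_diff_right cis_mult inner_commute scaleR_conv_of_real)
  then have "(LBINT y. F y xi) = (E xi *\<^sub>R cis (xi \<bullet> x)) * FT h xi" by (simp only: FT_def integral_mult_right_zero)
  then show ?case using z[OF elim] by simp
  qed
  qed auto
  finally show ?thesis by simp
 qed
 obtain C where C: "0 < C" "!!s z. 0 < s ==> z ~= 0 ==> gauss s (z::'a) <= C * s powr 1 * norm z powr (- (real DIM('a) + 2))"
  using gauss_decay[of 1, where 'a='a] by auto
 show ?thesis
 proof (rule ccontr)
  assume hx: "h x ~= 0"
  define \<eta> where "\<eta> = \<bar>h x\<bar> / 4"
  have \<eta>: "0 < \<eta>" using hx by (simp add: \<eta>_def)
  obtain d where d: "0 < d" "!!y. dist y x < d ==> \<bar>h y - h x\<bar> < \<eta>"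
  using c \<eta> unfolding continuous_at_eps_delta by (auto simp: dist_real_def)
  define G where "G = C * d powr (- (real DIM('a) + 2))"
  have G: "0 < G" using C d by (simp add: G_def)
  define I where "I = (LBINT y. \<bar>h y\<bar>)"
  define K where "K = G * I + \<bar>h x\<bar> * (2 powr (real DIM('a) / 2) * (8 / d\<^sup>2))"
  have K0: "0 <= K" using G by (auto simp: K_def I_def intro!: add_nonneg_nonneg mult_nonneg_nonneg)
  define e where "e = \<eta> / (K + 1)"
  have e: "0 < e" using \<eta> K0 by (simp add: e_def)
  have eK: "e * K < \<eta>" using \<eta> K0 by (simp add: e_def field_simps)
  have gi: "integrable lborel (%y. gauss s (x - y))" "(LBINT y. gauss s (x - y)) = 1" if "0 < s" for s
  proof -
  have nn: "(NN y. EN (gauss s (x - y))) = 1"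
  using nn_integral_lborel_reflect[of "%y. EN (gauss s y)" x] nn_integral_gauss[OF that, where 'a='a] by simp
  then show "integrable lborel (%y. gauss s (x - y))" by (intro integrableI_nonneg) auto
  show "(LBINT y. gauss s (x - y)) = 1" using nn by (subst integral_eq_nn_integral) auto
  qed
  have far: "gauss e z <= 2 powr (real DIM('a) / 2) * (8 / d\<^sup>2) * e * gauss (2 * e) z" if "d <= norm z" for z :: 'a
  proof -
  have "(4 * pi * e) powr (- (real DIM('a) / 2)) = 2 powr (real DIM('a) / 2) * (4 * pi * (2 * e)) powr (- (real DIM('a) / 2))"
  proof -
  have "(4 * pi * (2 * e)) powr (- (real DIM('a) / 2)) = 2 powr (- (real DIM('a) / 2)) * (4 * pi * e) powr (- (real DIM('a) / 2))"
  using e by (simp add: powr_mult[symmetric] ac_simps)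
  then show ?thesis by (simp add: mult.assoc[symmetric] powr_add[symmetric])
  qed
  moreover have "exp (- (norm z)\<^sup>2 / (4 * e)) = exp (- ((norm z)\<^sup>2 / (8 * e))) * exp (- (norm z)\<^sup>2 / (4 * (2 * e)))"
  by (simp add: exp_add[symmetric])
  ultimately have "gauss e z = 2 powr (real DIM('a) / 2) * exp (- ((norm z)\<^sup>2 / (8 * e))) * gauss (2 * e) z"
  by (simp add: gauss_def)
  also have "... <= 2 powr (real DIM('a) / 2) * (8 * e / d\<^sup>2) * gauss (2 * e) z"
  proof (intro mult_right_mono mult_left_mono)
  have y: "d\<^sup>2 / (8 * e) <= (norm z)\<^sup>2 / (8 * e)" using that d e by (intro divide_right_mono power_mono) auto
  have y0: "0 < d\<^sup>2 / (8 * e)" using d e by simp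
  have "exp (- ((norm z)\<^sup>2 / (8 * e))) <= exp (- (d\<^sup>2 / (8 * e)))" using y by simp
  also have "... = 1 / exp (d\<^sup>2 / (8 * e))" by (simp only: exp_minus inverse_eq_divide)
  also have "... <= 1 / (d\<^sup>2 / (8 * e))"
  by (rule divide_left_mono) (use exp_ge_add_one_self[of "d\<^sup>2 / (8 * e)"] y0 in linarith, simp, rule mult_pos_pos[OF exp_gt_zero y0])
  finally show "exp (- ((norm z)\<^sup>2 / (8 * e))) <= 8 * e / d\<^sup>2" by simp
  qed auto
  finally show ?thesis by (simp add: ac_simps)
  qed
  define B where "B y = \<eta> * gauss e (x - y) + G * e * \<bar>h y\<bar> + \<bar>h x\<bar> * (2 powr (real DIM('a) / 2) * (8 / d\<^sup>2) * e) * gauss (2 * e) (x - y)" for y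
  have Bi: "integrable lborel B" unfolding B_def using gi[OF e] gi[of "2 * e"] e hi
  by (intro Bochner_Integration.integrable_add integrable_mult_right integrable_abs) auto
  have Bv: "(LBINT y. B y) = \<eta> + e * K"
  proof -
  have "(LBINT y. B y) = \<eta> * (LBINT y. gauss e (x - y)) + G * e * I + \<bar>h x\<bar> * (2 powr (real DIM('a) / 2) * (8 / d\<^sup>2) * e) * (LBINT y. gauss (2 * e) (x - y))"
  unfolding B_def I_def using gi(1)[OF e] gi(1)[of "2 * e"] e hi
  by (subst Bochner_Integration.integral_add Bochner_Integration.integral_add, auto)+
  then show ?thesis using gi(2)[OF e] gi(2)[of "2 * e"] e by (simp add: K_def algebra_simps)
  qed
  have pt: "norm ((h y - h x) * gauss e (x - y)) <= B y" for y
  proof (cases "dist y x < d")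
  case True
  have "\<bar>h y - h x\<bar> * gauss e (x - y) <= \<eta> * gauss e (x - y)" using d(2)[OF True] by (intro mult_right_mono) auto
  moreover have "0 <= G * e * \<bar>h y\<bar> + \<bar>h x\<bar> * (2 powr (real DIM('a) / 2) * (8 / d\<^sup>2) * e) * gauss (2 * e) (x - y)"
  using G e by (auto intro!: add_nonneg_nonneg mult_nonneg_nonneg)
  ultimately show ?thesis by (simp add: B_def abs_mult)
  next
  case False
  then have z: "d <= norm (x - y)" by (simp add: dist_norm norm_minus_commute)
  then have z0: "x - y ~= 0" using d by auto
  have "gauss e (x - y) <= C * e powr 1 * norm (x - y) powr (- (real DIM('a) + 2))" by (rule C(2)[OF e z0])
  also have "... <= C * e powr 1 * d powr (- (real DIM('a) + 2))"
  using z d C e by (intro mult_left_mono powr_mono2') auto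
  also have "... = G * e" using e by (simp add: G_def)
  finally have 1: "\<bar>h y\<bar> * gauss e (x - y) <= G * e * \<bar>h y\<bar>" by (subst mult.commute) (auto intro: mult_right_mono)
  have 2: "\<bar>h x\<bar> * gauss e (x - y) <= \<bar>h x\<bar> * (2 powr (real DIM('a) / 2) * (8 / d\<^sup>2) * e * gauss (2 * e) (x - y))"
  by (intro mult_left_mono far z) auto
  have "\<bar>h y - h x\<bar> * gauss e (x - y) <= (\<bar>h y\<bar> + \<bar>h x\<bar>) * gauss e (x - y)" by (intro mult_right_mono) auto
  also have "... = \<bar>h y\<bar> * gauss e (x - y) + \<bar>h x\<bar> * gauss e (x - y)" by (simp add: distrib_right)
  also have "... <= G * e * \<bar>h y\<bar> + \<bar>h x\<bar> * (2 powr (real DIM('a) / 2) * (8 / d\<^sup>2) * e * gauss (2 * e) (x - y))" using 1 2 by simp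
  also have "... <= B y" using \<eta> by (simp add: B_def mult.assoc)
  finally show ?thesis by (simp add: abs_mult)
  qed
  have Di: "integrable lborel (%y. (h y - h x) * gauss e (x - y))"
  by (rule Bochner_Integration.integrable_bound[OF Bi]) (use pt in \<open>auto intro: order_trans[OF _ abs_ge_self]\<close>)
  have hgi: "integrable lborel (%y. h y * gauss e (x - y))"
  proof -
  have "integrable lborel (%y. (h y - h x) * gauss e (x - y) + h x * gauss e (x - y))" using Di gi[OF e] by auto
  then show ?thesis by (simp add: algebra_simps)
  qed
  have "(LBINT y. (h y - h x) * gauss e (x - y)) = (LBINT y. h y * gauss e (x - y)) - (LBINT y. h x * gauss e (x - y))"
  using hgi gi[OF e] by (subst Bochner_Integration.integral_diff[symmetric]) (auto simp: algebra_simps)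
  also have "... = - h x" using conv0[OF e] gi[OF e] by simp
  finally have "\<bar>h x\<bar> = norm (LBINT y. (h y - h x) * gauss e (x - y))" by simp
  also have "... <= (LBINT y. norm ((h y - h x) * gauss e (x - y)))" by (rule integral_norm_bound)
  also have "... <= (LBINT y. B y)" using Di Bi pt by (intro integral_mono) auto
  also have "... < 2 * \<eta>" using Bv eK by simp
  finally show False using \<eta> by (simp add: \<eta>_def)
 qed
qed

section \<open>Mixtures of heat kernels\<close>

text \<open>The random time at which the heat kernel is evaluated: the first coordinate inverts a stable
subordinator of order \<open>\<alpha>\<close> (fractional time derivative), the second is a stable variable of order \<open>\<beta>\<close>
(fractional Laplacian).\<close>

definition rho :: "real => real => real => real \<times> real => real" where
 "rho al be t wo = (t / fst wo) powr (al / be) * snd wo"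

text \<open>Mixture of heat kernels, with weight \<open>w\<close> on the first stable variable. \<open>w = 1\<close> gives \<open>Z\<close>, and
\<open>w \<sigma> = \<sigma>^(-\<alpha>)\<close> gives \<open>Y\<close> up to the factor \<open>\<alpha> t^(\<alpha>-1)\<close>.\<close>

definition Km :: "real => real => (real => real) => real => 'a::euclidean_space => real" where
 "Km al be w t x = (\<integral>wo. w (fst wo) * gauss (rho al be t wo) x \<partial>(mix al be))"

context
 fixes al be :: real
 assumes ab: "0 < al" "al < 1" "0 < be" "be <= 1"
begin

interpretation A: real_distribution "stab al" by (rule stab_real_distribution) (use ab in auto)
interpretation B: real_distribution "stab be" by (rule stab_real_distribution) (use ab in auto)
interpretation P: pair_prob_space "stab al" "stab be" ..

lemma sets_mix: "sets (mix al be) = sets (borel \<Otimes>\<^sub>M borel)"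
 by (intro sets_pair_measure_cong A.events_eq_borel B.events_eq_borel)

lemma fst_mix_measurable [measurable (raw)]:
 assumes "g \<in> M \<rightarrow>\<^sub>M (mix al be)" shows "(%x. fst (g x)) \<in> borel_measurable M"
 using measurable_compose[OF assms measurable_fst] unfolding measurable_cong_sets[OF refl A.events_eq_borel] .

lemma snd_mix_measurable [measurable (raw)]:
 assumes "g \<in> M \<rightarrow>\<^sub>M (mix al be)" shows "(%x. snd (g x)) \<in> borel_measurable M"
 using measurable_compose[OF assms measurable_snd] unfolding measurable_cong_sets[OF refl B.events_eq_borel] .

lemma rho_measurable [measurable (raw)]:
 assumes [measurable]: "f \<in> borel_measurable M" "g \<in> M \<rightarrow>\<^sub>M (mix al be)"
 shows "(%x. rho al be (f x) (g x)) \<in> borel_measurable M"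
 unfolding rho_def by measurable

lemma AE_mix_pos: "AE wo in mix al be. 0 < fst wo & 0 < snd wo"
proof (rule P.AE_pair_measure)
 have "AE x in stab al. 0 < x" "AE x in stab be. 0 < x" using ab by (auto intro: stab_pos[OF _ _ refl])
 then show "AE x in stab al. AE y in stab be. 0 < fst (x, y) & 0 < snd (x, y)"
  by (auto elim!: eventually_mono)
 show "{x \<in> space (mix al be). 0 < fst x & 0 < snd x} \<in> sets (mix al be)"
  by measurable
qed

lemma AE_rho_pos: "0 < t ==> AE wo in mix al be. 0 < rho al be t wo"
 using AE_mix_pos by eventually_elim (auto simp: rho_def intro!: mult_pos_pos)

lemma gauss_rho_bound:
 "\<exists>C>0. \<forall>t>0. \<forall>z::'a::euclidean_space. z ~= 0 --> (AE wo in mix al be. gauss (rho al be t wo) z <= C * norm z powr (- real DIM('a)))"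
proof -
 obtain C where C: "0 < C" "!!s z. 0 < s ==> z ~= 0 ==> gauss s (z::'a) <= C * s powr 0 * norm z powr (- (real DIM('a) + 2 * 0))"
  using gauss_decay[of 0, where 'a='a] by auto
 have "AE wo in mix al be. gauss (rho al be t wo) z <= C * norm z powr (- real DIM('a))" if t: "0 < t" and z: "z ~= 0" for t and z :: 'a
  using AE_rho_pos[OF t]
 proof eventually_elim
  case (elim wo)
  then show ?case using C(2)[OF elim z] by simp
 qed
 then show ?thesis using C(1) by blast
qed

context
 fixes w :: "real => real"
 assumes w0: "!!sg. 0 <= w sg" and wm [measurable]: "w \<in> Bm" and wi: "integrable (stab al) w"
begin

lemma w_mix_integrable: "integrable (mix al be) (%wo. w (fst wo))"
 and w_mix_integral: "(\<integral>wo. w (fst wo) \<partial>(mix al be)) = integral\<^sup>L (stab al) w"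
proof -
 have "(\<integral>\<^sup>+wo. EN (w (fst wo)) \<partial>(mix al be)) = (\<integral>\<^sup>+sg. \<integral>\<^sup>+S. EN (w sg) \<partial>stab be \<partial>stab al)"
  by (subst B.nn_integral_fst[symmetric]) auto
 also have "... = (\<integral>\<^sup>+sg. EN (w sg) \<partial>stab al)" using B.emeasure_space_1 by simp
 also have "... = EN (integral\<^sup>L (stab al) w)" using wi w0 by (intro nn_integral_eq_integral) auto
 finally have e: "(\<integral>\<^sup>+wo. EN (w (fst wo)) \<partial>(mix al be)) = EN (integral\<^sup>L (stab al) w)" .
 then show "integrable (mix al be) (%wo. w (fst wo))" using w0 by (intro integrableI_nonneg) auto
 show "(\<integral>wo. w (fst wo) \<partial>(mix al be)) = integral\<^sup>L (stab al) w"
  using e w0 by (subst integral_eq_nn_integral) (auto intro: integral_nonneg_AE)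
qed

abbreviation "W \<equiv> integral\<^sup>L (stab al) w"

lemma W0: "0 <= W" using w0 by (intro integral_nonneg_AE) auto

lemma Km_nonneg [simp]: "0 <= Km al be w t x" unfolding Km_def using w0 by (intro integral_nonneg_AE) auto

lemma Km_integrand_integrable:
 fixes x :: "'a::euclidean_space" assumes "0 < t" "x ~= 0"
 shows "integrable (mix al be) (%wo. w (fst wo) * gauss (rho al be t wo) x)"
proof -
 obtain C where C: "0 < C" "!!t z::'a. 0 < t ==> z ~= 0 ==> AE wo in mix al be. gauss (rho al be t wo) z <= C * norm z powr (- real DIM('a))"
  using gauss_rho_bound[where 'a='a] by blast
 show ?thesis
 proof (rule Bochner_Integration.integrable_bound)
  show "integrable (mix al be) (%wo. w (fst wo) * (C * norm x powr (- real DIM('a))))"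
  using w_mix_integrable by (rule integrable_mult_left)
  show "AE wo in mix al be. norm (w (fst wo) * gauss (rho al be t wo) x) <= norm (w (fst wo) * (C * norm x powr (- real DIM('a))))"
  using C(2)[OF assms] by eventually_elim (use w0 C(1) in \<open>auto simp: abs_mult intro!: mult_left_mono\<close>)
 qed measurable
qed

lemma Km_bound:
 "\<exists>C>0. \<forall>t>0. \<forall>x::'a::euclidean_space. x ~= 0 --> Km al be w t x <= C * norm x powr (- real DIM('a))"
proof -
 obtain C where C: "0 < C" "!!t z::'a. 0 < t ==> z ~= 0 ==> AE wo in mix al be. gauss (rho al be t wo) z <= C * norm z powr (- real DIM('a))"
  using gauss_rho_bound[where 'a='a] by blast
 have "Km al be w t x <= ((W + 1) * C) * norm x powr (- real DIM('a))" if t: "0 < t" and x: "x ~= 0" for t and x :: 'a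
 proof -
  have "Km al be w t x <= (\<integral>wo. w (fst wo) * (C * norm x powr (- real DIM('a))) \<partial>(mix al be))"
  unfolding Km_def
  proof (rule integral_mono_AE)
  show "AE wo in mix al be. w (fst wo) * gauss (rho al be t wo) x <= w (fst wo) * (C * norm x powr (- real DIM('a)))"
  using C(2)[OF t x] by eventually_elim (use w0 in \<open>auto intro!: mult_left_mono\<close>)
  qed (use Km_integrand_integrable[OF t x] w_mix_integrable in auto)
  also have "... = W * (C * norm x powr (- real DIM('a)))" by (simp add: w_mix_integral)
  also have "... <= (W + 1) * (C * norm x powr (- real DIM('a)))" using C by (intro mult_right_mono) auto
  finally show ?thesis by (simp add: mult.assoc)
 qed
 moreover have "0 < (W + 1) * C" using W0 C by simp
 ultimately show ?thesis by blast
qed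

lemma Km_measurable: "(%(t, x). Km al be w t x) \<in> borel_measurable (borel \<Otimes>\<^sub>M (borel :: 'a::euclidean_space measure))"
 unfolding Km_def by measurable

lemma Km_measurable' [measurable (raw)]:
 assumes [measurable]: "f \<in> borel_measurable M" "g \<in> borel_measurable M"
 shows "(%z. Km al be w (f z) (g z :: 'a::euclidean_space)) \<in> borel_measurable M"
 using measurable_compose[OF measurable_Pair[OF assms] Km_measurable] by simp

lemma nn_Km:
 assumes t: "0 < t" and x: "x ~= 0"
 shows "(\<integral>\<^sup>+wo. EN (w (fst wo) * gauss (rho al be t wo) x) \<partial>(mix al be)) = EN (Km al be w t x)"
 unfolding Km_def using Km_integrand_integrable[OF assms] w0 by (intro nn_integral_eq_integral) auto

lemma nn_integral_Km:
 assumes t: "0 < t"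
 shows "(NN x. EN (Km al be w t (x :: 'a::euclidean_space))) = EN W"
proof -
 interpret Q: pair_sigma_finite "mix al be" "lborel :: 'a measure" ..
 have "(NN x. EN (Km al be w t (x :: 'a))) = (NN x. \<integral>\<^sup>+wo. EN (w (fst wo) * gauss (rho al be t wo) (x::'a)) \<partial>(mix al be))"
 proof (rule nn_integral_cong_AE)
  have "AEl x. x ~= (0::'a)" by (rule AE_lborel_singleton)
  then show "AEl x. EN (Km al be w t (x :: 'a)) = (\<integral>\<^sup>+wo. EN (w (fst wo) * gauss (rho al be t wo) (x::'a)) \<partial>(mix al be))"
  by eventually_elim (simp add: nn_Km[OF t])
 qed
 also have "... = (\<integral>\<^sup>+wo. (NN x. EN (w (fst wo) * gauss (rho al be t wo) (x::'a))) \<partial>(mix al be))"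
  by (rule Q.Fubini') measurable
 also have "... = (\<integral>\<^sup>+wo. EN (w (fst wo)) \<partial>(mix al be))"
 proof (rule nn_integral_cong_AE)
  show "AE wo in mix al be. (NN x. EN (w (fst wo) * gauss (rho al be t wo) (x::'a))) = EN (w (fst wo))"
  using AE_rho_pos[OF t]
  proof eventually_elim
  case (elim wo)
  have "(NN x. EN (w (fst wo) * gauss (rho al be t wo) (x::'a))) = (NN x. EN (w (fst wo)) * EN (gauss (rho al be t wo) (x::'a)))"
  using w0 by (simp add: ennreal_mult)
  also have "... = EN (w (fst wo))" by (subst nn_integral_cmult) (auto simp: nn_integral_gauss[OF elim])
  finally show ?case .
  qed
 qed
 also have "... = EN W" using w_mix_integrable w0 by (subst nn_integral_eq_integral) (auto simp: w_mix_integral)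
 finally show ?thesis .
qed

lemma Km_integrable: "0 < t ==> integrable lborel (Km al be w t :: 'a::euclidean_space => real)"
 by (intro integrableI_nonneg) (auto simp: nn_integral_Km)

text \<open>Transforming the heat kernel gives \<open>exp (-\<rho> |\<xi>|^2)\<close>; the expectation over the second variable
replaces \<open>|\<xi>|^2\<close> by its power \<open>\<beta>\<close>.\<close>

lemma FT_Km:
 fixes xi :: "'a::euclidean_space" assumes t: "0 < t"
 shows "FT (Km al be w t) xi = of_real (\<integral>sg. w sg * exp (- ((norm xi powr (2 * be) * t powr al) * sg powr (- al))) \<partial>stab al)"
proof -
 interpret Q: pair_sigma_finite "mix al be" "lborel :: 'a measure" ..
 define F where "F wo x = (w (fst wo) * gauss (rho al be t wo) x) *\<^sub>R cis (- (x \<bullet> xi))" for wo and x :: 'a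
 have Fm: "(%(wo, x). F wo x) \<in> borel_measurable ((mix al be) \<Otimes>\<^sub>M lborel)"
  unfolding F_def by measurable
 have inner: "AE wo in mix al be. integrable lborel (F wo) & (LBINT x. norm (F wo x)) = w (fst wo) & (LBINT x. F wo x) = of_real (w (fst wo) * exp (- (rho al be t wo * (norm xi)\<^sup>2)))"
  using AE_rho_pos[OF t]
 proof eventually_elim
  case (elim wo)
  have gi: "integrable lborel (gauss (rho al be t wo) :: 'a => real)" by (rule gauss_integrable[OF elim])
  have g1: "(LBINT x. gauss (rho al be t wo) (x::'a)) = 1"
  using nn_integral_gauss[OF elim, where 'a='a] by (subst integral_eq_nn_integral) auto
  have "integrable lborel (F wo)"
  proof (rule Bochner_Integration.integrable_bound)
  show "integrable lborel (%x::'a. w (fst wo) * gauss (rho al be t wo) x)" using gi by simp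
  show "F wo \<in> borel_measurable lborel" unfolding F_def measurable_lborel2 by measurable
  qed (auto simp: F_def)
  moreover have "(LBINT x. norm (F wo x)) = w (fst wo)" using w0 g1 by (simp add: F_def abs_mult)
  moreover have "(LBINT x. F wo x) = w (fst wo) *\<^sub>R FT (gauss (rho al be t wo)) xi"
  unfolding FT_def F_def by (simp only: scaleR_scaleR[symmetric] integral_scaleR_right)
  ultimately show ?case by (simp add: FT_gauss[OF elim] scaleR_conv_of_real)
 qed
 have Fi: "integrable ((mix al be) \<Otimes>\<^sub>M lborel) (%(wo, x). F wo x)"
 proof (rule Q.Fubini_integrable[OF Fm])
  show "integrable (mix al be) (%wo. (LBINT x. norm (case (wo, x) of (wo, x) => F wo x)))"
  proof (rule integrable_cong_AE[THEN iffD1, OF _ _ _ w_mix_integrable])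
  show "AE wo in mix al be. w (fst wo) = (LBINT x. norm (case (wo, x) of (wo, x) => F wo x))"
  using inner by eventually_elim auto
  show "(%wo. (LBINT x. norm (case (wo, x) of (wo, x) => F wo x))) \<in> borel_measurable (mix al be)"
  using Fm by measurable
  qed measurable
  show "AE wo in mix al be. integrable lborel (%x. case (wo, x) of (wo, x) => F wo x)"
  using inner by eventually_elim auto
 qed
 have "FT (Km al be w t) xi = (LBINT x. \<integral>wo. F wo x \<partial>(mix al be))"
  unfolding FT_def
 proof (rule integral_cong_AE)
  have "AEl x. x ~= (0::'a)" by (rule AE_lborel_singleton)
  then show "AEl x. Km al be w t x *\<^sub>R cis (- (x \<bullet> xi)) = (\<integral>wo. F wo x \<partial>(mix al be))"
  proof eventually_elim
  case (elim x)
  show ?case unfolding F_def Km_def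
  using Km_integrand_integrable[OF t elim] by (intro integral_scaleR_left[symmetric]) auto
  qed
  show "(%x. \<integral>wo. F wo x \<partial>(mix al be)) \<in> borel_measurable lborel"
  unfolding F_def by measurable
 qed measurable
 also have "... = (\<integral>wo. (LBINT x. F wo x) \<partial>(mix al be))"
  by (rule Q.Fubini_integral) (rule Fi)
 also have "... = (\<integral>wo. of_real (w (fst wo) * exp (- (rho al be t wo * (norm xi)\<^sup>2))) \<partial>(mix al be))"
 proof (rule integral_cong_AE)
  show "AE wo in mix al be. (LBINT x. F wo x) = of_real (w (fst wo) * exp (- (rho al be t wo * (norm xi)\<^sup>2)))"
  using inner by eventually_elim auto
  show "(%wo. (LBINT x. F wo x)) \<in> borel_measurable (mix al be)"
  using Fm by measurable
 qed measurable
 also have "... = of_real (\<integral>wo. w (fst wo) * exp (- (rho al be t wo * (norm xi)\<^sup>2)) \<partial>(mix al be))"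
  by (rule integral_complex_of_real)
 also have "(\<integral>wo. w (fst wo) * exp (- (rho al be t wo * (norm xi)\<^sup>2)) \<partial>(mix al be)) = (\<integral>sg. \<integral>S. w sg * exp (- (rho al be t (sg, S) * (norm xi)\<^sup>2)) \<partial>stab be \<partial>stab al)"
 proof -
  have "integrable (mix al be) (%wo. w (fst wo) * exp (- (rho al be t wo * (norm xi)\<^sup>2)))"
  proof (rule Bochner_Integration.integrable_bound[OF w_mix_integrable])
  show "AE wo in mix al be. norm (w (fst wo) * exp (- (rho al be t wo * (norm xi)\<^sup>2))) <= norm (w (fst wo))"
  using AE_rho_pos[OF t]
  proof eventually_elim
  case (elim wo)
  then have "exp (- (rho al be t wo * (norm xi)\<^sup>2)) <= 1" by simp
  then show ?case using mult_left_mono[of "exp (- (rho al be t wo * (norm xi)\<^sup>2))" 1 "\<bar>w (fst wo)\<bar>"] by (simp add: abs_mult)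
  qed
  qed measurable
  from P.integral_fst'[OF this] show ?thesis by simp
 qed
 also have "... = (\<integral>sg. w sg * exp (- ((norm xi powr (2 * be) * t powr al) * sg powr (- al))) \<partial>stab al)"
 proof (rule integral_cong_AE)
  have "AE sg in stab al. 0 < sg" using ab by (intro stab_pos) auto
  then show "AE sg in stab al. (\<integral>S. w sg * exp (- (rho al be t (sg, S) * (norm xi)\<^sup>2)) \<partial>stab be) = w sg * exp (- ((norm xi powr (2 * be) * t powr al) * sg powr (- al)))"
  proof eventually_elim
  case (elim sg)
  define s where "s = (t / sg) powr (al / be) * (norm xi)\<^sup>2"
  have s0: "0 <= s" by (simp add: s_def)
  have "s powr be = (t / sg) powr al * norm xi powr (2 * be)"
  proof -
  have "((norm xi)\<^sup>2) powr be = norm xi powr (2 * be)"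
  proof (cases "xi = 0")
  case False
  then have "(norm xi)\<^sup>2 = norm xi powr 2" by simp
  then show ?thesis by (simp only: powr_powr)
  qed simp
  then show ?thesis using ab t elim by (simp add: s_def powr_mult powr_powr)
  qed
  also have "(t / sg) powr al = t powr al * sg powr (- al)" using t elim by (simp add: powr_divide powr_minus_divide)
  finally have sb: "s powr be = (norm xi powr (2 * be) * t powr al) * sg powr (- al)" by (simp add: ac_simps)
  have "(\<integral>\<^sup>+S. EN (exp (- (s * S))) \<partial>stab be) = EN (exp (- (s powr be)))"
  using ab s0 by (intro stab_Lap) auto
  then have "(\<integral>S. exp (- (s * S)) \<partial>stab be) = exp (- (s powr be))"
  by (subst integral_eq_nn_integral) auto
  moreover have "rho al be t (sg, S) * (norm xi)\<^sup>2 = s * S" for S by (simp add: rho_def s_def)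
  ultimately show ?case by (simp add: sb)
  qed
  have "(%wo. w (fst wo) * exp (- (rho al be t wo * (norm xi)\<^sup>2))) \<in> borel_measurable (mix al be)"
  by measurable
  then have "(%(sg, S). w sg * exp (- (rho al be t (sg, S) * (norm xi)\<^sup>2))) \<in> borel_measurable (mix al be)"
  by (simp add: case_prod_beta')
  then show "(%sg. \<integral>S. w sg * exp (- (rho al be t (sg, S) * (norm xi)\<^sup>2)) \<partial>stab be) \<in> borel_measurable (stab al)"
  by (rule B.borel_measurable_lebesgue_integral)
  show "(%sg. w sg * exp (- ((norm xi powr (2 * be) * t powr al) * sg powr (- al)))) \<in> borel_measurable (stab al)"
  unfolding measurable_cong_sets[OF A.events_eq_borel refl] by measurable
 qed
 finally show ?thesis .
qed

lemma Km_continuous: "continuous_on ({0<..} \<times> (- {0})) (%(t, x). Km al be w t (x :: 'a::euclidean_space))"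
proof -
 obtain C where C: "0 < C" "!!t z::'a. 0 < t ==> z ~= 0 ==> AE wo in mix al be. gauss (rho al be t wo) z <= C * norm z powr (- real DIM('a))"
  using gauss_rho_bound[where 'a='a] by blast
 have *: "continuous_on ({0<..} \<times> {x. d < norm x}) (%(t, x). Km al be w t (x :: 'a))" if d: "0 < d" for d
  unfolding continuous_on_sequentially comp_def
 proof (intro ballI allI impI)
  fix y0 and y :: "nat => real \<times> 'a"
  assume y: "y0 \<in> {0<..} \<times> {x. d < norm x}" "(\<forall>n. y n \<in> {0<..} \<times> {x. d < norm x}) & y \<longlonglongrightarrow> y0"
  have t: "0 < fst y0" "0 < fst (y n)" and x: "d < norm (snd y0)" "d < norm (snd (y n))" for n
  using y by (auto simp: mem_Times_iff)
  have lt: "(%n. fst (y n)) \<longlonglongrightarrow> fst y0" and lx: "(%n. snd (y n)) \<longlonglongrightarrow> snd y0" using y by (auto intro: tendsto_intros)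
  have "(%n. Km al be w (fst (y n)) (snd (y n))) \<longlonglongrightarrow> Km al be w (fst y0) (snd y0)"
  unfolding Km_def
  proof (rule integral_dominated_convergence[where w="%wo. w (fst wo) * (C * d powr (- real DIM('a)))"])
  show "integrable (mix al be) (%wo. w (fst wo) * (C * d powr (- real DIM('a))))"
  using w_mix_integrable by (rule integrable_mult_left)
  show "AE wo in mix al be. (%n. w (fst wo) * gauss (rho al be (fst (y n)) wo) (snd (y n))) \<longlonglongrightarrow> w (fst wo) * gauss (rho al be (fst y0) wo) (snd y0)"
  using AE_mix_pos
  proof eventually_elim
  case (elim wo)
  have "0 < fst y0 / fst wo" using t elim by simp
  have l1: "(%n. fst (y n) / fst wo) \<longlonglongrightarrow> fst y0 / fst wo" using elim by (intro tendsto_divide lt tendsto_const) auto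
  have l2: "(%n. rho al be (fst (y n)) wo) \<longlonglongrightarrow> rho al be (fst y0) wo" unfolding rho_def
  using \<open>0 < fst y0 / fst wo\<close> by (intro tendsto_mult tendsto_const tendsto_powr l1) auto
  have r0: "0 < rho al be (fst y0) wo" unfolding rho_def using \<open>0 < fst y0 / fst wo\<close> elim by (intro mult_pos_pos) auto
  show ?case unfolding gauss_def
  using r0 by (intro tendsto_mult tendsto_const tendsto_powr tendsto_exp tendsto_divide tendsto_minus tendsto_power tendsto_norm lx l2) auto
  qed
  show "AE wo in mix al be. norm (w (fst wo) * gauss (rho al be (fst (y n)) wo) (snd (y n))) <= w (fst wo) * (C * d powr (- real DIM('a)))" for n
  proof -
  have "snd (y n) ~= 0" using x(2)[of n] d by auto
  from C(2)[OF t(2)[of n] this] show ?thesis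
  proof eventually_elim
  case (elim wo)
  have "C * norm (snd (y n)) powr (- real DIM('a)) <= C * d powr (- real DIM('a))"
  using x(2)[of n] d C by (intro mult_left_mono powr_mono2') auto
  then have "gauss (rho al be (fst (y n)) wo) (snd (y n)) <= C * d powr (- real DIM('a))" using elim by linarith
  then show ?case using w0 by (simp add: abs_mult mult_left_mono)
  qed
  qed
  qed measurable
  then show "(%n. case y n of (t, x) => Km al be w t x) \<longlonglongrightarrow> (case y0 of (t, x) => Km al be w t x)"
  by (simp add: case_prod_beta)
 qed
 show ?thesis
  unfolding continuous_on_eq_continuous_at[OF open_Times[OF open_greaterThan open_Compl[OF closed_singleton]]]
 proof (intro ballI)
  fix y :: "real \<times> 'a" assume y: "y \<in> {0<..} \<times> - {0}"
  define d where "d = norm (snd y) / 2"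
  have d: "0 < d" "y \<in> {0<..} \<times> {x. d < norm x}" using y by (auto simp: d_def mem_Times_iff)
  have "open ({0::real<..} \<times> {x::'a. d < norm x})"
  by (intro open_Times open_greaterThan open_Collect_less continuous_intros)
  then show "isCont (%(t, x). Km al be w t x) y" using *[OF d(1)] d(2)
  by (cases y) (simp add: continuous_on_eq_continuous_at)
 qed
qed

text \<open>Superposition of the kernels in time.\<close>
context
 fixes vp :: "real => real" and ta :: real
 assumes ph0: "!!s. 0 <= vp s" and phm [measurable]: "vp \<in> Bm" and phi: "set_integrable lborel {0<..<ta} vp"
begin

definition TK :: "'a::euclidean_space => real" where "TK x = (LBINT s:{0<..<ta}. vp s * Km al be w s x)"

lemma ind_Ioo: "indicat_real {0<..<ta} s = (if 0 < s & s < ta then 1 else 0)" by (auto simp: indicator_def)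

lemma TK_integrand:
 fixes x :: "'a::euclidean_space" assumes x: "x ~= 0"
 shows "set_integrable lborel {0<..<ta} (%s. vp s * Km al be w s x)"
proof -
 obtain C where C: "0 < C" "!!t x::'a. 0 < t ==> x ~= 0 ==> Km al be w t x <= C * norm x powr (- real DIM('a))"
  using Km_bound[where 'a='a] by blast
 show ?thesis unfolding set_integrable_def
 proof (rule Bochner_Integration.integrable_bound)
  show "integrable lborel (%s. (C * norm x powr (- real DIM('a))) * (indicator {0<..<ta} s *\<^sub>R vp s))"
  using phi unfolding set_integrable_def by (rule integrable_mult_right)
  show "AEl s. norm (indicat_real {0<..<ta} s *\<^sub>R (vp s * Km al be w s x)) <= norm (C * norm x powr (- real DIM('a)) * indicat_real {0<..<ta} s *\<^sub>R vp s)"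
  using C x ph0 by (intro AE_I2) (auto simp: indicator_def abs_mult mult.commute intro!: mult_left_mono)
  show "(%s. indicat_real {0<..<ta} s *\<^sub>R (vp s * Km al be w s x)) \<in> borel_measurable lborel"
  unfolding ind_Ioo measurable_lborel2 by measurable
 qed
qed

lemma TK_isCont:
 fixes x :: "'a::euclidean_space" assumes x: "x ~= 0" shows "isCont TK x"
proof -
 obtain C where C: "0 < C" "!!t x::'a. 0 < t ==> x ~= 0 ==> Km al be w t x <= C * norm x powr (- real DIM('a))"
  using Km_bound[where 'a='a] by blast
 define d where "d = norm x / 2"
 have d: "0 < d" "d < norm x" using x by (auto simp: d_def)
 have "continuous_on {x. d < norm x} (TK :: 'a => real)"
  unfolding continuous_on_sequentially comp_def
 proof (intro ballI allI impI)
  fix y0 :: 'a and y :: "nat => 'a"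
  assume y: "y0 \<in> {x. d < norm x}" "(\<forall>n. y n \<in> {x. d < norm x}) & y \<longlonglongrightarrow> y0"
  show "(%n. TK (y n)) \<longlonglongrightarrow> TK y0"
  unfolding TK_def set_lebesgue_integral_def
  proof (rule integral_dominated_convergence[where w="%s. (C * d powr (- real DIM('a))) * (indicator {0<..<ta} s *\<^sub>R vp s)"])
  show "integrable lborel (%s. (C * d powr (- real DIM('a))) * (indicator {0<..<ta} s *\<^sub>R vp s))"
  using phi unfolding set_integrable_def by (rule integrable_mult_right)
  show "AEl s. (%n. indicat_real {0<..<ta} s *\<^sub>R (vp s * Km al be w s (y n))) \<longlonglongrightarrow> indicat_real {0<..<ta} s *\<^sub>R (vp s * Km al be w s y0)"
  proof (rule AE_I2)
  fix s
  show "(%n. indicat_real {0<..<ta} s *\<^sub>R (vp s * Km al be w s (y n))) \<longlonglongrightarrow> indicat_real {0<..<ta} s *\<^sub>R (vp s * Km al be w s y0)"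
  proof (cases "0 < s")
  case True
  have "y n ~= 0" for n
  proof -
  have "d < norm (y n)" using y by auto
  then show ?thesis using d by auto
  qed
  then have "(s, y0) \<in> {0<..} \<times> (- {0})" "!!n. (s, y n) \<in> {0<..} \<times> (- {0})" using True y d by auto
  moreover have "(%n. (s, y n)) \<longlonglongrightarrow> (s, y0)" using y by (intro tendsto_intros) auto
  ultimately have "(%n. Km al be w s (y n)) \<longlonglongrightarrow> Km al be w s y0"
  using continuous_on_tendsto_compose[OF Km_continuous[where 'a='a], of "%n. (s, y n)" "(s, y0)" sequentially] by simp
  then show ?thesis by (intro tendsto_intros)
  qed simp
  qed
  show "AEl s. norm (indicat_real {0<..<ta} s *\<^sub>R (vp s * Km al be w s (y n))) <= (C * d powr (- real DIM('a))) * (indicator {0<..<ta} s *\<^sub>R vp s)" for n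
  proof (rule AE_I2)
  fix s
  have yn: "d < norm (y n)" using y by auto
  then have yn0: "y n ~= 0" using d by auto
  show "norm (indicat_real {0<..<ta} s *\<^sub>R (vp s * Km al be w s (y n))) <= (C * d powr (- real DIM('a))) * (indicator {0<..<ta} s *\<^sub>R vp s)"
  proof (cases "s \<in> {0<..<ta}")
  case True
  have "Km al be w s (y n) <= C * norm (y n) powr (- real DIM('a))" using True yn0 by (intro C) auto
  also have "... <= C * d powr (- real DIM('a))" using yn d C by (intro mult_left_mono powr_mono2') auto
  finally have "vp s * Km al be w s (y n) <= vp s * (C * d powr (- real DIM('a)))" by (intro mult_left_mono ph0)
  then show ?thesis using True ph0[of s] by (simp add: abs_mult mult.commute)
  qed simp
  qed
  show "(%s. indicat_real {0<..<ta} s *\<^sub>R (vp s * Km al be w s z)) \<in> borel_measurable lborel" for z :: 'a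
  unfolding ind_Ioo measurable_lborel2 by measurable
  then show "(%s. indicat_real {0<..<ta} s *\<^sub>R (vp s * Km al be w s z)) \<in> borel_measurable lborel" for z :: 'a .
  qed
 qed
 moreover have "open {x::'a. d < norm x}" by (intro open_Collect_less continuous_intros)
 ultimately show ?thesis using d by (simp add: continuous_on_eq_continuous_at)
qed

text \<open>The transform commutes with the integral in time because the kernel has a total mass independent of time.\<close>

lemma TK_FT:
 shows "integrable lborel (TK :: 'a::euclidean_space => real)"
  and "FT TK (xi::'a) = of_real (LBINT s:{0<..<ta}. vp s * (\<integral>sg. w sg * exp (- ((norm xi powr (2 * be) * s powr al) * sg powr (- al))) \<partial>stab al))"
proof -
 define G where "G s x = (indicator {0<..<ta} s * (vp s * Km al be w s x)) *\<^sub>R cis (- (x \<bullet> xi))" for s and x :: 'a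
 have Gm: "(%(s, x). G s x) \<in> borel_measurable (lborel \<Otimes>\<^sub>M lborel)"
 proof -
  have "(%(s, x). G s x) \<in> Bm2" unfolding G_def ind_Ioo by measurable
  then show ?thesis by (subst measurable_cong_sets[OF sets_pair_measure_cong[OF sets_lborel sets_lborel] refl])
 qed
 have ik: "(LBINT x. Km al be w s (x::'a)) = W" if "0 < s" for s
  using nn_integral_Km[OF that, where 'a='a] W0 by (subst integral_eq_nn_integral) auto
 have nG: "(LBINT x. norm (G s x)) = indicator {0<..<ta} s * vp s * W" for s
 proof (cases "s \<in> {0<..<ta}")
  case True
  have "(LBINT x. norm (G s x)) = (LBINT x. vp s * Km al be w s (x::'a))"
  using True ph0[of s] by (intro Bochner_Integration.integral_cong) (auto simp: G_def abs_mult)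
  then show ?thesis using True ik[of s] by simp
 qed (simp add: G_def)
 have Gs: "integrable lborel (G s)" for s
 proof (cases "s \<in> {0<..<ta}")
  case True
  then have "integrable lborel (%x::'a. vp s * Km al be w s x)" by (intro integrable_mult_right Km_integrable) auto
  then show ?thesis
  proof (rule Bochner_Integration.integrable_bound)
  show "G s \<in> borel_measurable lborel" unfolding G_def measurable_lborel2 by measurable
  show "AEl x. norm (G s x) <= norm (vp s * Km al be w s x)"
  using True by (intro AE_I2) (simp add: G_def)
  qed
 next
  case False
  then have "G s = (%x. 0)" by (intro ext) (simp add: G_def)
  then show ?thesis by simp
 qed
 have Gi: "integrable (lborel \<Otimes>\<^sub>M lborel) (%(s, x). G s x)"
 proof (rule lborel_pair.Fubini_integrable[OF Gm])
  show "integrable lborel (%s. (LBINT x. norm (case (s, x) of (s, x) => G s x)))"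
  using phi by (simp add: nG set_integrable_def)
 qed (use Gs in auto)
 have TG: "AEl x. complex_of_real (TK x) * cis (- (x \<bullet> xi)) = (LBINT s. G s x)"
  using AE_lborel_singleton[of "0::'a"]
 proof eventually_elim
  case (elim x)
  have "(LBINT s. G s x) = (LBINT s. indicator {0<..<ta} s *\<^sub>R (vp s * Km al be w s x)) *\<^sub>R cis (- (x \<bullet> xi))"
  unfolding G_def using TK_integrand[OF elim] by (subst integral_scaleR_left) (auto simp: set_integrable_def)
  then show ?case by (simp add: TK_def set_lebesgue_integral_def scaleR_conv_of_real)
 qed
 have TKm: "(TK :: 'a => real) \<in> Bm"
  unfolding TK_def set_lebesgue_integral_def ind_Ioo
  by (rule lborel.borel_measurable_lebesgue_integral)
  (subst measurable_cong_sets[OF sets_pair_measure_cong[OF refl sets_lborel] refl], measurable)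
 have i1: "integrable lborel (%x. complex_of_real (TK x) * cis (- (x \<bullet> xi)))"
 proof (rule integrable_cong_AE[THEN iffD2, OF _ _ TG])
  show "integrable lborel (%x. (LBINT s. G s x))"
  using lborel_pair.integrable_snd[OF Gi] by simp
  then show "(%x. (LBINT s. G s x)) \<in> borel_measurable lborel" by (rule borel_measurable_integrable)
  show "(%x. complex_of_real (TK x) * cis (- (x \<bullet> xi))) \<in> borel_measurable lborel" using TKm by measurable
 qed
 have "integrable lborel (%x. norm (complex_of_real (TK x) * cis (- (x \<bullet> xi))))" using i1 by (rule integrable_norm)
 then have "integrable lborel (%x::'a. \<bar>TK x\<bar>)" by (simp add: norm_mult)
 then show "integrable lborel (TK :: 'a => real)" using TKm by (subst integrable_abs_iff[symmetric]) auto
 have "FT TK xi = (LBINT x. complex_of_real (TK x) * cis (- (x \<bullet> xi)))" by (simp add: FT_def scaleR_conv_of_real)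
 also have "... = (LBINT x. (LBINT s. G s x))"
  using i1 TG lborel_pair.integrable_snd[OF Gi] by (intro integral_cong_AE) (auto intro: borel_measurable_integrable)
 also have "... = (LBINT s. (LBINT x. G s x))" by (rule lborel_pair.Fubini_integral[OF Gi])
 also have "... = (LBINT s. complex_of_real (indicator {0<..<ta} s *\<^sub>R (vp s * (\<integral>sg. w sg * exp (- ((norm xi powr (2 * be) * s powr al) * sg powr (- al))) \<partial>stab al))))"
 proof (rule Bochner_Integration.integral_cong[OF refl])
  fix s
  show "(LBINT x. G s x) = complex_of_real (indicator {0<..<ta} s *\<^sub>R (vp s * (\<integral>sg. w sg * exp (- ((norm xi powr (2 * be) * s powr al) * sg powr (- al))) \<partial>stab al)))"
  proof (cases "s \<in> {0<..<ta}")
  case True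
  have "(LBINT x. G s x) = (LBINT x. vp s *\<^sub>R (Km al be w s x *\<^sub>R cis (- (x \<bullet> xi))))"
  using True by (simp add: G_def)
  also have "... = vp s *\<^sub>R FT (Km al be w s) xi" unfolding FT_def by (rule integral_scaleR_right)
  finally show ?thesis using True by (subst (asm) FT_Km) (auto simp: scaleR_conv_of_real)
  qed (simp add: G_def)
 qed
 also have "... = of_real (LBINT s:{0<..<ta}. vp s * (\<integral>sg. w sg * exp (- ((norm xi powr (2 * be) * s powr al) * sg powr (- al))) \<partial>stab al))"
  unfolding set_lebesgue_integral_def by (rule integral_complex_of_real)
 finally show "FT TK (xi::'a) = of_real (LBINT s:{0<..<ta}. vp s * (\<integral>sg. w sg * exp (- ((norm xi powr (2 * be) * s powr al) * sg powr (- al))) \<partial>stab al))" .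
qed

end

end

end

section \<open>Identification of the fundamental solution\<close>

lemma FT_diff:
 fixes f g :: "'a::euclidean_space => real"
 assumes f: "integrable lborel f" and g: "integrable lborel g"
 shows "FT (%x. f x - g x) xi = FT f xi - FT g xi"
proof -
 have *: "integrable lborel (%x. f x *\<^sub>R cis (- (x \<bullet> xi)))" if "integrable lborel f" for f :: "'a => real"
 proof (rule Bochner_Integration.integrable_bound[OF that])
  have "f \<in> Bm" using borel_measurable_integrable[OF that] by simp
  then show "(%x. f x *\<^sub>R cis (- (x \<bullet> xi))) \<in> borel_measurable lborel" unfolding measurable_lborel2 by measurable
 qed simp
 show ?thesis unfolding FT_def scaleR_left_diff_distrib by (intro Bochner_Integration.integral_diff * f g)
qed

lemma has_caputo_derivative_cong:
 assumes "!!s. 0 <= s ==> v s = w s" and "has_caputo_derivative al v D t"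
 shows "has_caputo_derivative al w D t"
proof -
 have "(LINT s:{0<..<ta}|lebesgue. (1 / (ta - s) powr al) *\<^sub>R (v s - v 0)) = (LINT s:{0<..<ta}|lebesgue. (1 / (ta - s) powr al) *\<^sub>R (w s - w 0))" for ta
  by (rule set_lebesgue_integral_cong) (use assms(1) in auto)
 then show ?thesis using assms(2) unfolding has_caputo_derivative_def by simp
qed

lemma set_integral_powr_diff:
 fixes a ta :: real assumes "0 < a" "0 < ta"
 shows "set_integrable lborel {0<..<ta} (%s. (ta - s) powr (a - 1))" "set_integrable lborel {0<..<ta} (%s. s powr (a - 1))"
proof -
 have 1: "(%s. indicat_real {0<..<ta} s *\<^sub>R ((ta - s) powr (a - 1) * (s - 0) powr (1 - 1))) = (%s. indicat_real {0<..<ta} s *\<^sub>R ((ta - s) powr (a - 1)))"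
  by (rule ext) (auto simp: indicator_def)
 show "set_integrable lborel {0<..<ta} (%s. (ta - s) powr (a - 1))"
  using integral_Beta(1)[of a 1 0 ta] assms unfolding set_integrable_def 1 by simp
 have 2: "(%s. indicat_real {0<..<ta} s *\<^sub>R ((ta - s) powr (1 - 1) * (s - 0) powr (a - 1))) = (%s. indicat_real {0<..<ta} s *\<^sub>R (s powr (a - 1)))"
  by (rule ext) (auto simp: indicator_def)
 show "set_integrable lborel {0<..<ta} (%s. s powr (a - 1))"
  using integral_Beta(1)[of 1 a 0 ta] assms unfolding set_integrable_def 2 by simp
qed

lemma set_integral_has_derivative:
 fixes g :: "real => real"
 assumes g: "continuous_on {0<..} g" and gi: "!!ta. set_integrable lborel {0<..<ta} g" and t: "0 < t"
 shows "((%ta. LBINT s:{0<..<ta}. g s) has_real_derivative g t) (at t)"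
proof -
 have split: "(LBINT s:{0<..<ta}. g s) = (LBINT s:{0<..t/2}. g s) + integral {t/2..ta} g" if ta: "t/2 < ta" for ta
 proof -
  have c: "continuous_on {t/2..ta} g" using t by (intro continuous_on_subset[OF g]) auto
  have i2: "set_integrable lborel {t/2..ta} g" using c by (rule borel_integrable_atLeastAtMost')
  have "(LBINT s:{t/2..ta}. g s) = integral {t/2..ta} g" using i2 by (rule set_borel_integral_eq_integral)
  moreover have "(LBINT s:{t/2..ta}. g s) = (LBINT s:{t/2<..<ta}. g s)"
  unfolding set_lebesgue_integral_def
  proof (rule integral_cong_AE)
  have "AEl s. s ~= t/2" "AEl s. s ~= ta" by (rule AE_lborel_singleton)+
  then show "AEl s. indicat_real {t/2..ta} s *\<^sub>R g s = indicat_real {t/2<..<ta} s *\<^sub>R g s"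
  by eventually_elim (auto simp: indicator_def)
  show "(%s. indicat_real {t/2..ta} s *\<^sub>R g s) \<in> borel_measurable lborel"
  using i2 by (auto simp: set_integrable_def)
  show "(%s. indicat_real {t/2<..<ta} s *\<^sub>R g s) \<in> borel_measurable lborel"
  proof -
  have "set_integrable lborel {t/2<..<ta} g" using i2 by (rule set_integrable_subset) auto
  then show ?thesis by (auto simp: set_integrable_def)
  qed
  qed
  moreover have "(LBINT s:{0<..<ta}. g s) = (LBINT s:{0<..t/2}. g s) + (LBINT s:{t/2<..<ta}. g s)"
  proof -
  have "{0<..<ta} = {0<..t/2} \<union> {t/2<..<ta}" using t ta by auto
  moreover have "set_integrable lborel {0<..t/2} g" "set_integrable lborel {t/2<..<ta} g"
  using t ta by (auto intro!: set_integrable_subset[OF gi[of ta]])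
  ultimately show ?thesis by (simp only:) (rule set_integral_Un, auto)
  qed
  ultimately show ?thesis by simp
 qed
 have "continuous_on {t/2..t+1} g" using t by (intro continuous_on_subset[OF g]) auto
 then have "((%u. integral {t/2..u} g) has_real_derivative g t) (at t within {t/2..t+1})"
  using t by (intro integral_has_real_derivative) auto
 then have "((%u. integral {t/2..u} g) has_real_derivative g t) (at t within {t/2<..<t+1})"
  by (rule DERIV_subset) auto
 then have "((%u. integral {t/2..u} g) has_real_derivative g t) (at t)"
  using t by (subst (asm) at_within_open) auto
 then have "((%u. (LBINT s:{0<..t/2}. g s) + integral {t/2..u} g) has_real_derivative g t) (at t)"
  by (auto intro!: derivative_eq_intros)
 then show ?thesis
  by (rule DERIV_cong_ev[THEN iffD1, rotated 3]) (use t split in \<open>auto intro!: eventually_mono[OF eventually_gt_at_top] simp: eventually_nhds intro: exI[of _ "{t/2<..}"]\<close>)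
qed

context
 fixes al be :: real and Z :: "real => 'a::euclidean_space => real"
 assumes ab: "0 < al" "al < 1" "0 < be" "be <= 1" and Z: "fundamental_solution al be Z"
begin

interpretation A: real_distribution "stab al" by (rule stab_real_distribution) (use ab in auto)

text \<open>Both sides have the same transform, by uniqueness for the relaxation equation, and both are continuous
off the origin.\<close>

lemma fundamental_solution_Z:
 assumes t: "0 < t" and x: "x ~= 0"
 shows "Z t x = Km al be (%_. 1) t x"
proof -
 have cZ: "continuous_on ({0<..} \<times> (- {0})) (%(t, x). Z t x)" and iZ: "integrable lebesgue (Z t)"
  using Z t by (auto simp: fundamental_solution_def)
 have cZt: "continuous_on (- {0}) (Z t)"
 proof -
  have "continuous_on (- {0}) (%x. case (t, x) of (t, x) => Z t x)"
  proof (rule continuous_on_compose2[OF cZ])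
  show "continuous_on (- {0}) (%x. (t, x))" by (intro continuous_intros)
  qed (use t in auto)
  then show ?thesis by simp
 qed
 have Zm: "Z t \<in> Bm"
  by (rule borel_measurable_continuous_countable_exceptions[of "{0}"]) (use cZt in auto)
 have iZ': "integrable lborel (Z t)" using iZ Zm by (subst (asm) integrable_completion) auto
 have one: "integrable (stab al) (%_. 1 :: real)" by simp
 have iK: "integrable lborel (Km al be (%_. 1) t :: 'a => real)"
  by (rule Km_integrable[OF ab _ _ one t]) auto
 have FTZ: "FT (Z t) xi = of_real (ml al (norm xi powr (2 * be) * t powr al))" for xi
 proof -
  define w where "w = (%t. if t = 0 then 1 else fourier (Z t) xi)"
  have w: "continuous_on {0..} w" "!!t. 0 < t ==> has_caputo_derivative al w (- ((norm xi powr (2 * be)) *\<^sub>R w t)) t"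
  using Z unfolding fundamental_solution_def w_def Let_def by blast+
  define V where "V s = w (max 0 s)" for s
  have "V t = of_real (ml al (norm xi powr (2 * be) * t powr al))"
  proof (rule caputo_relaxation_unique[OF ab(1,2) _ _ _ _ t])
  show "continuous_on UNIV V" unfolding V_def by (rule continuous_on_compose2[OF w(1)]) (auto intro!: continuous_intros)
  show "V 0 = 1" by (simp add: V_def w_def)
  fix s :: real assume s: "0 < s"
  have "has_caputo_derivative al V (- ((norm xi powr (2 * be)) *\<^sub>R w s)) s"
  by (rule has_caputo_derivative_cong[OF _ w(2)[OF s]]) (simp add: V_def)
  then show "has_caputo_derivative al V (- ((norm xi powr (2 * be)) *\<^sub>R V s)) s" using s by (simp add: V_def)
  qed simp
  then have "fourier (Z t) xi = of_real (ml al (norm xi powr (2 * be) * t powr al))" using t by (simp add: V_def w_def)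
  moreover have "fourier (Z t) xi = FT (Z t) xi"
  unfolding fourier_def FT_def
  proof (rule integral_completion)
  show "(%x. Z t x *\<^sub>R cis (- (x \<bullet> xi))) \<in> borel_measurable lborel"
  using Zm unfolding measurable_lborel2 by measurable
  qed
  ultimately show ?thesis by simp
 qed
 have FTK: "FT (Km al be (%_. 1) t) xi = of_real (ml al (norm xi powr (2 * be) * t powr al))" for xi :: 'a
  by (subst FT_Km[OF ab _ _ one t]) (auto simp: ml_def)
 have "Z t x - Km al be (%_. 1) t x = 0"
 proof (rule fourier_uniqueness[where h="%x. Z t x - Km al be (%_. 1) t x" and x=x])
  show "integrable lborel (%x. Z t x - Km al be (%_. 1) t x)" using iZ' iK by simp
  show "FT (%x. Z t x - Km al be (%_. 1) t x) xi = 0" for xi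
  by (simp add: FT_diff[OF iZ' iK] FTZ FTK)
  have "isCont (Z t) x" using cZt x by (simp add: continuous_on_eq_continuous_at open_Compl)
  moreover have "isCont (Km al be (%_. 1) t) x"
  proof -
  have "continuous_on ({0<..} \<times> (- {0})) (%(t, x). Km al be (%_. 1) t (x :: 'a))"
  by (rule Km_continuous[OF ab _ _ one]) auto
  then have "continuous_on (- {0}) (Km al be (%_. 1) t :: 'a => real)"
  proof -
  assume c: "continuous_on ({0<..} \<times> (- {0})) (%(t, x). Km al be (%_. 1) t (x :: 'a))"
  have "continuous_on (- {0}) (%x. case (t, x) of (t, x) => Km al be (%_. 1) t (x :: 'a))"
  proof (rule continuous_on_compose2[OF c])
  show "continuous_on (- {0}) (%x. (t, x))" by (intro continuous_intros)
  qed (use t in auto)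
  then show ?thesis by simp
  qed
  then show ?thesis using x by (simp add: continuous_on_eq_continuous_at open_Compl)
  qed
  ultimately show "isCont (%x. Z t x - Km al be (%_. 1) t x) x" by (intro continuous_intros)
 qed
 then show ?thesis by simp
qed

lemma inverse_moment_integrable: "integrable (stab al) (%sg. sg powr (- al))"
 using stab_integer_moment[OF ab(1,2), of 1] by (intro integrableI_nonneg) auto

lemma nn_integral_relaxation:
 assumes L: "0 < L" and ta: "0 < ta" and c: "0 < c"
 shows "(NN s. EN (al * s powr (al - 1) * (c * exp (- ((L * s powr al) * c)))) * indicator {0<..<ta} s) = EN ((1 - exp (- ((L * ta powr al) * c))) / L)"
proof (rule nn_integral_has_integral_lebesgue')
 define F where "F s = - exp (- ((L * s powr al) * c)) / L" for s
 have "((%s. al * s powr (al - 1) * (c * exp (- ((L * s powr al) * c)))) has_integral (F ta - F 0)) {0..ta}"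
 proof (rule fundamental_theorem_of_calculus_interior)
  show "continuous_on {0..ta} F" unfolding F_def using ab L
  by (intro continuous_intros continuous_on_powr') auto
  fix s assume s: "s \<in> {0<..<ta}"
  have "(F has_real_derivative (al * s powr (al - 1) * (c * exp (- ((L * s powr al) * c))))) (at s)"
  unfolding F_def using s L by (auto intro!: derivative_eq_intros simp: field_simps)
  then show "(F has_vector_derivative (al * s powr (al - 1) * (c * exp (- ((L * s powr al) * c))))) (at s)"
  by (simp add: has_real_derivative_iff_has_vector_derivative)
 qed (use ta in auto)
 also have "F ta - F 0 = (1 - exp (- ((L * ta powr al) * c))) / L" using ab L by (simp add: F_def field_simps)
 finally show "((%s. al * s powr (al - 1) * (c * exp (- ((L * s powr al) * c)))) has_integral (1 - exp (- ((L * ta powr al) * c))) / L) {0<..<ta}"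
  by (simp add: has_integral_Icc_iff_Ioo)
qed (use ab c in auto)

text \<open>The relaxation kernel \<open>\<alpha> s^(\<alpha>-1) E[\<sigma>^(-\<alpha>) exp (-L s^\<alpha> \<sigma>^(-\<alpha>))]\<close> is \<open>-1/L\<close> times the derivative of the
Mittag-Leffler function.\<close>

lemma integral_relaxation_kernel:
 assumes L: "0 < L" and ta: "0 < ta"
 shows "(LBINT s:{0<..<ta}. al * s powr (al - 1) * (\<integral>sg. sg powr (- al) * exp (- ((L * s powr al) * sg powr (- al))) \<partial>stab al)) = (1 - ml al (L * ta powr al)) / L"
proof -
 interpret Q: pair_sigma_finite "stab al" "lborel :: real measure" ..
 define g where "g s sg = al * s powr (al - 1) * (sg powr (- al) * exp (- ((L * s powr al) * sg powr (- al))))" for s sg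
 have g0: "0 <= g s sg" for s sg using ab by (simp add: g_def)
 have ind: "indicator {0<..<ta} s = (if 0 < s & s < ta then 1 else 0 :: ennreal)" for s by (auto simp: indicator_def)
 have ii: "integrable (stab al) (%sg. sg powr (- al) * exp (- ((L * s powr al) * sg powr (- al))))" for s
 proof (rule Bochner_Integration.integrable_bound[OF inverse_moment_integrable])
  show "AE sg in stab al. norm (sg powr (- al) * exp (- ((L * s powr al) * sg powr (- al)))) <= norm (sg powr (- al))"
  proof (rule AE_I2)
  fix sg
  have "exp (- ((L * s powr al) * sg powr (- al))) <= 1" using L by simp
  from mult_left_mono[OF this, of "sg powr (- al)"]
  show "norm (sg powr (- al) * exp (- ((L * s powr al) * sg powr (- al)))) <= norm (sg powr (- al))" by (simp add: abs_mult)
  qed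
  show "(%sg. sg powr (- al) * exp (- ((L * s powr al) * sg powr (- al)))) \<in> borel_measurable (stab al)"
  unfolding measurable_cong_sets[OF A.events_eq_borel refl] by measurable
 qed
 have "(NN s. EN (indicator {0<..<ta} s *\<^sub>R (al * s powr (al - 1) * (\<integral>sg. sg powr (- al) * exp (- ((L * s powr al) * sg powr (- al))) \<partial>stab al))))
  = (NN s. \<integral>\<^sup>+sg. EN (g s sg) * indicator {0<..<ta} s \<partial>stab al)"
 proof (rule nn_integral_cong)
  fix s
  have "(\<integral>\<^sup>+sg. EN (g s sg) \<partial>stab al) = EN (\<integral>sg. g s sg \<partial>stab al)"
  using g0 ii[of s] unfolding g_def by (intro nn_integral_eq_integral) auto
  also have "(\<integral>sg. g s sg \<partial>stab al) = al * s powr (al - 1) * (\<integral>sg. sg powr (- al) * exp (- ((L * s powr al) * sg powr (- al))) \<partial>stab al)"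
  unfolding g_def by (rule integral_mult_right_zero)
  finally show "EN (indicator {0<..<ta} s *\<^sub>R (al * s powr (al - 1) * (\<integral>sg. sg powr (- al) * exp (- ((L * s powr al) * sg powr (- al))) \<partial>stab al))) = (\<integral>\<^sup>+sg. EN (g s sg) * indicator {0<..<ta} s \<partial>stab al)"
  by (cases "s \<in> {0<..<ta}") auto
 qed
 also have "... = (\<integral>\<^sup>+sg. (NN s. EN (g s sg) * indicator {0<..<ta} s) \<partial>stab al)"
 proof (rule Q.Fubini')
  have "(%(sg, s). EN (g s sg) * indicator {0<..<ta} s) \<in> Bm2"
  unfolding g_def ind by measurable
  then show "(%(sg, s). EN (g s sg) * indicator {0<..<ta} s) \<in> borel_measurable (stab al \<Otimes>\<^sub>M lborel)"
  by (subst measurable_cong_sets[OF sets_pair_measure_cong[OF A.events_eq_borel sets_lborel] refl])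
 qed
 also have "... = (\<integral>\<^sup>+sg. EN ((1 - exp (- ((L * ta powr al) * sg powr (- al)))) / L) \<partial>stab al)"
 proof (rule nn_integral_cong_AE)
  have "AE sg in stab al. 0 < sg" using ab by (intro stab_pos[OF _ _ refl]) auto
  then show "AE sg in stab al. (NN s. EN (g s sg) * indicator {0<..<ta} s) = EN ((1 - exp (- ((L * ta powr al) * sg powr (- al)))) / L)"
  unfolding g_def by eventually_elim (intro nn_integral_relaxation L ta, simp)
 qed
 also have "... = EN (\<integral>sg. (1 - exp (- ((L * ta powr al) * sg powr (- al)))) / L \<partial>stab al)"
  using L by (intro nn_integral_eq_integral integrable_divide_zero Bochner_Integration.integrable_diff A.integrable_const_bound[where B=1]) (auto intro!: A.integrable_const_bound[where B=1])
 also have "(\<integral>sg. (1 - exp (- ((L * ta powr al) * sg powr (- al)))) / L \<partial>stab al) = (1 - ml al (L * ta powr al)) / L"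
 proof -
  have "integrable (stab al) (%sg. exp (- ((L * ta powr al) * sg powr (- al))))"
  using L by (intro A.integrable_const_bound[where B=1]) auto
  then show ?thesis using A.prob_space by (simp add: ml_def)
 qed
 finally have e: "(NN s. EN (indicator {0<..<ta} s *\<^sub>R (al * s powr (al - 1) * (\<integral>sg. sg powr (- al) * exp (- ((L * s powr al) * sg powr (- al))) \<partial>stab al)))) = EN ((1 - ml al (L * ta powr al)) / L)" .
 have indr: "indicator {0<..<ta} s = (if 0 < s & s < ta then 1 else 0 :: real)" for s by (auto simp: indicator_def)
 have m: "(%s. indicator {0<..<ta} s *\<^sub>R (al * s powr (al - 1) * (\<integral>sg. sg powr (- al) * exp (- ((L * s powr al) * sg powr (- al))) \<partial>stab al))) \<in> Bm"
 proof -
  have "(%(s, sg). sg powr (- al) * exp (- ((L * s powr al) * sg powr (- al)))) \<in> Bm2"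
  by measurable
  then have "(%(s, sg). sg powr (- al) * exp (- ((L * s powr al) * sg powr (- al)))) \<in> borel_measurable (borel \<Otimes>\<^sub>M stab al)"
  by (subst measurable_cong_sets[OF sets_pair_measure_cong[OF refl A.events_eq_borel] refl])
  then have [measurable]: "(%s. \<integral>sg. sg powr (- al) * exp (- ((L * s powr al) * sg powr (- al))) \<partial>stab al) \<in> Bm"
  by (rule A.borel_measurable_lebesgue_integral)
  show ?thesis unfolding indr by measurable
 qed
 show ?thesis unfolding set_lebesgue_integral_def
  using e m ab ml_bounds(2)[OF ab(1,2), of "L * ta powr al"] L
  by (subst integral_eq_nn_integral) (auto intro!: AE_I2 mult_nonneg_nonneg integral_nonneg_AE)
qed

text \<open>It suffices that the fractional integral of order \<open>\<alpha>\<close> of \<open>Z\<close> is the time integral of the claimed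
kernel, at every \<open>x \<noteq> 0\<close>. Up to a common factor the transforms of both are \<open>(1 - ml)/L\<close> with \<open>L = |\<xi>|^(2\<beta>)\<close>, by the Volterra equation for \<open>ml\<close>, and both are
continuous off the origin.\<close>

lemma fundamental_solution_Y:
 assumes t: "0 < t" and x: "x ~= 0"
 shows "Y_kernel al Z t x = al * t powr (al - 1) * Km al be (%sg. sg powr (- al)) t x"
proof -
 have G: "0 < Gamma al" using ab by (intro Gamma_real_pos)
 have one: "integrable (stab al) (%_. 1 :: real)" by simp
 note inv = inverse_moment_integrable
 have m1: "(%_. 1 :: real) \<in> Bm" "(%sg::real. sg powr (- al)) \<in> Bm" by auto
 define vp1 where "vp1 ta s = (ta - s) powr (al - 1)" for ta s :: real
 define vp2 where "vp2 s = Gamma al * (al * s powr (al - 1))" for s :: real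
 have ph: "!!s ta. 0 <= vp1 ta s" "!!s. 0 <= vp2 s" "!!ta. vp1 ta \<in> Bm" "vp2 \<in> Bm"
  using ab G by (auto simp: vp1_def[abs_def] vp2_def[abs_def])
 have phi1: "set_integrable lborel {0<..<ta} (vp1 ta)" and phi2: "set_integrable lborel {0<..<ta} vp2" if "0 < ta" for ta
  using set_integral_powr_diff[OF ab(1) that] unfolding vp1_def[abs_def] vp2_def[abs_def] by auto
 define T1 where "T1 ta = (TK al be (%_. 1) (vp1 ta) ta :: 'a => real)" for ta
 define T2 where "T2 ta = (TK al be (%sg. sg powr (- al)) vp2 ta :: 'a => real)" for ta
 have T12: "T1 ta x = T2 ta x" if ta: "0 < ta" for ta
 proof -
  have i: "integrable lborel (T1 ta)" "integrable lborel (T2 ta)"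
  unfolding T1_def T2_def
  using TK_FT(1)[OF ab _ m1(1) one ph(1,3) phi1[OF ta]] TK_FT(1)[OF ab _ m1(2) inv ph(2,4) phi2[OF ta]] by auto
  have "T1 ta x - T2 ta x = 0"
  proof (rule fourier_uniqueness[where h="%x. T1 ta x - T2 ta x" and x=x])
  show "integrable lborel (%x. T1 ta x - T2 ta x)" using i by simp
  show "isCont (%x. T1 ta x - T2 ta x) x" unfolding T1_def T2_def
  using TK_isCont[OF ab _ m1(1) one ph(1,3) phi1[OF ta] x] TK_isCont[OF ab _ m1(2) inv ph(2,4) phi2[OF ta] x] by (intro continuous_intros) auto
  fix xi :: 'a assume xi: "xi ~= 0"
  define L where "L = norm xi powr (2 * be)"
  have L: "0 < L" using xi by (simp add: L_def)
  have "FT (T1 ta) xi = of_real (LBINT s:{0<..<ta}. vp1 ta s * (\<integral>sg. 1 * exp (- ((norm xi powr (2 * be) * s powr al) * sg powr (- al))) \<partial>stab al))"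
  unfolding T1_def by (rule TK_FT(2)[OF ab _ m1(1) one ph(1,3) phi1[OF ta]]) auto
  also have "(LBINT s:{0<..<ta}. vp1 ta s * (\<integral>sg. 1 * exp (- ((norm xi powr (2 * be) * s powr al) * sg powr (- al))) \<partial>stab al)) = (LBINT s:{0<..<ta}. (ta - s) powr (al - 1) * ml al (L * s powr al))"
  by (simp add: vp1_def ml_def L_def)
  also have "... = Gamma al * (1 - ml al (L * ta powr al)) / L"
  using ml_volterra(2)[OF ab(1,2), of L ta] L ta by (simp add: field_simps)
  finally have F1: "FT (T1 ta) xi = of_real (Gamma al * (1 - ml al (L * ta powr al)) / L)" .
  have "FT (T2 ta) xi = of_real (LBINT s:{0<..<ta}. vp2 s * (\<integral>sg. sg powr (- al) * exp (- ((norm xi powr (2 * be) * s powr al) * sg powr (- al))) \<partial>stab al))"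
  unfolding T2_def by (rule TK_FT(2)[OF ab _ m1(2) inv ph(2,4) phi2[OF ta]]) auto
  also have "(LBINT s:{0<..<ta}. vp2 s * (\<integral>sg. sg powr (- al) * exp (- ((norm xi powr (2 * be) * s powr al) * sg powr (- al))) \<partial>stab al))
  = (LBINT s:{0<..<ta}. Gamma al * (al * s powr (al - 1) * (\<integral>sg. sg powr (- al) * exp (- ((L * s powr al) * sg powr (- al))) \<partial>stab al)))"
  by (simp add: vp2_def L_def mult.assoc)
  also have "... = Gamma al * (LBINT s:{0<..<ta}. al * s powr (al - 1) * (\<integral>sg. sg powr (- al) * exp (- ((L * s powr al) * sg powr (- al))) \<partial>stab al))"
  by (rule set_integral_mult_right)
  also have "... = Gamma al * (1 - ml al (L * ta powr al)) / L"
  unfolding integral_relaxation_kernel[OF L ta] by simp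
  finally have F2: "FT (T2 ta) xi = of_real (Gamma al * (1 - ml al (L * ta powr al)) / L)" .
  show "FT (%x. T1 ta x - T2 ta x) xi = 0" unfolding FT_diff[OF i] F1 F2 by simp
  qed
  then show ?thesis by simp
 qed
 define g where "g s = vp2 s * Km al be (%sg. sg powr (- al)) s x" for s
 have eq: "(LINT s:{0<..<ta}|lebesgue. Z s x / (ta - s) powr (1 - al)) = (LBINT s:{0<..<ta}. g s)" if ta: "0 < ta" for ta
 proof -
  have "(LINT s:{0<..<ta}|lebesgue. Z s x / (ta - s) powr (1 - al)) = (LINT s:{0<..<ta}|lebesgue. vp1 ta s * Km al be (%_. 1) s x)"
  proof (rule set_lebesgue_integral_cong)
  have "Z s x / (ta - s) powr (1 - al) = vp1 ta s * Km al be (%_. 1) s x" if "s \<in> {0<..<ta}" for s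
  proof -
  have "(ta - s) powr (al - 1) = 1 / (ta - s) powr (1 - al)" by (subst powr_minus_divide[symmetric]) simp
  then show ?thesis using that by (simp add: vp1_def fundamental_solution_Z[OF _ x])
  qed
  then show "\<forall>s. s \<in> {0<..<ta} --> Z s x / (ta - s) powr (1 - al) = vp1 ta s * Km al be (%_. 1) s x" by blast
  qed auto
  also have "... = T1 ta x"
  proof -
  have si: "set_integrable lborel {0<..<ta} (%s. vp1 ta s * Km al be (%_. 1) s x)"
  by (rule TK_integrand[OF ab _ m1(1) one ph(1,3) phi1[OF ta] x]) auto
  show ?thesis unfolding T1_def TK_def[OF ab _ m1(1) one ph(1,3) phi1[OF ta], simplified] set_lebesgue_integral_def
  using si unfolding set_integrable_def by (intro integral_completion) auto
  qed
  also have "... = T2 ta x" by (rule T12[OF ta])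
  also have "... = (LBINT s:{0<..<ta}. g s)"
  unfolding T2_def TK_def[OF ab _ m1(2) inv ph(2,4) phi2[OF ta], simplified] g_def ..
  finally show ?thesis .
 qed
 have "((%ta. LBINT s:{0<..<ta}. g s) has_real_derivative g t) (at t)"
 proof (rule set_integral_has_derivative[OF _ _ t])
  show "continuous_on {0<..} g"
  proof -
  have "continuous_on ({0<..} \<times> (- {0})) (%(t, x). Km al be (%sg. sg powr (- al)) t (x :: 'a))"
  by (rule Km_continuous[OF ab _ m1(2) inv]) auto
  then have "continuous_on {0<..} (%s. Km al be (%sg. sg powr (- al)) s x)"
  proof -
  assume c: "continuous_on ({0<..} \<times> (- {0})) (%(t, x). Km al be (%sg. sg powr (- al)) t (x :: 'a))"
  have "continuous_on {0<..} (%s. case (s, x) of (t, x) => Km al be (%sg. sg powr (- al)) t (x :: 'a))"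
  proof (rule continuous_on_compose2[OF c])
  show "continuous_on {0<..} (%s. (s, x))" by (intro continuous_intros)
  qed (use x in auto)
  then show ?thesis by simp
  qed
  then show ?thesis unfolding g_def vp2_def by (intro continuous_intros) auto
  qed
  show "set_integrable lborel {0<..<ta} g" for ta
  proof (cases "0 < ta")
  case True
  show ?thesis unfolding g_def
  by (rule TK_integrand[OF ab _ m1(2) inv ph(2,4) phi2[OF True] x]) auto
  next
  case False
  then have "{0<..<ta} = {}" by auto
  then show ?thesis by (simp add: set_integrable_def)
  qed
 qed
 then have "((%ta. LINT s:{0<..<ta}|lebesgue. Z s x / (ta - s) powr (1 - al)) has_real_derivative g t) (at t)"
  by (rule has_field_derivative_transform_within_open[of _ _ _ "{0<..}"]) (use t eq in auto)
 then have "deriv (%ta. LINT s:{0<..<ta}|lebesgue. Z s x / (ta - s) powr (1 - al)) t = g t" by (rule DERIV_imp_deriv)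
 then show ?thesis using G by (simp add: Y_kernel_def g_def vp2_def)
qed

end

section \<open>Smoothing by heat kernels and polynomial weights\<close>

definition conv :: "('a::euclidean_space => ennreal) => ('a => ennreal) => 'a => ennreal" where
 "conv k f x = (NN y. k (x - y) * f y)"

lemma conv_measurable [measurable (raw)]:
 assumes [measurable]: "(%(z, x). k z x) \<in> borel_measurable (M \<Otimes>\<^sub>M borel)" "(%(z, x). f z x) \<in> borel_measurable (M \<Otimes>\<^sub>M borel)" "g \<in> M \<rightarrow>\<^sub>M borel"
 shows "(%z. conv (k z) (f z) (g z :: 'a::euclidean_space)) \<in> borel_measurable M"
 unfolding conv_def by measurable

lemma gauss_density_prob:
 fixes x :: "'a::euclidean_space" assumes s: "0 < s"
 shows "prob_space (density lborel (%y. EN (gauss s (x - y))))"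
proof (rule prob_spaceI)
 have "(NN y. EN (gauss s (x - y))) = 1"
  using nn_integral_lborel_reflect[of "%y. EN (gauss s y)" x] nn_integral_gauss[OF s, where 'a='a] by simp
 then show "emeasure (density lborel (%y. EN (gauss s (x - y)))) (space (density lborel (%y. EN (gauss s (x - y))))) = 1"
  by (simp add: emeasure_density cong: nn_integral_cong)
qed

lemma gauss_le: "0 < s ==> gauss s (x::'a::euclidean_space) <= (4 * pi * s) powr (- (real DIM('a) / 2))"
 unfolding gauss_def by (rule mult_left_le) auto

lemma conv_gauss_jensen:
 fixes f :: "'a::euclidean_space => ennreal"
 assumes s: "0 < s" and [measurable]: "f \<in> Bm" and c: "1 <= c"
 shows "epow (conv (%x. EN (gauss s x)) f x) c <= (NN y. EN (gauss s (x - y)) * epow (f y) c)"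
proof -
 let ?P = "density lborel (%y. EN (gauss s (x - y)))"
 have "epow (\<integral>\<^sup>+y. f y \<partial>?P) c <= (\<integral>\<^sup>+y. epow (f y) c \<partial>?P)"
  by (rule jensen_epow[OF gauss_density_prob[OF s]]) (use c in auto)
 then show ?thesis by (simp add: nn_integral_density conv_def)
qed

lemma Nm_gauss_conv_same:
 fixes f :: "'a::euclidean_space => ennreal"
 assumes s: "0 < s" and [measurable]: "f \<in> Bm" and i: "0 <= i" "i <= 1"
 shows "Nm i (conv (%x. EN (gauss s x)) f) <= Nm i f"
proof (cases "i = 0")
 case True
 show ?thesis unfolding True
 proof (rule Nm0_le, rule AE_I2)
  fix x :: 'a
  have "conv (%x. EN (gauss s x)) f x <= (NN y. EN (gauss s (x - y)) * Nm 0 f)"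
  unfolding conv_def using AE_le_Nm0[of f] by (intro nn_integral_mono_AE) (auto elim!: eventually_mono intro!: mult_left_mono)
  also have "... = Nm 0 f"
  using nn_integral_lborel_reflect[of "%y. EN (gauss s y)" x] nn_integral_gauss[OF s, where 'a='a] by (simp add: nn_integral_multc)
  finally show "conv (%x. EN (gauss s x)) f x <= Nm 0 f" .
 qed
next
 case False
 then have i0: "0 < i" using i by simp
 have c: "1 <= 1 / i" using i0 i by simp
 have "(NN x. epow (conv (%x. EN (gauss s x)) f x) (1/i)) <= (NN x. (NN y. EN (gauss s (x - y)) * epow (f y) (1/i)))"
  by (intro nn_integral_mono conv_gauss_jensen s c) auto
 also have "... = (NN y. (NN x. EN (gauss s (x - y)) * epow (f y) (1/i)))"
  by (rule lborel_pair.Fubini') measurable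
 also have "... = (NN y. epow (f y) (1/i))"
 proof (rule nn_integral_cong)
  fix y :: 'a
  have "(NN x. EN (gauss s (x - y))) = 1"
  using nn_integral_lborel_shift[of "%y. EN (gauss s y)" y] nn_integral_gauss[OF s, where 'a='a] by simp
  then show "(NN x. EN (gauss s (x - y)) * epow (f y) (1/i)) = epow (f y) (1/i)"
  by (simp add: nn_integral_multc)
 qed
 finally show ?thesis using i0 by (auto simp: Nm_def intro!: epow_mono)
qed

lemma conv_gauss_le:
 fixes f :: "'a::euclidean_space => ennreal"
 assumes s: "0 < s" and [measurable]: "f \<in> Bm" and i: "0 < i" "i <= 1"
 shows "conv (%x. EN (gauss s x)) f x <= EN ((4 * pi * s) powr (- (real DIM('a) / 2 * i))) * Nm i f"
proof -
 have c: "1 <= 1 / i" using i by simp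
 have "epow (conv (%x. EN (gauss s x)) f x) (1/i) <= (NN y. EN (gauss s (x - y)) * epow (f y) (1/i))"
  by (rule conv_gauss_jensen[OF s _ c]) auto
 also have "... <= (NN y. EN ((4 * pi * s) powr (- (real DIM('a) / 2))) * epow (f y) (1/i))"
  by (intro nn_integral_mono mult_right_mono ennreal_leI gauss_le s) auto
 also have "... = EN ((4 * pi * s) powr (- (real DIM('a) / 2))) * (NN y. epow (f y) (1/i))"
  by (rule nn_integral_cmult) measurable
 finally have "epow (epow (conv (%x. EN (gauss s x)) f x) (1/i)) i <= epow (EN ((4 * pi * s) powr (- (real DIM('a) / 2))) * (NN y. epow (f y) (1/i))) i"
  using i by (intro epow_mono) auto
 then show ?thesis using i by (simp add: epow_inverse' epow_mult Nm_def epow_ennreal powr_powr)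
qed

text \<open>Jensen's inequality covers equal indices, Hoelder's the bounded target; the general case interpolates between
the two.\<close>

lemma Nm_gauss_conv:
 fixes f :: "'a::euclidean_space => ennreal"
 assumes s: "0 < s" and fm[measurable]: "f \<in> Bm" and i: "0 <= ib" "ib <= ic" "ic <= 1"
 shows "Nm ib (conv (%x. EN (gauss s x)) f) <= EN ((4 * pi * s) powr (- (real DIM('a) / 2 * (ic - ib)))) * Nm ic f"
proof -
 define h where "h = conv (%x. EN (gauss s x)) f"
 have hm[measurable]: "h \<in> Bm" unfolding h_def by measurable
 consider "ib = ic" | "ib = 0" "0 < ic" | "0 < ib" "ib < ic" using i by linarith
 then show ?thesis
 proof cases
  case 1
  then show ?thesis using Nm_gauss_conv_same[OF s fm, of ic] i s by simp
 next
  case 2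
  then show ?thesis using conv_gauss_le[OF s fm, of ic] i by (auto intro!: Nm0_le)
 next
  case 3
  define b where "b = 1 / ib"
  define c where "c = 1 / ic"
  have bc: "0 < c" "c < b" "ib = 1 / b" "ic = 1 / c" "0 < b" using 3 i by (auto simp: b_def c_def field_simps)
  define M where "M = EN ((4 * pi * s) powr (- (real DIM('a) / 2 * ic))) * Nm ic f"
  have hM: "h x <= M" for x unfolding h_def M_def using 3 i by (intro conv_gauss_le[OF s fm]) auto
  have "(NN x. epow (h x) b) <= (NN x. epow M (b - c) * epow (h x) c)"
  proof (rule nn_integral_mono)
  fix x
  have "epow (h x) b = epow (h x) (b - c) * epow (h x) c" using bc epow_add[of "b - c" c "h x"] by simp
  also have "... <= epow M (b - c) * epow (h x) c" using bc hM by (intro mult_right_mono epow_mono) auto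
  finally show "epow (h x) b <= epow M (b - c) * epow (h x) c" .
  qed
  also have "... = epow M (b - c) * (NN x. epow (h x) c)" by (rule nn_integral_cmult) measurable
  also have "(NN x. epow (h x) c) = epow (Nm ic h) c"
  using bc by (simp add: Nm_def epow_inverse')
  also have "epow (Nm ic h) c <= epow (Nm ic f) c"
  unfolding h_def using i bc by (intro epow_mono Nm_gauss_conv_same s fm) auto
  finally have le: "(NN x. epow (h x) b) <= epow M (b - c) * epow (Nm ic f) c"
  by (simp add: mult_left_mono)
  have "Nm ib h = epow (NN x. epow (h x) b) ib" using 3 by (simp add: Nm_def b_def)
  also have "... <= epow (epow M (b - c) * epow (Nm ic f) c) ib" using 3 by (intro epow_mono le) auto
  also have "... = epow M ((b - c) * ib) * epow (Nm ic f) (c * ib)"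
  using bc 3 by (simp add: epow_mult epow_epow)
  also have "epow M ((b - c) * ib) = EN ((4 * pi * s) powr (- (real DIM('a) / 2 * (ic - ib)))) * epow (Nm ic f) ((b - c) * ib)"
  proof -
  have e: "(- (real DIM('a) / 2 * ic)) * ((b - c) * ib) = - (real DIM('a) / 2 * (ic - ib))"
  using bc by (simp add: field_simps)
  have "epow (EN ((4 * pi * s) powr (- (real DIM('a) / 2 * ic)))) ((b - c) * ib) = EN ((4 * pi * s) powr (- (real DIM('a) / 2 * (ic - ib))))"
  proof -
  have ne: "(b - c) * ib ~= 0" using bc 3 by simp
  show ?thesis by (subst epow_ennreal[OF powr_ge_zero ne]) (simp only: powr_powr e)
  qed
  then show ?thesis unfolding M_def using bc 3 by (subst epow_mult) auto
  qed
  also have "EN ((4 * pi * s) powr (- (real DIM('a) / 2 * (ic - ib)))) * epow (Nm ic f) ((b - c) * ib) * epow (Nm ic f) (c * ib)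
  = EN ((4 * pi * s) powr (- (real DIM('a) / 2 * (ic - ib)))) * epow (Nm ic f) ((b - c) * ib + c * ib)"
  using bc 3 by (subst epow_add) (auto simp: mult.assoc)
  also have "(b - c) * ib + c * ib = 1" using bc by (simp add: field_simps)
  finally show ?thesis by (simp add: h_def)
 qed
qed

text \<open>A polynomial weight that tends to 1 as \<open>e\<close> tends to 0. The decay exponent \<open>2k\<close> stays below \<open>2\<beta>\<close>, so that
the kernels, whose tails are of order \<open>|x|^(-N-2\<beta>)\<close>, preserve the weighted spaces uniformly in \<open>e\<close>.\<close>

definition om :: "real => real => 'a::euclidean_space => real" where
 "om e k x = (1 + e\<^sup>2 * (norm x)\<^sup>2) powr (- k)"

lemma om_pos: "0 < om e k x"
proof -
 have "0 < 1 + e\<^sup>2 * (norm x)\<^sup>2" by (intro add_pos_nonneg) auto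
 then show ?thesis unfolding om_def powr_gt_zero by (rule less_imp_neq[symmetric])
qed

lemma om_le_1: "0 <= k ==> om e k x <= 1"
proof -
 assume k: "0 <= k"
 have "om e k x <= 1 powr (- k)" unfolding om_def using k by (intro powr_mono2') auto
 then show ?thesis by simp
qed
lemma om_measurable [measurable]: "om e k \<in> Bm" unfolding om_def[abs_def] by measurable

text \<open>Peetre's inequality, uniform in \<open>e\<close>.\<close>

lemma om_peetre:
 fixes x y :: "'a::euclidean_space" assumes e: "0 <= e" "e <= 1" and k: "0 <= k"
 shows "om e k x <= 2 powr k * (1 + (norm (x - y))\<^sup>2) powr k * om e k y"
proof -
 define A where "A = 1 + e\<^sup>2 * (norm x)\<^sup>2"
 define B where "B = 1 + e\<^sup>2 * (norm y)\<^sup>2"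
 define Cc where "Cc = 1 + (norm (x - y))\<^sup>2"
 have pos: "1 <= A" "1 <= B" "1 <= Cc" by (auto simp: A_def B_def Cc_def)
 have "norm y <= norm x + norm (x - y)" using norm_triangle_ineq4[of x "x - y"] by simp
 then have "(norm y)\<^sup>2 <= (norm x + norm (x - y))\<^sup>2" by (intro power_mono) auto
 also have "... <= 2 * (norm x)\<^sup>2 + 2 * (norm (x - y))\<^sup>2"
  using sum_squares_bound[of "norm x" "norm (x - y)"] by (simp add: power2_sum)
 finally have "e\<^sup>2 * (norm y)\<^sup>2 <= e\<^sup>2 * (2 * (norm x)\<^sup>2 + 2 * (norm (x - y))\<^sup>2)" by (intro mult_left_mono) auto
 also have "... <= 2 * (e\<^sup>2 * (norm x)\<^sup>2) + 2 * (norm (x - y))\<^sup>2"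
  using e mult_right_mono[of "e\<^sup>2" 1 "(norm (x - y))\<^sup>2"] by (simp add: algebra_simps power_le_one)
 finally have "B <= 2 * A * Cc"
 proof -
  assume le: "e\<^sup>2 * (norm y)\<^sup>2 <= 2 * (e\<^sup>2 * (norm x)\<^sup>2) + 2 * (norm (x - y))\<^sup>2"
  have "0 <= (e\<^sup>2 * (norm x)\<^sup>2) * (norm (x - y))\<^sup>2" by simp
  moreover have "2 * A * Cc = 2 + 2 * (e\<^sup>2 * (norm x)\<^sup>2) + 2 * (norm (x - y))\<^sup>2 + 2 * ((e\<^sup>2 * (norm x)\<^sup>2) * (norm (x - y))\<^sup>2)"
  by (simp add: A_def Cc_def algebra_simps)
  ultimately show ?thesis using le unfolding B_def by linarith
 qed
 then have "B powr k <= (2 * Cc * A) powr k" using k pos by (intro powr_mono2) (auto simp: ac_simps)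
 also have "... = (2 powr k * Cc powr k) * A powr k" using pos by (simp add: powr_mult)
 finally have BA: "B powr k <= (2 powr k * Cc powr k) * A powr k" .
 have "om e k x = A powr (- k) * (B powr k * B powr (- k))" using pos by (simp add: om_def A_def powr_add[symmetric])
 also have "... <= A powr (- k) * ((2 powr k * Cc powr k) * A powr k * B powr (- k))"
  using BA by (intro mult_left_mono mult_right_mono) auto
 also have "... = (A powr (- k) * A powr k) * (2 powr k * Cc powr k * B powr (- k))" by (simp add: ac_simps)
 also have "... = 2 powr k * Cc powr k * B powr (- k)" using pos by (simp add: powr_add[symmetric])
 finally show ?thesis by (simp add: om_def B_def Cc_def)
qed

lemma one_plus_powr_le:
 fixes a k :: real assumes "0 <= a" "0 <= k" "k <= 1" shows "(1 + a) powr k <= 1 + a powr k"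
proof (cases "a = 0")
 case False
 have "(1 + a) powr k = (1 + a) powr (k - 1) * (1 + a)" using assms powr_add[of "1 + a" "k - 1" 1] by simp
 then have eq: "(1 + a) powr k = (1 + a) powr (k - 1) + (1 + a) powr (k - 1) * a" by (simp add: algebra_simps)
 have 1: "(1 + a) powr (k - 1) <= 1 powr (k - 1)" using assms by (intro powr_mono2') auto
 have 2: "(1 + a) powr (k - 1) * a <= a powr (k - 1) * a" using assms False by (intro mult_right_mono powr_mono2') auto
 have 3: "a powr (k - 1) * a = a powr k" using assms False powr_add[of a "k - 1" 1] by simp
 show ?thesis using eq 1 2 3 by simp
qed simp

text \<open>Doubling the time of the heat kernel leaves a Gaussian factor that absorbs polynomial weights.\<close>

lemma gauss_double: "0 < s ==> gauss s (z::'a::euclidean_space) = 2 powr (real DIM('a) / 2) * exp (- ((norm z)\<^sup>2 / (8 * s))) * gauss (2 * s) z"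
proof -
 assume s: "0 < s"
 have "(4 * pi * s) powr (- (real DIM('a) / 2)) = 2 powr (real DIM('a) / 2) * (4 * pi * (2 * s)) powr (- (real DIM('a) / 2))"
 proof -
  have "(4 * pi * (2 * s)) powr (- (real DIM('a) / 2)) = 2 powr (- (real DIM('a) / 2)) * (4 * pi * s) powr (- (real DIM('a) / 2))"
  using s by (simp add: powr_mult[symmetric] ac_simps)
  then show ?thesis by (simp add: mult.assoc[symmetric] powr_add[symmetric])
 qed
 moreover have "exp (- (norm z)\<^sup>2 / (4 * s)) = exp (- ((norm z)\<^sup>2 / (8 * s))) * exp (- (norm z)\<^sup>2 / (4 * (2 * s)))"
  by (simp add: exp_add[symmetric])
 ultimately show ?thesis by (simp add: gauss_def)
qed

lemma gauss_weight:
 assumes k: "0 <= k" "k <= 1"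
 shows "\<exists>C>0. \<forall>s>0. \<forall>z::'a::euclidean_space. (1 + (norm z)\<^sup>2) powr k * gauss s z <= C * (1 + s powr k) * gauss (2 * s) z"
proof -
 obtain C where C: "0 < C" "!!y. 0 < y ==> y powr k * exp (- y) <= C" using powr_exp_bounded[OF k(1)] by blast
 define C' where "C' = 2 powr (real DIM('a) / 2) * (1 + 8 powr k * C)"
 have "(1 + (norm z)\<^sup>2) powr k * gauss s z <= C' * (1 + s powr k) * gauss (2 * s) z" if s: "0 < s" for s and z :: 'a
 proof -
  define y where "y = (norm z)\<^sup>2 / (8 * s)"
  have y0: "0 <= y" using s by (simp add: y_def)
  have zy: "(norm z)\<^sup>2 = 8 * s * y" using s by (simp add: y_def)
  have "(1 + (norm z)\<^sup>2) powr k * exp (- y) <= (1 + ((norm z)\<^sup>2) powr k) * exp (- y)"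
  using k by (intro mult_right_mono one_plus_powr_le) auto
  also have "... = exp (- y) + 8 powr k * s powr k * (y powr k * exp (- y))"
  unfolding zy using s y0 by (simp add: powr_mult algebra_simps)
  also have "... <= 1 + 8 powr k * s powr k * C"
  proof (intro add_mono mult_left_mono)
  show "y powr k * exp (- y) <= C" using C y0 by (cases "y = 0") auto
  qed (use y0 in auto)
  also have "... <= (1 + 8 powr k * C) * (1 + s powr k)" using C by (simp add: algebra_simps)
  finally have "(1 + (norm z)\<^sup>2) powr k * exp (- y) <= (1 + 8 powr k * C) * (1 + s powr k)" .
  then have "(2 powr (real DIM('a) / 2) * gauss (2 * s) z) * ((1 + (norm z)\<^sup>2) powr k * exp (- y)) <= (2 powr (real DIM('a) / 2) * gauss (2 * s) z) * ((1 + 8 powr k * C) * (1 + s powr k))"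
  by (intro mult_left_mono) auto
  then show ?thesis unfolding gauss_double[OF s, of z] C'_def y_def by (simp add: ac_simps)
 qed
 moreover have "0 < C'" using C by (simp add: C'_def add_pos_pos)
 ultimately show ?thesis by blast
qed

lemma om_conv_gauss:
 assumes k: "0 <= k" "k <= 1"
 shows "\<exists>C>0. \<forall>s>0. \<forall>e f. 0 <= e --> e <= 1 --> f \<in> Bm --> (\<forall>x::'a::euclidean_space.
  EN (om e k x) * conv (%x. EN (gauss s x)) f x <= EN (C * (1 + s powr k)) * conv (%x. EN (gauss (2 * s) x)) (%y. EN (om e k y) * f y) x)"
proof -
 obtain C where C: "0 < C" "!!s z. 0 < s ==> (1 + (norm (z::'a))\<^sup>2) powr k * gauss s z <= C * (1 + s powr k) * gauss (2 * s) z"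
  using gauss_weight[OF k] by blast
 have "EN (om e k x) * conv (%x. EN (gauss s x)) f x <= EN ((2 powr k * C) * (1 + s powr k)) * conv (%x. EN (gauss (2 * s) x)) (%y. EN (om e k y) * f y) x"
  if s: "0 < s" and e: "0 <= e" "e <= 1" and [measurable]: "f \<in> Bm" for s e f and x :: 'a
 proof -
  have "EN (om e k x) * conv (%x. EN (gauss s x)) f x = (NN y. EN (om e k x) * (EN (gauss s (x - y)) * f y))"
  unfolding conv_def by (rule nn_integral_cmult[symmetric]) measurable
  also have "... <= (NN y. EN ((2 powr k * C) * (1 + s powr k)) * (EN (gauss (2 * s) (x - y)) * (EN (om e k y) * f y)))"
  proof (rule nn_integral_mono)
  fix y :: 'a
  have "om e k x * gauss s (x - y) <= (2 powr k * (1 + (norm (x - y))\<^sup>2) powr k * om e k y) * gauss s (x - y)"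
  by (intro mult_right_mono om_peetre e k) auto
  also have "... = 2 powr k * om e k y * ((1 + (norm (x - y))\<^sup>2) powr k * gauss s (x - y))" by (simp add: ac_simps)
  also have "... <= 2 powr k * om e k y * (C * (1 + s powr k) * gauss (2 * s) (x - y))"
  using om_pos[of e k y] by (intro mult_left_mono C s) auto
  finally have le: "om e k x * gauss s (x - y) <= (2 powr k * C) * (1 + s powr k) * gauss (2 * s) (x - y) * om e k y" by (simp add: ac_simps)
  have "EN (om e k x) * (EN (gauss s (x - y)) * f y) = EN (om e k x * gauss s (x - y)) * f y"
  using om_pos[of e k x] by (simp add: ennreal_mult mult.assoc)
  also have "... <= EN ((2 powr k * C) * (1 + s powr k) * gauss (2 * s) (x - y) * om e k y) * f y"
  by (intro mult_right_mono ennreal_leI le) auto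
  also have "... = EN ((2 powr k * C) * (1 + s powr k)) * (EN (gauss (2 * s) (x - y)) * (EN (om e k y) * f y))"
  using C om_pos[of e k y] by (simp add: ennreal_mult mult.assoc)
  finally show "EN (om e k x) * (EN (gauss s (x - y)) * f y) <= ..." .
  qed
  also have "... = EN ((2 powr k * C) * (1 + s powr k)) * conv (%x. EN (gauss (2 * s) x)) (%y. EN (om e k y) * f y) x"
  unfolding conv_def by (rule nn_integral_cmult) measurable
  finally show ?thesis .
 qed
 moreover have "0 < 2 powr k * C" using C by simp
 ultimately show ?thesis by blast
qed

section \<open>Upper and lower bounds for the kernels\<close>

lemma stab_moment_finite:
 assumes b: "0 < b" "b <= 1" and r: "r < b"
 shows "(\<integral>\<^sup>+x. EN (x powr r) \<partial>stab b) < \<infinity>"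
proof -
 interpret S: real_distribution "stab b" by (rule stab_real_distribution[OF b refl])
 consider "r < 0" | "r = 0" | "0 < r" by linarith
 then show ?thesis
 proof cases
  case 1
  then show ?thesis using stab_neg_moment[OF b refl, of "- r"] by simp
 next
  case 2
  have "(\<integral>\<^sup>+x. EN (x powr r) \<partial>stab b) <= (\<integral>\<^sup>+x. 1 \<partial>stab b)"
  using 2 by (intro nn_integral_mono) (auto simp: powr_def)
  also have "... < \<infinity>" using S.emeasure_space_1 by simp
  finally show ?thesis .
 next
  case 3
  then show ?thesis using stab_pos_moment[OF b refl _ r] by simp
 qed
qed

definition Zn :: "real => real => real => 'a::euclidean_space => ennreal" where
 "Zn al be t x = EN (Km al be (%_. 1) t x)"

definition Yn :: "real => real => real => 'a::euclidean_space => ennreal" where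
 "Yn al be t x = EN (al * t powr (al - 1)) * EN (Km al be (%sg. sg powr (- al)) t x)"

text \<open>As \<open>exp (-r) \<ge> exp (-1/2) exp (-r^2/2)\<close>, the exponential weight can be replaced by a Gaussian one.\<close>

lemma gauss_exp_lower:
 assumes s: "0 < s" and R: "0 < R"
 shows "EN (exp (-1/2) * (1 + 2 * s / R\<^sup>2) powr (- (real DIM('a) / 2))) <= (NN z. EN (gauss s (z::'a::euclidean_space)) * EN (exp (- norm z / R)))"
proof -
 define u where "u = 1 + 2 * s / R\<^sup>2"
 have u: "0 < u" "1 <= u" using s R by (auto simp: u_def add_pos_nonneg)
 define s' where "s' = s / u"
 have s': "0 < s'" using s u by (simp add: s'_def)
 have eq: "gauss s z * exp (- (norm z)\<^sup>2 / (2 * R\<^sup>2)) = u powr (- (real DIM('a) / 2)) * gauss s' z" for z :: 'a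
 proof -
  have "(4 * pi * s) powr (- (real DIM('a) / 2)) = u powr (- (real DIM('a) / 2)) * (4 * pi * s') powr (- (real DIM('a) / 2))"
  using s u s' by (simp add: powr_mult[symmetric] s'_def)
  moreover have "- (norm z)\<^sup>2 / (4 * s) + - (norm z)\<^sup>2 / (2 * R\<^sup>2) = - (norm z)\<^sup>2 / (4 * s')"
  using s R u by (simp add: s'_def u_def field_simps)
  ultimately show ?thesis by (simp add: gauss_def exp_add[symmetric])
 qed
 have le: "exp (-1/2) * (gauss s z * exp (- (norm z)\<^sup>2 / (2 * R\<^sup>2))) <= gauss s z * exp (- norm z / R)" for z :: 'a
 proof -
  have "2 * (norm z / R) <= 1 + (norm z / R)\<^sup>2" using sum_squares_bound[of 1 "norm z / R"] by simp
  then have "-1/2 + - (norm z)\<^sup>2 / (2 * R\<^sup>2) <= - norm z / R" by (simp add: power_divide)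
  then have "exp (-1/2) * exp (- (norm z)\<^sup>2 / (2 * R\<^sup>2)) <= exp (- norm z / R)" by (simp only: exp_add[symmetric] exp_le_cancel_iff)
  then have "gauss s z * (exp (-1/2) * exp (- (norm z)\<^sup>2 / (2 * R\<^sup>2))) <= gauss s z * exp (- norm z / R)"
  by (rule mult_left_mono) simp
  then show ?thesis by (simp add: ac_simps)
 qed
 have "EN (exp (-1/2) * u powr (- (real DIM('a) / 2))) = (NN z. EN (exp (-1/2) * u powr (- (real DIM('a) / 2))) * EN (gauss s' (z::'a)))"
  by (subst nn_integral_cmult) (auto simp: nn_integral_gauss[OF s'])
 also have "... <= (NN z. EN (gauss s (z::'a)) * EN (exp (- norm z / R)))"
 proof (rule nn_integral_mono)
  fix z :: 'a
  have "EN (exp (-1/2) * u powr (- (real DIM('a) / 2))) * EN (gauss s' z) = EN (exp (-1/2) * (gauss s z * exp (- (norm z)\<^sup>2 / (2 * R\<^sup>2))))"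
  unfolding eq by (simp add: ennreal_mult mult.assoc)
  also have "... <= EN (gauss s z * exp (- norm z / R))" by (intro ennreal_leI le)
  finally show "EN (exp (-1/2) * u powr (- (real DIM('a) / 2))) * EN (gauss s' z) <= EN (gauss s z) * EN (exp (- norm z / R))"
  by (simp add: ennreal_mult)
 qed
 finally show ?thesis by (simp add: u_def)
qed

context
 fixes al be :: real
 assumes ab: "0 < al" "al < 1" "0 < be" "be <= 1"
begin

interpretation A: real_distribution "stab al" by (rule stab_real_distribution) (use ab in auto)
interpretation B: real_distribution "stab be" by (rule stab_real_distribution) (use ab in auto)
interpretation P: pair_prob_space "stab al" "stab be" ..

declare fst_mix_measurable[OF ab, measurable (raw)] snd_mix_measurable[OF ab, measurable (raw)] rho_measurable[OF ab, measurable (raw)]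

lemma rho_scale: "0 < t ==> 0 < fst wo ==> rho al be t wo = t powr (al / be) * rho al be 1 wo"
 by (simp add: rho_def powr_divide)

text \<open>By independence the moment factorises. The conditions keep the order of the positive moments of the two stable variables
below \<open>\<alpha>\<close> and \<open>\<beta>\<close>.\<close>

lemma rho_moment:
 assumes q: "q - al * r / be < al" and r: "r < be"
 shows "\<exists>C\<ge>0. \<forall>t>0. (\<integral>\<^sup>+wo. EN (fst wo powr q * rho al be t wo powr r) \<partial>(mix al be)) = EN (C * t powr (al * r / be))"
proof -
 define m1 where "m1 = (\<integral>\<^sup>+sg. EN (sg powr (q - al * r / be)) \<partial>stab al)"
 define m2 where "m2 = (\<integral>\<^sup>+S. EN (S powr r) \<partial>stab be)"
 have fin: "m1 < \<infinity>" "m2 < \<infinity>" unfolding m1_def m2_def using stab_moment_finite[OF ab(1) _ q] stab_moment_finite[OF ab(3,4) r] ab by simp_all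
 have "(\<integral>\<^sup>+wo. EN (fst wo powr q * rho al be t wo powr r) \<partial>(mix al be)) = EN (enn2real m1 * enn2real m2 * t powr (al * r / be))" if t: "0 < t" for t
 proof -
  have "(\<integral>\<^sup>+wo. EN (fst wo powr q * rho al be t wo powr r) \<partial>(mix al be))
  = (\<integral>\<^sup>+wo. EN (t powr (al * r / be)) * (EN (fst wo powr (q - al * r / be)) * EN (snd wo powr r)) \<partial>(mix al be))"
  proof (rule nn_integral_cong_AE)
  show "AE wo in mix al be. EN (fst wo powr q * rho al be t wo powr r) = EN (t powr (al * r / be)) * (EN (fst wo powr (q - al * r / be)) * EN (snd wo powr r))"
  using AE_mix_pos[OF ab]
  proof eventually_elim
  case (elim wo)
  have "rho al be t wo powr r = (t / fst wo) powr (al * r / be) * snd wo powr r"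
  using elim t by (simp add: rho_def powr_mult powr_powr)
  also have "(t / fst wo) powr (al * r / be) = t powr (al * r / be) * fst wo powr (- (al * r / be))"
  using elim t by (simp add: powr_divide powr_minus_divide)
  finally have "fst wo powr q * rho al be t wo powr r = t powr (al * r / be) * ((fst wo powr q * fst wo powr (- (al * r / be))) * snd wo powr r)"
  by simp
  also have "fst wo powr q * fst wo powr (- (al * r / be)) = fst wo powr (q - al * r / be)"
  by (simp add: powr_add[symmetric])
  finally show ?case by (simp add: ennreal_mult)
  qed
  qed
  also have "... = EN (t powr (al * r / be)) * (\<integral>\<^sup>+wo. (EN (fst wo powr (q - al * r / be)) * EN (snd wo powr r)) \<partial>(mix al be))"
  by (rule nn_integral_cmult) measurable
  also have "(\<integral>\<^sup>+wo. (EN (fst wo powr (q - al * r / be)) * EN (snd wo powr r)) \<partial>(mix al be)) = (\<integral>\<^sup>+sg. \<integral>\<^sup>+S. EN (sg powr (q - al * r / be)) * EN (S powr r) \<partial>stab be \<partial>stab al)"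
  proof -
  have "(%wo. EN (fst wo powr (q - al * r / be)) * EN (snd wo powr r)) \<in> borel_measurable (mix al be)"
  by measurable
  from B.nn_integral_fst[OF this] show ?thesis by simp
  qed
  also have "... = m1 * m2"
  proof -
  have [measurable]: "(%S. EN (S powr r)) \<in> borel_measurable (stab be)" "(%sg. EN (sg powr (q - al * r / be))) \<in> borel_measurable (stab al)"
  unfolding measurable_cong_sets[OF A.events_eq_borel refl] measurable_cong_sets[OF B.events_eq_borel refl] by measurable
  show ?thesis by (simp add: nn_integral_cmult nn_integral_multc m1_def m2_def)
  qed
  finally show ?thesis using fin by (cases m1; cases m2) (auto simp: ennreal_mult ac_simps)
 qed
 then show ?thesis by (intro exI[of _ "enn2real m1 * enn2real m2"]) auto
qed

context
 fixes w :: "real => real"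
 assumes w0: "!!sg. 0 <= w sg" and wm [measurable]: "w \<in> Bm" and wi: "integrable (stab al) w"
begin

lemma Km_diff_measurable [measurable (raw)]:
 assumes [measurable]: "f \<in> borel_measurable M" "g \<in> borel_measurable M"
 shows "(%z. Km al be w (f z) (g z :: 'a::euclidean_space)) \<in> borel_measurable M"
 by (rule Km_measurable'[OF ab w0 wm wi assms])

lemma conv_Km:
 fixes f :: "'a::euclidean_space => ennreal"
 assumes t: "0 < t" and [measurable]: "f \<in> Bm"
 shows "conv (%x. EN (Km al be w t x)) f x = (\<integral>\<^sup>+wo. EN (w (fst wo)) * conv (%x. EN (gauss (rho al be t wo) x)) f x \<partial>(mix al be))"
proof -
 interpret Q: pair_sigma_finite "mix al be" "lborel :: 'a measure" ..
 have "conv (%x. EN (Km al be w t x)) f x = (NN y. \<integral>\<^sup>+wo. EN (w (fst wo) * gauss (rho al be t wo) (x - y)) * f y \<partial>(mix al be))"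
  unfolding conv_def
 proof (rule nn_integral_cong_AE)
  have "AEl y. y ~= x" by (rule AE_lborel_singleton)
  then show "AEl y. EN (Km al be w t (x - y)) * f y = (\<integral>\<^sup>+wo. EN (w (fst wo) * gauss (rho al be t wo) (x - y)) * f y \<partial>(mix al be))"
  proof eventually_elim
  case (elim y)
  have "(\<integral>\<^sup>+wo. EN (w (fst wo) * gauss (rho al be t wo) (x - y)) * f y \<partial>(mix al be)) = (\<integral>\<^sup>+wo. EN (w (fst wo) * gauss (rho al be t wo) (x - y)) \<partial>(mix al be)) * f y"
  by (rule nn_integral_multc) measurable
  then show ?case using nn_Km[OF ab w0 wm wi t, of "x - y"] elim by simp
  qed
 qed
 also have "... = (\<integral>\<^sup>+wo. (NN y. EN (w (fst wo) * gauss (rho al be t wo) (x - y)) * f y) \<partial>(mix al be))"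
  by (rule Q.Fubini') measurable
 also have "... = (\<integral>\<^sup>+wo. EN (w (fst wo)) * conv (%x. EN (gauss (rho al be t wo) x)) f x \<partial>(mix al be))"
 proof (rule nn_integral_cong)
  fix wo
  have "(NN y. EN (w (fst wo) * gauss (rho al be t wo) (x - y)) * f y) = (NN y. EN (w (fst wo)) * (EN (gauss (rho al be t wo) (x - y)) * f y))"
  using w0 by (simp add: ennreal_mult mult.assoc)
  also have "... = EN (w (fst wo)) * conv (%x. EN (gauss (rho al be t wo) x)) f x"
  unfolding conv_def by (rule nn_integral_cmult) measurable
  finally show "(NN y. EN (w (fst wo) * gauss (rho al be t wo) (x - y)) * f y) = ..." .
 qed
 finally show ?thesis .
qed

text \<open>Minkowski's inequality over the mixing law reduces the estimate to Gaussians.\<close>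

lemma Nm_om_conv_Km:
 assumes i: "0 <= ib" "ib <= ic" "ic <= 1" and k: "0 <= k" "k < be"
 defines "E \<equiv> real DIM('a) / 2 * (ic - ib)"
 shows "\<exists>C>0. \<forall>t>0. \<forall>e f. 0 <= e --> e <= 1 --> f \<in> Bm -->
  Nm ib (%x::'a::euclidean_space. EN (om e k x) * conv (%x. EN (Km al be w t x)) f x)
  <= (\<integral>\<^sup>+wo. EN (C * (w (fst wo) * rho al be t wo powr (- E) + w (fst wo) * rho al be t wo powr (k - E))) \<partial>(mix al be)) * Nm ic (%x. EN (om e k x) * f x)"
proof -
 obtain C where C: "0 < C" "!!s e f x. 0 < s ==> 0 <= e ==> e <= 1 ==> f \<in> Bm ==>
  EN (om e k (x::'a)) * conv (%x. EN (gauss s x)) f x <= EN (C * (1 + s powr k)) * conv (%x. EN (gauss (2 * s) x)) (%y. EN (om e k y) * f y) x"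
  using om_conv_gauss[of k, where 'a='a] k ab by (auto simp: less_imp_le)
 define C' where "C' = C * (8 * pi) powr (- E)"
 have "Nm ib (%x::'a. EN (om e k x) * conv (%x. EN (Km al be w t x)) f x)
  <= (\<integral>\<^sup>+wo. EN (C' * (w (fst wo) * rho al be t wo powr (- E) + w (fst wo) * rho al be t wo powr (k - E))) \<partial>(mix al be)) * Nm ic (%x. EN (om e k x) * f x)"
  if t: "0 < t" and e: "0 <= e" "e <= 1" and fm[measurable]: "f \<in> Bm" for t e and f :: "'a => ennreal"
 proof -
  define g where "g = (%x. EN (om e k x) * f x)"
  have gm[measurable]: "g \<in> Bm" unfolding g_def by measurable
  define n where "n wo = EN (C' * (w (fst wo) * rho al be t wo powr (- E) + w (fst wo) * rho al be t wo powr (k - E))) * Nm ic g" for wo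
  define F where "F wo x = EN (om e k x) * (EN (w (fst wo)) * conv (%x. EN (gauss (rho al be t wo) x)) f x)" for wo and x :: 'a
  have Fm[measurable]: "(%(wo, x). F wo x) \<in> borel_measurable ((mix al be) \<Otimes>\<^sub>M borel)"
  unfolding F_def conv_def by measurable
  have eq: "EN (om e k x) * conv (%x. EN (Km al be w t x)) f x = (\<integral>\<^sup>+wo. F wo x \<partial>(mix al be))" for x
  proof -
  have "(%wo. EN (w (fst wo)) * conv (%x. EN (gauss (rho al be t wo) x)) f x) \<in> borel_measurable (mix al be)"
  unfolding conv_def by measurable
  then show ?thesis unfolding conv_Km[OF t fm] F_def by (rule nn_integral_cmult[symmetric])
  qed
  have "Nm ib (%x. \<integral>\<^sup>+wo. F wo x \<partial>(mix al be)) <= (\<integral>\<^sup>+wo. n wo \<partial>(mix al be))"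
  proof (rule minkowski_integral[OF _ Fm])
  show "sigma_finite_measure (mix al be)" by unfold_locales
  show "n \<in> borel_measurable (mix al be)" unfolding n_def by measurable
  show "AE wo in mix al be. Nm ib (F wo) <= n wo"
  using AE_rho_pos[OF ab t]
  proof eventually_elim
  case (elim wo)
  define r where "r = rho al be t wo"
  have r: "0 < r" using elim by (simp add: r_def)
  have c0: "0 <= w (fst wo) * (C * (1 + r powr k))" using w0 C by simp
  have "Nm ib (F wo) <= Nm ib (%x. EN (w (fst wo) * (C * (1 + r powr k))) * conv (%x. EN (gauss (2 * r) x)) g x)"
  proof (rule Nm_mono[OF _ i(1)])
  fix x
  have "F wo x = EN (w (fst wo)) * (EN (om e k x) * conv (%x. EN (gauss r x)) f x)" by (simp add: F_def r_def ac_simps)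
  also have "... <= EN (w (fst wo)) * (EN (C * (1 + r powr k)) * conv (%x. EN (gauss (2 * r) x)) g x)"
  unfolding g_def by (intro mult_left_mono C r e fm) auto
  finally show "F wo x <= EN (w (fst wo) * (C * (1 + r powr k))) * conv (%x. EN (gauss (2 * r) x)) g x"
  using w0 C by (simp add: ennreal_mult mult.assoc)
  qed
  also have "... <= EN (w (fst wo) * (C * (1 + r powr k))) * Nm ib (conv (%x. EN (gauss (2 * r) x)) g)"
  by (rule Nm_cmult) (use i in measurable)
  also have "... <= EN (w (fst wo) * (C * (1 + r powr k))) * (EN ((4 * pi * (2 * r)) powr (- (real DIM('a) / 2 * (ic - ib)))) * Nm ic g)"
  using r by (intro mult_left_mono Nm_gauss_conv gm i) auto
  also have "... = n wo"
  proof -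
  have "(4 * pi * (2 * r)) powr (- E) = (8 * pi) powr (- E) * r powr (- E)" using r by (simp add: powr_mult[symmetric] ac_simps)
  moreover have "r powr k * r powr (- E) = r powr (k - E)" by (simp add: powr_add[symmetric])
  ultimately have "w (fst wo) * (C * (1 + r powr k)) * (4 * pi * (2 * r)) powr (- E) = C' * (w (fst wo) * r powr (- E) + w (fst wo) * r powr (k - E))"
  by (simp add: C'_def algebra_simps)
  then show ?thesis unfolding n_def r_def[symmetric] E_def[symmetric] using c0 by (simp add: emult mult.assoc[symmetric])
  qed
  finally show ?case .
  qed
  qed (use i in auto)
  also have "(\<integral>\<^sup>+wo. n wo \<partial>(mix al be)) = (\<integral>\<^sup>+wo. EN (C' * (w (fst wo) * rho al be t wo powr (- E) + w (fst wo) * rho al be t wo powr (k - E))) \<partial>(mix al be)) * Nm ic g"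
  unfolding n_def by (rule nn_integral_multc) measurable
  finally show ?thesis unfolding eq by (simp add: g_def)
 qed
 moreover have "0 < C'" using C by (simp add: C'_def)
 ultimately show ?thesis by blast
qed

lemma conv_Km_lower:
 assumes wpos: "AE sg in stab al. 0 < w sg"
 shows "\<exists>c>0. \<forall>t>0. \<forall>R>0. t powr (al / be) <= R\<^sup>2 --> (\<forall>a vp. vp \<in> Bm -->
  (\<forall>x y. a * EN (exp (- norm (x - y) / R)) * vp x <= vp y) -->
  (\<forall>x::'a::euclidean_space. EN c * a * vp x <= conv (%x. EN (Km al be w t x)) vp x))"
proof -
 interpret Q: pair_sigma_finite "mix al be" "lborel :: 'a measure" ..
 define I where "I = (\<integral>\<^sup>+wo. EN (w (fst wo) * (exp (-1/2) * (1 + 2 * rho al be 1 wo) powr (- (real DIM('a) / 2)))) \<partial>(mix al be))"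
 have wpos': "AE wo in mix al be. 0 < w (fst wo)"
 proof (rule P.AE_pair_measure)
  show "AE x in stab al. AE y in stab be. 0 < w (fst (x, y))" using wpos by (auto elim!: eventually_mono)
  have [measurable]: "(%wo. w (fst wo)) \<in> borel_measurable (mix al be)"
  using measurable_compose[OF fst_mix_measurable[OF ab measurable_ident] wm] by simp
  show "{x \<in> space (mix al be). 0 < w (fst x)} \<in> sets (mix al be)" by measurable
 qed
 have "I ~= 0"
 proof
  assume "I = 0"
  then have "AE wo in mix al be. EN (w (fst wo) * (exp (-1/2) * (1 + 2 * rho al be 1 wo) powr (- (real DIM('a) / 2)))) = 0"
  proof -
  have "(%wo. EN (w (fst wo) * (exp (-1/2) * (1 + 2 * rho al be 1 wo) powr (- (real DIM('a) / 2))))) \<in> borel_measurable (mix al be)"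
  by measurable
  from nn_integral_0_iff_AE[OF this] show ?thesis using \<open>I = 0\<close> by (simp add: I_def)
  qed
  with wpos' AE_rho_pos[OF ab zero_less_one] have "AE wo in mix al be. False"
  proof eventually_elim
  case (elim wo)
  have "0 < w (fst wo) * (exp (-1/2) * (1 + 2 * rho al be 1 wo) powr (- (real DIM('a) / 2)))"
  using elim(1,2) by (intro mult_pos_pos) auto
  then show ?case using elim(3) unfolding ennreal_eq_0_iff by linarith
  qed
  then show False by (simp add: P.AE_False)
 qed
 then obtain c where c: "0 < c" "EN c <= I"
 proof (cases I)
  case (real r)
  then show ?thesis using that[of r] \<open>I ~= 0\<close> by auto
 next
  case top
  then show ?thesis using that[of 1] by auto
 qed
 have "EN c * a * vp x <= conv (%x. EN (Km al be w t x)) vp x"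
  if t: "0 < t" and R: "0 < R" and tR: "t powr (al / be) <= R\<^sup>2" and pm[measurable]: "vp \<in> Bm"
  and ph: "!!x y. a * EN (exp (- norm (x - y) / R)) * vp x <= vp y" for t R a vp and x :: 'a
 proof -
  have "I <= (\<integral>\<^sup>+wo. EN (w (fst wo)) * (NN y. EN (gauss (rho al be t wo) (x - y)) * EN (exp (- norm (x - y) / R))) \<partial>(mix al be))"
  unfolding I_def
  proof (rule nn_integral_mono_AE)
  show "AE wo in mix al be. EN (w (fst wo) * (exp (-1/2) * (1 + 2 * rho al be 1 wo) powr (- (real DIM('a) / 2)))) <= EN (w (fst wo)) * (NN y. EN (gauss (rho al be t wo) (x - y)) * EN (exp (- norm (x - y) / R)))"
  using AE_mix_pos[OF ab] AE_rho_pos[OF ab t] AE_rho_pos[OF ab zero_less_one]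
  proof eventually_elim
  case (elim wo)
  have "rho al be t wo <= R\<^sup>2 * rho al be 1 wo" using elim tR by (subst rho_scale[OF t]) (auto intro: mult_right_mono)
  then have "rho al be t wo / R\<^sup>2 <= rho al be 1 wo" using R by (simp add: field_simps)
  then have "(1 + 2 * rho al be 1 wo) powr (- (real DIM('a) / 2)) <= (1 + 2 * rho al be t wo / R\<^sup>2) powr (- (real DIM('a) / 2))"
  using elim R by (intro powr_mono2') (auto intro: add_pos_nonneg)
  then have "EN (exp (-1/2) * (1 + 2 * rho al be 1 wo) powr (- (real DIM('a) / 2))) <= EN (exp (-1/2) * (1 + 2 * rho al be t wo / R\<^sup>2) powr (- (real DIM('a) / 2)))"
  by (intro ennreal_leI mult_left_mono) auto
  also have "... <= (NN z. EN (gauss (rho al be t wo) (z::'a)) * EN (exp (- norm z / R)))"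
  by (rule gauss_exp_lower[OF elim(2) R])
  also have "... = (NN y. EN (gauss (rho al be t wo) (x - y)) * EN (exp (- norm (x - y) / R)))"
  by (rule nn_integral_lborel_reflect[symmetric]) measurable
  finally show ?case using w0 by (simp add: ennreal_mult mult_left_mono)
  qed
  qed
  then have "EN c <= (\<integral>\<^sup>+wo. EN (w (fst wo)) * (NN y. EN (gauss (rho al be t wo) (x - y)) * EN (exp (- norm (x - y) / R))) \<partial>(mix al be))"
  using c by simp
  also have "... = (\<integral>\<^sup>+wo. EN (w (fst wo)) * conv (%x. EN (gauss (rho al be t wo) x)) (%y. EN (exp (- norm (x - y) / R))) x \<partial>(mix al be))"
  by (simp add: conv_def)
  also have "... = conv (%x. EN (Km al be w t x)) (%y. EN (exp (- norm (x - y) / R))) x"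
  by (rule conv_Km[OF t, symmetric]) measurable
  finally have le: "EN c <= conv (%x. EN (Km al be w t x)) (%y. EN (exp (- norm (x - y) / R))) x" .
  have "EN c * a * vp x = (a * vp x) * EN c" by (simp add: ac_simps)
  also have "... <= (a * vp x) * conv (%x. EN (Km al be w t x)) (%y. EN (exp (- norm (x - y) / R))) x"
  by (intro mult_left_mono le) auto
  also have "... = (NN y. (a * vp x) * (EN (Km al be w t (x - y)) * EN (exp (- norm (x - y) / R))))"
  unfolding conv_def by (rule nn_integral_cmult[symmetric]) measurable
  also have "... <= (NN y. EN (Km al be w t (x - y)) * vp y)"
  proof (rule nn_integral_mono)
  fix y
  have "(a * vp x) * (EN (Km al be w t (x - y)) * EN (exp (- norm (x - y) / R))) = EN (Km al be w t (x - y)) * (a * EN (exp (- norm (x - y) / R)) * vp x)"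
  by (simp add: ac_simps)
  also have "... <= EN (Km al be w t (x - y)) * vp y" by (intro mult_left_mono ph) auto
  finally show "(a * vp x) * (EN (Km al be w t (x - y)) * EN (exp (- norm (x - y) / R))) <= EN (Km al be w t (x - y)) * vp y" .
  qed
  finally show ?thesis by (simp add: conv_def)
 qed
 then show ?thesis using c(1) by blast
qed

lemma Nm_om_conv_Km_time:
 assumes i: "0 <= ib" "ib <= ic" "ic <= 1" and k: "0 <= k" "k < be" and E: "real DIM('a) / 2 * (ic - ib) < be"
  and wq: "!!sg. 0 < sg ==> w sg = sg powr q" and q: "q <= 0" and T: "0 < T"
 shows "\<exists>C\<ge>0. \<forall>t e f. 0 < t --> t <= T --> 0 <= e --> e <= 1 --> f \<in> Bm -->
  Nm ib (%x::'a::euclidean_space. EN (om e k x) * conv (%x. EN (Km al be w t x)) f x)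
  <= EN (C * t powr (- (al * (real DIM('a) / 2 * (ic - ib)) / be))) * Nm ic (%x. EN (om e k x) * f x)"
proof -
 define E where "E = real DIM('a) / 2 * (ic - ib)"
 have E: "0 <= E" "E < be" using E i by (auto simp: E_def)
 obtain C where C: "0 < C" "!!t e f. 0 < t ==> 0 <= e ==> e <= 1 ==> f \<in> Bm ==>
  Nm ib (%x::'a. EN (om e k x) * conv (%x. EN (Km al be w t x)) f x)
  <= (\<integral>\<^sup>+wo. EN (C * (w (fst wo) * rho al be t wo powr (- E) + w (fst wo) * rho al be t wo powr (k - E))) \<partial>(mix al be)) * Nm ic (%x. EN (om e k x) * f x)"
  using Nm_om_conv_Km[OF i k, where 'a='a] unfolding E_def by blast
 have aE: "al * E / be < al" using ab E by (simp add: field_simps)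
 have ak: "0 <= al * k / be" using ab k by simp
 have q1: "q - al * (- E) / be < al" using aE q by simp
 have q2: "q - al * (k - E) / be < al" using aE ak q by (simp add: algebra_simps diff_divide_distrib)
 obtain C1 where C1: "0 <= C1" "!!t. 0 < t ==> (\<integral>\<^sup>+wo. EN (fst wo powr q * rho al be t wo powr (- E)) \<partial>(mix al be)) = EN (C1 * t powr (al * (- E) / be))"
  using rho_moment[OF q1] ab E by auto
 obtain C2 where C2: "0 <= C2" "!!t. 0 < t ==> (\<integral>\<^sup>+wo. EN (fst wo powr q * rho al be t wo powr (k - E)) \<partial>(mix al be)) = EN (C2 * t powr (al * (k - E) / be))"
  using rho_moment[OF q2] k E by auto
 define C' where "C' = C * (C1 + C2 * T powr (al * k / be))"
 have I: "(\<integral>\<^sup>+wo. EN (C * (w (fst wo) * rho al be t wo powr (- E) + w (fst wo) * rho al be t wo powr (k - E))) \<partial>(mix al be)) <= EN (C' * t powr (- (al * E / be)))"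
  if t: "0 < t" "t <= T" for t
 proof -
  have "(\<integral>\<^sup>+wo. EN (C * (w (fst wo) * rho al be t wo powr (- E) + w (fst wo) * rho al be t wo powr (k - E))) \<partial>(mix al be))
  = (\<integral>\<^sup>+wo. EN C * (EN (fst wo powr q * rho al be t wo powr (- E)) + EN (fst wo powr q * rho al be t wo powr (k - E))) \<partial>(mix al be))"
  proof (rule nn_integral_cong_AE)
  show "AE wo in mix al be. EN (C * (w (fst wo) * rho al be t wo powr (- E) + w (fst wo) * rho al be t wo powr (k - E))) = EN C * (EN (fst wo powr q * rho al be t wo powr (- E)) + EN (fst wo powr q * rho al be t wo powr (k - E)))"
  using AE_mix_pos[OF ab] by eventually_elim (use C in \<open>simp add: wq ennreal_mult ennreal_plus\<close>)
  qed
  also have "... = EN C * ((\<integral>\<^sup>+wo. EN (fst wo powr q * rho al be t wo powr (- E)) \<partial>(mix al be)) + (\<integral>\<^sup>+wo. EN (fst wo powr q * rho al be t wo powr (k - E)) \<partial>(mix al be)))"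
  proof -
  have [measurable]: "(%wo. EN (fst wo powr q * rho al be t wo powr r)) \<in> borel_measurable (mix al be)" for r by measurable
  show ?thesis by (simp add: nn_integral_cmult nn_integral_add)
  qed
  also have "... = EN (C * (C1 * t powr (al * (- E) / be) + C2 * t powr (al * (k - E) / be)))"
  using C C1 C2 t by (simp add: ennreal_mult ennreal_plus)
  also have "... <= EN (C' * t powr (- (al * E / be)))"
  proof (rule ennreal_leI)
  have "t powr (al * (k - E) / be) = t powr (al * k / be) * t powr (- (al * E / be))"
  by (simp add: powr_add[symmetric] algebra_simps diff_divide_distrib)
  also have "... <= T powr (al * k / be) * t powr (- (al * E / be))" using t ak by (intro mult_right_mono powr_mono2) auto
  finally have "C2 * t powr (al * (k - E) / be) <= C2 * (T powr (al * k / be) * t powr (- (al * E / be)))" using C2 by (intro mult_left_mono) auto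
  then have "C * (C1 * t powr (al * (- E) / be) + C2 * t powr (al * (k - E) / be)) <= C * (C1 * t powr (al * (- E) / be) + C2 * (T powr (al * k / be) * t powr (- (al * E / be))))"
  using C by (intro mult_left_mono) auto
  then show "C * (C1 * t powr (al * (- E) / be) + C2 * t powr (al * (k - E) / be)) <= C' * t powr (- (al * E / be))"
  by (simp add: C'_def algebra_simps)
  qed
  finally show ?thesis .
 qed
 have C'0: "0 <= C'" using C C1 C2 by (simp add: C'_def)
 show ?thesis
 proof (intro exI[of _ C'] conjI C'0 allI impI)
  fix t e :: real and f :: "'a => ennreal"
  assume t: "0 < t" "t <= T" and e: "0 <= e" "e <= 1" and f: "f \<in> Bm"
  show "Nm ib (%x. EN (om e k x) * conv (%x. EN (Km al be w t x)) f x) <= EN (C' * t powr (- (al * (real DIM('a) / 2 * (ic - ib)) / be))) * Nm ic (%x. EN (om e k x) * f x)"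
  unfolding E_def[symmetric]
  by (rule order_trans[OF C(2)[OF t(1) e f] mult_right_mono[OF I[OF t]]]) simp
 qed
qed

end

lemma one_weight: "integrable (stab al) (%_. 1 :: real)" by simp

lemma inv_weight: "integrable (stab al) (%sg. sg powr (- al))"
 using stab_integer_moment[OF ab(1,2), of 1] by (intro integrableI_nonneg) auto

lemma Zn_measurable [measurable (raw)]:
 assumes [measurable]: "f \<in> borel_measurable M" "g \<in> borel_measurable M"
 shows "(%z. Zn al be (f z) (g z :: 'a::euclidean_space)) \<in> borel_measurable M"
 unfolding Zn_def using Km_diff_measurable[of "%_. 1", OF _ _ one_weight assms] by simp

lemma Yn_measurable [measurable (raw)]:
 assumes [measurable]: "f \<in> borel_measurable M" "g \<in> borel_measurable M"
 shows "(%z. Yn al be (f z) (g z :: 'a::euclidean_space)) \<in> borel_measurable M"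
proof -
 have [measurable]: "(%z. Km al be (%sg. sg powr (- al)) (f z) (g z)) \<in> borel_measurable M"
  by (rule Km_diff_measurable[OF _ _ inv_weight assms]) auto
 show ?thesis unfolding Yn_def by measurable
qed

lemma Zn_commute: "Zn al be t (x - y) = Zn al be t (y - x)" and Yn_commute: "Yn al be t (x - y) = Yn al be t (y - x)"
 by (simp_all add: Zn_def Yn_def Km_def gauss_commute[of _ x y])

lemma conv_Yn:
 fixes f :: "'a::euclidean_space => ennreal"
 assumes [measurable]: "f \<in> Bm"
 shows "conv (Yn al be t) f x = EN (al * t powr (al - 1)) * conv (%x. EN (Km al be (%sg. sg powr (- al)) t x)) f x"
proof -
 have [measurable]: "(%y. Km al be (%sg. sg powr (- al)) t (x - y)) \<in> Bm"
  by (rule Km_diff_measurable[OF _ _ inv_weight]) auto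
 show ?thesis unfolding conv_def Yn_def by (simp add: mult.assoc nn_integral_cmult)
qed

theorem Zn_bound:
 assumes i: "0 <= ib" "ib <= ic" "ic <= 1" and k: "0 <= k" "k < be" and E: "real DIM('a) / 2 * (ic - ib) < be" and T: "0 < T"
 shows "\<exists>C\<ge>0. \<forall>t e f. 0 < t --> t <= T --> 0 <= e --> e <= 1 --> f \<in> Bm -->
  Nm ib (%x::'a::euclidean_space. EN (om e k x) * conv (Zn al be t) f x)
  <= EN (C * t powr (- (al * (real DIM('a) / 2 * (ic - ib)) / be))) * Nm ic (%x. EN (om e k x) * f x)"
 unfolding Zn_def[abs_def]
 by (rule Nm_om_conv_Km_time[of "%_. 1", OF _ _ one_weight i k E _ _ T, of 0]) auto

theorem Yn_bound:
 assumes i: "0 <= ib" "ib <= ic" "ic <= 1" and k: "0 <= k" "k < be" and E: "real DIM('a) / 2 * (ic - ib) < be" and T: "0 < T"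
 shows "\<exists>C\<ge>0. \<forall>t e f. 0 < t --> t <= T --> 0 <= e --> e <= 1 --> f \<in> Bm -->
  Nm ib (%x::'a::euclidean_space. EN (om e k x) * conv (Yn al be t) f x)
  <= EN (C * t powr (al - 1 - al * (real DIM('a) / 2 * (ic - ib)) / be)) * Nm ic (%x. EN (om e k x) * f x)"
proof -
 define E where "E = al * (real DIM('a) / 2 * (ic - ib)) / be"
 obtain C where C: "0 <= C" "!!t e f. 0 < t ==> t <= T ==> 0 <= e ==> e <= 1 ==> f \<in> Bm ==>
  Nm ib (%x::'a. EN (om e k x) * conv (%x. EN (Km al be (%sg. sg powr (- al)) t x)) f x)
  <= EN (C * t powr (- E)) * Nm ic (%x. EN (om e k x) * f x)"
  using Nm_om_conv_Km_time[of "%sg. sg powr (- al)", OF _ _ inv_weight i k E _ _ T, of "- al"] ab unfolding E_def by auto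
 show ?thesis
 proof (intro exI[of _ "al * C"] conjI allI impI)
  fix t e :: real and f :: "'a => ennreal"
  assume t: "0 < t" "t <= T" and e: "0 <= e" "e <= 1" and f[measurable]: "f \<in> Bm"
  have [measurable]: "(%z. Km al be (%sg. sg powr (- al)) t (fst z - snd z :: 'a)) \<in> Bm2"
  by (rule Km_diff_measurable[OF _ _ inv_weight]) auto
  have m: "(%x::'a. EN (om e k x) * conv (%x. EN (Km al be (%sg. sg powr (- al)) t x)) f x) \<in> Bm"
  unfolding conv_def by measurable
  have "Nm ib (%x::'a. EN (om e k x) * conv (Yn al be t) f x) = Nm ib (%x::'a. EN (al * t powr (al - 1)) * (EN (om e k x) * conv (%x. EN (Km al be (%sg. sg powr (- al)) t x)) f x))"
  by (simp add: conv_Yn ac_simps)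
  also have "... <= EN (al * t powr (al - 1)) * Nm ib (%x::'a. EN (om e k x) * conv (%x. EN (Km al be (%sg. sg powr (- al)) t x)) f x)"
  by (rule Nm_cmult[OF m i(1)])
  also have "... <= EN (al * t powr (al - 1)) * (EN (C * t powr (- E)) * Nm ic (%x. EN (om e k x) * f x))"
  by (intro mult_left_mono C t e f) auto
  also have "... = EN ((al * t powr (al - 1)) * (C * t powr (- E))) * Nm ic (%x. EN (om e k x) * f x)"
  using ab C by (simp add: emult mult.assoc[symmetric])
  also have "(al * t powr (al - 1)) * (C * t powr (- E)) = al * C * t powr (al - 1 - E)"
  proof -
  have "t powr (al - 1) * t powr (- E) = t powr (al - 1 - E)" by (simp add: powr_add[symmetric])
  then show ?thesis by (simp add: ac_simps)
  qed
  finally show "Nm ib (%x. EN (om e k x) * conv (Yn al be t) f x) <= EN (al * C * t powr (al - 1 - al * (real DIM('a) / 2 * (ic - ib)) / be)) * Nm ic (%x. EN (om e k x) * f x)"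
  unfolding E_def .
 qed (use ab C in auto)
qed

text \<open>A function that varies at most exponentially on the scale \<open>R\<close> loses only a constant factor under the
kernels as long as their typical width \<open>t^(\<alpha>/(2\<beta>))\<close> is at most \<open>R\<close>. The constant is the mean of a positive function of the
mixing parameters, hence positive.\<close>

theorem conv_lower:
 shows "\<exists>c>0. \<forall>t>0. \<forall>R>0. t powr (al / be) <= R\<^sup>2 --> (\<forall>a vp. vp \<in> Bm -->
  (\<forall>x y. a * EN (exp (- norm (x - y) / R)) * vp x <= vp y) -->
  (\<forall>x::'a::euclidean_space. EN c * a * vp x <= conv (Zn al be t) vp x & EN (c * t powr (al - 1)) * a * vp x <= conv (Yn al be t) vp x))"
proof -
 obtain c1 where c1: "0 < c1" "!!t R a vp x. 0 < t ==> 0 < R ==> t powr (al / be) <= R\<^sup>2 ==> vp \<in> Bm ==>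
  (\<forall>x y. a * EN (exp (- norm (x - y) / R)) * vp x <= vp y) ==> ennreal c1 * a * vp (x::'a) <= conv (%x. EN (Km al be (%_. 1) t x)) vp x"
  using conv_Km_lower[of "%_. 1", OF _ _ one_weight, where 'a='a] by auto
 have AEp: "AE sg in stab al. 0 < sg powr (- al)"
 proof -
  have "AE sg in stab al. 0 < sg" using ab by (intro stab_pos[OF _ _ refl]) auto
  then show ?thesis by eventually_elim simp
 qed
 obtain c2 where c2: "0 < c2" "!!t R a vp x. 0 < t ==> 0 < R ==> t powr (al / be) <= R\<^sup>2 ==> vp \<in> Bm ==>
  (\<forall>x y. a * EN (exp (- norm (x - y) / R)) * vp x <= vp y) ==> ennreal c2 * a * vp (x::'a) <= conv (%x. EN (Km al be (%sg. sg powr (- al)) t x)) vp x"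
  using conv_Km_lower[of "%sg. sg powr (- al)", OF _ _ inv_weight AEp, where 'a='a] by auto
 define c where "c = min c1 (al * c2)"
 have c: "0 < c" using c1 c2 ab by (simp add: c_def)
 have "EN c * a * vp x <= conv (Zn al be t) vp x & EN (c * t powr (al - 1)) * a * vp x <= conv (Yn al be t) vp x"
  if t: "0 < t" and R: "0 < R" "t powr (al / be) <= R\<^sup>2" and f: "vp \<in> Bm" "\<forall>x y. a * EN (exp (- norm (x - y) / R)) * vp x <= vp y"
  for t R a vp and x :: 'a
 proof
  have "EN c * (a * vp x) <= EN c1 * (a * vp x)" by (intro mult_right_mono ennreal_leI) (auto simp: c_def)
  also have "... <= conv (Zn al be t) vp x" using c1(2)[OF t R f, of x] unfolding Zn_def[abs_def] by (simp add: mult.assoc)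
  finally show "EN c * a * vp x <= conv (Zn al be t) vp x" by (simp add: mult.assoc)
  have "EN (c * t powr (al - 1)) * (a * vp x) <= EN ((al * c2) * t powr (al - 1)) * (a * vp x)"
  by (intro mult_right_mono ennreal_leI) (auto simp: c_def)
  also have "... = EN (al * t powr (al - 1)) * (EN c2 * a * vp x)"
  using ab c2 by (simp add: ennreal_mult ac_simps)
  also have "... <= EN (al * t powr (al - 1)) * conv (%x. EN (Km al be (%sg. sg powr (- al)) t x)) vp x"
  by (intro mult_left_mono c2(2)[OF t R f]) auto
  also have "... = conv (Yn al be t) vp x" by (rule conv_Yn[OF f(1), symmetric])
  finally show "EN (c * t powr (al - 1)) * a * vp x <= conv (Yn al be t) vp x" by (simp add: mult.assoc)
 qed
 then show ?thesis using c by blast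
qed

end

section \<open>Weights, test functions and the doubling argument\<close>

lemma Nm_holder:
 assumes [measurable]: "f \<in> Bm" "g \<in> Bm" and i: "0 <= i" "i <= 1"
 shows "(NN x. f x * g x) <= Nm i f * Nm (1 - i) g"
proof -
 have end0: "(NN x. f x * g x) <= Nm 0 f * Nm 1 g"
  if [measurable]: "f \<in> Bm" "g \<in> Bm" for f g :: "'a => ennreal"
 proof -
  have "(NN x. f x * g x) <= (NN x. Nm 0 f * g x)"
  using AE_le_Nm0[of f] by (intro nn_integral_mono_AE) (auto elim!: eventually_mono intro!: mult_right_mono)
  then show ?thesis by (simp add: nn_integral_cmult Nm_1)
 qed
 consider "i = 0" | "i = 1" | "0 < i" "i < 1" using i by linarith
 then show ?thesis
 proof cases
  case 1 then show ?thesis using end0[of f g] by simp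
 next
  case 2 then show ?thesis using end0[of g f] by (simp add: mult.commute)
 next
  case 3
  have "(NN x. f x * g x) = (NN x. epow (epow (f x) (1/i)) i * epow (epow (g x) (1/(1-i))) (1 - i))"
  using 3 by (simp add: epow_inverse')
  also have "... <= epow (NN x. epow (f x) (1/i)) i * epow (NN x. epow (g x) (1/(1-i))) (1 - i)"
  using 3 by (intro holder_nn) auto
  finally show ?thesis using 3 by (simp add: Nm_pos)
 qed
qed

lemma lborel_pair_borel:
 "(f \<in> borel_measurable ((lborel :: 'b::euclidean_space measure) \<Otimes>\<^sub>M (lborel :: 'a::euclidean_space measure))) \<longleftrightarrow> f \<in> Bm2"
 by (simp cong: measurable_cong_sets add: measurable_cong_sets[OF sets_pair_measure_cong[OF sets_lborel sets_lborel] refl])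

lemma nn_integral_swap:
 assumes "(%(x, y). f x y) \<in> Bm2"
 shows "(NN (x::'a::euclidean_space). (NN (y::'b::euclidean_space). f x y)) = (NN y. (NN x. f x y))"
 by (rule lborel_pair.Fubini'[symmetric]) (simp add: lborel_pair_borel assms)

lemma nn_integral_lborel_measurable:
 assumes "(%(x, y). f x y) \<in> Bm2"
 shows "(%x::'a::euclidean_space. (NN (y::'b::euclidean_space). f x y)) \<in> Bm"
 using lborel.borel_measurable_nn_integral[of f borel] assms
 by (simp add: measurable_cong_sets[OF sets_pair_measure_cong[OF refl sets_lborel] refl])

text \<open>Write the weight as a superposition of Gaussians by means of the Gamma integral.\<close>

lemma nn_integral_om:
 fixes e k :: real assumes e: "0 < e" and k: "real DIM('a) / 2 < k"
 shows "(NN x. EN (om e k (x::'a::euclidean_space)))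
  = EN (pi powr (real DIM('a) / 2) * Gamma (k - real DIM('a) / 2) / Gamma k * e powr (- real DIM('a)))"
proof -
 let ?N = "real DIM('a)"
 have k0: "0 < k" using k by (auto intro: less_trans[of _ "?N / 2"])
 have G: "0 < Gamma k" using k0 by (rule Gamma_real_pos)
 have gi: "(NN x. EN (exp (- (s * (e\<^sup>2 * (norm (x::'a))\<^sup>2))))) = EN ((pi / (s * e\<^sup>2)) powr (?N / 2))" if s: "0 < s" for s
 proof -
  define r where "r = 1 / (4 * s * e\<^sup>2)"
  have r: "0 < r" using s e by (simp add: r_def)
  have "EN (exp (- (s * (e\<^sup>2 * (norm x)\<^sup>2)))) = EN ((4 * pi * r) powr (?N / 2)) * EN (gauss r x)" for x :: 'a
  proof -
  have "- (s * (e\<^sup>2 * (norm x)\<^sup>2)) = - (norm x)\<^sup>2 / (4 * r)" using s e by (simp add: r_def field_simps)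
  then show ?thesis using r by (simp add: gauss_def emult mult.assoc[symmetric] powr_add[symmetric])
  qed
  then have "(NN x. EN (exp (- (s * (e\<^sup>2 * (norm (x::'a))\<^sup>2))))) = EN ((4 * pi * r) powr (?N / 2))"
  by (simp add: nn_integral_cmult nn_integral_gauss r)
  moreover have "4 * pi * r = pi / (s * e\<^sup>2)" by (simp add: r_def)
  ultimately show ?thesis by simp
 qed
 have om: "EN (om e k x) = EN (1 / Gamma k) * (NN s. EN (s powr (k - 1) * exp (- (s * (1 + e\<^sup>2 * (norm x)\<^sup>2)))) * indicator {0<..} s)" for x :: 'a
  using G less_imp_neq[OF G, symmetric] by (subst nn_integral_powr_exp) (auto simp: k0 om_def emult add_pos_nonneg)
 have "(NN x. EN (om e k (x::'a))) = EN (1 / Gamma k) *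
  (NN (x::'a). (NN s. EN (s powr (k - 1) * exp (- (s * (1 + e\<^sup>2 * (norm x)\<^sup>2)))) * indicator {0<..} s))"
  unfolding om by (rule nn_integral_cmult, subst measurable_lborel2, rule nn_integral_lborel_measurable) measurable
 also have "(NN (x::'a). (NN s. EN (s powr (k - 1) * exp (- (s * (1 + e\<^sup>2 * (norm x)\<^sup>2)))) * indicator {0<..} s))
  = (NN s. (NN (x::'a). EN (s powr (k - 1) * exp (- (s * (1 + e\<^sup>2 * (norm x)\<^sup>2)))) * indicator {0<..} s))"
  by (rule nn_integral_swap) measurable
 also have "... = (NN s. EN ((pi / e\<^sup>2) powr (?N / 2)) * (EN (s powr (k - ?N / 2 - 1) * exp (- (s * 1))) * indicator {0<..} s))"
 proof (rule nn_integral_cong)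
  fix s :: real
  show "(NN (x::'a). EN (s powr (k - 1) * exp (- (s * (1 + e\<^sup>2 * (norm x)\<^sup>2)))) * indicator {0<..} s)
  = EN ((pi / e\<^sup>2) powr (?N / 2)) * (EN (s powr (k - ?N / 2 - 1) * exp (- (s * 1))) * indicator {0<..} s)"
  proof (cases "0 < s")
  case s: True
  have "EN (s powr (k - 1) * exp (- (s * (1 + e\<^sup>2 * (norm x)\<^sup>2)))) * indicator {0<..} s
  = EN (s powr (k - 1) * exp (- s)) * EN (exp (- (s * (e\<^sup>2 * (norm x)\<^sup>2))))" for x :: 'a
  using s by (simp add: emult exp_add[symmetric] distrib_left)
  then have "(NN (x::'a). EN (s powr (k - 1) * exp (- (s * (1 + e\<^sup>2 * (norm x)\<^sup>2)))) * indicator {0<..} s)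
  = EN (s powr (k - 1) * exp (- s) * (pi / (s * e\<^sup>2)) powr (?N / 2))"
  by (simp add: nn_integral_cmult gi s ennreal_mult)
  also have "s powr (k - 1) * exp (- s) * (pi / (s * e\<^sup>2)) powr (?N / 2) = (pi / e\<^sup>2) powr (?N / 2) * (s powr (k - ?N / 2 - 1) * exp (- (s * 1)))"
  proof -
  have "(pi / (s * e\<^sup>2)) powr (?N / 2) = (pi / e\<^sup>2) powr (?N / 2) * s powr (- (?N / 2))"
  using s e by (simp add: powr_divide powr_mult powr_minus_divide)
  moreover have "s powr (k - 1) * s powr (- (?N / 2)) = s powr (k - ?N / 2 - 1)" by (simp add: powr_add[symmetric] algebra_simps)
  ultimately show ?thesis by (simp add: ac_simps)
  qed
  finally show ?thesis using s by (simp add: ennreal_mult)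
  qed simp
 qed
 also have "... = EN ((pi / e\<^sup>2) powr (?N / 2)) * EN (Gamma (k - ?N / 2))"
  using nn_integral_powr_exp[of 1 "k - ?N / 2"] k by (simp add: nn_integral_cmult)
 finally have eq: "(NN x. EN (om e k (x::'a))) = EN (1 / Gamma k) * (EN ((pi / e\<^sup>2) powr (?N / 2)) * EN (Gamma (k - ?N / 2)))" .
 have "(pi / e\<^sup>2) powr (?N / 2) = pi powr (?N / 2) * e powr (- ?N)"
 proof -
  have "(e\<^sup>2) powr (?N / 2) = e powr ?N" using e by (simp add: powr_powr powr_numeral[symmetric] del: powr_numeral)
  then show ?thesis using e by (simp add: powr_divide powr_minus_divide)
 qed
 moreover have "0 <= Gamma (k - ?N / 2)" using k by (intro less_imp_le Gamma_real_pos) simp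
 ultimately show ?thesis unfolding eq using G by (simp add: emult field_simps)
qed

definition expw :: "real => 'a::euclidean_space => ennreal" where
 "expw R x = EN (exp (- norm x / R))"

lemma expw_measurable [measurable]: "expw R \<in> Bm" unfolding expw_def[abs_def] by measurable

lemma expw_integral:
 "\<exists>C>0. \<forall>R>0. (NN x. expw R (x::'a::euclidean_space)) <= EN (C * R powr real DIM('a))"
proof -
 let ?N = "real DIM('a)"
 obtain C where C: "0 < C" "!!y. 0 < y ==> y powr (2 * ?N) * exp (- y) <= C" using powr_exp_bounded[of "2 * ?N"] by auto
 define D where "D = pi powr (?N / 2) * Gamma (?N - ?N / 2) / Gamma ?N"
 have D: "0 < D" unfolding D_def by (intro divide_pos_pos mult_pos_pos Gamma_real_pos) auto
 have "(NN x. expw R (x::'a)) <= EN ((C * exp 1 * D) * R powr ?N)" if R: "0 < R" for R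
 proof -
  have b: "exp (- norm x / R) <= C * exp 1 * om (1/R) ?N x" for x :: 'a
  proof -
  define y where "y = norm x / R"
  have y: "0 <= y" using R by (simp add: y_def)
  have om: "om (1/R) ?N x = (1 + y\<^sup>2) powr (- ?N)" by (simp add: om_def y_def power_divide)
  have "(1 + y\<^sup>2) powr ?N <= ((1 + y)\<^sup>2) powr ?N" using y by (intro powr_mono2) (auto simp: power2_eq_square algebra_simps)
  also have "... = (1 + y) powr (2 * ?N)" using y by (simp add: powr_powr powr_numeral[symmetric] del: powr_numeral)
  finally have "(1 + y\<^sup>2) powr ?N * exp (- (1 + y)) <= (1 + y) powr (2 * ?N) * exp (- (1 + y))" by (rule mult_right_mono) simp
  also have "... <= C" using C(2)[of "1 + y"] y by simp
  finally have *: "(1 + y\<^sup>2) powr ?N * exp (- (1 + y)) <= C" .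
  have "exp (- y) = ((1 + y\<^sup>2) powr ?N * exp (- (1 + y))) * exp 1 * (1 + y\<^sup>2) powr (- ?N)"
  proof -
  have "(1 + y\<^sup>2) powr ?N * (1 + y\<^sup>2) powr (- ?N) = 1" by (simp add: powr_add[symmetric] add_pos_nonneg less_imp_neq[symmetric])
  moreover have "exp (- (1 + y)) * exp 1 = exp (- y)" by (simp add: exp_add[symmetric])
  ultimately show ?thesis by (metis (no_types, lifting) mult.assoc mult.commute mult_1)
  qed
  also have "... <= C * exp 1 * (1 + y\<^sup>2) powr (- ?N)" by (intro mult_right_mono *) auto
  finally show ?thesis unfolding om by (simp add: y_def)
  qed
  have "(NN x. expw R (x::'a)) <= (NN x. EN (C * exp 1) * EN (om (1/R) ?N (x::'a)))"
  unfolding expw_def using C b by (intro nn_integral_mono) (auto simp: emult less_imp_le om_pos intro!: ennreal_leI)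
  also have "... = EN (C * exp 1) * EN (D * (1/R) powr (- ?N))"
  using R by (simp add: nn_integral_cmult nn_integral_om D_def)
  also have "(1/R) powr (- ?N) = R powr ?N" using R by (simp add: powr_divide powr_minus field_simps)
  finally show ?thesis using C D by (simp add: emult ac_simps)
 qed
 then show ?thesis using C D by (intro exI[of _ "C * exp 1 * D"]) auto
qed

text \<open>For \<open>f \<le> 1\<close> and an exponent \<open>c \<ge> 1\<close> one has \<open>f^c \<le> f\<close>.\<close>

lemma Nm_bounded_integrable:
 assumes [measurable]: "f \<in> Bm" and 1: "!!x. f x <= 1" and fin: "(NN x. f x) < top" and j: "0 <= j" "j <= 1"
 shows "Nm j f < top"
proof (cases "j = 0")
 case True
 have "Nm 0 f <= 1" using 1 by (intro Nm0_le) auto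
 then show ?thesis using True by (simp add: le_less_trans)
next
 case False
 have "epow (f x) (1/j) <= f x" for x
 proof -
  have "epow (f x) (1/j) = epow (f x) (1/j - 1) * f x" using epow_add[of "1/j - 1" 1 "f x"] j False by (simp add: field_simps)
  also have "... <= epow 1 (1/j - 1) * f x" using j False 1 by (intro mult_right_mono epow_mono) (auto simp: field_simps)
  finally show ?thesis using j by (cases "j = 1") (auto simp: mult_right_mono)
 qed
 then have "(NN x. epow (f x) (1/j)) <= (NN x. f x)" by (rule nn_integral_mono)
 then have "(NN x. epow (f x) (1/j)) < top" using fin by (rule le_less_trans)
 then show ?thesis using False j by (simp add: Nm_pos less_top[symmetric] epow_eq_top_iff)
qed

text \<open>From the value \<open>2^k A\<close> at some time, \<open>M\<close> grows at rate at least \<open>B (2^k A)^p\<close> and doubles within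
\<open>2^(-k(p-1)) A^(1-p)/B\<close>. These times form a geometric series, so \<open>M\<close> would be infinite at time
\<open>A^(1-p)/B / (1 - 2^(1-p))\<close>.\<close>

lemma doubling:
 fixes M :: "real => real"
 assumes A: "0 < A" and B: "0 < B" and p: "1 < p" and M0: "A <= M 0"
  and step: "!!t1 t2. 0 <= t1 ==> t1 <= t2 ==> t2 < ta ==> M t1 + B * M t1 powr p * (t2 - t1) <= M t2"
 shows "A powr (p - 1) * B * ta <= 1 / (1 - 2 powr (1 - p))"
proof (rule ccontr)
 assume n: "~ ?thesis"
 define r where "r = (2::real) powr (1 - p)"
 have r: "0 < r" "r < 1" using p by (auto simp: r_def powr_less_one)
 define l where "l = A powr (1 - p) / B"
 define t where "t = (%k. l * (\<Sum>j<k. r ^ j))"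
 have l: "0 < l" using A B by (simp add: l_def)
 have t0: "0 <= t k" for k unfolding t_def using l r by (intro mult_nonneg_nonneg sum_nonneg) auto
 have tle: "t k <= l / (1 - r)" for k
 proof -
  have "(\<Sum>j<k. r ^ j) <= 1 / (1 - r)" using r by (simp add: sum_gp_strict divide_right_mono)
  then show ?thesis unfolding t_def using l by (simp add: mult_left_mono[of _ "1 / (1 - r)" l, simplified])
 qed
 have "1 / (1 - r) < A powr (p - 1) * B * ta" using n by (simp add: r_def)
 then have "l * (1 / (1 - r)) < l * (A powr (p - 1) * B * ta)" using l by (rule mult_strict_left_mono)
 also have "l * (A powr (p - 1) * B * ta) = (A powr (1 - p) * A powr (p - 1)) * ta" using B by (simp add: l_def)
 also have "... = ta" using A by (simp add: powr_add[symmetric])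
 finally have lt: "l / (1 - r) < ta" by simp
 have Mk: "2 ^ k * A <= M (t k)" for k
 proof (induction k)
  case 0 then show ?case using M0 by (simp add: t_def)
 next
  case (Suc k)
  have ts: "t (Suc k) = t k + l * r ^ k" by (simp add: t_def distrib_left)
  have "(2 ^ k * A) powr p <= M (t k) powr p" using Suc A p by (intro powr_mono2) auto
  then have "B * (2 ^ k * A) powr p * (l * r ^ k) <= B * M (t k) powr p * (l * r ^ k)" using B l r by (intro mult_right_mono mult_left_mono) auto
  moreover have "B * (2 ^ k * A) powr p * (l * r ^ k) = 2 ^ k * A"
  proof -
  have "(2 ^ k * A) powr p = (2 powr real k) powr p * A powr p" using A by (simp add: powr_mult powr_realpow)
  moreover have "r ^ k = (2 powr real k) powr (1 - p)" unfolding r_def by (simp add: powr_realpow[symmetric] powr_powr mult.commute)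
  moreover have "(2 powr real k) powr p * (2 powr real k) powr (1 - p) = 2 powr real k" by (simp add: powr_add[symmetric])
  moreover have "A powr p * A powr (1 - p) = A" using A by (simp add: powr_add[symmetric])
  moreover have "(2::real) powr real k = 2 ^ k" by (simp add: powr_realpow)
  moreover have "B * (2 ^ k * A) powr p * (l * r ^ k) = (B / B) * ((2 ^ k * A) powr p * A powr (1 - p) * r ^ k)" by (simp add: l_def)
  ultimately show ?thesis using B by (metis (no_types, lifting) div_self less_irrefl mult.assoc mult.commute mult_1)
  qed
  moreover have "M (t k) + B * M (t k) powr p * (l * r ^ k) <= M (t (Suc k))"
  using step[OF t0[of k], of "t (Suc k)"] tle[of "Suc k"] lt l r by (simp add: ts)
  ultimately show ?case using Suc by simp
 qed
 define T where "T = l / (1 - r)"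
 have "2 ^ k * A <= M T" for k
 proof -
  have "M (t k) + B * M (t k) powr p * (T - t k) <= M T" by (rule step[OF t0]) (use tle[of k] lt in \<open>auto simp: T_def\<close>)
  moreover have "0 <= B * M (t k) powr p * (T - t k)" using B tle[of k] by (auto simp: T_def)
  ultimately show ?thesis using Mk[of k] by linarith
 qed
 moreover obtain k where "M T / A < 2 ^ k" using real_arch_pow[of 2] by auto
 ultimately show False using A by (metis not_le pos_divide_less_eq)
qed

section \<open>The Duhamel formula for nonnegative functions\<close>

text \<open>The right-hand side of the Duhamel formula for nonnegative data. In \<open>[0, \<infinity>]\<close> it is always
defined and monotone, and commutes with increasing limits.\<close>

definition duhamel :: "real => real => real => ('a::euclidean_space => ennreal) => (real => 'a => ennreal) => real => 'a => ennreal" where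
 "duhamel al be p u0 U t x = conv (Zn al be t) u0 x +
  (NN s. (if 0 < s & s < t then conv (Yn al be (t - s)) (%y. epow (U s y) p) x else 0))"

text \<open>Borel representatives make the integrals in time and space interchangeable without completing the product measure.\<close>

definition mild :: "real => real => real => ('a::euclidean_space => ennreal) => (real => 'a => ennreal) => ereal => bool" where
 "mild al be p u0 U T \<longleftrightarrow> u0 \<in> Bm & (%(t, x). U t x) \<in> Bm2 &
  (AEl t. 0 < t & ereal t < T --> (AEl x. U t x = duhamel al be p u0 U t x))"

lemma pairing_conv:
 fixes f g :: "'a::euclidean_space => ennreal"
 assumes [measurable]: "k \<in> Bm" "f \<in> Bm" "g \<in> Bm" and sym: "!!x y. k (x - y) = k (y - x)"
 shows "(NN x. conv k f x * g x) = (NN y. f y * conv k g y)"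
proof -
 have "(NN x. conv k f x * g x) = (NN x. (NN y. k (x - y) * f y * g x))"
  unfolding conv_def by (intro nn_integral_cong nn_integral_multc[symmetric]) measurable
 also have "... = (NN y. (NN x. k (x - y) * f y * g x))" by (rule nn_integral_swap) measurable
 also have "... = (NN y. (NN x. f y * (k (y - x) * g x)))" by (simp add: sym ac_simps)
 also have "... = (NN y. f y * conv k g y)" unfolding conv_def by (intro nn_integral_cong nn_integral_cmult) measurable
 finally show ?thesis .
qed

context
 fixes al be p :: real
 assumes ab: "0 < al" "al < 1" "0 < be" "be <= 1"
begin

lemma duhamel_measurable [measurable]:
 fixes U :: "real => 'a::euclidean_space => ennreal"
 assumes [measurable]: "u0 \<in> Bm" "(%(t, x). U t x) \<in> Bm2"
 shows "(%(t, x). duhamel al be p u0 U t x) \<in> Bm2"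
proof -
 note [measurable] = Zn_measurable[OF ab] Yn_measurable[OF ab]
 have "(%z. if 0 < snd z & snd z < fst (fst z) then conv (Yn al be (fst (fst z) - snd z)) (%y. epow (U (snd z) y) p) (snd (fst z)) else 0) \<in> borel_measurable ((borel \<Otimes>\<^sub>M borel) \<Otimes>\<^sub>M (borel :: real measure))"
  by measurable
 then have [measurable]: "(%(z, s). if 0 < s & s < fst z then conv (Yn al be (fst z - s)) (%y. epow (U s y) p) (snd z) else 0) \<in> borel_measurable ((borel \<Otimes>\<^sub>M borel) \<Otimes>\<^sub>M lborel)"
  by (simp add: split_beta measurable_cong_sets[OF sets_pair_measure_cong[OF refl sets_lborel] refl])
 have "(%z. duhamel al be p u0 U (fst z) (snd z)) \<in> Bm2"
  unfolding duhamel_def by measurable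
 then show ?thesis by (simp add: split_beta)
qed

text \<open>Integrate the Duhamel formula against the test function and move the even kernels onto it by Tonelli.
For \<open>t - s \<le> \<tau>\<close> the factor \<open>(t-s)^(\<alpha>-1)\<close> is at least \<open>\<tau>^(\<alpha>-1)\<close>.\<close>

lemma pairing_lower:
 fixes u0 vp :: "'a::euclidean_space => ennreal"
 assumes m: "mild al be p u0 U T" and [measurable]: "vp \<in> Bm"
  and low: "!!r x. 0 < r ==> r <= ta ==> ennreal c * vp x <= conv (Zn al be r) vp x & EN (c * r powr (al - 1)) * vp x <= conv (Yn al be r) vp x"
  and c: "0 <= c" and t: "0 < t" "t <= ta" and eq: "AEl x. U t x = duhamel al be p u0 U t x"
 shows "EN c * (NN x. u0 x * vp x) +
  EN (c * ta powr (al - 1)) * (NN s. (if 0 < s & s < t then (NN x. epow (U s x) p * vp x) else 0))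
  <= (NN x. U t x * vp x)"
proof -
 note [measurable] = Zn_measurable[OF ab] Yn_measurable[OF ab]
 have [measurable]: "u0 \<in> Bm" "(%(t, x). U t x) \<in> Bm2" using m by (auto simp: mild_def)
 define Q where "Q = (%s x. if 0 < s & s < t then conv (Yn al be (t - s)) (%y. epow (U s y) p) x else 0)"
 have Qm[measurable]: "(%(s, x). Q s x) \<in> Bm2" unfolding Q_def by measurable
 then have Qs: "(%s. Q s x) \<in> Bm" for x by measurable
 from Qm have [measurable]: "(%(x, s). Q s x) \<in> Bm2" by measurable
 then have [measurable]: "(%x. (NN s. Q s x)) \<in> Bm" by (rule nn_integral_lborel_measurable)
 have "(%(s, x). epow (U s x) p * vp x) \<in> Bm2" by measurable
 then have [measurable]: "(%s. (NN x. epow (U s x) p * vp x)) \<in> Bm" by (rule nn_integral_lborel_measurable)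
 have "(NN x. U t x * vp x) = (NN x. conv (Zn al be t) u0 x * vp x + (NN s. Q s x) * vp x)"
  using eq by (intro nn_integral_cong_AE) (auto elim!: eventually_mono simp: duhamel_def Q_def distrib_right)
 also have "... = (NN x. conv (Zn al be t) u0 x * vp x) + (NN x. (NN s. Q s x) * vp x)"
  by (rule nn_integral_add) measurable
 also have "(NN x. (NN s. Q s x) * vp x) = (NN x. (NN s. Q s x * vp x))"
  by (subst nn_integral_multc) (simp_all add: Qs)
 also have "... = (NN s. (NN x. Q s x * vp x))" by (rule nn_integral_swap) measurable
 finally have id: "(NN x. U t x * vp x) = (NN x. conv (Zn al be t) u0 x * vp x) + (NN s. (NN x. Q s x * vp x))" .
 have "EN c * (NN x. u0 x * vp x) = (NN x. u0 x * (EN c * vp x))"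
  by (subst nn_integral_cmult[symmetric]) (auto simp: ac_simps)
 also have "... <= (NN x. u0 x * conv (Zn al be t) vp x)" using low[of t] t by (intro nn_integral_mono mult_left_mono) auto
 also have "... = (NN x. conv (Zn al be t) u0 x * vp x)"
  by (rule pairing_conv[symmetric]) (auto intro: Zn_commute[OF ab] simp del: minus_diff_eq)
 finally have Z: "EN c * (NN x. u0 x * vp x) <= (NN x. conv (Zn al be t) u0 x * vp x)" .
 have Y: "EN (c * ta powr (al - 1)) * (NN s. (if 0 < s & s < t then (NN x. epow (U s x) p * vp x) else 0))
  <= (NN s. (NN x. Q s x * vp x))"
 proof (rule ord_eq_le_trans[OF nn_integral_cmult[symmetric]])
  show "(%s. if 0 < s & s < t then (NN x. epow (U s x) p * vp x) else 0) \<in> borel_measurable lborel"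
  unfolding measurable_lborel2 by measurable
 next
  show "(NN s. EN (c * ta powr (al - 1)) * (if 0 < s & s < t then (NN x. epow (U s x) p * vp x) else 0))
  <= (NN s. (NN x. Q s x * vp x))"
  proof (rule nn_integral_mono)
  fix s :: real
  show "EN (c * ta powr (al - 1)) * (if 0 < s & s < t then (NN x. epow (U s x) p * vp x) else 0) <= (NN x. Q s x * vp x)"
  proof (cases "0 < s & s < t")
  case True
  have "EN (c * ta powr (al - 1)) * (NN x. epow (U s x) p * vp x) = (NN x. epow (U s x) p * (EN (c * ta powr (al - 1)) * vp x))"
  by (subst nn_integral_cmult[symmetric]) (auto simp: ac_simps)
  also have "... <= (NN x. epow (U s x) p * conv (Yn al be (t - s)) vp x)"
  proof (intro nn_integral_mono mult_left_mono)
  fix x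
  have "ta powr (al - 1) <= (t - s) powr (al - 1)" using True t ab by (intro powr_mono2') auto
  then have "EN (c * ta powr (al - 1)) * vp x <= EN (c * (t - s) powr (al - 1)) * vp x" using c by (intro mult_right_mono ennreal_leI mult_left_mono) auto
  also have "... <= conv (Yn al be (t - s)) vp x" using low[of "t - s" x] True t by auto
  finally show "EN (c * ta powr (al - 1)) * vp x <= conv (Yn al be (t - s)) vp x" .
  qed auto
  also have "... = (NN x. conv (Yn al be (t - s)) (%x. epow (U s x) p) x * vp x)"
  by (rule pairing_conv[symmetric]) (measurable, rule Yn_commute[OF ab])
  finally show ?thesis using True by (simp add: Q_def)
  qed auto
  qed
 qed
 show ?thesis unfolding id by (rule add_mono[OF Z Y])
qed

lemma expw_lower:
 "\<exists>c>0. \<forall>R>0. \<forall>r>0. r <= R powr (2 * be / al) --> (\<forall>x::'a::euclidean_space. EN c * expw R x <= conv (Zn al be r) (expw R) x &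
  EN (c * r powr (al - 1)) * expw R x <= conv (Yn al be r) (expw R) x)"
proof -
 obtain c where c: "0 < c" and low: "!!t R a vp x. 0 < t ==> 0 < R ==> t powr (al / be) <= R\<^sup>2 ==> vp \<in> Bm ==>
  (!!x y. a * EN (exp (- norm (x - y) / R)) * vp x <= vp y) ==>
  EN c * a * vp (x::'a) <= conv (Zn al be t) vp x & EN (c * t powr (al - 1)) * a * vp x <= conv (Yn al be t) vp x"
  using conv_lower[OF ab, where 'a='a] by metis
 have "EN c * 1 * expw R x <= conv (Zn al be r) (expw R) x & EN (c * r powr (al - 1)) * 1 * expw R x <= conv (Yn al be r) (expw R) x"
  if R: "0 < R" and r: "0 < r" "r <= R powr (2 * be / al)" for R r and x :: 'a
 proof (rule low[OF r(1) R])
  have "r powr (al / be) <= (R powr (2 * be / al)) powr (al / be)" using r ab by (intro powr_mono2) auto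
  then show "r powr (al / be) <= R\<^sup>2" using ab R by (simp add: powr_powr)
  fix x y :: 'a
  have "- norm (x - y) / R + - norm x / R <= - norm y / R" using norm_triangle_ineq4[of x "x - y"] R
  divide_right_mono[of "norm y" "norm x + norm (x - y)" R] by (simp add: add_divide_distrib)
  then show "1 * EN (exp (- norm (x - y) / R)) * expw R x <= expw R y" by (simp add: expw_def emult exp_add[symmetric])
 qed simp
 then show ?thesis using c by (intro exI[of _ c]) auto
qed

end

section \<open>Nonexistence of global solutions\<close>

text \<open>Jensen's inequality for the weight, whose total mass is of order \<open>R^N\<close>.\<close>

lemma expw_power_mean:
 fixes g :: "'a::euclidean_space => ennreal"
 assumes [measurable]: "g \<in> Bm" and p: "1 < p" and G: "(NN x. expw R (x::'a)) <= EN G" "0 < G"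
 shows "EN (G powr (1 - p)) * epow (NN x. g x * expw R x) p <= (NN x. epow (g x) p * expw R x)"
proof -
 define b where "b = (NN x. epow (g x) p * expw R x)"
 have "g x * expw R x = epow (epow (g x) p * expw R x) (1/p) * epow (expw R x) (1 - 1/p)" for x
 proof -
  have "epow (epow (g x) p * expw R x) (1/p) * epow (expw R x) (1 - 1/p) = g x * (epow (expw R x) (1/p) * epow (expw R x) (1 - 1/p))"
  using p by (simp add: epow_mult epow_inverse mult.assoc)
  also have "epow (expw R x) (1/p) * epow (expw R x) (1 - 1/p) = expw R x" using p by (subst epow_add[symmetric]) auto
  finally show ?thesis by simp
 qed
 then have "(NN x. g x * expw R x) = (NN x. epow (epow (g x) p * expw R x) (1/p) * epow (expw R x) (1 - 1/p))" by simp
 also have "... <= epow b (1/p) * epow (NN x. expw R (x::'a)) (1 - 1/p)" unfolding b_def using p by (intro holder_nn) auto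
 also have "... <= epow b (1/p) * epow (EN G) (1 - 1/p)" using p G by (intro mult_left_mono epow_mono) auto
 finally have "epow (NN x. g x * expw R x) p <= epow (epow b (1/p) * epow (EN G) (1 - 1/p)) p" using p by (intro epow_mono) auto
 also have "... = b * epow (EN G) ((1 - 1/p) * p)" using p by (simp add: epow_mult epow_inverse' epow_epow)
 also have "(1 - 1/p) * p = p - 1" using p by (simp add: field_simps)
 finally have "epow (NN x. g x * expw R x) p <= b * EN (G powr (p - 1))" using p G by (simp add: epow_ennreal)
 then have "EN (G powr (1 - p)) * epow (NN x. g x * expw R x) p <= EN (G powr (1 - p)) * (b * EN (G powr (p - 1)))" by (rule mult_left_mono) simp
 also have "... = b * (EN (G powr (1 - p)) * EN (G powr (p - 1)))" by (simp add: ac_simps)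
 also have "EN (G powr (1 - p)) * EN (G powr (p - 1)) = 1" using G by (simp add: emult powr_add[symmetric])
 finally show ?thesis by (simp add: b_def)
qed

text \<open>The right-hand side \<open>A + B J(t)\<close> is monotone in time and therefore satisfies the doubling hypothesis at every time,
although \<open>I\<close> is controlled only almost everywhere.\<close>

lemma mass_doubling:
 fixes I b J :: "real => ennreal"
 assumes [measurable]: "b \<in> Bm"
  and A: "0 < A" and B: "0 < B" and D: "0 < D" and p: "1 < p" and t0: "0 < ta"
  and J: "!!t. J t = (NN s. (if 0 < s & s < t then b s else 0))"
  and I: "AEl t. 0 < t & t < ta --> EN A + EN B * J t <= I t & I t < top & EN D * epow (I t) p <= b t"
 shows "A powr (p - 1) * (B * D) * ta <= 1 / (1 - 2 powr (1 - p))"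
proof -
 have Jmono: "J t1 <= J t2" if "t1 <= t2" for t1 t2 unfolding J using that by (intro nn_integral_mono) auto
 have Jfin: "J t < top" if t: "t < ta" for t
 proof -
  have "\<exists>t'\<in>{max t 0<..<ta}. EN A + EN B * J t' < top"
  proof (rule ccontr)
  assume n: "~ ?thesis"
  have "AEl t'. t' \<notin> {max t 0<..<ta}" using I
  by eventually_elim (use n in \<open>auto dest: le_less_trans\<close>)
  then have "emeasure lborel {max t 0<..<ta} = 0" by (subst (asm) AE_iff_measurable[OF _ refl]) (auto simp: greaterThanLessThan_def greaterThan_def lessThan_def Int_def conj_commute conj_left_commute)
  then show False using t t0 by simp
  qed
  then obtain t' where t': "t < t'" "EN A + EN B * J t' < top" by auto
  then have "EN B * J t' < top" by simp
  then have "J t' < top" using B by (simp add: less_top[symmetric] ennreal_mult_eq_top_iff)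
  then show ?thesis using Jmono[of t t'] t' by (auto intro: le_less_trans)
 qed
 define M where "M = (%t. A + B * enn2real (J t))"
 have M: "EN (M t) = EN A + EN B * J t" if "t < ta" for t
  using Jfin[OF that] A B by (simp add: M_def ennreal_plus[symmetric] ennreal_mult del: ennreal_plus) (auto simp: ennreal_plus ennreal_mult)
 have Mpos: "0 < M t" for t unfolding M_def using A B by (auto intro!: add_pos_nonneg)
 have step: "M t1 + (B * D) * M t1 powr p * (t2 - t1) <= M t2" if t: "0 <= t1" "t1 <= t2" "t2 < ta" for t1 t2
 proof -
  have "EN (D * M t1 powr p * (t2 - t1)) = (NN s. EN (D * M t1 powr p) * indicator {t1<..<t2} s)"
  using D t by (simp add: nn_integral_cmult_indicator ennreal_mult)
  also have "... <= (NN s. (if t1 < s & s < t2 then b s else 0))"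
  proof (rule nn_integral_mono_AE)
  show "AEl s. EN (D * M t1 powr p) * indicator {t1<..<t2} s <= (if t1 < s & s < t2 then b s else 0)"
  using I
  proof eventually_elim
  fix s assume h: "0 < s & s < ta --> EN A + EN B * J s <= I s & I s < top & EN D * epow (I s) p <= b s"
  show "EN (D * M t1 powr p) * indicator {t1<..<t2} s <= (if t1 < s & s < t2 then b s else 0)"
  proof (cases "t1 < s & s < t2")
  case True
  then have s: "0 < s" "s < ta" using t by auto
  have "EN (M t1) <= EN (M s)" using True s t Jmono[of t1 s] by (auto simp: M intro!: add_left_mono mult_left_mono)
  also have "... <= I s" using h s by (simp add: M)
  finally have "epow (EN (M t1)) p <= epow (I s) p" using p by (intro epow_mono) auto
  then have "EN D * epow (EN (M t1)) p <= EN D * epow (I s) p" by (rule mult_left_mono) simp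
  also have "... <= b s" using h s by simp
  finally show ?thesis using True p D Mpos[of t1] by (simp add: epow_ennreal ennreal_mult less_imp_le)
  qed auto
  qed
  qed
  finally have 1: "EN (D * M t1 powr p * (t2 - t1)) <= (NN s. (if t1 < s & s < t2 then b s else 0))" .
  have "J t1 + (NN s. (if t1 < s & s < t2 then b s else 0)) <= J t2"
  unfolding J by (subst nn_integral_add[symmetric]) (use t in \<open>auto intro!: nn_integral_mono\<close>)
  with 1 have "J t1 + EN (D * M t1 powr p * (t2 - t1)) <= J t2" by (meson add_left_mono order_trans)
  then have "EN A + EN B * (J t1 + EN (D * M t1 powr p * (t2 - t1))) <= EN A + EN B * J t2" by (intro add_left_mono mult_left_mono) auto
  also have "... = EN (M t2)" using t by (simp add: M)
  also have "EN A + EN B * (J t1 + EN (D * M t1 powr p * (t2 - t1))) = EN (M t1 + (B * D) * M t1 powr p * (t2 - t1))"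
  proof -
  have "EN (M t1 + (B * D) * M t1 powr p * (t2 - t1)) = EN (M t1) + EN B * EN (D * M t1 powr p * (t2 - t1))"
  using Mpos[of t1] B D t by (simp add: ennreal_plus[symmetric] emult ac_simps del: ennreal_plus)
  then show ?thesis using t by (simp add: M distrib_left add.assoc)
  qed
  finally show ?thesis using Mpos[of t2] by (simp add: ennreal_le_iff)
 qed
 show ?thesis by (rule doubling[of A "B * D" p M]) (use A B D p step in \<open>auto simp: M_def\<close>)
qed

context
 fixes al be p :: real
 assumes ab: "0 < al" "al < 1" "0 < be" "be <= 1"
begin

text \<open>The mass inequality holds on \<open>(0, R^(2\<beta>/\<alpha>))\<close> for every \<open>R \<ge> 1\<close>. With nonzero initial datum
the bound of the doubling lemma fails for large \<open>R\<close>, since \<open>2\<beta> - N(p-1) > 0\<close>.\<close>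

theorem no_global_mild:
 fixes u0 :: "'a::euclidean_space => ennreal"
 assumes p: "1 < p" "p < 1 + 2 * be / real DIM('a)" and i: "0 <= i" "i <= 1"
  and m: "mild al be p u0 U \<infinity>" and bd: "!!T'. \<exists>C. AEl t. 0 < t & t < T' --> Nm i (U t) <= EN C"
 shows "AEl x. u0 x = 0"
proof (rule ccontr)
 assume n: "~ ?thesis"
 let ?N = "real DIM('a)"
 have [measurable]: "u0 \<in> Bm" and Um[measurable]: "(%(t, x). U t x) \<in> Bm2" using m by (auto simp: mild_def)
 obtain c where c: "0 < c" and low: "!!R r x. 0 < R ==> 0 < r ==> r <= R powr (2 * be / al) ==> ennreal c * expw R (x::'a) <= conv (Zn al be r) (expw R) x &
  EN (c * r powr (al - 1)) * expw R x <= conv (Yn al be r) (expw R) x"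
  using expw_lower[OF ab, where 'a='a] by metis
 obtain C where C: "0 < C" "!!R. 0 < R ==> (NN x. expw R (x::'a)) <= EN (C * R powr ?N)"
  using expw_integral[where 'a='a] by metis
 have "(NN x. u0 x * expw 1 x) ~= 0" using n by (subst nn_integral_0_iff_AE) (auto simp: expw_def)
 then obtain A0 where A0: "0 < A0" "EN A0 <= (NN x. u0 x * expw 1 x)"
  by (cases "(NN x. u0 x * expw 1 x)") (auto simp: le_less intro: that[of 1] that)
 have main: "(c * A0) powr (p - 1) * ((c * (R powr (2 * be / al)) powr (al - 1)) * (C * R powr ?N) powr (1 - p)) * R powr (2 * be / al) <= 1 / (1 - 2 powr (1 - p))"
  if R: "1 <= R" for R
 proof -
  define ta where "ta = R powr (2 * be / al)"
  have tau: "0 < ta" using R by (simp add: ta_def)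
  have G: "0 < C * R powr ?N" using C R by simp
  define b where "b = (%s. (NN x. epow (U s x) p * expw R x))"
  have "(%(s, x). epow (U s x) p * expw R x) \<in> Bm2" by measurable
  then have bm[measurable]: "b \<in> Bm" unfolding b_def by (rule nn_integral_lborel_measurable)
  define J where "J = (%t. (NN s. (if 0 < s & s < t then b s else 0)))"
  have A: "EN (c * A0) <= EN c * (NN x. u0 x * expw R x)"
  proof -
  have "(NN x. u0 x * expw 1 x) <= (NN x. u0 x * expw R x)"
  unfolding expw_def using R by (intro nn_integral_mono mult_left_mono ennreal_leI) (auto simp: field_simps intro: mult_right_mono[of 1 R, simplified])
  with A0 have "EN A0 <= (NN x. u0 x * expw R x)" by (rule_tac order_trans)
  then show ?thesis using c A0 by (simp add: ennreal_mult mult_left_mono)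
  qed
  obtain CT where CT: "AEl t. 0 < t & t < ta --> Nm i (U t) <= EN CT" using bd by blast
  have fin: "Nm (1 - i) (expw R :: 'a => ennreal) < top"
  using C(2)[of R] R i by (intro Nm_bounded_integrable) (auto simp: expw_def intro: le_less_trans)
  have "AEl t. 0 < t & ereal t < \<infinity> --> (AEl x. U t x = duhamel al be p u0 U t x)" using m by (simp add: mild_def)
  with CT have I: "AEl t. 0 < t & t < ta --> EN (c * A0) + EN (c * ta powr (al - 1)) * J t <= (NN x. U t x * expw R x) &
  (NN x. U t x * expw R x) < top & EN ((C * R powr ?N) powr (1 - p)) * epow (NN x. U t x * expw R x) p <= b t"
  proof eventually_elim
  case (elim t)
  show ?case
  proof (intro impI conjI)
  assume t: "0 < t & t < ta"
  have "EN c * (NN x. u0 x * expw R x) + EN (c * ta powr (al - 1)) * J t <= (NN x. U t x * expw R x)"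
  unfolding J_def b_def using t elim c R by (intro pairing_lower[OF ab m _ low]) (auto simp: ta_def)
  then show "EN (c * A0) + EN (c * ta powr (al - 1)) * J t <= (NN x. U t x * expw R x)"
  using A by (meson add_right_mono order_trans)
  have "(NN x. U t x * expw R x) <= Nm i (U t) * Nm (1 - i) (expw R :: 'a => ennreal)" using i by (intro Nm_holder) auto
  also have "... <= EN CT * Nm (1 - i) (expw R :: 'a => ennreal)" using elim t by (intro mult_right_mono) auto
  also have "... < top" using fin by (simp add: ennreal_mult_less_top)
  finally show "(NN x. U t x * expw R x) < top" .
  show "EN ((C * R powr ?N) powr (1 - p)) * epow (NN x. U t x * expw R x) p <= b t"
  unfolding b_def using C(2)[of R] R G p by (intro expw_power_mean) auto
  qed
  qed
  show ?thesis unfolding ta_def[symmetric]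
  by (rule mass_doubling[OF bm _ _ _ p(1) tau _ I]) (use c A0 G tau in \<open>auto simp: J_def\<close>)
 qed
 define e where "e = 2 * be - ?N * (p - 1)"
 have e: "0 < e" using p by (simp add: e_def field_simps)
 define D where "D = (c * A0) powr (p - 1) * c * C powr (1 - p)"
 have D: "0 < D" using c A0 C by (simp add: D_def)
 define K where "K = 1 / (1 - 2 powr (1 - p))"
 have K: "0 < K" using p by (auto simp: K_def powr_less_one)
 have main': "D * R powr e <= K" if R: "1 <= R" for R
 proof -
  have 1: "(C * R powr ?N) powr (1 - p) = C powr (1 - p) * R powr (?N * (1 - p))" using C R by (simp add: powr_mult powr_powr)
  have 2: "(R powr (2 * be / al)) powr (al - 1) = R powr (2 * be - 2 * be / al)" using ab by (simp add: powr_powr field_simps)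
  have 3: "R powr (2 * be - 2 * be / al) * R powr (?N * (1 - p)) * R powr (2 * be / al) = R powr e"
  by (simp add: powr_add[symmetric] e_def algebra_simps)
  have "D * R powr e = (c * A0) powr (p - 1) * ((c * (R powr (2 * be / al)) powr (al - 1)) * (C * R powr ?N) powr (1 - p)) * R powr (2 * be / al)"
  unfolding D_def 1 2 3[symmetric] by (simp only: ac_simps)
  then show ?thesis using main[OF R] by (simp add: K_def)
 qed
 define R where "R = (1 + K / D) powr (1 / e)"
 have "1 <= R" unfolding R_def using K D e by (intro ge_one_powr_ge_zero) auto
 moreover have "R powr e = 1 + K / D" unfolding R_def using e K D by (simp add: powr_powr add_pos_pos)
 ultimately show False using main'[of R] D by (simp add: distrib_left)
qed

end

section \<open>A Gronwall inequality with singular kernel\<close>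

text \<open>The Riemann-Liouville integral of order \<open>b\<close>, without the factor \<open>1/\<Gamma>(b)\<close>.\<close>

definition fint :: "real => (real => ennreal) => real => ennreal" where
 "fint b vp t = (NN s. (if 0 < s & s < t then EN ((t - s) powr (b - 1)) * vp s else 0))"

lemma fint_measurable [measurable]:
 assumes [measurable]: "vp \<in> Bm" shows "fint b vp \<in> Bm"
 unfolding fint_def[abs_def] by (rule nn_integral_lborel_measurable) measurable

lemma fint_integrand_measurable [measurable]:
 assumes [measurable]: "vp \<in> Bm"
 shows "(%s. if 0 < s & s < t then EN ((t - s) powr (b - 1)) * vp s else 0) \<in> borel_measurable lborel"
 unfolding measurable_lborel2 by measurable

lemma fint_mono_AE:
 assumes "AEl s. 0 < s & s < t --> vp s <= \<psi> s" shows "fint b vp t <= fint b \<psi> t"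
 unfolding fint_def using assms by (intro nn_integral_mono_AE) (auto elim!: eventually_mono intro!: mult_left_mono)

lemma fint_add:
 assumes [measurable]: "vp \<in> Bm" "\<psi> \<in> Bm"
 shows "fint b (%s. vp s + \<psi> s) t = fint b vp t + fint b \<psi> t"
 unfolding fint_def by (subst nn_integral_add[symmetric]) (auto intro!: nn_integral_cong simp: distrib_left)

lemma fint_cmult:
 assumes [measurable]: "vp \<in> Bm"
 shows "fint b (%s. c * vp s) t = c * fint b vp t"
 unfolding fint_def by (subst nn_integral_cmult[symmetric]) (auto intro!: nn_integral_cong simp: ac_simps)

lemma fint_powr:
 assumes "0 < a" "0 < b" shows "fint b (%s. EN (s powr (a - 1))) t <= EN (Beta a b * t powr (a + b - 1))"
proof (cases "0 < t")
 case True
 have "fint b (%s. EN (s powr (a - 1))) t = (NN s. EN ((t - s) powr (b - 1) * (s - 0) powr (a - 1)) * indicator {0<..<t} s)"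
  unfolding fint_def by (intro nn_integral_cong) (auto simp: indicator_def ennreal_mult)
 then show ?thesis using nn_integral_Beta[of b a 0 t] assms True by (simp add: Beta_commute add.commute ac_simps)
next
 case False
 then have "fint b (%s. EN (s powr (a - 1))) t = (\<integral>\<^sup>+s. 0 \<partial>(lborel :: real measure))" unfolding fint_def by (intro nn_integral_cong) auto
 then show ?thesis by simp
qed


lemma fint_exp_weight:
 assumes [measurable]: "D \<in> Bm" and b: "0 < b" and l: "0 < l"
 shows "(NN t. EN (exp (- l * t)) * fint b D t) <= EN (Gamma b * l powr (- b)) * (NN s. (if 0 < s then EN (exp (- l * s)) * D s else 0))"
proof -
 have "(NN t. EN (exp (- l * t)) * fint b D t)
  = (NN t. (NN s. (if 0 < s & s < t then EN (exp (- l * t)) * (EN ((t - s) powr (b - 1)) * D s) else 0)))"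
  unfolding fint_def by (intro nn_integral_cong, subst nn_integral_cmult[symmetric]) (auto intro!: nn_integral_cong)
 also have "... = (NN s. (NN t. (if 0 < s & s < t then EN (exp (- l * t)) * (EN ((t - s) powr (b - 1)) * D s) else 0)))"
  by (rule nn_integral_swap) measurable
 also have "... = (NN s. (if 0 < s then EN (exp (- l * s)) * D s else 0) * EN (Gamma b * l powr (- b)))"
 proof (rule nn_integral_cong)
  fix s :: real
  have "(NN t. (if 0 < s & s < t then EN (exp (- l * t)) * (EN ((t - s) powr (b - 1)) * D s) else 0))
  = (NN t. (if 0 < s then EN (exp (- l * s)) * D s else 0) * (EN ((t - s) powr (b - 1) * exp (- ((t - s) * l))) * indicator {0<..} (t - s)))"
  proof (intro nn_integral_cong)
  fix t :: real
  have "exp (- l * t) = exp (- l * s) * exp (- ((t - s) * l))" by (simp add: exp_add[symmetric] algebra_simps)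
  then show "(if 0 < s & s < t then EN (exp (- l * t)) * (EN ((t - s) powr (b - 1)) * D s) else 0)
  = (if 0 < s then EN (exp (- l * s)) * D s else 0) * (EN ((t - s) powr (b - 1) * exp (- ((t - s) * l))) * indicator {0<..} (t - s))"
  by (auto simp: indicator_def ennreal_mult ac_simps)
  qed
  also have "... = (if 0 < s then EN (exp (- l * s)) * D s else 0) * (NN t. EN ((t - s) powr (b - 1) * exp (- ((t - s) * l))) * indicator {0<..} (t - s))"
  by (rule nn_integral_cmult, unfold measurable_lborel2, measurable)
  also have "(NN t. EN ((t - s) powr (b - 1) * exp (- ((t - s) * l))) * indicator {0<..} (t - s)) = EN (Gamma b * l powr (- b))"
  using nn_integral_lborel_shift[of "%u. EN (u powr (b - 1) * exp (- (u * l))) * indicator {0<..} u" s] nn_integral_powr_exp[OF l b] by simp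
  finally show "(NN t. (if 0 < s & s < t then EN (exp (- l * t)) * (EN ((t - s) powr (b - 1)) * D s) else 0))
  = (if 0 < s then EN (exp (- l * s)) * D s else 0) * EN (Gamma b * l powr (- b))" .
 qed
 also have "... = (NN s. (if 0 < s then EN (exp (- l * s)) * D s else 0)) * EN (Gamma b * l powr (- b))"
  by (rule nn_integral_multc) (unfold measurable_lborel2, measurable)
 finally show ?thesis by (simp add: mult.commute)
qed

text \<open>For large \<open>l\<close> the function \<open>2A t^(-a) exp (l t)\<close> is a supersolution. The positive part \<open>D\<close> of the difference then
satisfies \<open>D \<le> C fint b D\<close>, and in the integral norm with weight \<open>exp (-l t)\<close> the right-hand side
has at most half the norm of \<open>D\<close>.
Finiteness of that norm is where integrability of \<open>\<phi>\<close> enters. The constant does not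
depend on \<open>\<phi>\<close>, which later permits a limit in the weight.\<close>

theorem singular_gronwall:
 fixes a b C T :: real
 assumes a: "0 <= a" "a < 1" and b: "0 < b" and C: "0 <= C" and T: "0 < T"
 shows "\<exists>M\<ge>0. \<forall>A vp. vp \<in> Bm --> (NN s. (if 0 < s & s < T then vp s else 0)) < top --> 0 <= A -->
  (AEl t. 0 < t & t < T --> vp t <= EN (A * t powr (-a)) + EN C * fint b vp t) -->
  (AEl t. 0 < t & t < T --> vp t <= EN (M * A * t powr (-a)))"
proof -
 define d where "d = b / 2"
 have d: "0 < d" "b - d = d" using b by (auto simp: d_def)
 obtain Cd where Cd: "0 < Cd" "!!y. 0 < y ==> y powr d * exp (- y) <= Cd" using powr_exp_bounded[of d] d by auto
 have beta: "0 < Beta (1 - a) d" unfolding Beta_def using a d by (intro divide_pos_pos mult_pos_pos Gamma_real_pos) auto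
 define P where "P = C * Cd * Beta (1 - a) d * T powr d"
 have P: "0 <= P" using C Cd beta by (auto simp: P_def)
 define l where "l = max ((1 + 2 * P) powr (1 / d)) ((1 + 2 * C * Gamma b) powr (1 / b))"
 have G: "0 < Gamma b" using b by (rule Gamma_real_pos)
 have l: "0 < l" using P by (auto simp: l_def less_max_iff_disj)
 have l1: "P * l powr (- d) <= 1/2"
 proof -
  have "((1 + 2 * P) powr (1 / d)) powr d <= l powr d" using d by (intro powr_mono2) (auto simp: l_def)
  then have "2 * P <= l powr d" using P d by (simp add: powr_powr)
  then show ?thesis using l by (simp add: powr_minus field_simps)
 qed
 have l2: "C * (Gamma b * l powr (- b)) <= 1/2"
 proof -
  have "((1 + 2 * C * Gamma b) powr (1 / b)) powr b <= l powr b" using b by (intro powr_mono2) (auto simp: l_def)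
  then have "2 * C * Gamma b <= l powr b" using C G b by (simp add: powr_powr)
  then show ?thesis using l by (simp add: powr_minus field_simps)
 qed
 have le_add: "x <= y + (x - y)" for x y :: ennreal
  by (cases "y <= x") (auto simp: add.commute[of y] diff_add_self_ennreal intro: add_increasing2)
 define g where "g = (%t::real. EN (exp (l * t) * t powr (- a)))"
 have [measurable]: "g \<in> Bm" unfolding g_def by measurable
 have super: "EN C * fint b g t <= EN (1/2) * g t" if t: "0 < t" "t < T" for t
 proof -
  have "fint b g t <= (NN s. EN (exp (l * t) * (Cd * l powr (- d))) * (if 0 < s & s < t then EN ((t - s) powr (d - 1)) * EN (s powr ((1 - a) - 1)) else 0))"
  unfolding fint_def
  proof (rule nn_integral_mono)
  fix s :: real
  show "(if 0 < s & s < t then EN ((t - s) powr (b - 1)) * g s else 0) <= EN (exp (l * t) * (Cd * l powr (- d))) * (if 0 < s & s < t then EN ((t - s) powr (d - 1)) * EN (s powr ((1 - a) - 1)) else 0)"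
  proof (cases "0 < s & s < t")
  case True
  have "(l * (t - s)) powr d * exp (- (l * (t - s))) <= Cd" using True l by (intro Cd) auto
  moreover have "(l * (t - s)) powr d = l powr d * (t - s) powr d" by (rule powr_mult)
  ultimately have "l powr (- d) * (l powr d * (t - s) powr d * exp (- (l * (t - s)))) <= l powr (- d) * Cd" by (intro mult_left_mono) auto
  moreover have "l powr (- d) * l powr d = 1" using l by (simp add: powr_add[symmetric])
  ultimately have "(t - s) powr d * exp (- (l * (t - s))) <= Cd * l powr (- d)" by (simp only: mult.assoc[symmetric] mult.commute[of Cd] mult_1)
  then have "exp (l * t) * ((t - s) powr (d - 1) * s powr (- a)) * ((t - s) powr d * exp (- (l * (t - s)))) <= exp (l * t) * ((t - s) powr (d - 1) * s powr (- a)) * (Cd * l powr (- d))"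
  by (intro mult_left_mono) auto
  note le = this
  have e1: "(t - s) powr (d - 1) * (t - s) powr d = (t - s) powr (b - 1)" using d by (simp add: powr_add[symmetric] algebra_simps)
  have e2: "exp (l * t) * exp (- (l * (t - s))) = exp (l * s)" by (simp add: exp_add[symmetric] algebra_simps)
  have "(t - s) powr (b - 1) * (exp (l * s) * s powr (- a)) = exp (l * t) * ((t - s) powr (d - 1) * s powr (- a)) * ((t - s) powr d * exp (- (l * (t - s))))"
  unfolding e1[symmetric] e2[symmetric] by (simp only: ac_simps)
  also note le
  finally have "(t - s) powr (b - 1) * (exp (l * s) * s powr (- a)) <= exp (l * t) * (Cd * l powr (- d)) * ((t - s) powr (d - 1) * s powr (- a))"
  by (simp only: ac_simps)
  then show ?thesis using True Cd by (simp add: g_def emult)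
  qed auto
  qed
  also have "... = EN (exp (l * t) * (Cd * l powr (- d))) * fint d (%s. EN (s powr ((1 - a) - 1))) t"
  unfolding fint_def by (rule nn_integral_cmult) measurable
  also have "... <= EN (exp (l * t) * (Cd * l powr (- d))) * EN (Beta (1 - a) d * t powr ((1 - a) + d - 1))"
  using a d by (intro mult_left_mono fint_powr) auto
  also have "... <= EN (exp (l * t) * (Cd * l powr (- d))) * EN (Beta (1 - a) d * (T powr d * t powr (- a)))"
  proof -
  have "t powr ((1 - a) + d - 1) = t powr d * t powr (- a)" by (simp add: powr_add[symmetric])
  also have "... <= T powr d * t powr (- a)" using t d by (intro mult_right_mono powr_mono2) auto
  finally show ?thesis using beta by (intro mult_left_mono ennreal_leI) auto
  qed
  finally have "EN C * fint b g t <= EN C * (EN (exp (l * t) * (Cd * l powr (- d))) * EN (Beta (1 - a) d * (T powr d * t powr (- a))))" by (rule mult_left_mono) simp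
  also have "... = EN ((P * l powr (- d)) * (exp (l * t) * t powr (- a)))" using C Cd beta by (simp add: emult P_def ac_simps)
  also have "... <= EN (1/2 * (exp (l * t) * t powr (- a)))" by (intro ennreal_leI mult_right_mono l1) auto
  also have "... = EN (1/2) * g t" unfolding g_def by (rule ennreal_mult) auto
  finally show ?thesis .
 qed
 have main: "AEl t. 0 < t & t < T --> vp t <= EN (2 * exp (l * T) * A * t powr (-a))"
  if [measurable]: "vp \<in> Bm" and fin: "(NN s. (if 0 < s & s < T then vp s else 0)) < top" and A: "0 <= A"
  and ineq: "AEl t. 0 < t & t < T --> vp t <= EN (A * t powr (-a)) + EN C * fint b vp t" for A vp
 proof -
  define \<psi> where "\<psi> = (%t. EN (2 * A) * g t)"
  define D where "D = (%t. if 0 < t & t < T then vp t - \<psi> t else 0)"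
  have [measurable]: "\<psi> \<in> Bm" unfolding \<psi>_def by measurable
  have [measurable]: "D \<in> Bm" unfolding D_def by measurable
  have Dle: "AEl t. D t <= (if 0 < t & t < T then EN C * fint b D t else 0)"
  using ineq
  proof eventually_elim
  case (elim t)
  show ?case
  proof (cases "0 < t & t < T")
  case True
  have "fint b vp t <= fint b (%s. \<psi> s + D s) t" using True
  by (intro fint_mono_AE) (auto simp: D_def intro!: always_eventually le_add)
  also have "... = EN (2 * A) * fint b g t + fint b D t" unfolding \<psi>_def by (simp add: fint_add fint_cmult)
  finally have "EN C * fint b vp t <= EN (2 * A) * (EN C * fint b g t) + EN C * fint b D t"
  by (rule order_trans[OF mult_left_mono]) (auto simp: distrib_left ac_simps)
  also have "... <= EN (2 * A) * (EN (1/2) * g t) + EN C * fint b D t" using super True by (intro add_right_mono mult_left_mono) auto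
  finally have "vp t <= EN (A * t powr (-a)) + (EN (2 * A) * (EN (1/2) * g t) + EN C * fint b D t)"
  using elim True by (meson add_left_mono order_trans)
  also have "EN (2 * A) * (EN (1/2) * g t) = (EN (2 * A) * EN (1/2)) * g t" by (simp only: mult.assoc)
  also have "EN (2 * A) * EN (1/2) = EN A" using A by (subst emult) auto
  also have "EN (A * t powr (-a)) + (EN A * g t + EN C * fint b D t) <= EN A * g t + (EN A * g t + EN C * fint b D t)"
  proof -
  have "t powr (-a) <= exp (l * t) * t powr (-a)" using mult_right_mono[of 1 "exp (l * t)" "t powr (-a)"] True l by simp
  then show ?thesis using A unfolding g_def by (intro add_right_mono) (simp add: emult mult_left_mono)
  qed
  also have "... = \<psi> t + EN C * fint b D t" 
  proof -
  have "EN (2 * A) = EN A + EN A" using A by (simp add: ennreal_plus[symmetric] del: ennreal_plus)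
  then show ?thesis by (simp add: \<psi>_def distrib_right add.assoc)
  qed
  finally have "vp t - \<psi> t <= EN C * fint b D t"
  by (auto simp: ennreal_minus_le_iff \<psi>_def g_def ennreal_mult_eq_top_iff)
  then show ?thesis using True by (simp add: D_def)
  qed (auto simp: D_def)
  qed
  define X where "X = (NN s. (if 0 < s then EN (exp (- l * s)) * D s else 0))"
  have "X <= (NN s. (if 0 < s & s < T then vp s else 0))" unfolding X_def
  proof (rule nn_integral_mono)
  fix s :: real
  have "EN (exp (- l * s)) * (vp s - \<psi> s) <= 1 * vp s" if "0 < s" using l that by (intro mult_mono) (auto simp: diff_le_self_ennreal)
  then show "(if 0 < s then EN (exp (- l * s)) * D s else 0) <= (if 0 < s & s < T then vp s else 0)" by (auto simp: D_def)
  qed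
  then have Xfin: "X < top" using fin by (rule le_less_trans)
  have "X <= (NN t. EN C * (EN (exp (- l * t)) * fint b D t))" unfolding X_def
  proof (rule nn_integral_mono_AE)
  show "AEl s. (if 0 < s then EN (exp (- l * s)) * D s else 0) <= EN C * (EN (exp (- l * s)) * fint b D s)"
  using Dle
  proof eventually_elim
  case (elim s)
  then have "D s <= EN C * fint b D s" by (auto split: if_splits)
  then have "EN (exp (- l * s)) * D s <= EN (exp (- l * s)) * (EN C * fint b D s)" by (rule mult_left_mono) simp
  then show ?case by (auto simp: mult.left_commute)
  qed
  qed
  also have "... = EN C * (NN t. EN (exp (- l * t)) * fint b D t)" by (rule nn_integral_cmult) (unfold measurable_lborel2, measurable)
  also have "... <= EN C * (EN (Gamma b * l powr (- b)) * X)" unfolding X_def using b l by (intro mult_left_mono fint_exp_weight) auto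
  also have "... = EN (C * (Gamma b * l powr (- b))) * X" using C G by (simp add: ennreal_mult mult.assoc)
  also have "... <= EN (1/2) * X" by (intro mult_right_mono ennreal_leI l2) simp
  finally have "X <= EN (1/2) * X" .
  then have "X = 0" using Xfin
  proof (cases X)
  case (real r)
  then have "EN r <= EN (1/2 * r)" using \<open>X <= EN (1/2) * X\<close> by (subst ennreal_mult) auto
  then have "r <= 1/2 * r" using real by (subst (asm) ennreal_le_iff) auto
  then show ?thesis using real by simp
  qed simp
  then have "AEl s. (if 0 < s then EN (exp (- l * s)) * D s else 0) = 0"
  unfolding X_def by (subst (asm) nn_integral_0_iff_AE) (unfold measurable_lborel2, measurable)
  then show ?thesis
  proof eventually_elim
  case (elim t)
  show ?case
  proof
  assume t: "0 < t & t < T"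
  have "vp t - \<psi> t = 0" using elim t by (auto simp: D_def ennreal_eq_0_iff)
  then have "vp t <= \<psi> t" by (simp add: diff_eq_0_iff_ennreal)
  also have "... <= EN (2 * exp (l * T) * A * t powr (-a))"
  proof -
  have "exp (l * t) <= exp (l * T)" using t l by simp
  then have "2 * A * (exp (l * t) * t powr (- a)) <= 2 * A * (exp (l * T) * t powr (- a))" using A by (intro mult_left_mono mult_right_mono) auto
  then show ?thesis using A by (simp add: \<psi>_def g_def emult ac_simps)
  qed
  finally show "vp t <= EN (2 * exp (l * T) * A * t powr (-a))" .
  qed
  qed
 qed
 show ?thesis by (rule exI[of _ "2 * exp (l * T)"]) (use main in auto)
qed

section \<open>Weighted estimates for the Duhamel formula\<close>

lemma Nm_holder_add:
 assumes [measurable]: "f \<in> Bm" "g \<in> Bm" and ij: "0 <= i" "0 <= j"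
 shows "Nm (i + j) (%x. f x * g x) <= Nm i f * Nm j g"
proof (cases "i + j = 0")
 case True
 then have z: "i = 0" "j = 0" using ij by auto
 have "AEl x. f x * g x <= Nm 0 f * Nm 0 g"
  using AE_le_Nm0[of f] AE_le_Nm0[of g] by (auto elim!: eventually_elim2 intro!: mult_mono)
 then show ?thesis unfolding z by (simp add: Nm0_le)
next
 case False
 define s where "s = i + j"
 have s: "0 < s" using False ij by (simp add: s_def)
 have "(NN x. epow (f x) (1/s) * epow (g x) (1/s)) <= Nm (i/s) (%x. epow (f x) (1/s)) * Nm (1 - i/s) (%x. epow (g x) (1/s))"
  using s ij by (intro Nm_holder) (auto simp: s_def)
 also have "Nm (i/s) (%x. epow (f x) (1/s)) = epow (Nm i f) (1/s)" using Nm_epow[of f i "1/s"] s ij by simp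
 also have "1 - i/s = 1/s * j" using s by (simp add: s_def field_simps)
 also have "Nm (1/s * j) (%x. epow (g x) (1/s)) = epow (Nm j g) (1/s)" using s ij by (intro Nm_epow) auto
 finally have "epow (NN x. epow (f x) (1/s) * epow (g x) (1/s)) s <= epow (epow (Nm i f) (1/s) * epow (Nm j g) (1/s)) s"
  using s by (intro epow_mono) auto
 then show ?thesis unfolding s_def[symmetric] using s by (simp add: Nm_pos epow_mult epow_inverse')
qed

lemma Nm_add:
 fixes f g :: "'a::euclidean_space => ennreal"
 assumes [measurable]: "f \<in> Bm" "g \<in> Bm" and i: "0 <= i" "i <= 1"
 shows "Nm i (%x. f x + g x) <= Nm i f + Nm i g"
proof -
 have sf: "sigma_finite_measure (count_space (UNIV :: bool set))" by (intro sigma_finite_measure_count_space_finite) auto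
 have "(%(b, x). if b then f x else g x) \<in> borel_measurable (count_space (UNIV :: bool set) \<Otimes>\<^sub>M borel)" by measurable
 from minkowski_integral[OF sf this _ i, of "%b. if b then Nm i f else Nm i g"]
 have "Nm i (%x. \<integral>\<^sup>+b. (if b then f x else g x) \<partial>count_space UNIV) <= (\<integral>\<^sup>+b. (if b then Nm i f else Nm i g) \<partial>count_space UNIV)"
  by (auto simp: cong: if_cong intro!: always_eventually)
 then show ?thesis by (simp add: nn_integral_count_space_finite UNIV_bool add.commute)
qed

text \<open>Hoelder's inequality for \<open>w g^p = g^(p-1) (w g)\<close>: only one factor carries the weight.\<close>

lemma weighted_power:
 fixes g w :: "'a::euclidean_space => ennreal"
 assumes [measurable]: "g \<in> Bm" "w \<in> Bm" and p: "1 < p" and i: "0 <= i" "0 <= ib"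
 shows "Nm ((p - 1) * i + ib) (%x. w x * epow (g x) p) <= epow (Nm i g) (p - 1) * Nm ib (%x. w x * g x)"
proof -
 have "w x * epow (g x) p = epow (g x) (p - 1) * (w x * g x)" for x
  using epow_add[of "p - 1" 1 "g x"] p by (simp add: ac_simps)
 then have "Nm ((p - 1) * i + ib) (%x. w x * epow (g x) p) <= Nm ((p - 1) * i) (%x. epow (g x) (p - 1)) * Nm ib (%x. w x * g x)"
  using p i by (simp add: Nm_holder_add)
 also have "Nm ((p - 1) * i) (%x. epow (g x) (p - 1)) = epow (Nm i g) (p - 1)" using p i by (intro Nm_epow) auto
 finally show ?thesis .
qed

lemma Nm_om_finite:
 assumes e: "0 < e" and i: "0 <= i" "i <= 1" and k: "0 <= k" "real DIM('a) / 2 * (1 - i) < k"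
 shows "Nm (1 - i) (%x. EN (om e k (x::'a::euclidean_space))) < top"
proof (cases "i = 1")
 case True
 have "Nm 0 (%x. EN (om e k (x::'a))) <= 1" by (intro Nm0_le) (simp add: om_le_1 k)
 then show ?thesis using True by (simp add: le_less_trans)
next
 case False
 then have i1: "0 < 1 - i" using i by simp
 have "epow (EN (om e k x)) (1/(1 - i)) = EN (om e (k / (1 - i)) x)" for x :: 'a
  using i1 om_pos[of e k x] by (subst epow_ennreal) (auto simp: om_def powr_powr)
 moreover have "(NN x. EN (om e (k / (1 - i)) (x::'a))) < top"
  using nn_integral_om[OF e, of "k / (1 - i)", where 'a='a] k i1 by (simp add: field_simps)
 ultimately show ?thesis using i1 by (simp add: Nm_pos less_top[symmetric] epow_eq_top_iff)
qed

context
 fixes al be p :: real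
 assumes ab: "0 < al" "al < 1" "0 < be" "be <= 1"
begin

lemma potential_integrand_measurable:
 fixes f :: "real => 'a::euclidean_space => ennreal"
 assumes [measurable]: "(%(s, x). f s x) \<in> Bm2"
 shows "(%(s, x). if 0 < s & s < t then conv (Yn al be (t - s)) (f s) x else 0) \<in> Bm2"
proof -
 note [measurable] = Yn_measurable[OF ab]
 show ?thesis by measurable
qed

lemma potential_bound:
 assumes i: "0 <= ib" "ib <= ic" "ic <= 1" and k: "0 <= k" "k < be" and E: "real DIM('a) / 2 * (ic - ib) < be" and T: "0 < T"
 shows "\<exists>C\<ge>0. \<forall>t e f F. 0 < t --> t <= T --> 0 <= e --> e <= 1 --> (%(s, x). f s x) \<in> Bm2 --> F \<in> Bm -->
  (AEl s. 0 < s & s < t --> Nm ic (%x::'a::euclidean_space. EN (om e k x) * f s x) <= F s) -->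
  Nm ib (%x. EN (om e k x) * (NN s. (if 0 < s & s < t then conv (Yn al be (t - s)) (f s) x else 0)))
  <= EN C * fint (al - al * (real DIM('a) / 2 * (ic - ib)) / be) F t"
proof -
 define b where "b = al - al * (real DIM('a) / 2 * (ic - ib)) / be"
 have bb: "b - 1 = al - 1 - al * (real DIM('a) / 2 * (ic - ib)) / be" by (simp add: b_def)
 obtain C where C: "0 <= C" "!!t e f. 0 < t ==> t <= T ==> 0 <= e ==> e <= 1 ==> f \<in> Bm ==>
  Nm ib (%x::'a. EN (om e k x) * conv (Yn al be t) f x) <= EN (C * t powr (b - 1)) * Nm ic (%x. EN (om e k x) * f x)"
  using Yn_bound[OF ab i k E T] unfolding bb[symmetric] by blast
 have "Nm ib (%x. EN (om e k x) * (NN s. (if 0 < s & s < t then conv (Yn al be (t - s)) (f s) x else 0))) <= EN C * fint b F t"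
  if t: "0 < t" "t <= T" and e: "0 <= e" "e <= 1" and fm[measurable]: "(%(s, x). f s x) \<in> Bm2" and Fm[measurable]: "F \<in> Bm"
  and F: "AEl s. 0 < s & s < t --> Nm ic (%x::'a. EN (om e k x) * f s x) <= F s" for t e F and f :: "real => 'a => ennreal"
 proof -
  let ?q = "%s x. if 0 < s & s < t then conv (Yn al be (t - s)) (f s) x else 0"
  note qm[measurable] = potential_integrand_measurable[OF fm, of t]
  have qs: "(%s. ?q s x) \<in> borel_measurable lborel" for x unfolding measurable_lborel2 using qm by measurable
  have 1: "EN (om e k x) * (NN s. ?q s x) = (NN s. EN (om e k x) * ?q s x)" for x
  by (rule nn_integral_cmult[symmetric, OF qs])
  have "(%(s, x). EN (om e k x) * ?q s x) \<in> Bm2" using qm by measurable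
  then have m: "(%(s, x). EN (om e k x) * ?q s x) \<in> borel_measurable (lborel \<Otimes>\<^sub>M borel)"
  by (simp only: measurable_cong_sets[OF sets_pair_measure_cong[OF sets_lborel refl] refl])
  have "Nm ib (%x. (NN s. EN (om e k x) * ?q s x)) <= (NN s. (if 0 < s & s < t then EN C * (EN ((t - s) powr (b - 1)) * F s) else 0))"
  proof (rule minkowski_integral[OF _ m])
  show "(%s. if 0 < s & s < t then EN C * (EN ((t - s) powr (b - 1)) * F s) else 0) \<in> borel_measurable lborel" unfolding measurable_lborel2 by measurable
  show "AEl s. Nm ib (%x. EN (om e k x) * ?q s x) <= (if 0 < s & s < t then EN C * (EN ((t - s) powr (b - 1)) * F s) else 0)"
  using F
  proof eventually_elim
  case (elim s)
  show ?case
  proof (cases "0 < s & s < t")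
  case True
  have [measurable]: "f s \<in> Bm" using fm by measurable
  have "Nm ib (%x. EN (om e k x) * conv (Yn al be (t - s)) (f s) x) <= EN (C * (t - s) powr (b - 1)) * Nm ic (%x. EN (om e k x) * f s x)"
  using True t e by (intro C) auto
  also have "... <= EN (C * (t - s) powr (b - 1)) * F s" using elim True by (intro mult_left_mono) auto
  finally show ?thesis using True C by (simp add: ennreal_mult mult.assoc)
  next
  case False
  then have "(%x. EN (om e k x) * ?q s x) = (%x. 0)" by auto
  then show ?thesis using i by (simp only:) (simp add: Nm_zero)
  qed
  qed
  qed (use i in \<open>auto simp: sigma_finite_lborel\<close>)
  also have "... = EN C * fint b F t" unfolding fint_def
  by (subst nn_integral_cmult[symmetric]) (auto intro!: nn_integral_cong)
  finally show ?thesis unfolding 1 .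
 qed
 then show ?thesis using C unfolding b_def[symmetric] by blast
qed

lemma duhamel_Nm_split:
 fixes u0 :: "'a::euclidean_space => ennreal"
 assumes [measurable]: "u0 \<in> Bm" "(%(t, x). U t x) \<in> Bm2" and i: "0 <= i" "i <= 1"
 shows "Nm i (%x. EN (om e k x) * duhamel al be p u0 U t x) <= Nm i (%x. EN (om e k x) * conv (Zn al be t) u0 x) +
  Nm i (%x. EN (om e k x) * (NN s. (if 0 < s & s < t then conv (Yn al be (t - s)) (%y. epow (U s y) p) x else 0)))"
proof -
 note [measurable] = Zn_measurable[OF ab] Yn_measurable[OF ab]
 have "(%(s, y). epow (U s y) p) \<in> Bm2" by measurable
 from potential_integrand_measurable[OF this, of t]
 have "(%(x, s). if 0 < s & s < t then conv (Yn al be (t - s)) (%y. epow (U s y) p) x else 0) \<in> Bm2" by measurable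
 then have [measurable]: "(%x. (NN s. (if 0 < s & s < t then conv (Yn al be (t - s)) (%y. epow (U s y) p) x else 0))) \<in> Bm"
  by (rule nn_integral_lborel_measurable)
 show ?thesis unfolding duhamel_def distrib_left by (rule Nm_add) (use i in measurable)
qed

text \<open>The weight varies by at most \<open>2^k (1 + |z|^2)^k\<close> over a distance \<open>|z|\<close>, and \<open>1 + z^2 \<le> 2 R^2 exp (z/R)\<close> for \<open>R \<ge> 1\<close>.\<close>

lemma om_lower:
 assumes T: "0 < T" and k: "0 <= k" "k <= 1"
 shows "\<exists>c>0. \<forall>e r. 0 <= e --> e <= 1 --> 0 < r --> r <= T --> (\<forall>x::'a::euclidean_space. EN c * EN (om e k x) <= conv (Zn al be r) (%x. EN (om e k x)) x &
  EN (c * r powr (al - 1)) * EN (om e k x) <= conv (Yn al be r) (%x. EN (om e k x)) x)"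
proof -
 obtain c where c: "0 < c" and low: "!!t R a vp x. 0 < t ==> 0 < R ==> t powr (al / be) <= R\<^sup>2 ==> vp \<in> Bm ==>
  (!!x y. a * EN (exp (- norm (x - y) / R)) * vp x <= vp y) ==>
  EN c * a * vp (x::'a) <= conv (Zn al be t) vp x & EN (c * t powr (al - 1)) * a * vp x <= conv (Yn al be t) vp x"
  using conv_lower[OF ab, where 'a='a] by metis
 define R where "R = max 1 (T powr (al / be))"
 have R: "1 <= R" "0 < R" by (auto simp: R_def)
 have TR: "T powr (al / be) <= R\<^sup>2"
  using R self_le_power[of R 2] by (auto simp: R_def)
 define a where "a = 1 / (2 powr k * (2 * R\<^sup>2))"
 have a: "0 < a" using R by (simp add: a_def)
 have key: "a * exp (- norm (x - y) / R) * om e k x <= om e k y" if e: "0 <= e" "e <= 1" for e and x y :: 'a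
 proof -
  define z where "z = norm (x - y)"
  have z: "0 <= z" by (simp add: z_def)
  have "1 + z / R + (z / R)\<^sup>2 / 2 <= exp (z / R)" using z R by (intro exp_lower_Taylor_quadratic) auto
  then have "2 * R\<^sup>2 * (1 + z / R + (z / R)\<^sup>2 / 2) <= 2 * R\<^sup>2 * exp (z / R)" by (rule mult_left_mono) simp
  moreover have "2 * R\<^sup>2 * (1 + z / R + (z / R)\<^sup>2 / 2) = 2 * R\<^sup>2 + 2 * R * z + z\<^sup>2" using R by (simp add: field_simps power2_eq_square)
  moreover have "1 <= R\<^sup>2" "0 <= R * z" using R z by (auto simp: one_le_power)
  ultimately have "1 + z\<^sup>2 <= 2 * R\<^sup>2 * exp (z / R)" by linarith
  moreover have "(1 + z\<^sup>2) powr k <= (1 + z\<^sup>2) powr 1" using k by (intro powr_mono) auto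
  ultimately have "(1 + z\<^sup>2) powr k <= 2 * R\<^sup>2 * exp (z / R)" by simp
  then have le: "2 powr k * (1 + z\<^sup>2) powr k * om e k y <= 2 powr k * (2 * R\<^sup>2 * exp (z / R)) * om e k y" using om_pos[of e k y] by (intro mult_right_mono mult_left_mono) auto
  have "om e k x <= 2 powr k * (1 + z\<^sup>2) powr k * om e k y" unfolding z_def by (rule om_peetre[OF e k(1)])
  also note le
  finally have "om e k x <= 2 powr k * (2 * R\<^sup>2 * exp (z / R)) * om e k y" .
  then have "a * exp (- z / R) * om e k x <= a * exp (- z / R) * (2 powr k * (2 * R\<^sup>2 * exp (z / R)) * om e k y)" using a by (intro mult_left_mono) auto
  also have "... = (a * (2 powr k * (2 * R\<^sup>2))) * (exp (- z / R) * exp (z / R)) * om e k y" by (simp only: ac_simps)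
  also have "... = om e k y" using R by (simp add: a_def exp_add[symmetric])
  finally show ?thesis by (simp add: z_def)
 qed
 have "EN (c * a) * EN (om e k x) <= conv (Zn al be r) (%x. EN (om e k x)) x &
  EN ((c * a) * r powr (al - 1)) * EN (om e k x) <= conv (Yn al be r) (%x. EN (om e k x)) x"
  if e: "0 <= e" "e <= 1" and r: "0 < r" "r <= T" for e r and x :: 'a
 proof -
  have "r powr (al / be) <= T powr (al / be)" using r ab by (intro powr_mono2) auto
  then have rR: "r powr (al / be) <= R\<^sup>2" using TR by linarith
  have "EN c * EN a * EN (om e k x) <= conv (Zn al be r) (%x. EN (om e k x)) x &
  EN (c * r powr (al - 1)) * EN a * EN (om e k x) <= conv (Yn al be r) (%x. EN (om e k x)) x"
  proof (rule low[OF r(1) R(2) rR])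
  fix x y :: 'a
  have "EN (a * exp (- norm (x - y) / R) * om e k x) <= EN (om e k y)" using key[OF e] by (rule ennreal_leI)
  then show "EN a * EN (exp (- norm (x - y) / R)) * EN (om e k x) <= EN (om e k y)"
  using a by (simp only: ennreal_mult less_imp_le[OF om_pos] less_imp_le mult_nonneg_nonneg exp_ge_zero)
  qed simp
  then show ?thesis using c a by (simp add: emult less_imp_le ac_simps)
 qed
 then show ?thesis using c a by (intro exI[of _ "c * a"]) auto
qed

end

section \<open>Gain of integrability\<close>

text \<open>The bound is known at almost every \<open>t\<close>; monotonicity extends it to every \<open>t < T\<close> and monotone convergence to \<open>T\<close>.\<close>

lemma cumulative_bound:
 fixes F :: "real => ennreal"
 assumes [measurable]: "F \<in> Bm" and T: "0 < T"
  and K: "AEl t. 0 < t & t < T --> (NN s. (if 0 < s & s < t then F s else 0)) <= K"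
 shows "(NN s. (if 0 < s & s < T then F s else 0)) <= K"
proof -
 define J where "J = (%t. (NN s. (if 0 < s & s < t then F s else 0)))"
 have Jmono: "J t1 <= J t2" if "t1 <= t2" for t1 t2 unfolding J_def using that by (intro nn_integral_mono) auto
 have JK: "J t <= K" if t: "t < T" for t
 proof (rule ccontr)
  assume n: "~ J t <= K"
  have "AEl t'. t' \<notin> {max t 0<..<T}" using K
  proof eventually_elim
  case (elim t')
  show ?case
  proof
  assume "t' \<in> {max t 0<..<T}"
  then have "t <= t'" "J t' <= K" using elim by (auto simp: J_def)
  then show False using n Jmono[of t t'] by (meson order_trans)
  qed
  qed
  then have "emeasure lborel {max t 0<..<T} = 0"
  by (subst (asm) AE_iff_measurable[OF _ refl]) (auto simp: greaterThanLessThan_def greaterThan_def lessThan_def Int_def conj_commute conj_left_commute)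
  then show False using t T by simp
 qed
 define r where "r = (%n. T - T / (real n + 1))"
 have r: "incseq r" "r n < T" for n using T by (auto simp: r_def incseq_def intro!: divide_left_mono)
 have lim: "r \<longlonglongrightarrow> T" unfolding r_def by real_asymp
 have "(if 0 < s & s < T then F s else 0) = (SUP n. (if 0 < s & s < r n then F s else 0))" for s
 proof (rule antisym)
  show "(SUP n. (if 0 < s & s < r n then F s else 0)) <= (if 0 < s & s < T then F s else 0)"
  by (rule SUP_least) (auto dest: less_trans[OF _ r(2)])
  show "(if 0 < s & s < T then F s else 0) <= (SUP n. (if 0 < s & s < r n then F s else 0))"
  proof (cases "0 < s & s < T")
  case True
  then have "eventually (%n. s < r n) sequentially" using lim by (auto simp: order_tendsto_iff)
  then obtain n where "s < r n" by (auto simp: eventually_sequentially)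
  then show ?thesis using True by (intro SUP_upper2[of n]) auto
  qed auto
 qed
 then have "(NN s. (if 0 < s & s < T then F s else 0)) = (NN s. (SUP n. (if 0 < s & s < r n then F s else 0)))" by simp
 also have "... = (SUP n. J (r n))" unfolding J_def
  by (rule nn_integral_monotone_convergence_SUP)
  (use r(1) in \<open>auto simp: incseq_def le_fun_def intro: less_le_trans\<close>)
 also have "... <= K" by (rule SUP_least) (rule JK[OF r(2)])
 finally show ?thesis .
qed

context
 fixes al be p i ib ic :: real
 assumes ab: "0 < al" "al < 1" "0 < be" "be <= 1"
  and p: "1 < p" "p < 2" "real DIM('a::euclidean_space) / 2 * (p - 1) < be" and i: "0 <= i" "i <= 1"
  and ib_def: "ib = min i (1 - (p - 1) * i)" and ic_def: "ic = (p - 1) * i + ib"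
begin

lemma exponent_order: "0 <= ib" "ib <= i" "i <= ic" "ib <= ic" "ic <= 1"
proof -
 have "(p - 1) * i <= 1 * 1" using p i by (intro mult_mono) auto
 moreover have "0 <= (p - 1) * i" using p i by simp
 ultimately show "0 <= ib" "ib <= i" "i <= ic" "ib <= ic" "ic <= 1" using i by (auto simp: ib_def ic_def min_def)
qed

lemma exponent_gaps:
 "real DIM('a) / 2 * (ic - ib) < be" "real DIM('a) / 2 * (i - ib) < be" "real DIM('a) / 2 * (ic - i) < be"
proof -
 have pi: "(p - 1) * i <= p - 1" using p i by (simp add: mult_left_le)
 have "ic - ib <= p - 1" "i - ib <= p - 1" "ic - i <= p - 1" using pi mult_left_le[of i p] i p by (auto simp: ic_def ib_def min_def algebra_simps)
 then have "real DIM('a) / 2 * (ic - ib) <= real DIM('a) / 2 * (p - 1)" "real DIM('a) / 2 * (i - ib) <= real DIM('a) / 2 * (p - 1)"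
  "real DIM('a) / 2 * (ic - i) <= real DIM('a) / 2 * (p - 1)" by (auto intro!: mult_left_mono)
 then show "real DIM('a) / 2 * (ic - ib) < be" "real DIM('a) / 2 * (i - ib) < be" "real DIM('a) / 2 * (ic - i) < be" using p by linarith+
qed

lemma time_exponent: "0 <= x ==> x < be ==> 0 <= al * x / be & al * x / be < al"
 using ab by (auto simp: divide_less_eq)

text \<open>Here \<open>i = 1/q\<close>. The index \<open>ib\<close> is \<open>i\<close> if \<open>p i \<le> 1\<close>, and otherwise the largest one for which bounds in \<open>L^(1/i)\<close> and \<open>L^(1/ib)\<close>
place \<open>u^p\<close> in \<open>L^1\<close>; in both cases \<open>u^p\<close> lies in \<open>L^(1/ic)\<close>. The weighted norm \<open>\<phi>\<close> in \<open>L^(1/ib)\<close> satisfies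
\<open>\<phi>(t) \<le> C t^(-a) + C fint b \<phi> t\<close>, where the bound on \<open>u\<close> in \<open>L^q\<close> is spent on the factor \<open>u^(p-1)\<close>. That \<open>\<phi>\<close> is integrable follows for
\<open>1 < p i\<close> from a lower bound: pairing the Duhamel formula with the weight controls the weighted integral of \<open>u^p\<close> by
the norm of \<open>u(t)\<close> in \<open>L^q\<close>. Then the weight is removed by \<open>e \<rightarrow> 0\<close>.\<close>

theorem smoothing:
 fixes u0 :: "'a => ennreal"
 assumes m: "mild al be p u0 U T'" and T: "0 < T" "ereal T <= T'" and A0: "0 <= A0" "Nm i u0 <= EN A0"
  and CB: "0 <= CB" "AEl t. 0 < t & t < T --> Nm i (U t) <= EN CB"
 shows "\<exists>M\<ge>0. AEl t. 0 < t & t < T --> Nm ib (U t) <= EN (M * A0 * t powr (- (al * (real DIM('a) / 2 * (i - ib)) / be)))"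
proof -
 have um[measurable]: "u0 \<in> Bm" and Um[measurable]: "(%(t, x). U t x) \<in> Bm2" using m by (auto simp: mild_def)
 have Us[measurable]: "U t \<in> Bm" for t using Um by measurable
 define d where "d = real DIM('a) / 2"
 have d: "0 < d" by (simp add: d_def)
 define a where "a = al * (d * (i - ib)) / be"
 define b where "b = al - al * (d * (ic - ib)) / be"
 note eo = exponent_order and eg = exponent_gaps[folded d_def]
 have "0 <= a & a < al" unfolding a_def by (rule time_exponent) (use eo eg d in auto)
 then have a: "0 <= a" "a < 1" using ab by auto
 have "al * (d * (ic - ib)) / be < al" by (rule time_exponent[THEN conjunct2]) (use eo eg d in auto)
 then have b: "0 < b" by (simp add: b_def)
 have "\<exists>k. 0 <= k & k < be & (1 < p * i --> d * (1 - i) < k)"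
 proof (cases "1 < p * i")
  case True
  have "1 - i <= (p - 1) * i" using True by (simp add: algebra_simps)
  then have "1 - i <= p - 1" using p i by (smt (verit) mult_left_le)
  then have "d * (1 - i) <= d * (p - 1)" using d by (intro mult_left_mono) auto
  also have "d * (p - 1) < be" unfolding d_def by (rule p(3))
  finally have "d * (1 - i) < be" .
  moreover have "0 <= d * (1 - i)" using d i by simp
  ultimately have "d * (1 - i) < be" "0 <= d * (1 - i)" by auto
  then show ?thesis using True by (intro exI[of _ "(d * (1 - i) + be) / 2"]) auto
 qed (use ab in auto)
 then obtain k where k: "0 <= k" "k < be" "1 < p * i ==> d * (1 - i) < k" by auto
 define om' where "om' = (%e (x::'a). EN (om e k x))"
 have [measurable]: "om' e \<in> Bm" for e unfolding om'_def by measurable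
 have om1: "om' e x <= 1" for e x by (simp add: om'_def om_le_1 k)
 have om_mult: "om' e x * z <= z" for e x z using mult_right_mono[OF om1[of e x], of z] by simp
 obtain C1 where C1: "0 <= C1" "!!t e f. 0 < t ==> t <= T ==> 0 <= e ==> e <= 1 ==> f \<in> Bm ==>
  Nm ib (%x. om' e x * conv (Zn al be t) f x) <= EN (C1 * t powr (- a)) * Nm i (%x. om' e x * f x)"
  using Zn_bound[OF ab eo(1,2) i(2) k(1,2) eg(2)[unfolded d_def] T(1)] unfolding a_def d_def om'_def by blast
 obtain C2 where C2: "0 <= C2" "!!t e f F. 0 < t ==> t <= T ==> 0 <= e ==> e <= 1 ==> (%(s, x). f s x) \<in> Bm2 ==> F \<in> Bm ==>
  (AEl s. 0 < s & s < t --> Nm ic (%x. om' e x * f s x) <= F s) ==>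
  Nm ib (%x. om' e x * (NN s. (if 0 < s & s < t then conv (Yn al be (t - s)) (f s) x else 0))) <= EN C2 * fint b F t"
  using potential_bound[OF ab eo(1,4,5) k(1,2) eg(1)[unfolded d_def] T(1)] unfolding b_def d_def om'_def by blast
 define L where "L = CB powr (p - 1)"
 have L: "0 <= L" by (simp add: L_def)
 define vp where "vp = (%e t. Nm ib (%x. om' e x * U t x))"
 define F where "F = (%e t. Nm ic (%x. om' e x * epow (U t x) p))"
 have jm: "(%(t, x). om' e x * U t x) \<in> Bm2" "(%(t, x). om' e x * epow (U t x) p) \<in> Bm2"
  and pm: "(%(t, x). epow (U t x) p) \<in> Bm2" for e by measurable
 have phm[measurable]: "vp e \<in> Bm" for e unfolding vp_def by (rule Nm_measurable[OF jm(1) eo(1)])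
 have Fm[measurable]: "F e \<in> Bm" for e unfolding F_def using eo by (intro Nm_measurable[OF jm(2)]) auto
 have FL: "AEl s. 0 < s & s < T --> F e s <= EN L * vp e s" for e
  using CB(2)
 proof eventually_elim
  case (elim s)
  show ?case
  proof
  assume s: "0 < s & s < T"
  have "F e s <= epow (Nm i (U s)) (p - 1) * vp e s" unfolding F_def vp_def ic_def using p i eo by (intro weighted_power) auto
  also have "... <= epow (EN CB) (p - 1) * vp e s" using elim s p by (intro mult_right_mono epow_mono) auto
  also have "epow (EN CB) (p - 1) = EN L" using CB p by (simp add: epow_ennreal L_def)
  finally show "F e s <= EN L * vp e s" .
  qed
 qed
 have mAE: "AEl t. 0 < t & t < T --> (AEl x. U t x = duhamel al be p u0 U t x)"
 proof -
  have "AEl t. 0 < t & ereal t < T' --> (AEl x. U t x = duhamel al be p u0 U t x)" using m by (simp add: mild_def)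
  then show ?thesis by eventually_elim (use T in \<open>auto intro: less_le_trans[of _ "ereal T"]\<close>)
 qed
 have ineq: "AEl t. 0 < t & t < T --> vp e t <= EN (C1 * A0 * t powr (- a)) + EN C2 * fint b (F e) t" if e: "0 <= e" "e <= 1" for e
  using mAE
 proof eventually_elim
  case (elim t)
  show ?case
  proof
  assume t: "0 < t & t < T"
  have "vp e t = Nm ib (%x. om' e x * duhamel al be p u0 U t x)" unfolding vp_def
  using elim t eo by (intro Nm_cong_AE) (auto elim!: eventually_mono)
  also have "... <= Nm ib (%x. om' e x * conv (Zn al be t) u0 x) +
  Nm ib (%x. om' e x * (NN s. (if 0 < s & s < t then conv (Yn al be (t - s)) (%y. epow (U s y) p) x else 0)))"
  unfolding om'_def using eo by (intro duhamel_Nm_split[OF ab]) auto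
  also have "... <= EN (C1 * A0 * t powr (- a)) + EN C2 * fint b (F e) t"
  proof (rule add_mono)
  have "Nm i (%x. om' e x * u0 x) <= Nm i u0" using i by (intro Nm_mono om_mult)
  then have "Nm i (%x. om' e x * u0 x) <= EN A0" using A0 by (rule_tac order_trans)
  then have "EN (C1 * t powr (- a)) * Nm i (%x. om' e x * u0 x) <= EN (C1 * t powr (- a)) * EN A0" by (rule mult_left_mono) simp
  also have "... = EN (C1 * A0 * t powr (- a))" using C1 A0 by (simp add: emult ac_simps)
  finally show "Nm ib (%x. om' e x * conv (Zn al be t) u0 x) <= EN (C1 * A0 * t powr (- a))"
  using C1(2)[of t e u0] t e by (auto intro: order_trans)
  show "Nm ib (%x. om' e x * (NN s. (if 0 < s & s < t then conv (Yn al be (t - s)) (%y. epow (U s y) p) x else 0))) <= EN C2 * fint b (F e) t"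
  using t e by (intro C2(2)[OF _ _ e pm Fm]) (auto simp: F_def)
  qed
  finally show "vp e t <= EN (C1 * A0 * t powr (- a)) + EN C2 * fint b (F e) t" .
  qed
 qed
 have fin: "(NN s. (if 0 < s & s < T then vp e s else 0)) < top" if e: "0 < e" "e <= 1" for e
 proof (cases "1 < p * i")
  case False
  then have ibi: "ib = i" by (auto simp: ib_def min_def algebra_simps)
  have "(NN s. (if 0 < s & s < T then vp e s else 0)) <= (NN s. EN CB * indicator {0<..<T} s)"
  proof (rule nn_integral_mono_AE)
  show "AEl s. (if 0 < s & s < T then vp e s else 0) <= EN CB * indicator {0<..<T} s"
  using CB(2)
  proof eventually_elim
  case (elim s)
  have "vp e s <= Nm i (U s)" unfolding vp_def ibi using i by (intro Nm_mono om_mult)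
  then show ?case using elim by (auto intro: order_trans)
  qed
  qed
  also have "... < top" using T by (simp add: nn_integral_cmult_indicator ennreal_mult_less_top)
  finally show ?thesis .
 next
  case True
  then have ic1: "ic = 1" by (auto simp: ib_def ic_def min_def algebra_simps)
  have k1: "k <= 1" using k ab by simp
  obtain c where c: "0 < c" and low: "!!r x. 0 < r ==> r <= T ==> ennreal c * om' e x <= conv (Zn al be r) (om' e) x &
  EN (c * r powr (al - 1)) * om' e x <= conv (Yn al be r) (om' e) x"
  using om_lower[OF ab T(1) k(1) k1, where 'a='a] e less_imp_le[OF e(1)] unfolding om'_def by blast
  define K where "K = EN CB * Nm (1 - i) (om' e)"
  have K: "K < top" using Nm_om_finite[OF e(1) i k(1), where 'a='a] k(3)[OF True] by (simp add: K_def om'_def d_def ennreal_mult_less_top)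
  have "AEl t. 0 < t & t < T --> EN (c * T powr (al - 1)) * (NN s. (if 0 < s & s < t then F e s else 0)) <= K"
  using mAE CB(2)
  proof eventually_elim
  case (elim t)
  show ?case
  proof
  assume t: "0 < t & t < T"
  have FI: "F e s = (NN x. epow (U s x) p * om' e x)" for s by (simp add: F_def ic1 Nm_1 mult.commute)
  have "EN (c * T powr (al - 1)) * (NN s. (if 0 < s & s < t then F e s else 0)) <=
  EN c * (NN x. u0 x * om' e x) + EN (c * T powr (al - 1)) * (NN s. (if 0 < s & s < t then F e s else 0))" by simp
  also have "... <= (NN x. U t x * om' e x)"
  unfolding FI using t elim c low by (intro pairing_lower[OF ab m]) auto
  also have "... <= Nm i (U t) * Nm (1 - i) (om' e)" using i by (intro Nm_holder) auto
  also have "... <= K" unfolding K_def using elim t by (intro mult_right_mono) auto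
  finally show "EN (c * T powr (al - 1)) * (NN s. (if 0 < s & s < t then F e s else 0)) <= K" .
  qed
  qed
  moreover have "EN (c * T powr (al - 1)) * (NN s. (if 0 < s & s < t then F e s else 0))
  = (NN s. (if 0 < s & s < t then EN (c * T powr (al - 1)) * F e s else 0))" for t
  by (subst nn_integral_cmult[symmetric]) (auto intro!: nn_integral_cong)
  ultimately have "EN (c * T powr (al - 1)) * (NN s. (if 0 < s & s < T then F e s else 0)) <= K"
  using cumulative_bound[of "%s. EN (c * T powr (al - 1)) * F e s" T K] T by simp
  then have "EN (c * T powr (al - 1)) * (NN s. (if 0 < s & s < T then F e s else 0)) < top" using K by (rule le_less_trans)
  then have FT: "(NN s. (if 0 < s & s < T then F e s else 0)) < top"
  using c T by (auto simp: less_top[symmetric] ennreal_mult_eq_top_iff)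
  define F1 where "F1 = (%s. if 0 < s & s < T then F e s else 0)"
  have [measurable]: "F1 \<in> Bm" unfolding F1_def by measurable
  have "(NN s. (if 0 < s & s < T then vp e s else 0)) <=
  (NN t. EN (C1 * A0) * (if 0 < t & t < T then EN ((T - t) powr (1 - 1)) * EN (t powr ((1 - a) - 1)) else 0) + EN (C2 * exp T) * (EN (exp (- 1 * t)) * fint b F1 t))"
  proof (rule nn_integral_mono_AE)
  show "AEl t. (if 0 < t & t < T then vp e t else 0) <= EN (C1 * A0) * (if 0 < t & t < T then EN ((T - t) powr (1 - 1)) * EN (t powr ((1 - a) - 1)) else 0)
  + EN (C2 * exp T) * (EN (exp (- 1 * t)) * fint b F1 t)"
  using ineq[OF less_imp_le[OF e(1)] e(2)]
  proof eventually_elim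
  case (elim t)
  show ?case
  proof (cases "0 < t & t < T")
  case True
  have "fint b (F e) t <= fint b F1 t" using True by (intro fint_mono_AE) (auto simp: F1_def)
  then have "EN C2 * fint b (F e) t <= EN C2 * (1 * fint b F1 t)" by (simp add: mult_left_mono)
  also have "... <= EN C2 * ((EN (exp T) * EN (exp (- 1 * t))) * fint b F1 t)"
  using True by (intro mult_left_mono mult_right_mono) (auto simp: emult exp_add[symmetric])
  also have "... = EN (C2 * exp T) * (EN (exp (- 1 * t)) * fint b F1 t)" using C2 by (simp add: ennreal_mult ac_simps)
  finally have "EN (C1 * A0 * t powr (- a)) + EN C2 * fint b (F e) t <= EN (C1 * A0 * t powr (- a)) + EN (C2 * exp T) * (EN (exp (- 1 * t)) * fint b F1 t)"
  by (rule add_left_mono)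
  then show ?thesis using elim True C1 A0 by (auto simp: ennreal_mult intro: order_trans)
  qed auto
  qed
  qed
  also have "... = EN (C1 * A0) * fint 1 (%t. EN (t powr ((1 - a) - 1))) T + EN (C2 * exp T) * (NN t. EN (exp (- 1 * t)) * fint b F1 t)"
  unfolding fint_def[of 1] by (subst nn_integral_add, (unfold measurable_lborel2, measurable)[2], subst (1 2) nn_integral_cmult) (unfold measurable_lborel2, auto)
  also have "... < top"
  proof -
  have "fint 1 (%t. EN (t powr ((1 - a) - 1))) T < top" using fint_powr[of "1 - a" 1 T] a by (auto intro: le_less_trans)
  moreover have "(NN s. (if 0 < s then EN (exp (- 1 * s)) * F1 s else 0)) <= (NN s. (if 0 < s & s < T then F e s else 0))"
  proof (rule nn_integral_mono)
  fix s :: real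
  have "0 < s ==> ennreal (exp (- 1 * s)) * F1 s <= 1 * F1 s" by (intro mult_right_mono) auto
  then show "(if 0 < s then EN (exp (- 1 * s)) * F1 s else 0) <= (if 0 < s & s < T then F e s else 0)" by (auto simp: F1_def)
  qed
  then have "(NN s. (if 0 < s then EN (exp (- 1 * s)) * F1 s else 0)) < top" using FT by (rule le_less_trans)
  then have "(NN t. EN (exp (- 1 * t)) * fint b F1 t) < top"
  using fint_exp_weight[of F1 b 1] b by (auto simp: ennreal_mult_less_top intro: le_less_trans)
  ultimately show ?thesis by (simp add: ennreal_mult_less_top)
  qed
  finally show ?thesis .
 qed
 obtain M where M: "0 <= M" "!!A vp. vp \<in> Bm ==> (NN s. (if 0 < s & s < T then vp s else 0)) < top ==> 0 <= A ==>
  (AEl t. 0 < t & t < T --> vp t <= EN (A * t powr (-a)) + EN (C2 * L) * fint b vp t) ==>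
  (AEl t. 0 < t & t < T --> vp t <= EN (M * A * t powr (-a)))"
  using singular_gronwall[OF a b mult_nonneg_nonneg[OF C2(1) L] T(1)] by blast
 have bnd: "AEl t. 0 < t & t < T --> vp e t <= EN (M * (C1 * A0) * t powr (- a))" if e: "0 < e" "e <= 1" for e
 proof (rule M(2)[OF phm fin[OF e]])
  show "AEl t. 0 < t & t < T --> vp e t <= EN (C1 * A0 * t powr (- a)) + EN (C2 * L) * fint b (vp e) t"
  using ineq[OF less_imp_le[OF e(1)] e(2)]
  proof eventually_elim
  case (elim t)
  show ?case
  proof
  assume t: "0 < t & t < T"
  have "fint b (F e) t <= fint b (%s. EN L * vp e s) t" using FL[of e] t by (intro fint_mono_AE) (auto elim!: eventually_mono)
  also have "... = EN L * fint b (vp e) t" by (rule fint_cmult) measurable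
  finally have "EN C2 * fint b (F e) t <= EN C2 * (EN L * fint b (vp e) t)" by (rule mult_left_mono) simp
  also have "... = EN (C2 * L) * fint b (vp e) t" using C2 L by (simp add: ennreal_mult mult.assoc)
  finally have "EN (C1 * A0 * t powr (- a)) + EN C2 * fint b (F e) t <= EN (C1 * A0 * t powr (- a)) + EN (C2 * L) * fint b (vp e) t" by (rule add_left_mono)
  then show "vp e t <= EN (C1 * A0 * t powr (- a)) + EN (C2 * L) * fint b (vp e) t" using elim t by (auto intro: order_trans)
  qed
  qed
 qed (use C1 A0 in auto)
 define en where "en = (%n. 1 / (real n + 1))"
 have en: "0 < en n" "en n <= 1" for n by (auto simp: en_def)
 have all: "AEl t. \<forall>n. 0 < t & t < T --> vp (en n) t <= EN (M * (C1 * A0) * t powr (- a))"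
  by (subst AE_all_countable) (use bnd en in auto)
 have ominc: "incseq (%n. om' (en n) x)" for x
 proof (rule incseq_SucI)
  fix n
  have "1 + (en (Suc n))\<^sup>2 * (norm x)\<^sup>2 <= 1 + (en n)\<^sup>2 * (norm x)\<^sup>2"
  unfolding en_def by (intro add_left_mono mult_right_mono power_mono divide_left_mono) auto
  then show "om' (en n) x <= om' (en (Suc n)) x" unfolding om'_def om_def using k by (intro ennreal_leI powr_mono2') (auto intro!: add_pos_nonneg)
 qed
 have omlim: "(SUP n. om' (en n) x) = 1" for x
 proof -
  have "(%n. (1 + (en n)\<^sup>2 * (norm x)\<^sup>2) powr (- k)) \<longlonglongrightarrow> (1 + 0\<^sup>2 * (norm x)\<^sup>2) powr (- k)"
  unfolding en_def by (intro tendsto_intros) (real_asymp, auto)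
  then have "(%n. om' (en n) x) \<longlonglongrightarrow> ennreal 1" unfolding om'_def om_def by (intro tendsto_ennrealI) simp
  with LIMSEQ_SUP[OF ominc[of x]] show ?thesis using LIMSEQ_unique by fastforce
 qed
 have "AEl t. 0 < t & t < T --> Nm ib (U t) <= EN (M * C1 * A0 * t powr (- a))"
  using all
 proof eventually_elim
  case (elim t)
  show ?case
  proof
  assume t: "0 < t & t < T"
  have "Nm ib (%x. SUP n. om' (en n) x * U t x) <= EN (M * (C1 * A0) * t powr (- a))"
  proof (rule Nm_SUP)
  show "incseq (%n x. om' (en n) x * U t x)" using ominc by (auto simp: incseq_def le_fun_def intro!: mult_right_mono)
  show "Nm ib (%x. om' (en n) x * U t x) <= EN (M * (C1 * A0) * t powr (- a))" for n using elim t by (simp add: vp_def)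
  qed (use eo in auto)
  also have "(%x. SUP n. om' (en n) x * U t x) = U t" by (simp add: SUP_mult_right_ennreal[symmetric] omlim)
  finally show "Nm ib (U t) <= EN (M * C1 * A0 * t powr (- a))" by (simp add: mult.assoc)
  qed
 qed
 then show ?thesis unfolding a_def d_def using M C1 by (intro exI[of _ "M * C1"]) auto
qed

end

section \<open>Continuation of bounded solutions\<close>

lemma conv_SUP:
 fixes f :: "nat => 'a::euclidean_space => ennreal"
 assumes [measurable]: "k \<in> Bm" "!!n. f n \<in> Bm" and inc: "!!y. incseq (%n. f n y)"
 shows "conv k (%y. SUP n. f n y) x = (SUP n. conv k (f n) x)"
proof -
 have "conv k (%y. SUP n. f n y) x = (NN y. (SUP n. k (x - y) * f n y))"
  unfolding conv_def by (simp add: SUP_mult_left_ennreal)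
 also have "... = (SUP n. conv k (f n) x)" unfolding conv_def
 proof (rule nn_integral_monotone_convergence_SUP)
  show "incseq (%n y. k (x - y) * f n y)"
  using inc by (intro incseq_SucI le_funI mult_left_mono) (auto simp: incseq_def)
  show "(%y. k (x - y) * f n y) \<in> borel_measurable lborel" for n by measurable
 qed
 finally show ?thesis .
qed

context
 fixes al be p :: real
 assumes ab: "0 < al" "al < 1" "0 < be" "be <= 1" and p: "1 < p"
begin

lemma duhamel_mono:
 fixes V W :: "real => 'a::euclidean_space => ennreal"
 assumes "!!s y. 0 < s ==> s < t ==> V s y <= W s y"
 shows "duhamel al be p u0 V t x <= duhamel al be p u0 W t x"
 unfolding duhamel_def conv_def using assms p by (intro add_left_mono nn_integral_mono) (auto intro!: nn_integral_mono mult_left_mono epow_mono)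

lemma duhamel_cong:
 fixes V W :: "real => 'a::euclidean_space => ennreal"
 assumes "!!s y. 0 < s ==> s < t ==> V s y = W s y"
 shows "duhamel al be p u0 V t x = duhamel al be p u0 W t x"
 by (intro antisym duhamel_mono) (simp_all add: assms)

lemma duhamel_SUP:
 fixes V :: "nat => real => 'a::euclidean_space => ennreal"
 assumes Vm[measurable]: "!!n. (%(t, x). V n t x) \<in> Bm2" and inc: "!!s y. incseq (%n. V n s y)"
 shows "duhamel al be p u0 (%s y. SUP n. V n s y) t x = (SUP n. duhamel al be p u0 (V n) t x)"
proof -
 note [measurable] = Yn_measurable[OF ab]
 define q where "q = (%n s. if 0 < s & s < t then conv (Yn al be (t - s)) (%y. epow (V n s y) p) x else 0)"
 have pinc: "incseq (%n. epow (V n s y) p)" for s y using inc[of s y] p by (auto simp: incseq_def intro!: epow_mono)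
 have "(if 0 < s & s < t then conv (Yn al be (t - s)) (%y. epow (SUP n. V n s y) p) x else 0) = (SUP n. q n s)" for s
  using p unfolding q_def by (simp add: epow_SUP conv_SUP[OF _ _ pinc])
 then have "(NN s. (if 0 < s & s < t then conv (Yn al be (t - s)) (%y. epow (SUP n. V n s y) p) x else 0)) = (NN s. (SUP n. q n s))" by simp
 also have "... = (SUP n. (NN s. q n s))"
 proof (rule nn_integral_monotone_convergence_SUP)
  show "incseq q" unfolding q_def conv_def using pinc
  by (auto simp: incseq_def le_fun_def intro!: nn_integral_mono mult_left_mono)
  fix n
  have "(%(s, y). epow (V n s y) p) \<in> Bm2" by measurable
  from potential_integrand_measurable[OF ab this, of t]
  have "q n \<in> Bm" unfolding q_def by measurable
  then show "q n \<in> borel_measurable lborel" by simp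
 qed
 finally show ?thesis unfolding duhamel_def q_def by (simp add: ennreal_SUP_add_right)
qed

end

context
 fixes al be p i ib ic :: real
 assumes ab: "0 < al" "al < 1" "0 < be" "be <= 1"
  and p: "1 < p" "p < 2" "real DIM('a::euclidean_space) / 2 * (p - 1) < be" and i: "0 <= i" "i <= 1"
  and ib_def: "ib = min i (1 - (p - 1) * i)" and ic_def: "ic = (p - 1) * i + ib"
begin

text \<open>The part of the time integral before \<open>T\<close> is a convergent Beta integral by smoothing, and the part after \<open>T\<close> is small
with \<open>t - T\<close>.\<close>

lemma duhamel_step_bound:
 fixes u0 :: "'a => ennreal"
 assumes um[measurable]: "u0 \<in> Bm" and A0: "Nm i u0 <= EN A0" "0 <= A0" and T: "0 < T" and H: "0 <= H" and a: "0 <= a" "a < 1"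
  and j: "0 <= j" "j <= i" "real DIM('a) / 2 * (i - j) < be" "real DIM('a) / 2 * (ic - j) < be"
 shows "\<exists>E\<ge>0. \<exists>C\<ge>0. \<exists>b>0. \<forall>t V K. T <= t --> t <= T + 1 --> (%(t, x). V t x) \<in> Bm2 --> 0 <= K -->
  (AEl s. 0 < s & s < T --> Nm ic (%x. epow (V s x) p) <= EN (H * s powr (- a))) -->
  (\<forall>s. T < s & s < t --> Nm ic (%x. epow (V s x) p) <= EN K) -->
  Nm j (%x. duhamel al be p u0 V t x) <= EN (E + C * K * (t - T) powr b)"
proof -
 note eo = exponent_order[OF ab p i ib_def ic_def]
 have jc: "j <= ic" "j <= 1" using j eo i by auto
 have T1: "0 < T + 1" using T by simp
 define d where "d = real DIM('a) / 2"
 define x1 where "x1 = al * (d * (i - j)) / be"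
 define b where "b = al - al * (d * (ic - j)) / be"
 have x1: "0 <= x1" using ab j by (simp add: x1_def d_def)
 have b: "0 < b" using time_exponent[OF ab p i ib_def ic_def, of "d * (ic - j)"] j jc by (simp add: b_def d_def)
 have om1: "EN (om 0 0 (x::'a)) = 1" for x by (simp add: om_def)
 have k0: "(0::real) <= 0" by simp
 obtain C1 where C1: "0 <= C1" "!!t e f. 0 < t ==> t <= T + 1 ==> 0 <= e ==> e <= 1 ==> f \<in> Bm ==>
  Nm j (%x::'a. EN (om e 0 x) * conv (Zn al be t) f x) <= EN (C1 * t powr (- x1)) * Nm i (%x. EN (om e 0 x) * f x)"
  using Zn_bound[OF ab j(1,2) i(2) k0 ab(3) j(3) T1] unfolding x1_def d_def by blast
 obtain C2 where C2: "0 <= C2" "!!t e f F. 0 < t ==> t <= T + 1 ==> 0 <= e ==> e <= 1 ==> (%(s, x). f s x) \<in> Bm2 ==> F \<in> Bm ==>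
  (AEl s. 0 < s & s < t --> Nm ic (%x::'a. EN (om e 0 x) * f s x) <= F s) ==>
  Nm j (%x. EN (om e 0 x) * (NN s. (if 0 < s & s < t then conv (Yn al be (t - s)) (f s) x else 0))) <= EN C2 * fint b F t"
  using potential_bound[OF ab j(1) jc(1) eo(5) k0 ab(3) j(4) T1] unfolding b_def d_def by blast
 have B0: "0 < Beta (1 - a) b" "0 < Beta b 1" unfolding Beta_def using a b by (auto intro!: divide_pos_pos mult_pos_pos Gamma_real_pos)
 define Q where "Q = T powr (b - a) + (T + 1) powr (b - a)"
 define E where "E = C1 * T powr (- x1) * A0 + C2 * (H * (Beta (1 - a) b * Q))"
 have Q: "0 <= Q" by (simp add: Q_def)
 have "Nm j (%x. duhamel al be p u0 V t x) <= EN (E + (C2 * Beta b 1) * K * (t - T) powr b)"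
  if t: "T <= t" "t <= T + 1" and Vm[measurable]: "(%(t, x). V t x) \<in> Bm2" and K: "0 <= K"
  and V1: "AEl s. 0 < s & s < T --> Nm ic (%x. epow (V s x) p) <= EN (H * s powr (- a))"
  and V2: "\<forall>s. T < s & s < t --> Nm ic (%x. epow (V s x) p) <= EN K" for t K and V :: "real => 'a => ennreal"
 proof -
  have t0: "0 < t" using t T by simp
  define F where "F = (%s. EN H * EN (s powr ((1 - a) - 1)) + EN K * indicator {T<..} s)"
  have Fm[measurable]: "F \<in> Bm" unfolding F_def by measurable
  have pm: "(%(s, x). epow (V s x) p) \<in> Bm2" by measurable
  have "fint b F t = EN H * fint b (%s. EN (s powr ((1 - a) - 1))) t + EN K * fint b (indicator {T<..}) t"
  unfolding F_def by (subst fint_add; (simp only: fint_cmult)?) (auto simp: fint_cmult)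
  also have "... <= EN H * EN (Beta (1 - a) b * Q) + EN K * EN (Beta b 1 * (t - T) powr b)"
  proof (intro add_mono mult_left_mono)
  have "fint b (%s. EN (s powr ((1 - a) - 1))) t <= EN (Beta (1 - a) b * t powr ((1 - a) + b - 1))" using a b by (intro fint_powr) auto
  also have "t powr ((1 - a) + b - 1) <= Q"
  proof (cases "0 <= b - a")
  case True
  have "t powr (b - a) <= (T + 1) powr (b - a)" using True t t0 by (intro powr_mono2) auto
  then show ?thesis by (simp add: Q_def add_increasing)
  next
  case False
  have "t powr (b - a) <= T powr (b - a)" using False t T by (intro powr_mono2') auto
  then show ?thesis by (simp add: Q_def add_increasing2)
  qed
  finally show "fint b (%s. EN (s powr ((1 - a) - 1))) t <= EN (Beta (1 - a) b * Q)"
  using B0 by (auto simp: mult_left_mono ennreal_leI less_imp_le)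
  show "fint b (indicator {T<..}) t <= EN (Beta b 1 * (t - T) powr b)"
  proof (cases "T < t")
  case True
  have "fint b (indicator {T<..}) t = (NN s. EN ((t - s) powr (b - 1) * (s - T) powr (1 - 1)) * indicator {T<..<t} s)"
  unfolding fint_def using T by (intro nn_integral_cong) (auto simp: indicator_def)
  also have "... = EN ((t - T) powr (b + 1 - 1) * Beta b 1)" using b True by (intro nn_integral_Beta) auto
  finally show ?thesis by (simp add: mult.commute)
  next
  case False
  then have "fint b (indicator {T<..}) t = (\<integral>\<^sup>+s. 0 \<partial>(lborel :: real measure))"
  unfolding fint_def by (intro nn_integral_cong) (auto simp: indicator_def)
  then show ?thesis by simp
  qed
  qed auto
  finally have F: "EN C2 * fint b F t <= EN C2 * (EN H * EN (Beta (1 - a) b * Q) + EN K * EN (Beta b 1 * (t - T) powr b))"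
  by (rule mult_left_mono) simp
  have "AEl s. s ~= T" by (rule AE_lborel_singleton)
  with V1 have "AEl s. 0 < s & s < t --> Nm ic (%x. EN (om 0 0 x) * epow (V s x) p) <= F s"
  proof eventually_elim
  case (elim s)
  show ?case
  proof
  assume s: "0 < s & s < t"
  consider "s < T" | "T < s" using elim by linarith
  then have "Nm ic (%x. epow (V s x) p) <= F s"
  proof cases
  case 1
  then have "Nm ic (%x. epow (V s x) p) <= EN (H * s powr (- a))" using elim s by simp
  then show ?thesis using H 1 by (simp add: F_def ennreal_mult)
  next
  case 2
  then have "Nm ic (%x. epow (V s x) p) <= EN K" using V2 s by simp
  then show ?thesis using 2 by (simp add: F_def add_increasing)
  qed
  then show "Nm ic (%x. EN (om 0 0 x) * epow (V s x) p) <= F s" by (simp add: om1)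
  qed
  qed
  from C2(2)[OF t0 t(2) _ _ pm Fm this]
  have P: "Nm j (%x. EN (om 0 0 x) * (NN s. (if 0 < s & s < t then conv (Yn al be (t - s)) (%x. epow (V s x) p) x else 0))) <= EN C2 * fint b F t" by simp
  have Z: "Nm j (%x. EN (om 0 0 x) * conv (Zn al be t) u0 x) <= EN (C1 * T powr (- x1) * A0)"
  proof -
  have "Nm j (%x. EN (om 0 0 x) * conv (Zn al be t) u0 x) <= EN (C1 * t powr (- x1)) * Nm i u0" using C1(2)[OF t0 t(2), of 0 u0] by (simp add: om1)
  also have "... <= EN (C1 * T powr (- x1)) * EN A0"
  using C1 t T x1 A0 by (intro mult_mono ennreal_leI mult_left_mono powr_mono2') auto
  finally show ?thesis using C1 A0 by (simp add: emult)
  qed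
  have "Nm j (%x. duhamel al be p u0 V t x) = Nm j (%x. EN (om 0 0 x) * duhamel al be p u0 V t x)" by (simp add: om1)
  also have "... <= Nm j (%x. EN (om 0 0 x) * conv (Zn al be t) u0 x) +
  Nm j (%x. EN (om 0 0 x) * (NN s. (if 0 < s & s < t then conv (Yn al be (t - s)) (%x. epow (V s x) p) x else 0)))"
  by (rule duhamel_Nm_split[OF ab um Vm j(1) jc(2)])
  also have "... <= EN (C1 * T powr (- x1) * A0) + EN C2 * (EN H * EN (Beta (1 - a) b * Q) + EN K * EN (Beta b 1 * (t - T) powr b))"
  by (rule add_mono[OF Z order_trans[OF P F]])
  also have "... = EN (E + (C2 * Beta b 1) * K * (t - T) powr b)"
  proof -
  have n1: "0 <= C1 * T powr (- x1) * A0" using C1 A0 by simp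
  have n2: "0 <= H * (Beta (1 - a) b * Q)" using H B0 Q by simp
  have n3: "0 <= K * (Beta b 1 * (t - T) powr b)" using K B0 by simp
  have "EN H * EN (Beta (1 - a) b * Q) + EN K * EN (Beta b 1 * (t - T) powr b) = EN (H * (Beta (1 - a) b * Q) + K * (Beta b 1 * (t - T) powr b))"
  using n2 n3 H K B0 Q by (subst ennreal_plus) (auto simp: ennreal_mult)
  then have "EN (C1 * T powr (- x1) * A0) + EN C2 * (EN H * EN (Beta (1 - a) b * Q) + EN K * EN (Beta b 1 * (t - T) powr b))
  = EN (C1 * T powr (- x1) * A0) + EN (C2 * (H * (Beta (1 - a) b * Q) + K * (Beta b 1 * (t - T) powr b)))"
  using C2 n2 n3 by (subst (2) ennreal_mult) auto
  also have "... = EN (C1 * T powr (- x1) * A0 + C2 * (H * (Beta (1 - a) b * Q) + K * (Beta b 1 * (t - T) powr b)))"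
  by (rule ennreal_plus[symmetric, OF n1 mult_nonneg_nonneg[OF C2(1) add_nonneg_nonneg[OF n2 n3]]])
  finally show ?thesis unfolding E_def by (simp add: algebra_simps)
  qed
  finally show ?thesis .
 qed
 moreover have "0 <= E" unfolding E_def using C1 C2 A0 H B0 Q by (auto intro!: add_nonneg_nonneg mult_nonneg_nonneg)
 ultimately show ?thesis using C2 B0 b by (intro exI[of _ E] conjI exI[of _ "C2 * Beta b 1"] exI[of _ b]) auto
qed

text \<open>Iterate the Duhamel map beyond \<open>T\<close>, starting from 0 there. The iterates increase, stay below a common bound in
\<open>L^q\<close> and in \<open>L^(1/ib)\<close> on a short interval, and their supremum solves the equation by monotone convergence. Both
norms are needed: the product of the two controls \<open>u^p\<close>.\<close>

theorem continuation:
 fixes u0 :: "'a => ennreal"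
 assumes m: "mild al be p u0 U (ereal T)" and T: "0 < T" and A0: "Nm i u0 <= EN A0" "0 <= A0"
  and CB: "0 <= CB" "AEl t. 0 < t & t < T --> Nm i (U t) <= EN CB"
 shows "\<exists>T' V K. T < T' & mild al be p u0 V (ereal T') & (\<forall>t<T. V t = U t) & (AEl t. 0 < t & t < T' --> Nm i (V t) <= EN K)"
proof -
 have um[measurable]: "u0 \<in> Bm" and Um[measurable]: "(%(t, x). U t x) \<in> Bm2" using m by (auto simp: mild_def)
 note eo = exponent_order[OF ab p i ib_def ic_def] and eg = exponent_gaps[OF ab p i ib_def ic_def]
 define a where "a = al * (real DIM('a) / 2 * (i - ib)) / be"
 have "0 <= a & a < al" unfolding a_def using eo eg by (intro time_exponent[OF ab p i ib_def ic_def]) auto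
 then have a: "0 <= a" "a < 1" using ab by auto
 have power: "Nm ic (%x. epow (g x) p) <= epow (Nm i g) (p - 1) * Nm ib g" if [measurable]: "g \<in> Bm" for g :: "'a => ennreal"
  unfolding ic_def using weighted_power[of g "%_. 1" p i ib] p i eo by simp
 obtain M where M: "0 <= M" "AEl t. 0 < t & t < T --> Nm ib (U t) <= EN (M * A0 * t powr (- a))"
  using smoothing[OF ab p i ib_def ic_def m T _ A0(2,1) CB] unfolding a_def by auto
 define H where "H = CB powr (p - 1) * (M * A0)"
 have H: "0 <= H" using M A0 by (simp add: H_def)
 have HU: "AEl s. 0 < s & s < T --> Nm ic (%x. epow (U s x) p) <= EN (H * s powr (- a))"
  using M(2) CB(2)
 proof eventually_elim
  case (elim s)
  show ?case
  proof
  assume s: "0 < s & s < T"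
  have [measurable]: "U s \<in> Bm" using Um by measurable
  have "Nm ic (%x. epow (U s x) p) <= epow (Nm i (U s)) (p - 1) * Nm ib (U s)" by (rule power) measurable
  also have "... <= epow (EN CB) (p - 1) * EN (M * A0 * s powr (- a))" using elim s p by (intro mult_mono epow_mono) auto
  also have "... = EN (H * s powr (- a))" using p CB M A0 by (simp add: epow_ennreal H_def emult mult.assoc)
  finally show "Nm ic (%x. epow (U s x) p) <= EN (H * s powr (- a))" .
  qed
 qed
 have z: "real DIM('a) / 2 * (i - i) < be" using ab by simp
 obtain E1 C1 b1 where 1: "0 <= E1" "0 <= C1" "0 < b1" and s1: "!!t V K. T <= t ==> t <= T + 1 ==> (%(t, x). V t x) \<in> Bm2 ==> 0 <= K ==>
  (AEl s. 0 < s & s < T --> Nm ic (%x. epow (V s x) p) <= EN (H * s powr (- a))) ==>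
  (\<forall>s. T < s & s < t --> Nm ic (%x. epow (V s x) p) <= EN K) ==>
  Nm i (%x. duhamel al be p u0 V t x) <= EN (E1 + C1 * K * (t - T) powr b1)"
  using duhamel_step_bound[OF um A0 T H a i(1) order_refl z eg(3)] by blast
 obtain E2 C2 b2 where 2: "0 <= E2" "0 <= C2" "0 < b2" and s2: "!!t V K. T <= t ==> t <= T + 1 ==> (%(t, x). V t x) \<in> Bm2 ==> 0 <= K ==>
  (AEl s. 0 < s & s < T --> Nm ic (%x. epow (V s x) p) <= EN (H * s powr (- a))) ==>
  (\<forall>s. T < s & s < t --> Nm ic (%x. epow (V s x) p) <= EN K) ==>
  Nm ib (%x. duhamel al be p u0 V t x) <= EN (E2 + C2 * K * (t - T) powr b2)"
  using duhamel_step_bound[OF um A0 T H a eo(1,2) eg(2,1)] by blast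
 define K0 where "K0 = E1 + E2 + 1"
 have K0: "0 < K0" using 1 2 by (simp add: K0_def)
 define K where "K = K0 powr p"
 have K: "0 <= K" by (simp add: K_def)
 define \<delta> where "\<delta> = min 1 (min ((1 / (1 + C1 * K)) powr (1 / b1)) ((1 / (1 + C2 * K)) powr (1 / b2)))"
 have pos: "0 < 1 + C1 * K" "0 < 1 + C2 * K" using 1 2 K by (auto intro!: add_pos_nonneg)
 have \<delta>: "0 < \<delta>" "\<delta> <= 1" using pos by (auto simp: \<delta>_def)
 have small: "C * K * r powr b <= 1" if r: "0 <= r" "r <= (1 / (1 + C * K)) powr (1 / b)" and c: "0 <= C" "0 < b" for r C b
 proof -
  have cp: "0 < 1 + C * K" using c K by (auto intro!: add_pos_nonneg)
  have "r powr b <= ((1 / (1 + C * K)) powr (1 / b)) powr b" using r c by (intro powr_mono2) auto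
  also have "... = 1 / (1 + C * K)" using c cp by (simp add: powr_powr)
  finally have "C * K * r powr b <= C * K * (1 / (1 + C * K))" using c K by (intro mult_left_mono) auto
  also have "... <= 1" using cp by simp
  finally show ?thesis .
 qed
 define \<Phi> where "\<Phi> = (%(w :: real => 'a => ennreal) t x. if t < T then U t x else if t < T + \<delta> then duhamel al be p u0 w t x else 0)"
 define W where "W = (%n. (\<Phi> ^^ n) (%t x. if t < T then U t x else 0))"
 have W0: "W 0 t x = (if t < T then U t x else 0)" and WS: "W (Suc n) t x = \<Phi> (W n) t x" for n t x by (simp_all add: W_def)
 have WU: "t < T ==> W n t x = U t x" for n t x by (cases n) (auto simp: W0 WS \<Phi>_def)
 have Wm[measurable]: "(%(t, x). W n t x) \<in> Bm2" for n
 proof (induction n)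
  case 0 show ?case unfolding W0 by measurable
 next
  case (Suc n)
  note [measurable] = duhamel_measurable[OF ab um Suc, of p]
  show ?case unfolding WS \<Phi>_def by measurable
 qed
 have Wsec[measurable]: "W n t \<in> Bm" for n t using Wm[of n] by measurable
 have Wstep: "W n t x <= W (Suc n) t x" for n t x
 proof (induction n arbitrary: t x)
  case 0 show ?case by (simp add: W0 WS \<Phi>_def)
 next
  case (Suc n)
  have "duhamel al be p u0 (W n) t x <= duhamel al be p u0 (W (Suc n)) t x" using Suc.IH by (intro duhamel_mono[OF ab p(1)])
  then show ?case unfolding WS[of "Suc n"] WS[of n] \<Phi>_def by auto
 qed
 have Winc: "incseq (%n. W n t x)" for t x by (rule incseq_SucI) (rule Wstep)
 have Wb: "T <= t & t < T + \<delta> --> Nm i (W n t) <= EN K0 & Nm ib (W n t) <= EN K0" for n t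
 proof (induction n arbitrary: t)
  case 0
  have "T <= t ==> W 0 t = (%x. 0)" by (auto simp: W0)
  then show ?case using i eo by (simp add: Nm_zero)
 next
  case (Suc n)
  show ?case
  proof
  assume t: "T <= t & t < T + \<delta>"
  have 3: "AEl s. 0 < s & s < T --> Nm ic (%x. epow (W n s x) p) <= EN (H * s powr (- a))"
  using HU by eventually_elim (simp add: WU)
  have 4: "\<forall>s. T < s & s < t --> Nm ic (%x. epow (W n s x) p) <= EN K"
  proof (intro allI impI)
  fix s assume s: "T < s & s < t"
  have "Nm ic (%x. epow (W n s x) p) <= epow (Nm i (W n s)) (p - 1) * Nm ib (W n s)" by (rule power) measurable
  also have "... <= epow (EN K0) (p - 1) * EN K0" using Suc.IH[of s] s t p by (intro mult_mono epow_mono) auto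
  also have "... = epow (EN K0) p" using epow_add[of "p - 1" 1 "EN K0"] p by simp
  also have "... = EN K" using K0 p by (simp add: epow_ennreal K_def)
  finally show "Nm ic (%x. epow (W n s x) p) <= EN K" .
  qed
  have eq: "W (Suc n) t = (%x. duhamel al be p u0 (W n) t x)" using t by (auto simp: WS \<Phi>_def)
  have t1: "T <= t" "t <= T + 1" using t \<delta> by auto
  have tT: "0 <= t - T" "t - T <= \<delta>" using t by auto
  then have r: "t - T <= (1 / (1 + C1 * K)) powr (1 / b1)" "t - T <= (1 / (1 + C2 * K)) powr (1 / b2)" by (auto simp: \<delta>_def)
  have "E1 + C1 * K * (t - T) powr b1 <= K0" using small[OF tT(1) r(1) 1(2,3)] 2(1) by (simp add: K0_def)
  moreover have "E2 + C2 * K * (t - T) powr b2 <= K0" using small[OF tT(1) r(2) 2(2,3)] 1(1) by (simp add: K0_def)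
  ultimately show "Nm i (W (Suc n) t) <= EN K0 & Nm ib (W (Suc n) t) <= EN K0"
  unfolding eq using s1[OF t1 Wm K 3 4] s2[OF t1 Wm K 3 4] by (meson ennreal_leI order_trans)
  qed
 qed
 define V where "V = (%t x. SUP n. W n t x)"
 have VU: "t < T ==> V t x = U t x" for t x by (simp add: V_def WU)
 have Vm[measurable]: "(%(t, x). V t x) \<in> Bm2" unfolding V_def by measurable
 have Veq: "V t x = duhamel al be p u0 V t x" if t: "T <= t" "t < T + \<delta>" for t x
 proof -
  have "V t x = (SUP n. W (Suc n) t x)" unfolding V_def
  using Winc[of t x] by (intro antisym SUP_least) (auto intro: SUP_upper2 Wstep SUP_upper)
  also have "... = (SUP n. duhamel al be p u0 (W n) t x)" using t by (simp add: WS \<Phi>_def)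
  also have "... = duhamel al be p u0 V t x" unfolding V_def by (rule duhamel_SUP[OF ab p(1) Wm Winc, symmetric])
  finally show ?thesis .
 qed
 have "mild al be p u0 V (ereal (T + \<delta>))"
 proof -
  have "AEl t. 0 < t & ereal t < ereal T --> (AEl x. U t x = duhamel al be p u0 U t x)" using m by (simp add: mild_def)
  then have "AEl t. 0 < t & ereal t < ereal (T + \<delta>) --> (AEl x. V t x = duhamel al be p u0 V t x)"
  proof eventually_elim
  case (elim t)
  show ?case
  proof
  assume t: "0 < t & ereal t < ereal (T + \<delta>)"
  show "AEl x. V t x = duhamel al be p u0 V t x"
  proof (cases "t < T")
  case True
  have "duhamel al be p u0 V t x = duhamel al be p u0 U t x" for x using True by (intro duhamel_cong[OF ab p(1)] VU) auto
  then show ?thesis using elim t True by (simp add: VU)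
  next
  case False
  then show ?thesis using Veq[of t] t by (intro AE_I2) simp
  qed
  qed
  qed
  then show ?thesis using um Vm by (simp add: mild_def)
 qed
 moreover have "AEl t. 0 < t & t < T + \<delta> --> Nm i (V t) <= EN (max CB K0)"
  using CB(2)
 proof eventually_elim
  case (elim t)
  show ?case
  proof
  assume t: "0 < t & t < T + \<delta>"
  show "Nm i (V t) <= EN (max CB K0)"
  proof (cases "t < T")
  case True
  then have "V t = U t" by (auto simp: VU)
  then have "Nm i (V t) <= EN CB" using elim t True by simp
  also have "... <= EN (max CB K0)" by (intro ennreal_leI) auto
  finally show ?thesis .
  next
  case False
  have "Nm i (%x. SUP n. W n t x) <= EN K0"
  using Winc Wb[of t] t False i by (intro Nm_SUP) (auto simp: incseq_def le_fun_def)
  also have "... <= EN (max CB K0)" by (intro ennreal_leI) auto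
  finally show ?thesis by (simp add: V_def)
  qed
  qed
 qed
 moreover have "\<forall>t<T. V t = U t" by (auto simp: VU)
 moreover have "T < T + \<delta>" using \<delta> by simp
 ultimately show ?thesis by blast
qed

end

section \<open>From Lebesgue to Borel functions\<close>

text \<open>Completeness of the Lebesgue measure.\<close>

lemma lebesgue_measurable_AE:
 fixes f g :: "'a::euclidean_space => real"
 assumes f: "f \<in> borel_measurable lebesgue" and ae: "AEl x. f x = g x"
 shows "g \<in> borel_measurable lebesgue"
proof (rule measurableI)
 fix A :: "real set" assume A: "A \<in> sets borel"
 have "AE x in lebesgue. x \<in> f -` A \<longleftrightarrow> x \<in> g -` A" using AE_completion[OF ae] by eventually_elim auto
 moreover have "f -` A \<in> sets lebesgue" using measurable_sets[OF f A] by simp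
 ultimately have "g -` A \<in> sets lebesgue" by (rule completion.in_sets_AE) simp
 then show "g -` A \<inter> space lebesgue \<in> sets lebesgue" by simp
qed simp

lemma lebesgue_integral_nn:
 fixes f :: "'a::euclidean_space => real" and h :: "'a => ennreal"
 assumes [measurable]: "h \<in> Bm" and fin: "AEl x. h x < top" and eq: "AEl x. f x = enn2real (h x)"
 shows "integrable lebesgue f \<longleftrightarrow> (NN x. h x) < top" and "integral\<^sup>L lebesgue f = enn2real (NN x. h x)"
proof -
 have hm: "(%x. enn2real (h x)) \<in> borel_measurable lborel" by measurable
 have hl: "(%x. enn2real (h x)) \<in> borel_measurable lebesgue" by (rule measurable_completion[OF hm])
 have eql: "AE x in lebesgue. f x = enn2real (h x)" using eq by (rule AE_completion)
 have fl: "f \<in> borel_measurable lebesgue" by (rule lebesgue_measurable_AE[OF hl]) (use eq in \<open>auto elim!: eventually_mono\<close>)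
 have nn: "(NN x. EN (enn2real (h x))) = (NN x. h x)"
  using fin by (intro nn_integral_cong_AE) (auto elim!: eventually_mono)
 have "integrable lebesgue f \<longleftrightarrow> integrable lebesgue (%x. enn2real (h x))" by (rule integrable_cong_AE[OF fl hl eql])
 also have "... \<longleftrightarrow> integrable lborel (%x. enn2real (h x))" by (rule integrable_completion[OF hm])
 also have "... \<longleftrightarrow> (NN x. h x) < top" using hm nn by (simp add: integrable_iff_bounded)
 finally show "integrable lebesgue f \<longleftrightarrow> (NN x. h x) < top" .
 have "integral\<^sup>L lebesgue f = integral\<^sup>L lebesgue (%x. enn2real (h x))" by (rule integral_cong_AE[OF fl hl eql])
 also have "... = integral\<^sup>L lborel (%x. enn2real (h x))" by (rule integral_completion[OF hm])
 also have "... = enn2real (NN x. h x)" unfolding nn[symmetric] by (rule integral_eq_nn_integral[OF hm]) simp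
 finally show "integral\<^sup>L lebesgue f = enn2real (NN x. h x)" .
qed

text \<open>Fubini's theorem for a function that is measurable only for the completed product measure, through a nonnegative Borel
representative.\<close>

lemma iterated_integral_nn:
 fixes F :: "real => 'a::euclidean_space => real" and H :: "real => 'a => ennreal"
 assumes Hm[measurable]: "(%(s, y). H s y) \<in> Bm2" and fin: "!!s y. H s y < top"
  and eq: "AEl z. 0 < fst z & fst z < t --> F (fst z) (snd z) = enn2real (H (fst z) (snd z))"
 defines "I \<equiv> (NN s. (NN y. (if 0 < s & s < t then H s y else 0)))"
 shows "set_integrable lebesgue ({0<..<t} \<times> UNIV) (%(s, y). F s y) \<longleftrightarrow> I < top"
  and "I < top ==> (LINT s:{0<..<t}|lebesgue. LINT y|lebesgue. F s y) = enn2real I"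
proof -
 define h where "h = (%z. if 0 < fst z & fst z < t then H (fst z) (snd z) else 0)"
 have h2: "h \<in> Bm2" unfolding h_def by measurable
 then have hm: "h \<in> Bm" by (simp add: borel_prod)
 have I: "(NN z. h z) = I"
 proof -
  have "(NN z. h z) = (\<integral>\<^sup>+z. h z \<partial>(lborel \<Otimes>\<^sub>M lborel))" by (simp add: lborel_prod)
  also have "... = (NN s. (NN y. h (s, y)))"
  by (rule lborel.nn_integral_fst[symmetric]) (simp add: lborel_prod hm)
  finally show ?thesis unfolding h_def I_def fst_conv snd_conv .
 qed
 have eqz: "AEl z. indicator ({0<..<t} \<times> UNIV) z *\<^sub>R (case z of (s, y) => F s y) = enn2real (h z)"
  using eq by eventually_elim (auto simp: h_def indicator_def split: prod.splits)
 show "set_integrable lebesgue ({0<..<t} \<times> UNIV) (%(s, y). F s y) \<longleftrightarrow> I < top"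
  unfolding set_integrable_def I[symmetric] by (rule lebesgue_integral_nn(1)[OF hm _ eqz]) (simp add: h_def fin)
 assume Ifin: "I < top"
 define k where "k = (%s. (NN y. (if 0 < s & s < t then H s y else 0)))"
 have km[measurable]: "k \<in> Bm" unfolding k_def by (rule nn_integral_lborel_measurable) measurable
 have kfin: "AEl s. k s < top"
 proof -
  have "(NN s. k s) ~= \<infinity>" using Ifin by (simp add: I_def k_def)
  then have "AEl s. k s ~= \<infinity>" by (intro nn_integral_PInf_AE) auto
  then show ?thesis by (auto elim!: eventually_mono simp: less_top)
 qed
 have "AEl s. AEl y. 0 < s & s < t --> F s y = enn2real (H s y)"
  using lborel_pair.AE_pair[OF eq[folded lborel_prod]] by simp
 then have keq: "AEl s. indicator {0<..<t} s *\<^sub>R (LINT y|lebesgue. F s y) = enn2real (k s)"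
 proof eventually_elim
  case (elim s)
  show ?case
  proof (cases "0 < s & s < t")
  case True
  have "(LINT y|lebesgue. F s y) = enn2real (NN y. H s y)"
  by (rule lebesgue_integral_nn(2)) (use True elim fin in \<open>auto\<close>)
  then show ?thesis using True by (simp add: k_def)
  next
  case False
  then have "k s = (\<integral>\<^sup>+y. 0 \<partial>(lborel :: 'a measure))" unfolding k_def by (intro nn_integral_cong) auto
  then show ?thesis using False by auto
  qed
 qed
 show "(LINT s:{0<..<t}|lebesgue. LINT y|lebesgue. F s y) = enn2real I"
  unfolding set_lebesgue_integral_def using lebesgue_integral_nn(2)[OF km kfin keq] by (simp add: I_def k_def)
qed

text \<open>The index \<open>1/q\<close>, with value 0 at \<open>\<infinity>\<close>.\<close>

definition qexp :: "ereal => real" where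
 "qexp q = (if q = \<infinity> then 0 else 1 / real_of_ereal q)"

lemma qexp_bounds: "1 <= q ==> 0 <= qexp q & qexp q <= 1"
 by (cases q) (auto simp: qexp_def)

lemma Lq_norm_eq_Nm:
 fixes f :: "'a::euclidean_space => real"
 assumes f: "f \<in> borel_measurable lebesgue" and [measurable]: "g \<in> Bm" and eq: "AEl x. EN \<bar>f x\<bar> = g x" and q: "1 <= q"
 shows "Lq_norm q f = Nm (qexp q) g"
proof (cases "q = \<infinity>")
 case True
 have m: "(%x. EN \<bar>f x\<bar>) \<in> borel_measurable lebesgue" using f by measurable
 have "(AE x in lebesgue. EN \<bar>f x\<bar> <= z) \<longleftrightarrow> (AEl x. g x <= z)" for z
  unfolding AE_completion_iff using eq by (auto elim: eventually_elim2)
 then show ?thesis using True by (simp add: Lq_norm_def qexp_def esssup_eq_AE[OF m] Nm_def)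
next
 case False
 then obtain r where r: "q = ereal r" "1 <= r" using q by (cases q) auto
 have "(\<integral>\<^sup>+x. EN (\<bar>f x\<bar> powr r) \<partial>lebesgue) = (NN x. epow (g x) r)" unfolding nn_integral_completion
 proof (rule nn_integral_cong_AE)
  show "AEl x. EN (\<bar>f x\<bar> powr r) = epow (g x) r"
  using eq by eventually_elim (use r in \<open>simp add: epow_ennreal[symmetric]\<close>)
 qed
 then have "Lq_norm q f = epow (NN x. epow (g x) r) (1/r)"
  using r by (cases "(NN x. epow (g x) r)") (auto simp: Lq_norm_def Let_def epow_ennreal)
 then show ?thesis using r by (simp add: qexp_def Nm_pos)
qed

lemma AE_interval_witness:
 fixes a b :: real
 assumes "AEl t. a < t & t < b --> P t" and "a < b" obtains t where "a < t" "t < b" "P t"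
proof -
 have "\<exists>t. a < t & t < b & P t"
 proof (rule ccontr)
  assume n: "~ ?thesis"
  have "AEl t. t \<notin> {a<..<b}" using assms(1) by eventually_elim (use n in auto)
  then have "emeasure lborel {a<..<b} = 0"
  by (subst (asm) AE_iff_measurable[OF _ refl]) (auto simp: greaterThanLessThan_def greaterThan_def lessThan_def Int_def)
  then show False using assms(2) by simp
 qed
 then show ?thesis using that by auto
qed

lemma eventually_ess_at_right: "eventually P (ess_at_right 0) \<longleftrightarrow> (\<exists>e>0. AEl t. 0 < t & t < e --> P t)"
proof
 assume "eventually P (ess_at_right 0)"
 then obtain A B where A: "AE t in lebesgue. A t" and B: "eventually B (at_right 0)" and P: "!!t. A t ==> B t ==> P t"
  unfolding ess_at_right_def eventually_inf by auto
 obtain e where "0 < e" "!!t. 0 < t ==> t < e ==> B t" using B unfolding eventually_at_right_field by auto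
 with A P show "\<exists>e>0. AEl t. 0 < t & t < e --> P t" unfolding AE_completion_iff by (intro exI[of _ e]) (auto elim!: eventually_mono)
next
 assume "\<exists>e>0. AEl t. 0 < t & t < e --> P t"
 then obtain e :: real where e: "0 < e" "AEl t. 0 < t & t < e --> P t" by auto
 have "eventually (%t. 0 < t & t < e) (at_right 0)" unfolding eventually_at_right_field using e by auto
 moreover have "AE t in lebesgue. 0 < t & t < e --> P t" using e(2) by (rule AE_completion)
 ultimately show "eventually P (ess_at_right 0)" unfolding ess_at_right_def eventually_inf by blast
qed

lemma eventually_ess_at_left:
 assumes "eventually P (ess_at_left T)" shows "\<exists>e<T. AEl t. e < t & t < T --> P t"
proof -
 obtain A B where A: "AE t in lebesgue. A t" and B: "eventually B (at_left T)" and P: "!!t. A t ==> B t ==> P t"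
  using assms unfolding ess_at_left_def eventually_inf by auto
 obtain e where "e < T" "!!t. e < t ==> t < T ==> B t" using B unfolding eventually_at_left_field by auto
 with A P show ?thesis unfolding AE_completion_iff by (intro exI[of _ e]) (auto elim!: eventually_mono)
qed

lemma AE_neq_space:
 "AE z in (lborel :: (real \<times> 'a::euclidean_space) measure). snd z ~= x"
proof -
 have "open {z :: real \<times> 'a. snd z ~= x}" by (intro open_Collect_neq continuous_intros)
 then have "{z :: real \<times> 'a. snd z ~= x} \<in> sets borel" by (rule borel_open)
 then have m: "{z \<in> space ((lborel :: real measure) \<Otimes>\<^sub>M (lborel :: 'a measure)). snd z ~= x} \<in> sets (lborel \<Otimes>\<^sub>M lborel)"
  unfolding lborel_prod by simp
 have "AE z in (lborel :: real measure) \<Otimes>\<^sub>M (lborel :: 'a measure). snd z ~= x"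
  by (rule lborel_pair.AE_pair_measure[OF m]) (simp add: AE_lborel_singleton)
 then show ?thesis unfolding lborel_prod .
qed

context
 fixes al be p :: real and Z :: "real => 'a::euclidean_space => real"
 assumes ab: "0 < al" "al < 1" "0 < be" "be <= 1" and fs: "fundamental_solution al be Z" and p: "1 < p"
begin

lemma Z_eq_Zn: "0 < t ==> x ~= 0 ==> Z t x = enn2real (Zn al be t x)"
 using fundamental_solution_Z[OF ab fs] Km_nonneg[OF ab _ _ one_weight[OF ab], of t x] by (simp add: Zn_def)

lemma Y_eq_Yn: "0 < t ==> x ~= 0 ==> Y_kernel al Z t x = enn2real (Yn al be t x)"
 using fundamental_solution_Y[OF ab fs, of t x] Km_nonneg[OF ab _ _ inv_weight[OF ab], of t x] ab by (simp add: Yn_def enn2real_mult)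

text \<open>For nonnegative data the real-valued Duhamel formula together with absolute convergence of its integrals
says the same as the formula in \<open>[0, \<infinity>]\<close> with a finite left-hand side.\<close>

lemma duhamel_translation:
 assumes t: "0 < t" and [measurable]: "u0b \<in> Bm" and u0b: "!!y. 0 <= u0b y" "AEl y. u0 y = u0b y"
  and gm[measurable]: "(%(s, y). g s y) \<in> Bm2" and g0: "!!s y. 0 <= g s y"
  and g: "AEl z. 0 < fst z & fst z < t --> u (fst z) (snd z) = g (fst z) (snd z)" and w: "0 <= w"
 shows "(integrable lebesgue (%y. u0 y * Z t (x - y)) &
  set_integrable lebesgue ({0<..<t} \<times> UNIV) (%(s, y). \<bar>u s y\<bar> powr (p - 1) * u s y * Y_kernel al Z (t - s) (x - y)) &
  w = (LINT y|lebesgue. u0 y * Z t (x - y)) + (LINT s:{0<..<t}|lebesgue. LINT y|lebesgue. \<bar>u s y\<bar> powr (p - 1) * u s y * Y_kernel al Z (t - s) (x - y)))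
  \<longleftrightarrow> EN w = duhamel al be p (%y. EN (u0b y)) (%s y. EN (g s y)) t x"
proof -
 note [measurable] = Zn_measurable[OF ab] Yn_measurable[OF ab]
 define A where "A = conv (Zn al be t) (%y. EN (u0b y)) x"
 define H where "H = (%s y. Yn al be (t - s) (x - y) * epow (EN (g s y)) p)"
 define B where "B = (NN s. (NN y. (if 0 < s & s < t then H s y else 0)))"
 have Hm: "(%(s, y). H s y) \<in> Bm2" unfolding H_def by measurable
 have Hfin: "H s y < top" for s y using p by (simp add: H_def Yn_def epow_ennreal g0 ennreal_mult_less_top)
 have hm: "(%y. Zn al be t (x - y) * EN (u0b y)) \<in> Bm" by measurable
 have hfin: "AEl y. Zn al be t (x - y) * EN (u0b y) < top" by (simp add: Zn_def ennreal_mult_less_top)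
 have "AEl y. y ~= x" by (rule AE_lborel_singleton)
 with u0b(2) have heq: "AEl y. u0 y * Z t (x - y) = enn2real (Zn al be t (x - y) * EN (u0b y))"
  by eventually_elim (use t u0b(1) in \<open>simp add: Z_eq_Zn enn2real_mult\<close>)
 have Heq: "AEl z. 0 < fst z & fst z < t --> \<bar>u (fst z) (snd z)\<bar> powr (p - 1) * u (fst z) (snd z) * Y_kernel al Z (t - fst z) (x - snd z) = enn2real (H (fst z) (snd z))"
  using g AE_neq_space[of x]
 proof eventually_elim
  case (elim z)
  have pw: "r powr (p - 1) * r = r powr p" if "0 <= r" for r :: real
  using that powr_add[of r "p - 1" 1] by (cases "r = 0") auto
  show ?case using elim g0[of "fst z" "snd z"] p by (auto simp: pw H_def Y_eq_Yn enn2real_mult epow_ennreal)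
 qed
 have AZ: "integrable lebesgue (%y. u0 y * Z t (x - y)) \<longleftrightarrow> A < top" "(LINT y|lebesgue. u0 y * Z t (x - y)) = enn2real A"
  using lebesgue_integral_nn[OF hm hfin heq] by (simp_all add: A_def conv_def)
 note BY = iterated_integral_nn[where F = "%s y. \<bar>u s y\<bar> powr (p - 1) * u s y * Y_kernel al Z (t - s) (x - y)", OF Hm Hfin Heq, folded B_def]
 have "B = (NN s. (if 0 < s & s < t then conv (Yn al be (t - s)) (%y. epow (EN (g s y)) p) x else 0))"
  unfolding B_def H_def conv_def by (intro nn_integral_cong) auto
 then have D: "duhamel al be p (%y. EN (u0b y)) (%s y. EN (g s y)) t x = A + B" by (simp add: duhamel_def A_def)
 show ?thesis unfolding D AZ BY(1)
 proof
  assume h: "A < top & B < top & w = enn2real A + (LINT s:{0<..<t}|lebesgue. LINT y|lebesgue. \<bar>u s y\<bar> powr (p - 1) * u s y * Y_kernel al Z (t - s) (x - y))"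
  then have "w = enn2real A + enn2real B" using BY(2) by simp
  then show "EN w = A + B" using h by (simp add: ennreal_plus)
 next
  assume h: "EN w = A + B"
  then have AB: "A < top" "B < top" using ennreal_less_top[of w] by (auto simp: less_top[symmetric])
  have "w = enn2real (A + B)" using h w by (metis enn2real_ennreal)
  then show "A < top & B < top & w = enn2real A + (LINT s:{0<..<t}|lebesgue. LINT y|lebesgue. \<bar>u s y\<bar> powr (p - 1) * u s y * Y_kernel al Z (t - s) (x - y))"
  using AB BY(2)[OF AB(2)] by (simp add: enn2real_plus)
 qed
qed

end

section \<open>Blow-up\<close>

lemma AE_slices_imp_AE:
 fixes P :: "real \<times> 'a::euclidean_space => bool"
 assumes m: "{z. P z} \<in> sets borel" and ae: "AEl s. AEl y. P (s, y)"
 shows "AEl z. P z"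
proof -
 have "{z \<in> space ((lborel :: real measure) \<Otimes>\<^sub>M (lborel :: 'a measure)). P z} \<in> sets (lborel \<Otimes>\<^sub>M lborel)"
  unfolding lborel_prod using m by simp
 from lborel_pair.AE_pair_measure[OF this ae] show ?thesis unfolding lborel_prod .
qed

lemma AE_imp_AE_slices:
 fixes P :: "real \<times> 'a::euclidean_space => bool"
 assumes "AEl z. P z" shows "AEl s. AEl y. P (s, y)"
 by (rule lborel_pair.AE_pair) (unfold lborel_prod, rule assms)

lemma Lq_norm_diff_eq_Nm:
 fixes f h :: "'a::euclidean_space => real"
 assumes [measurable]: "f' \<in> Bm" "h' \<in> Bm"
  and f: "AEl x. f x = f' x" and h: "AEl x. h x = h' x" and q: "1 <= q"
 shows "Lq_norm q (%x. f x - h x) = Nm (qexp q) (%x. EN \<bar>f' x - h' x\<bar>)"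
proof (rule Lq_norm_eq_Nm[OF _ _ _ q])
 have "(%x. f' x - h' x) \<in> borel_measurable lborel" by measurable
 then have "(%x. f' x - h' x) \<in> borel_measurable lebesgue" by (rule measurable_completion)
 then show "(%x. f x - h x) \<in> borel_measurable lebesgue"
  by (rule lebesgue_measurable_AE) (use f h in \<open>auto elim: eventually_elim2\<close>)
 show "AEl x. EN \<bar>f x - h x\<bar> = EN \<bar>f' x - h' x\<bar>" using f h by eventually_elim simp
qed measurable

lemma Lq_norm_AE_eq_Nm:
 fixes f :: "'a::euclidean_space => real"
 assumes "f' \<in> Bm" "AEl x. f x = f' x" "!!x. 0 <= f' x" "1 <= q"
 shows "Lq_norm q f = Nm (qexp q) (%x. EN (f' x))"
 using Lq_norm_diff_eq_Nm[of f' "%_. 0" f "%_. 0" q] assms by simp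

context
 fixes al be p :: real and Z :: "real => 'a::euclidean_space => real" and q :: ereal and u0 :: "'a => real"
 assumes ab: "0 < al" "al < 1" "0 < be" "be <= 1" and fs: "fundamental_solution al be Z" and p: "1 < p" and q: "1 <= q"
begin

lemma open_time_domain: "open {t::real. 0 < t & ereal t < T}"
proof (cases T)
 case (real r)
 then have "{t. 0 < t & ereal t < T} = {0<..<r}" by auto
 then show ?thesis by simp
next
 case PInf
 then have "{t. 0 < t & ereal t < T} = {0<..}" by auto
 then show ?thesis by simp
qed auto

text \<open>Nonnegativity of the datum comes from the initial condition: the negative part of \<open>u0\<close> is bounded by
\<open>|u t - u0|\<close> because \<open>u t \<ge> 0\<close>, and the norm of the latter is arbitrarily small.\<close>

lemma nonnegative_solution_is_mild:
 assumes sol: "Lq_solution al Z p q u0 T u" and u0: "in_Lq q u0"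
  and nn: "AE t in lebesgue. 0 < t & ereal t < T --> (AE x in lebesgue. 0 <= u t x)"
 obtains u0b g where "u0b \<in> Bm" "!!y. 0 <= u0b y" "AEl y. u0 y = u0b y"
  "(%(s, y). g s y) \<in> Bm2" "!!s y. 0 <= g s y"
  "AEl z. 0 < fst z & ereal (fst z) < T --> u (fst z) (snd z) = g (fst z) (snd z)"
  "mild al be p (%y. EN (u0b y)) (%s y. EN (g s y)) T"
proof -
 define S where "S = {t::real. 0 < t & ereal t < T}"
 have S: "open S" unfolding S_def by (rule open_time_domain)
 have SU: "S \<times> (UNIV :: 'a set) \<in> sets lebesgue"
  using S open_Times[of S "UNIV :: 'a set"] by (intro sets_completionI_sets) auto
 have "(%(t, x). u t x) \<in> borel_measurable (lebesgue_on (S \<times> UNIV))" using sol by (simp add: Lq_solution_def S_def)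
 then have "(%z. indicator (S \<times> UNIV) z *\<^sub>R (case z of (t, x) => u t x)) \<in> borel_measurable lebesgue"
  using SU by (subst (asm) borel_measurable_restrict_space_iff) simp_all
 then obtain g' where g'm: "g' \<in> borel_measurable lborel" and g': "AEl z. indicator (S \<times> UNIV) z *\<^sub>R (case z of (t, x) => u t x) = g' z"
  by (auto dest: completion_ex_borel_measurable_real)
 have g'b[measurable]: "g' \<in> Bm" using g'm by simp
 define g where "g = (%s y. max 0 (g' (s, y)))"
 have gz: "(%z. g (fst z) (snd z)) \<in> Bm" unfolding g_def by simp measurable
 then have gm: "(%(s, y). g s y) \<in> Bm2" by (simp add: split_beta borel_prod)
 have ug': "AEl z. fst z \<in> S --> u (fst z) (snd z) = g' z"
  using g' by eventually_elim (auto simp: indicator_def split: prod.splits if_splits)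
 have ug: "AEl z. fst z \<in> S --> u (fst z) (snd z) = g (fst z) (snd z)"
 proof -
  have nn': "AEl t. t \<in> S --> (AEl x. 0 <= u t x)" using nn by (simp add: AE_completion_iff S_def)
  have "AEl t. AEl x. fst (t, x) \<in> S --> 0 <= g' (t, x)"
  using AE_imp_AE_slices[OF ug'] nn' by eventually_elim (auto elim: eventually_elim2)
  then have "AEl z. fst z \<in> S --> 0 <= g' z"
  proof (rule AE_slices_imp_AE[rotated])
  have "{z. fst z \<in> S --> 0 <= g' z} = - (S \<times> UNIV) \<union> {z \<in> space borel. 0 <= g' z}" by auto
  moreover have "- (S \<times> (UNIV :: 'a set)) \<in> sets borel" using S by (intro borel_closed closed_Compl open_Times) auto
  moreover have "{z \<in> space borel. 0 <= g' z} \<in> sets borel" by measurable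
  ultimately show "{z. fst z \<in> S --> 0 <= g' z} \<in> sets borel" by (simp only: sets.Un)
  qed
  with ug' show ?thesis by eventually_elim (auto simp: g_def)
 qed
 have u0l: "u0 \<in> borel_measurable lebesgue" using u0 by (simp add: in_Lq_def)
 then obtain v0 where v0m: "v0 \<in> borel_measurable lborel" and v0: "AEl y. u0 y = v0 y" by (auto dest: completion_ex_borel_measurable_real)
 have v0b[measurable]: "v0 \<in> Bm" using v0m by simp
 have gsec[measurable]: "g t \<in> Bm" for t using gm by measurable
 have ugt: "AEl t. t \<in> S --> (AEl x. u t x = g t x)"
  using AE_imp_AE_slices[OF ug] by eventually_elim auto
 have neg: "Nm (qexp q) (%y. EN (max 0 (- v0 y))) = 0"
 proof (rule ccontr)
  assume n: "Nm (qexp q) (%y. EN (max 0 (- v0 y))) ~= 0"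
  have "((%t. Lq_norm q (%x. u t x - u0 x)) \<longlongrightarrow> 0) (ess_at_right 0)" using sol by (simp add: Lq_solution_def)
  then have "eventually (%t. Lq_norm q (%x. u t x - u0 x) < Nm (qexp q) (%y. EN (max 0 (- v0 y)))) (ess_at_right 0)"
  using n by (auto simp: order_tendsto_iff zero_less_iff_neq_zero)
  then obtain e where e: "0 < e" "AEl t. 0 < t & t < e --> Lq_norm q (%x. u t x - u0 x) < Nm (qexp q) (%y. EN (max 0 (- v0 y)))"
  unfolding eventually_ess_at_right by auto
  have T0: "0 < T" using sol by (simp add: Lq_solution_def)
  then obtain r where r: "0 < r" "ereal r < T" by (cases T) (auto intro: that[of 1] dest: dense)
  have rT: "ereal t < T" if "t < r" for t using that r(2) by (meson ereal_less_eq(3) le_less_trans less_imp_le)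
  have "AEl t. 0 < t & t < min e r --> Lq_norm q (%x. u t x - u0 x) < Nm (qexp q) (%y. EN (max 0 (- v0 y))) & (AEl x. u t x = g t x)"
  using e(2) ugt by eventually_elim (auto simp: S_def rT)
  then obtain t where t: "Lq_norm q (%x. u t x - u0 x) < Nm (qexp q) (%y. EN (max 0 (- v0 y)))" "AEl x. u t x = g t x"
  using e(1) r(1) by (elim AE_interval_witness) auto
  have "Nm (qexp q) (%y. EN (max 0 (- v0 y))) <= Nm (qexp q) (%y. EN \<bar>g t y - v0 y\<bar>)"
  using qexp_bounds[OF q] by (intro Nm_mono ennreal_leI) (auto simp: g_def max_def)
  also have "... = Lq_norm q (%x. u t x - u0 x)" by (rule Lq_norm_diff_eq_Nm[OF gsec v0b t(2) v0 q, symmetric])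
  finally show False using t(1) by simp
 qed
 have "AEl y. EN (max 0 (- v0 y)) = 0" using qexp_bounds[OF q] by (intro Nm_eq_0[OF _ _ neg]) auto
 then have v0nn: "AEl y. 0 <= v0 y" by eventually_elim (auto simp: ennreal_eq_0_iff max_def split: if_splits)
 define u0b where "u0b = (%y. max 0 (v0 y))"
 have u0bm[measurable]: "u0b \<in> Bm" unfolding u0b_def by measurable
 have u0eq: "AEl y. u0 y = u0b y" using v0 v0nn by eventually_elim (simp add: u0b_def)
 have "AE t in lebesgue. 0 < t & ereal t < T --> (AE x in lebesgue.
  integrable lebesgue (%y. u0 y * Z t (x - y)) &
  set_integrable lebesgue ({0<..<t} \<times> UNIV) (%(s, y). \<bar>u s y\<bar> powr (p - 1) * u s y * Y_kernel al Z (t - s) (x - y)) &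
  u t x = (LINT y|lebesgue. u0 y * Z t (x - y)) +
  (LINT s:{0<..<t}|lebesgue. LINT y|lebesgue. \<bar>u s y\<bar> powr (p - 1) * u s y * Y_kernel al Z (t - s) (x - y)))"
  using sol unfolding Lq_solution_def by blast
 then have "AEl t. 0 < t & ereal t < T --> (AEl x. EN (g t x) = duhamel al be p (%y. EN (u0b y)) (%s y. EN (g s y)) t x)"
  unfolding AE_completion_iff using ugt
 proof eventually_elim
  case (elim t)
  show ?case
  proof
  assume t: "0 < t & ereal t < T"
  then have "t \<in> S" by (simp add: S_def)
  have ut: "AEl z. 0 < fst z & fst z < t --> u (fst z) (snd z) = g (fst z) (snd z)"
  using ug
  proof eventually_elim
  case (elim z)
  have "fst z < t ==> ereal (fst z) < T" using t by (meson ereal_less_eq(3) le_less_trans less_imp_le)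
  then show ?case using elim by (auto simp: S_def)
  qed
  have "0 <= g t x" for x by (simp add: g_def)
  note tr = duhamel_translation[OF ab fs p conjunct1[OF t] u0bm _ u0eq gm _ ut this]
  have "AEl x. u t x = g t x" using elim \<open>t \<in> S\<close> by simp
  with elim(1)[rule_format, OF t] show "AEl x. EN (g t x) = duhamel al be p (%y. EN (u0b y)) (%s y. EN (g s y)) t x"
  proof eventually_elim
  case (elim x)
  show ?case by (rule tr[THEN iffD1]) (use elim in \<open>auto simp: u0b_def g_def\<close>)
  qed
  qed
 qed
 moreover have "(%(s, y). EN (g s y)) \<in> Bm2" using gm by measurable
 ultimately have "mild al be p (%y. EN (u0b y)) (%s y. EN (g s y)) T" by (simp add: mild_def)
 with that[OF u0bm _ u0eq gm _ _ this] ug show ?thesis by (auto simp: u0b_def g_def S_def)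
qed

text \<open>Before \<open>T\<close> the extension agrees with \<open>u\<close>, so that the initial condition is inherited. Its finiteness almost
everywhere follows from the norm bound.\<close>

lemma mild_extension_is_solution:
 assumes sol: "Lq_solution al Z p q u0 (ereal T) u" and T: "0 < T" "T < T'"
  and u0bm[measurable]: "u0b \<in> Bm" and u0b: "!!y. 0 <= u0b y" "AEl y. u0 y = u0b y"
  and gm: "(%(s, y). g s y) \<in> Bm2" and g0: "!!s y. 0 <= g s y"
  and g: "AEl z. 0 < fst z & fst z < T --> u (fst z) (snd z) = g (fst z) (snd z)"
  and m: "mild al be p (%y. EN (u0b y)) V (ereal T')" and VU: "!!t x. t < T ==> V t x = EN (g t x)"
  and bd: "AEl t. 0 < t & t < T' --> Nm (qexp q) (V t) <= EN K"
 defines "v \<equiv> %t x. enn2real (V t x)"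
 shows "Lq_solution al Z p q u0 (ereal T') v" and "AEl t. 0 < t & t < T --> (AEl x. v t x = u t x)"
proof -
 have Vm[measurable]: "(%(t, x). V t x) \<in> Bm2" using m by (simp add: mild_def)
 have Vs[measurable]: "V t \<in> Bm" for t using Vm by measurable
 have vm: "(%(t, x). v t x) \<in> Bm2" unfolding v_def by measurable
 have vs[measurable]: "v t \<in> Bm" for t unfolding v_def by measurable
 have v0: "0 <= v t x" for t x by (simp add: v_def)
 have vg: "v t x = g t x" if "t < T" for t x using that g0 by (simp add: v_def VU)
 have ug: "AEl t. 0 < t & t < T --> (AEl x. u t x = v t x)"
  using AE_imp_AE_slices[OF g] by eventually_elim (auto elim!: eventually_mono simp: vg)
 then show vu: "AEl t. 0 < t & t < T --> (AEl x. v t x = u t x)"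
  by eventually_elim (auto elim!: eventually_mono)
 have fin: "AEl t. 0 < t & t < T' --> (AEl x. V t x < top)"
  using bd
 proof eventually_elim
  case (elim t)
  then show ?case using qexp_bounds[OF q] by (auto intro!: Nm_finite_AE[of _ "qexp q"] intro: le_less_trans)
 qed
 have Vv: "AEl z. 0 < fst z & fst z < T' --> V (fst z) (snd z) = EN (v (fst z) (snd z))"
 proof (rule AE_slices_imp_AE)
  have "(%z. V (fst z) (snd z)) \<in> Bm" using Vm by (simp add: case_prod_unfold borel_prod)
  then have "{z \<in> space borel. V (fst z) (snd z) = EN (v (fst z) (snd z))} \<in> sets borel" unfolding v_def by measurable
  moreover have "{z :: real \<times> 'a. 0 < fst z & fst z < T' --> V (fst z) (snd z) = EN (v (fst z) (snd z))}
  = - ({0<..<T'} \<times> UNIV) \<union> {z \<in> space borel. V (fst z) (snd z) = EN (v (fst z) (snd z))}" by auto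
  moreover have "- ({0<..<T'} \<times> (UNIV :: 'a set)) \<in> sets borel" by (intro borel_closed closed_Compl open_Times) auto
  ultimately show "{z :: real \<times> 'a. 0 < fst z & fst z < T' --> V (fst z) (snd z) = EN (v (fst z) (snd z))} \<in> sets borel" by (simp only: sets.Un)
  show "AEl s. AEl y. 0 < fst (s, y) & fst (s, y) < T' --> V (fst (s, y)) (snd (s, y)) = EN (v (fst (s, y)) (snd (s, y)))"
  using fin by eventually_elim (auto elim!: eventually_mono simp: v_def)
 qed
 have dv: "duhamel al be p (%y. EN (u0b y)) V t x = duhamel al be p (%y. EN (u0b y)) (%s y. EN (v s y)) t x" if "t < T'" for t x
 proof -
  have "AEl s. 0 < s & s < T' --> (AEl y. V s y = EN (v s y))"
  using AE_imp_AE_slices[OF Vv] by eventually_elim auto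
  then have "AEl s. (if 0 < s & s < t then conv (Yn al be (t - s)) (%y. epow (V s y) p) x else 0)
  = (if 0 < s & s < t then conv (Yn al be (t - s)) (%y. epow (EN (v s y)) p) x else 0)"
  proof eventually_elim
  case (elim s)
  then show ?case using that by (auto simp: conv_def intro!: nn_integral_cong_AE elim!: eventually_mono)
  qed
  then show ?thesis unfolding duhamel_def by (simp add: nn_integral_cong_AE)
 qed
 have eqn: "AEl t. 0 < t & ereal t < ereal T' --> (AEl x. V t x = duhamel al be p (%y. EN (u0b y)) V t x)"
  using m by (simp add: mild_def)
 have main: "AEl t. 0 < t & ereal t < ereal T' --> (AE x in lborel.
  integrable lebesgue (%y. u0 y * Z t (x - y)) &
  set_integrable lebesgue ({0<..<t} \<times> UNIV) (%(s, y). \<bar>v s y\<bar> powr (p - 1) * v s y * Y_kernel al Z (t - s) (x - y)) &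
  v t x = (LINT y|lebesgue. u0 y * Z t (x - y)) +
  (LINT s:{0<..<t}|lebesgue. LINT y|lebesgue. \<bar>v s y\<bar> powr (p - 1) * v s y * Y_kernel al Z (t - s) (x - y)))"
  using eqn fin
 proof eventually_elim
  case (elim t)
  show ?case
  proof
  assume t: "0 < t & ereal t < ereal T'"
  have vv: "AEl z. 0 < fst z & fst z < t --> v (fst z) (snd z) = v (fst z) (snd z)" by simp
  have e1: "AEl x. V t x = duhamel al be p (%y. EN (u0b y)) V t x" and e2: "AEl x. V t x < top" using elim t by auto
  show "AE x in lborel.
  integrable lebesgue (%y. u0 y * Z t (x - y)) &
  set_integrable lebesgue ({0<..<t} \<times> UNIV) (%(s, y). \<bar>v s y\<bar> powr (p - 1) * v s y * Y_kernel al Z (t - s) (x - y)) &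
  v t x = (LINT y|lebesgue. u0 y * Z t (x - y)) +
  (LINT s:{0<..<t}|lebesgue. LINT y|lebesgue. \<bar>v s y\<bar> powr (p - 1) * v s y * Y_kernel al Z (t - s) (x - y))"
  using e1 e2
  proof eventually_elim
  case (elim x)
  have "EN (v t x) = V t x" using elim(2) by (simp add: v_def)
  also have "... = duhamel al be p (%y. EN (u0b y)) (%s y. EN (v s y)) t x" using elim(1) dv[of t x] t by simp
  finally show ?case by (rule duhamel_translation[OF ab fs p conjunct1[OF t] u0bm u0b vm v0 vv v0, THEN iffD2])
  qed
  qed
 qed
 have norm: "Lq_norm q (v t) = Nm (qexp q) (%x. EN (v t x))" for t by (rule Lq_norm_AE_eq_Nm[OF vs _ v0 q]) simp
 have bdv: "AEl t. 0 < t & t < t1 --> Lq_norm q (v t) <= EN K" if "ereal t1 < ereal T'" for t1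
  using bd
 proof eventually_elim
  case (elim t)
  have "Lq_norm q (v t) <= Nm (qexp q) (V t)" unfolding norm using qexp_bounds[OF q] by (intro Nm_mono) (auto simp: v_def intro: ennreal_enn2real_if[THEN eq_refl, THEN order_trans])
  then show ?case using elim that by (auto intro: order_trans)
 qed
 have lim: "((%t. Lq_norm q (%x. v t x - u0 x)) \<longlongrightarrow> 0) (ess_at_right 0)"
 proof -
  have "((%t. Lq_norm q (%x. u t x - u0 x)) \<longlongrightarrow> 0) (ess_at_right 0)" using sol by (simp add: Lq_solution_def)
  moreover have "eventually (%t. Lq_norm q (%x. u t x - u0 x) = Lq_norm q (%x. v t x - u0 x)) (ess_at_right 0)"
  unfolding eventually_ess_at_right
  proof (intro exI[of _ T] conjI T(1))
  show "AEl t. 0 < t & t < T --> Lq_norm q (%x. u t x - u0 x) = Lq_norm q (%x. v t x - u0 x)"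
  using ug
  proof eventually_elim
  case (elim t)
  show ?case
  proof
  assume t: "0 < t & t < T"
  have uv: "AEl x. u t x = v t x" using elim t by simp
  have vv: "AEl x. v t x = v t x" by simp
  show "Lq_norm q (%x. u t x - u0 x) = Lq_norm q (%x. v t x - u0 x)"
  using Lq_norm_diff_eq_Nm[OF vs u0bm uv u0b(2) q] Lq_norm_diff_eq_Nm[OF vs u0bm vv u0b(2) q] by simp
  qed
  qed
  qed
  ultimately show ?thesis by (rule Lim_transform_eventually)
 qed
 have "(%(t, x). v t x) \<in> borel_measurable lborel" using vm by (simp add: borel_prod)
 then have "(%(t, x). v t x) \<in> borel_measurable lebesgue" by (rule measurable_completion)
 then have "(%(t, x). v t x) \<in> borel_measurable (lebesgue_on ({t. 0 < t & ereal t < ereal T'} \<times> UNIV))" by (rule measurable_restrict_space1)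
 moreover have "\<forall>t1. 0 < t1 & ereal t1 < ereal T' --> (\<exists>C. AEl t. 0 < t & t < t1 --> Lq_norm q (v t) <= EN C)" using bdv by blast
 ultimately show "Lq_solution al Z p q u0 (ereal T') v"
  using T main lim unfolding Lq_solution_def AE_completion_iff by auto
qed

end

text \<open>
  An infinite existence time contradicts the absence of global solutions; a finite one with bounded norm
  contradicts maximality. The blow-up time is therefore \<open>Tstar\<close> itself.
\<close>

theorem corollary6p2:
  fixes \<alpha> \<beta> p :: real and q Tstar :: ereal
    and Z u :: "real \<Rightarrow> 'a::euclidean_space \<Rightarrow> real" and u0 :: "'a \<Rightarrow> real"
  assumes "0 < \<alpha>" "\<alpha> < 1" "0 < \<beta>" "\<beta> \<le> 1" "real DIM('a) > 4 * \<beta>"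
    and "fundamental_solution \<alpha> \<beta> Z"
    and "1 < p" "p < 1 + 2 * \<beta> / real DIM('a)"
    and "1 \<le> q"
    and "in_Lq q u0"
    and "maximal_Lq_solution \<alpha> Z p q u0 Tstar u"
    and nonnegative: "AE t in lebesgue. 0 < t \<and> ereal t < Tstar \<longrightarrow> (AE x in lebesgue. 0 \<le> u t x)"
    and nontrivial:
      "\<not> (AE t in lebesgue. 0 < t \<and> ereal t < Tstar \<longrightarrow> (AE x in lebesgue. u t x = 0))"
  shows "\<exists>T::real. 0 < T \<and> ereal T \<le> Tstar \<and>
           Limsup (ess_at_left T) (\<lambda>t. Lq_norm q (u t)) = \<infinity>"
proof -
 note ab = assms(1-4) and fs = assms(6) and p1 = assms(7) and pf = assms(8) and q = assms(9)
 have p2: "p < 2"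
 proof -
  have "2 * \<beta> / real DIM('a) < 1" using assms(3,5) by (simp add: divide_less_eq)
  with pf show ?thesis by linarith
 qed
 have p3: "real DIM('a) / 2 * (p - 1) < \<beta>" using pf by (simp add: field_simps)
 have sol: "Lq_solution \<alpha> Z p q u0 Tstar u" and maxi: "!!T' v. Tstar < T' ==> Lq_solution \<alpha> Z p q u0 T' v ==>
  ~ (AE t in lebesgue. 0 < t & ereal t < Tstar --> (AE x in lebesgue. v t x = u t x))"
  using assms(11) by (auto simp: maximal_Lq_solution_def)
 have T0: "0 < Tstar" using sol by (simp add: Lq_solution_def)
 obtain u0b g where u0bm[measurable]: "u0b \<in> Bm" and u0b: "!!y. 0 <= u0b y" "AEl y. u0 y = u0b y"
  and gm: "(%(s, y). g s y) \<in> Bm2" and g0: "!!s y. 0 <= g s y"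
  and g: "AEl z. 0 < fst z & ereal (fst z) < Tstar --> u (fst z) (snd z) = g (fst z) (snd z)"
  and m: "mild \<alpha> \<beta> p (%y. EN (u0b y)) (%s y. EN (g s y)) Tstar"
  using nonnegative_solution_is_mild[OF ab fs p1 q sol assms(10) nonnegative] by blast
 have gs: "g t \<in> Bm" for t using gm by measurable
 define i where "i = qexp q"
 have i: "0 <= i" "i <= 1" using qexp_bounds[OF q] by (auto simp: i_def)
 have ug: "AEl t. 0 < t & ereal t < Tstar --> (AEl x. u t x = g t x)"
  using AE_imp_AE_slices[OF g] by eventually_elim auto
 have norm: "AEl t. 0 < t & ereal t < Tstar --> Lq_norm q (u t) = Nm i (%x. EN (g t x))"
  using ug by eventually_elim (auto simp: i_def intro!: Lq_norm_AE_eq_Nm[OF gs _ g0 q])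
 have bd: "\<exists>C. AEl t. 0 < t & t < t1 --> Nm i (%x. EN (g t x)) <= EN C" if t1: "0 < t1" "ereal t1 < Tstar" for t1
 proof -
  have "\<exists>C. AE t in lebesgue. 0 < t & t < t1 --> Lq_norm q (u t) <= EN C" using sol t1 unfolding Lq_solution_def by blast
  then obtain C where "AEl t. 0 < t & t < t1 --> Lq_norm q (u t) <= EN C" unfolding AE_completion_iff by blast
  then have "AEl t. 0 < t & t < t1 --> Nm i (%x. EN (g t x)) <= EN C"
  using norm
  proof eventually_elim
  case (elim t)
  show ?case
  proof
  assume t: "0 < t & t < t1"
  then have "ereal t < Tstar" using t1(2) by (meson ereal_less_eq(3) le_less_trans less_imp_le)
  then show "Nm i (%x. EN (g t x)) <= EN C" using elim t by simp
  qed
  qed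
  then show ?thesis ..
 qed
 have u0norm: "Nm i (%x. EN (u0b x)) < top"
  using Lq_norm_AE_eq_Nm[OF u0bm u0b(2) u0b(1) q] assms(10) by (simp add: in_Lq_def i_def)
 define A0 where "A0 = enn2real (Nm i (%x. EN (u0b x)))"
 have A0: "Nm i (%x. EN (u0b x)) <= EN A0" "0 <= A0" using u0norm by (auto simp: A0_def)
 have u0_nonzero: "~ (AEl x. EN (u0b x) = 0)"
 proof
  assume z: "AEl x. EN (u0b x) = 0"
  have "Nm i (%x. EN (u0b x)) = Nm i (%_ :: 'a. 0)" by (rule Nm_cong_AE) (use z i in auto)
  then have z0: "Nm i (%x. EN (u0b x)) <= ennreal 0" using i by (simp add: Nm_zero)
  have zero: "AEl t. 0 < t & t < T --> (AEl x. g t x = 0)" if T: "0 < T" "ereal T < Tstar" for T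
  proof -
  obtain C where "AEl t. 0 < t & t < T --> Nm i (%x. EN (g t x)) <= EN C" using bd[OF T] by blast
  then have C: "AEl t. 0 < t & t < T --> Nm i (%x. EN (g t x)) <= EN (max 0 C)"
  by eventually_elim (auto simp: max_def ennreal_neg)
  have eo: "0 <= min i (1 - (p - 1) * i)" by (rule exponent_order(1)[OF ab p1 p2 p3 i refl refl])
  have "\<exists>M\<ge>0. AEl t. 0 < t & t < T --> Nm (min i (1 - (p - 1) * i)) (%x. EN (g t x)) <= EN (M * 0 * t powr (- (\<alpha> * (real DIM('a) / 2 * (i - min i (1 - (p - 1) * i))) / \<beta>)))"
  by (rule smoothing[OF ab p1 p2 p3 i refl refl m T(1) less_imp_le[OF T(2)] order_refl z0 _ C]) simp
  then have "AEl t. 0 < t & t < T --> Nm (min i (1 - (p - 1) * i)) (%x. EN (g t x)) <= 0" by auto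
  then show ?thesis
  proof eventually_elim
  case (elim t)
  show ?case
  proof
  assume "0 < t & t < T"
  then have "Nm (min i (1 - (p - 1) * i)) (%x. EN (g t x)) = 0" using elim by simp
  then have "AEl x. EN (g t x) = 0" using gs[of t] eo by (intro Nm_eq_0) auto
  then show "AEl x. g t x = 0" by eventually_elim (use g0 in \<open>auto simp: ennreal_eq_0_iff intro: antisym\<close>)
  qed
  qed
  qed
  define Tn where "Tn = (%n::nat. if Tstar = \<infinity> then real n + 1 else real_of_ereal Tstar * (1 - 1 / (real n + 2)))"
  have Tn: "0 < Tn n & ereal (Tn n) < Tstar" for n
  proof (cases Tstar)
  case (real r)
  then have "0 < r" using T0 by simp
  then show ?thesis using real by (auto simp: Tn_def intro!: mult_pos_pos)
  qed (use T0 in \<open>auto simp: Tn_def\<close>)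
  have cover: "\<exists>n. t < Tn n" if "ereal t < Tstar" for t
  proof (cases Tstar)
  case (real r)
  have "(%n. r * (1 - 1 / (real n + 2))) \<longlonglongrightarrow> r" by real_asymp
  then have "eventually (%n. t < r * (1 - 1 / (real n + 2))) sequentially" using that real by (auto simp: order_tendsto_iff)
  then show ?thesis using real by (auto simp: Tn_def eventually_sequentially)
  next
  case PInf
  obtain n :: nat where "t < real n" using reals_Archimedean2 by blast
  then show ?thesis using PInf by (intro exI[of _ n]) (simp add: Tn_def)
  qed (use that in auto)
  have "AEl t. \<forall>n. 0 < t & t < Tn n --> (AEl x. g t x = 0)"
  by (subst AE_all_countable) (use zero Tn in blast)
  with ug have "AEl t. 0 < t & ereal t < Tstar --> (AEl x. u t x = 0)"
  proof eventually_elim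
  case (elim t)
  show ?case
  proof
  assume t: "0 < t & ereal t < Tstar"
  then have a: "AEl x. u t x = g t x" and b: "AEl x. g t x = 0" using elim cover[of t] by auto
  then show "AEl x. u t x = 0" by eventually_elim simp
  qed
  qed
  then show False using nontrivial unfolding AE_completion_iff by blast
 qed
 have Tfin: "Tstar ~= \<infinity>"
 proof
  assume inf: "Tstar = \<infinity>"
  have "\<exists>C. AEl t. 0 < t & t < T' --> Nm i (%x. EN (g t x)) <= EN C" for T'
  proof (cases "0 < T'")
  case True then show ?thesis using bd[of T'] inf by simp
  next
  case False then show ?thesis by (intro exI[of _ 0]) (auto intro!: always_eventually)
  qed
  then have "AEl x. EN (u0b x) = 0" using no_global_mild[OF ab p1 pf i m[unfolded inf]] by blast
  then show False using u0_nonzero by blast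
 qed
 then obtain T where T: "Tstar = ereal T" "0 < T" using T0 by (cases Tstar) auto
 have "Limsup (ess_at_left T) (%t. Lq_norm q (u t)) = \<infinity>"
 proof (rule ccontr)
  assume n: "~ ?thesis"
  then have "Limsup (ess_at_left T) (%t. Lq_norm q (u t)) < \<infinity>" by (simp add: less_top)
  then obtain c where c: "Limsup (ess_at_left T) (%t. Lq_norm q (u t)) < c" "c < \<infinity>" using dense by blast
  have "eventually (%t. Lq_norm q (u t) < c) (ess_at_left T)" by (rule Limsup_lessD[OF c(1)])
  then obtain e where e: "e < T" "AEl t. e < t & t < T --> Lq_norm q (u t) < c" using eventually_ess_at_left by blast
  define t1 where "t1 = (max 0 e + T) / 2"
  have t1: "0 < t1" "e < t1" "t1 < T" using e T by (auto simp: t1_def)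
  obtain C where C: "AEl t. 0 < t & t < t1 --> Nm i (%x. EN (g t x)) <= EN C" using bd[of t1] t1 T by auto
  define D where "D = max (max 0 C) (enn2real c)"
  have D: "0 <= D" "EN C <= EN D" "c <= EN D"
  using c(2) by (auto simp: D_def intro!: ennreal_leI) (metis ennreal_enn2real ennreal_leI max.cobounded2)
  have "AEl t. t ~= t1" by (rule AE_lborel_singleton)
  with C e(2) norm have bdT: "AEl t. 0 < t & t < T --> Nm i (%x. EN (g t x)) <= EN D"
  proof eventually_elim
  case (elim t)
  show ?case
  proof
  assume t: "0 < t & t < T"
  show "Nm i (%x. EN (g t x)) <= EN D"
  proof (cases "t < t1")
  case True then show ?thesis using elim t D by (auto intro: order_trans)
  next
  case False
  then have "Lq_norm q (u t) < c" using elim t t1 by simp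
  then show ?thesis using elim t T D by (auto intro: order_trans less_imp_le)
  qed
  qed
  qed
  obtain T' V K where V: "T < T'" "mild \<alpha> \<beta> p (%y. EN (u0b y)) V (ereal T')" "\<forall>t<T. V t = (%x. EN (g t x))"
  "AEl t. 0 < t & t < T' --> Nm i (V t) <= EN K"
  using continuation[OF ab p1 p2 p3 i refl refl m[unfolded T(1)] T(2) A0 D(1) bdT] by blast
  have gT: "AEl z. 0 < fst z & fst z < T --> u (fst z) (snd z) = g (fst z) (snd z)" using g by (simp add: T)
  have VU: "!!t x. t < T ==> V t x = EN (g t x)" using V(3) by simp
  note ext = mild_extension_is_solution[OF ab fs p1 q sol[unfolded T(1)] T(2) V(1) u0bm u0b gm g0 gT V(2) VU V(4)[unfolded i_def]]
  have "ereal T < ereal T'" using V(1) by simp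
  then show False using maxi[of "ereal T'", OF _ ext(1)] ext(2) unfolding T(1) AE_completion_iff by simp
 qed
 then show ?thesis using T by (intro exI[of _ T]) simp
qed

end
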